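(* Let $C$, $D$ and $E$ be abelian categories such that $C$ has enough projectives, let $F\colon C\times D\to E$ be an additive bifunctor, covariant in both variables and right-exact in both variables, and let $I$ and $J$ be small categories. Suppose we are given a morphism of short exact sequences in $C^I$ from $0\to L\to M\to N\to 0$ to $0\to L'\to M'\to N'\to 0$, and a morphism $A\to B$ in $D^J$. Then in $E^{I\times J}$ we have a commutative diagram whose rows are \[ \cdots\to F_{n+1}^{I\times J}(N,A)\xrightarrow{\delta_{n+1}^{I\times J}}F_n^{I\times J}(L,A)\to F_n^{I\times J}(M,A)\to F_n^{I\times J}(N,A)\xrightarrow{\delta_n^{I\times J}}F_{n-1}^{I\times J}(L,A)\to\cdots \] and \[ \cdots\to F_{n+1}^{I\times J}(N',B)\xrightarrow{\delta_{n+1}^{I\times J}}F_n^{I\times J}(L',B)\to F_n^{I\times J}(M',B)\to F_n^{I\times J}(N',B)\xrightarrow{\delta_n^{I\times J}}F_{n-1}^{I\times J}(L',B)\to\cdots, \] whose vertical maps (from the first row to the second) are those induced by the given morphisms, and whose rows are exact. Suppose in addition that $F(P,-)\colon D\to E$ is exact for all projective $P\in C$. Then the same holds with the variables switched, i.e. given a morphism of short exact sequences in $D^J$ from $0\to L\to M\to N\to 0$ to $0\to L'\to M'\to N'\to 0$, and a morphism $A\to B$ in $C^I$, we get a commutative diagram in $E^{I\times J}$ with exact rows \[ \cdots\to F_{n+1}^{I\times J}(A,N)\xrightarrow{\delta_{n+1}^{I\times J}}F_n^{I\times J}(A,L)\to F_n^{I\times J}(A,M)\to F_n^{I\times J}(A,N)\xrightarrow{\delta_n^{I\times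 J}}F_{n-1}^{I\times J}(A,L)\to\cdots \] and \[ \cdots\to F_{n+1}^{I\times J}(B,N')\xrightarrow{\delta_{n+1}^{I\times J}}F_n^{I\times J}(B,L')\to F_n^{I\times J}(B,M')\to F_n^{I\times J}(B,N')\xrightarrow{\delta_n^{I\times J}}F_{n-1}^{I\times J}(B,L')\to\cdots \] and with the induced vertical maps from the first row to the second.
   Context: $C^I$ denotes the (abelian) category of functors $I\to C$; for $X\in C^I$, $X^k$ is its value at $k\in I$. For $Y\in D$, $F_n(-,Y)$ denotes the left derived functor $L_n(F(-,Y))\colon C\to E$, i.e. $F_n(X,Y)=H_n(F(P_\ast,Y))$ for a projective resolution $P_\ast\to X$ in $C$ (and $F_n=0$ for $n<0$). This is a bifunctor $C\times D\to E$: morphisms $f\colon X\to X'$ in $C$ and $g\colon Y\to Y'$ in $D$ induce $F_n(f,g)\colon F_n(X,Y)\to F_n(X',Y')$, the map on homology of $F(f_\ast,g)\colon F(P_\ast,Y)\to F(P'_\ast,Y')$, where $f_\ast\colon P_\ast\to P'_\ast$ is a lift of $f$ to projective resolutions. For a short exact sequence $0\to L\to M\to N\to 0$ in $C$ and $Y\in D$, $\delta_n\colon F_n(N,Y)\to F_{n-1}(L,Y)$ is the usual connecting morphism of the derived functors of $F(-,Y)$. If $F(P,-)$ is exact for all projective $P$, then for a short exact sequence $0\to L\to M\to N\to 0$ in $D$ and $X\in C$ with projective resolution $P_\ast$, $\delta_n\colon F_n(X,N)\to F_{n-1}(X,L)$ is the connecting morphism of the short exact sequence of complexes $0\to F(P_\ast,L)\to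 F(P_\ast,M)\to F(P_\ast,N)\to 0$. The functor $F_n^{I\times J}\colon C^I\times D^J\to E^{I\times J}$ is defined componentwise: $F_n^{I\times J}(X,Y)$ has value $F_n(X^k,Y^i)$ at $(k,i)\in I\times J$, with structure maps and action on morphisms induced by functoriality of $F_n$. The morphisms $\delta_n^{I\times J}$ are those whose $(k,i)$ component is the corresponding connecting morphism $\delta_n$: $F_n(N^k,A^i)\to F_{n-1}(L^k,A^i)$ coming from $0\to L^k\to M^k\to N^k\to 0$ in $C$ in the first case, and $F_n(A^k,N^i)\to F_{n-1}(A^k,L^i)$ coming from $0\to L^i\to M^i\to N^i\to 0$ in $D$ in the second case. *)

theory Defs
  imports "HOL-Algebra.Group"
begin

section \<open>Categories\<close>

text \<open>
  Composition is written in the usual order: \<open>g \<cdot> f\<close> is "first \<open>f\<close>, then \<open>g\<close>". The fields of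
  the record are only meaningful on \<open>Ob\<close>, \<open>Ar\<close> and, for \<open>Comp\<close>, on composable pairs.
\<close>

record ('o, 'm) cat =
  Ob :: "'o set"
  Ar :: "'m set"
  Dom :: "'m \<Rightarrow> 'o"
  Cod :: "'m \<Rightarrow> 'o"
  Idn :: "'o \<Rightarrow> 'm"
  Comp :: "'m \<Rightarrow> 'm \<Rightarrow> 'm"  (infixl "\<cdot>\<index>" 70)

definition Hom :: "('o, 'm, 'z) cat_scheme \<Rightarrow> 'o \<Rightarrow> 'o \<Rightarrow> 'm set" where
  "Hom C a b = {f \<in> Ar C. Dom C f = a \<and> Cod C f = b}"

locale category =
  fixes C :: "('o, 'm, 'z) cat_scheme" (structure)
  assumes Dom_in: "f \<in> Ar C \<Longrightarrow> Dom C f \<in> Ob C"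
    and Cod_in: "f \<in> Ar C \<Longrightarrow> Cod C f \<in> Ob C"
    and Idn_in: "a \<in> Ob C \<Longrightarrow> Idn C a \<in> Hom C a a"
    and Comp_in: "f \<in> Hom C a b \<Longrightarrow> g \<in> Hom C b c \<Longrightarrow> g \<cdot> f \<in> Hom C a c"
    and Idn_left: "f \<in> Hom C a b \<Longrightarrow> Idn C b \<cdot> f = f"
    and Idn_right: "f \<in> Hom C a b \<Longrightarrow> f \<cdot> Idn C a = f"
    and Comp_assoc: "f \<in> Hom C a b \<Longrightarrow> g \<in> Hom C b c \<Longrightarrow> h \<in> Hom C c d \<Longrightarrow>
      (h \<cdot> g) \<cdot> f = h \<cdot> (g \<cdot> f)"

definition monic :: "('o, 'm, 'z) cat_scheme \<Rightarrow> 'm \<Rightarrow> bool" where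
  "monic C f \<longleftrightarrow> f \<in> Ar C \<and>
     (\<forall>a. \<forall>g \<in> Hom C a (Dom C f). \<forall>h \<in> Hom C a (Dom C f). f \<cdot>\<^bsub>C\<^esub> g = f \<cdot>\<^bsub>C\<^esub> h \<longrightarrow> g = h)"

definition epic :: "('o, 'm, 'z) cat_scheme \<Rightarrow> 'm \<Rightarrow> bool" where
  "epic C f \<longleftrightarrow> f \<in> Ar C \<and>
     (\<forall>b. \<forall>g \<in> Hom C (Cod C f) b. \<forall>h \<in> Hom C (Cod C f) b. g \<cdot>\<^bsub>C\<^esub> f = h \<cdot>\<^bsub>C\<^esub> f \<longrightarrow> g = h)"

definition zero_object :: "('o, 'm, 'z) cat_scheme \<Rightarrow> 'o \<Rightarrow> bool" where
  "zero_object C z \<longleftrightarrow> z \<in> Ob C \<and>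
     (\<forall>a \<in> Ob C. (\<exists>!f. f \<in> Hom C a z) \<and> (\<exists>!f. f \<in> Hom C z a))"

definition projective :: "('o, 'm, 'z) cat_scheme \<Rightarrow> 'o \<Rightarrow> bool" where
  "projective C P \<longleftrightarrow> P \<in> Ob C \<and>
     (\<forall>e. epic C e \<longrightarrow> (\<forall>f \<in> Hom C P (Cod C e). \<exists>g \<in> Hom C P (Dom C e). e \<cdot>\<^bsub>C\<^esub> g = f))"

definition enough_projectives :: "('o, 'm, 'z) cat_scheme \<Rightarrow> bool" where
  "enough_projectives C \<longleftrightarrow>
     (\<forall>a \<in> Ob C. \<exists>P e. projective C P \<and> e \<in> Hom C P a \<and> epic C e)"

definition prod_cat ::
  "('a, 'am, 'y) cat_scheme \<Rightarrow> ('b, 'bm, 'z) cat_scheme \<Rightarrow> ('a \<times> 'b, 'am \<times> 'bm) cat" where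
  "prod_cat A B =
     \<lparr> Ob = Ob A \<times> Ob B,
       Ar = Ar A \<times> Ar B,
       Dom = (\<lambda>(f, g). (Dom A f, Dom B g)),
       Cod = (\<lambda>(f, g). (Cod A f, Cod B g)),
       Idn = (\<lambda>(a, b). (Idn A a, Idn B b)),
       Comp = (\<lambda>(f', g') (f, g). (f' \<cdot>\<^bsub>A\<^esub> f, g' \<cdot>\<^bsub>B\<^esub> g)) \<rparr>"

section \<open>Preadditive and abelian categories\<close>

text \<open>
  \<open>Madd C\<close> adds parallel morphisms; \<open>Mzero C a b\<close> is the zero morphism from \<open>a\<close> to \<open>b\<close>.
\<close>

record ('o, 'm) acat = "('o, 'm) cat" +
  Madd :: "'m \<Rightarrow> 'm \<Rightarrow> 'm"
  Mzero :: "'o \<Rightarrow> 'o \<Rightarrow> 'm"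

definition Hom_group :: "('o, 'm) acat \<Rightarrow> 'o \<Rightarrow> 'o \<Rightarrow> 'm monoid" where
  "Hom_group C a b = \<lparr> carrier = Hom C a b, mult = Madd C, one = Mzero C a b \<rparr>"

definition is_kernel :: "('o, 'm) acat \<Rightarrow> 'm \<Rightarrow> 'm \<Rightarrow> bool" where
  "is_kernel C f k \<longleftrightarrow> f \<in> Ar C \<and> k \<in> Ar C \<and> Cod C k = Dom C f \<and>
     f \<cdot>\<^bsub>C\<^esub> k = Mzero C (Dom C k) (Cod C f) \<and>
     (\<forall>a. \<forall>h \<in> Hom C a (Dom C f). f \<cdot>\<^bsub>C\<^esub> h = Mzero C a (Cod C f) \<longrightarrow>
        (\<exists>!u. u \<in> Hom C a (Dom C k) \<and> k \<cdot>\<^bsub>C\<^esub> u = h))"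

definition is_cokernel :: "('o, 'm) acat \<Rightarrow> 'm \<Rightarrow> 'm \<Rightarrow> bool" where
  "is_cokernel C f q \<longleftrightarrow> f \<in> Ar C \<and> q \<in> Ar C \<and> Dom C q = Cod C f \<and>
     q \<cdot>\<^bsub>C\<^esub> f = Mzero C (Dom C f) (Cod C q) \<and>
     (\<forall>b. \<forall>h \<in> Hom C (Cod C f) b. h \<cdot>\<^bsub>C\<^esub> f = Mzero C (Dom C f) b \<longrightarrow>
        (\<exists>!u. u \<in> Hom C (Cod C q) b \<and> u \<cdot>\<^bsub>C\<^esub> q = h))"

definition is_biproduct ::
  "('o, 'm) acat \<Rightarrow> 'o \<Rightarrow> 'o \<Rightarrow> 'o \<Rightarrow> 'm \<Rightarrow> 'm \<Rightarrow> 'm \<Rightarrow> 'm \<Rightarrow> bool" where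
  "is_biproduct C a b s i j p q \<longleftrightarrow> s \<in> Ob C \<and>
     i \<in> Hom C a s \<and> j \<in> Hom C b s \<and> p \<in> Hom C s a \<and> q \<in> Hom C s b \<and>
     p \<cdot>\<^bsub>C\<^esub> i = Idn C a \<and> q \<cdot>\<^bsub>C\<^esub> j = Idn C b \<and>
     p \<cdot>\<^bsub>C\<^esub> j = Mzero C b a \<and> q \<cdot>\<^bsub>C\<^esub> i = Mzero C a b \<and>
     Madd C (i \<cdot>\<^bsub>C\<^esub> p) (j \<cdot>\<^bsub>C\<^esub> q) = Idn C s"

locale preadditive_category = category C for C :: "('o, 'm) acat" (structure) +
  assumes Hom_comm_group: "a \<in> Ob C \<Longrightarrow> b \<in> Ob C \<Longrightarrow> comm_group (Hom_group C a b)"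
    and Comp_Madd_right: "f \<in> Hom C a b \<Longrightarrow> g \<in> Hom C a b \<Longrightarrow> h \<in> Hom C b c \<Longrightarrow>
      h \<cdot> (Madd C f g) = Madd C (h \<cdot> f) (h \<cdot> g)"
    and Comp_Madd_left: "h \<in> Hom C a b \<Longrightarrow> f \<in> Hom C b c \<Longrightarrow> g \<in> Hom C b c \<Longrightarrow>
      (Madd C f g) \<cdot> h = Madd C (f \<cdot> h) (g \<cdot> h)"

locale abelian_category = preadditive_category +
  assumes ex_zero_object: "\<exists>z. zero_object C z"
    and ex_biproduct: "a \<in> Ob C \<Longrightarrow> b \<in> Ob C \<Longrightarrow> \<exists>s i j p q. is_biproduct C a b s i j p q"
    and ex_kernel: "f \<in> Ar C \<Longrightarrow> \<exists>k. is_kernel C f k"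
    and ex_cokernel: "f \<in> Ar C \<Longrightarrow> \<exists>q. is_cokernel C f q"
    and monic_normal: "monic C f \<Longrightarrow> \<exists>g. is_kernel C g f"
    and epic_normal: "epic C f \<Longrightarrow> \<exists>g. is_cokernel C g f"

text \<open>The image of \<open>f\<close> is the kernel of its cokernel; exactness says that it is the kernel of \<open>g\<close>.\<close>

definition is_image :: "('o, 'm) acat \<Rightarrow> 'm \<Rightarrow> 'm \<Rightarrow> bool" where
  "is_image C f m \<longleftrightarrow> (\<exists>q. is_cokernel C f q \<and> is_kernel C q m)"

definition exact_at :: "('o, 'm) acat \<Rightarrow> 'm \<Rightarrow> 'm \<Rightarrow> bool" where
  "exact_at C f g \<longleftrightarrow> (\<exists>m. is_image C f m \<and> is_kernel C g m)"

definition short_exact :: "('o, 'm) acat \<Rightarrow> 'm \<Rightarrow> 'm \<Rightarrow> bool" where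
  "short_exact C f g \<longleftrightarrow> monic C f \<and> exact_at C f g \<and> epic C g"

text \<open>
  A morphism from \<open>0 \<rightarrow> L \<rightarrow> M \<rightarrow> N \<rightarrow> 0\<close> (maps \<open>f\<close>, \<open>g\<close>) to \<open>0 \<rightarrow> L' \<rightarrow> M' \<rightarrow> N' \<rightarrow> 0\<close>
  (maps \<open>f'\<close>, \<open>g'\<close>) with components \<open>l\<close>, \<open>m\<close>, \<open>n\<close>.
\<close>

definition short_exact_morphism ::
  "('o, 'm) acat \<Rightarrow> 'm \<Rightarrow> 'm \<Rightarrow> 'm \<Rightarrow> 'm \<Rightarrow> 'm \<Rightarrow> 'm \<Rightarrow> 'm \<Rightarrow> bool" where
  "short_exact_morphism C f g f' g' l m n \<longleftrightarrow>
     short_exact C f g \<and> short_exact C f' g' \<and>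
     l \<in> Hom C (Dom C f) (Dom C f') \<and> m \<in> Hom C (Cod C f) (Cod C f') \<and>
     n \<in> Hom C (Cod C g) (Cod C g') \<and>
     m \<cdot>\<^bsub>C\<^esub> f = f' \<cdot>\<^bsub>C\<^esub> l \<and> n \<cdot>\<^bsub>C\<^esub> g = g' \<cdot>\<^bsub>C\<^esub> m"

section \<open>Functors and functor categories\<close>

record ('a, 'am, 'b, 'bm) ftor =
  fob :: "'a \<Rightarrow> 'b"
  far :: "'am \<Rightarrow> 'bm"

definition is_functor ::
  "('a, 'am, 'y) cat_scheme \<Rightarrow> ('b, 'bm, 'z) cat_scheme \<Rightarrow> ('a, 'am, 'b, 'bm) ftor \<Rightarrow> bool" where
  "is_functor A B G \<longleftrightarrow>
     (\<forall>a \<in> Ob A. fob G a \<in> Ob B) \<and>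
     (\<forall>f \<in> Ar A. far G f \<in> Hom B (fob G (Dom A f)) (fob G (Cod A f))) \<and>
     (\<forall>a \<in> Ob A. far G (Idn A a) = Idn B (fob G a)) \<and>
     (\<forall>a b c. \<forall>f \<in> Hom A a b. \<forall>g \<in> Hom A b c. far G (g \<cdot>\<^bsub>A\<^esub> f) = far G g \<cdot>\<^bsub>B\<^esub> far G f)"

record ('a, 'am, 'b, 'bm) ntr =
  nsrc :: "('a, 'am, 'b, 'bm) ftor"
  ntrg :: "('a, 'am, 'b, 'bm) ftor"
  ncmp :: "'a \<Rightarrow> 'bm"

text \<open>
  The category of functors from \<open>I\<close> to \<open>C\<close> with its componentwise additive structure. Functors
  and transformations are \<open>undefined\<close> outside \<open>I\<close> (\<open>extensional\<close>), so that equality of objects and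
  arrows is the intended one.
\<close>

definition functor_cat ::
  "('i, 'im, 'z) cat_scheme \<Rightarrow> ('o, 'm) acat \<Rightarrow>
   (('i, 'im, 'o, 'm) ftor, ('i, 'im, 'o, 'm) ntr) acat" where
  "functor_cat I C =
     (let functors = {X. is_functor I C X \<and> fob X \<in> extensional (Ob I) \<and> far X \<in> extensional (Ar I)}
      in
     \<lparr> Ob = functors,
       Ar = {\<eta>. nsrc \<eta> \<in> functors \<and> ntrg \<eta> \<in> functors \<and> ncmp \<eta> \<in> extensional (Ob I) \<and>
               (\<forall>k \<in> Ob I. ncmp \<eta> k \<in> Hom C (fob (nsrc \<eta>) k) (fob (ntrg \<eta>) k)) \<and>
               (\<forall>u \<in> Ar I. ncmp \<eta> (Cod I u) \<cdot>\<^bsub>C\<^esub> far (nsrc \<eta>) u =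
                           far (ntrg \<eta>) u \<cdot>\<^bsub>C\<^esub> ncmp \<eta> (Dom I u))},
       Dom = nsrc,
       Cod = ntrg,
       Idn = (\<lambda>X. \<lparr> nsrc = X, ntrg = X, ncmp = (\<lambda>k \<in> Ob I. Idn C (fob X k)) \<rparr>),
       Comp = (\<lambda>\<theta> \<eta>. \<lparr> nsrc = nsrc \<eta>, ntrg = ntrg \<theta>,
                        ncmp = (\<lambda>k \<in> Ob I. ncmp \<theta> k \<cdot>\<^bsub>C\<^esub> ncmp \<eta> k) \<rparr>),
       Madd = (\<lambda>\<eta> \<theta>. \<lparr> nsrc = nsrc \<eta>, ntrg = ntrg \<eta>,
                        ncmp = (\<lambda>k \<in> Ob I. Madd C (ncmp \<eta> k) (ncmp \<theta> k)) \<rparr>),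
       Mzero = (\<lambda>X Y. \<lparr> nsrc = X, ntrg = Y,
                         ncmp = (\<lambda>k \<in> Ob I. Mzero C (fob X k) (fob Y k)) \<rparr>) \<rparr>)"

definition additive_functor :: "('a, 'am) acat \<Rightarrow> ('b, 'bm) acat \<Rightarrow> ('a, 'am, 'b, 'bm) ftor \<Rightarrow> bool"
  where
  "additive_functor A B G \<longleftrightarrow> is_functor A B G \<and>
     (\<forall>a b. \<forall>f \<in> Hom A a b. \<forall>g \<in> Hom A a b. far G (Madd A f g) = Madd B (far G f) (far G g))"

definition right_exact :: "('a, 'am) acat \<Rightarrow> ('b, 'bm) acat \<Rightarrow> ('a, 'am, 'b, 'bm) ftor \<Rightarrow> bool" where
  "right_exact A B G \<longleftrightarrow> is_functor A B G \<and>
     (\<forall>f g. short_exact A f g \<longrightarrow> exact_at B (far G f) (far G g) \<and> epic B (far G g))"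

definition exact_functor :: "('a, 'am) acat \<Rightarrow> ('b, 'bm) acat \<Rightarrow> ('a, 'am, 'b, 'bm) ftor \<Rightarrow> bool"
  where
  "exact_functor A B G \<longleftrightarrow> is_functor A B G \<and>
     (\<forall>f g. short_exact A f g \<longrightarrow> short_exact B (far G f) (far G g))"

text \<open>The partial functors \<open>F(X, -)\<close> and \<open>F(-, Y)\<close> of a bifunctor, i.e. of a functor on \<open>C \<times> D\<close>.\<close>

definition fix_fst ::
  "('c, 'cm) acat \<Rightarrow> ('c \<times> 'd, 'cm \<times> 'dm, 'e, 'em) ftor \<Rightarrow> 'c \<Rightarrow> ('d, 'dm, 'e, 'em) ftor" where
  "fix_fst C F X = \<lparr> fob = (\<lambda>Y. fob F (X, Y)), far = (\<lambda>g. far F (Idn C X, g)) \<rparr>"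

definition fix_snd ::
  "('d, 'dm) acat \<Rightarrow> ('c \<times> 'd, 'cm \<times> 'dm, 'e, 'em) ftor \<Rightarrow> 'd \<Rightarrow> ('c, 'cm, 'e, 'em) ftor" where
  "fix_snd D F Y = \<lparr> fob = (\<lambda>X. fob F (X, Y)), far = (\<lambda>f. far F (f, Idn D Y)) \<rparr>"

definition additive_bifunctor ::
  "('c, 'cm) acat \<Rightarrow> ('d, 'dm) acat \<Rightarrow> ('e, 'em) acat \<Rightarrow>
   ('c \<times> 'd, 'cm \<times> 'dm, 'e, 'em) ftor \<Rightarrow> bool" where
  "additive_bifunctor C D E F \<longleftrightarrow> is_functor (prod_cat C D) E F \<and>
     (\<forall>Y \<in> Ob D. additive_functor C E (fix_snd D F Y)) \<and>
     (\<forall>X \<in> Ob C. additive_functor D E (fix_fst C F X))"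

definition right_exact_bifunctor ::
  "('c, 'cm) acat \<Rightarrow> ('d, 'dm) acat \<Rightarrow> ('e, 'em) acat \<Rightarrow>
   ('c \<times> 'd, 'cm \<times> 'dm, 'e, 'em) ftor \<Rightarrow> bool" where
  "right_exact_bifunctor C D E F \<longleftrightarrow>
     (\<forall>Y \<in> Ob D. right_exact C E (fix_snd D F Y)) \<and>
     (\<forall>X \<in> Ob C. right_exact D E (fix_fst C F X))"

section \<open>Chain complexes and homology\<close>

text \<open>Complexes are indexed by all integers; \<open>cdf K n\<close> goes from degree \<open>n\<close> to degree \<open>n - 1\<close>.\<close>

record ('o, 'm) cpx =
  cob :: "int \<Rightarrow> 'o"
  cdf :: "int \<Rightarrow> 'm"

definition chain_complex :: "('o, 'm) acat \<Rightarrow> ('o, 'm) cpx \<Rightarrow> bool" where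
  "chain_complex C K \<longleftrightarrow>
     (\<forall>n. cob K n \<in> Ob C \<and> cdf K n \<in> Hom C (cob K n) (cob K (n - 1)) \<and>
          cdf K (n - 1) \<cdot>\<^bsub>C\<^esub> cdf K n = Mzero C (cob K n) (cob K (n - 2)))"

definition chain_map :: "('o, 'm) acat \<Rightarrow> ('o, 'm) cpx \<Rightarrow> ('o, 'm) cpx \<Rightarrow> (int \<Rightarrow> 'm) \<Rightarrow> bool" where
  "chain_map C K L \<phi> \<longleftrightarrow>
     (\<forall>n. \<phi> n \<in> Hom C (cob K n) (cob L n) \<and> cdf L n \<cdot>\<^bsub>C\<^esub> \<phi> n = \<phi> (n - 1) \<cdot>\<^bsub>C\<^esub> cdf K n)"

definition map_cpx :: "('a, 'am, 'b, 'bm) ftor \<Rightarrow> ('a, 'am) cpx \<Rightarrow> ('b, 'bm) cpx" where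
  "map_cpx G K = \<lparr> cob = (\<lambda>n. fob G (cob K n)), cdf = (\<lambda>n. far G (cdf K n)) \<rparr>"

text \<open>
  Homology in degree \<open>n\<close> is \<open>Z/B\<close>: \<open>cycles\<close> is a kernel \<open>Z \<rightarrow> K\<^sub>n\<close> of the outgoing differential,
  \<open>boundary\<close> the incoming differential regarded as a map \<open>K\<^sub>n\<^sub>+\<^sub>1 \<rightarrow> Z\<close>, and \<open>homology_proj\<close> a cokernel
  of the latter. The choices are made once and for all with Hilbert's operator.
\<close>

definition cycles :: "('o, 'm) acat \<Rightarrow> ('o, 'm) cpx \<Rightarrow> int \<Rightarrow> 'm" where
  "cycles C K n = (SOME z. is_kernel C (cdf K n) z)"

definition boundary :: "('o, 'm) acat \<Rightarrow> ('o, 'm) cpx \<Rightarrow> int \<Rightarrow> 'm" where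
  "boundary C K n =
     (THE b. b \<in> Hom C (cob K (n + 1)) (Dom C (cycles C K n)) \<and>
             cycles C K n \<cdot>\<^bsub>C\<^esub> b = cdf K (n + 1))"

definition homology_proj :: "('o, 'm) acat \<Rightarrow> ('o, 'm) cpx \<Rightarrow> int \<Rightarrow> 'm" where
  "homology_proj C K n = (SOME q. is_cokernel C (boundary C K n) q)"

definition homology :: "('o, 'm) acat \<Rightarrow> ('o, 'm) cpx \<Rightarrow> int \<Rightarrow> 'o" where
  "homology C K n = Cod C (homology_proj C K n)"

text \<open>The map on homology: restrict \<open>\<phi>\<close> to cycles (\<open>\<zeta>\<close>) and pass to the quotient.\<close>

definition homology_map ::
  "('o, 'm) acat \<Rightarrow> ('o, 'm) cpx \<Rightarrow> ('o, 'm) cpx \<Rightarrow> (int \<Rightarrow> 'm) \<Rightarrow> int \<Rightarrow> 'm" where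
  "homology_map C K L \<phi> n =
     (THE h. h \<in> Hom C (homology C K n) (homology C L n) \<and>
        (\<exists>\<zeta> \<in> Hom C (Dom C (cycles C K n)) (Dom C (cycles C L n)).
           cycles C L n \<cdot>\<^bsub>C\<^esub> \<zeta> = \<phi> n \<cdot>\<^bsub>C\<^esub> cycles C K n \<and>
           h \<cdot>\<^bsub>C\<^esub> homology_proj C K n = homology_proj C L n \<cdot>\<^bsub>C\<^esub> \<zeta>))"

definition short_exact_complexes ::
  "('o, 'm) acat \<Rightarrow> ('o, 'm) cpx \<Rightarrow> ('o, 'm) cpx \<Rightarrow> ('o, 'm) cpx \<Rightarrow>
   (int \<Rightarrow> 'm) \<Rightarrow> (int \<Rightarrow> 'm) \<Rightarrow> bool" where
  "short_exact_complexes C K L M \<phi> \<psi> \<longleftrightarrow>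
     chain_complex C K \<and> chain_complex C L \<and> chain_complex C M \<and>
     chain_map C K L \<phi> \<and> chain_map C L M \<psi> \<and> (\<forall>n. short_exact C (\<phi> n) (\<psi> n))"

text \<open>
  The connecting morphism \<open>H\<^sub>n(M) \<rightarrow> H\<^sub>n\<^sub>-\<^sub>1(K)\<close> of a short exact sequence of complexes
  \<open>0 \<rightarrow> K \<rightarrow> L \<rightarrow> M \<rightarrow> 0\<close>. This is the usual recipe "lift a cycle \<open>x\<close> of \<open>M\<close> to \<open>y\<close> in \<open>L\<close>, and
  send the class of \<open>x\<close> to the class of the cycle \<open>z\<close> of \<open>K\<close> with \<open>\<phi> z = d y\<close>", read with generalised
  elements: \<open>x\<close>, \<open>y\<close>, \<open>z\<close> are arrows from an arbitrary common domain \<open>w\<close>. The morphism is unique because,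
  taking \<open>w\<close> to be the pullback of \<open>L\<^sub>n\<close> and \<open>Z\<^sub>n(M)\<close> over \<open>M\<^sub>n\<close>, the arrow \<open>x\<close> is an epimorphism.
\<close>

definition connecting ::
  "('o, 'm) acat \<Rightarrow> ('o, 'm) cpx \<Rightarrow> ('o, 'm) cpx \<Rightarrow> ('o, 'm) cpx \<Rightarrow>
   (int \<Rightarrow> 'm) \<Rightarrow> (int \<Rightarrow> 'm) \<Rightarrow> int \<Rightarrow> 'm" where
  "connecting C K L M \<phi> \<psi> n =
     (THE h. h \<in> Hom C (homology C M n) (homology C K (n - 1)) \<and>
        (\<forall>w. \<forall>x \<in> Hom C w (Dom C (cycles C M n)). \<forall>y \<in> Hom C w (cob L n).
         \<forall>z \<in> Hom C w (Dom C (cycles C K (n - 1))).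
           \<psi> n \<cdot>\<^bsub>C\<^esub> y = cycles C M n \<cdot>\<^bsub>C\<^esub> x \<and>
           \<phi> (n - 1) \<cdot>\<^bsub>C\<^esub> (cycles C K (n - 1) \<cdot>\<^bsub>C\<^esub> z) = cdf L n \<cdot>\<^bsub>C\<^esub> y \<longrightarrow>
           h \<cdot>\<^bsub>C\<^esub> (homology_proj C M n \<cdot>\<^bsub>C\<^esub> x) = homology_proj C K (n - 1) \<cdot>\<^bsub>C\<^esub> z))"

section \<open>Derived functors\<close>

text \<open>
  A projective resolution \<open>\<cdots> \<rightarrow> P\<^sub>1 \<rightarrow> P\<^sub>0 \<rightarrow> X \<rightarrow> 0\<close> with augmentation \<open>\<epsilon>\<close>, extended by zero
  objects in negative degrees. Hence the derived functors below vanish in negative degrees.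
\<close>

definition projective_resolution :: "('o, 'm) acat \<Rightarrow> 'o \<Rightarrow> ('o, 'm) cpx \<Rightarrow> 'm \<Rightarrow> bool" where
  "projective_resolution C X P \<epsilon> \<longleftrightarrow>
     chain_complex C P \<and> (\<forall>n \<ge> 0. projective C (cob P n)) \<and> (\<forall>n < 0. zero_object C (cob P n)) \<and>
     \<epsilon> \<in> Hom C (cob P 0) X \<and> epic C \<epsilon> \<and> exact_at C (cdf P 1) \<epsilon> \<and>
     (\<forall>n \<ge> 1. exact_at C (cdf P (n + 1)) (cdf P n))"

definition resolution :: "('o, 'm) acat \<Rightarrow> 'o \<Rightarrow> ('o, 'm) cpx \<times> 'm" where
  "resolution C X = (SOME (P, \<epsilon>). projective_resolution C X P \<epsilon>)"

definition res :: "('o, 'm) acat \<Rightarrow> 'o \<Rightarrow> ('o, 'm) cpx" where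
  "res C X = fst (resolution C X)"

definition aug :: "('o, 'm) acat \<Rightarrow> 'o \<Rightarrow> 'm" where
  "aug C X = snd (resolution C X)"

definition lift :: "('o, 'm) acat \<Rightarrow> 'm \<Rightarrow> int \<Rightarrow> 'm" where
  "lift C f = (SOME \<phi>. chain_map C (res C (Dom C f)) (res C (Cod C f)) \<phi> \<and>
                       aug C (Cod C f) \<cdot>\<^bsub>C\<^esub> \<phi> 0 = f \<cdot>\<^bsub>C\<^esub> aug C (Dom C f))"

text \<open>\<open>derived_ob \<dots> n X Y\<close> is \<open>F\<^sub>n(X, Y)\<close> and \<open>derived_ar \<dots> n f g\<close> is \<open>F\<^sub>n(f, g)\<close>.\<close>

definition derived_ob ::
  "('c, 'cm) acat \<Rightarrow> ('d, 'dm) acat \<Rightarrow> ('e, 'em) acat \<Rightarrow> ('c \<times> 'd, 'cm \<times> 'dm, 'e, 'em) ftor \<Rightarrow>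
   int \<Rightarrow> 'c \<Rightarrow> 'd \<Rightarrow> 'e" where
  "derived_ob C D E F n X Y = homology E (map_cpx (fix_snd D F Y) (res C X)) n"

definition derived_ar ::
  "('c, 'cm) acat \<Rightarrow> ('d, 'dm) acat \<Rightarrow> ('e, 'em) acat \<Rightarrow> ('c \<times> 'd, 'cm \<times> 'dm, 'e, 'em) ftor \<Rightarrow>
   int \<Rightarrow> 'cm \<Rightarrow> 'dm \<Rightarrow> 'em" where
  "derived_ar C D E F n f g =
     homology_map E
       (map_cpx (fix_snd D F (Dom D g)) (res C (Dom C f)))
       (map_cpx (fix_snd D F (Cod D g)) (res C (Cod C f)))
       (\<lambda>m. far F (lift C f m, g)) n"

text \<open>
  For a short exact sequence \<open>0 \<rightarrow> L \<rightarrow> M \<rightarrow> N \<rightarrow> 0\<close> in \<open>C\<close> with maps \<open>f\<close>, \<open>g\<close>: a short exact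
  sequence \<open>0 \<rightarrow> P\<^sub>L \<rightarrow> Q \<rightarrow> P\<^sub>N \<rightarrow> 0\<close> of projective resolutions over it, where \<open>P\<^sub>L\<close>, \<open>P\<^sub>N\<close> are the
  chosen resolutions of \<open>L\<close> and \<open>N\<close> (horseshoe lemma).
\<close>

definition horseshoe ::
  "('o, 'm) acat \<Rightarrow> 'm \<Rightarrow> 'm \<Rightarrow> ('o, 'm) cpx \<Rightarrow> (int \<Rightarrow> 'm) \<Rightarrow> (int \<Rightarrow> 'm) \<Rightarrow> bool" where
  "horseshoe C f g Q \<phi> \<psi> \<longleftrightarrow>
     (\<exists>\<epsilon>. projective_resolution C (Cod C f) Q \<epsilon> \<and>
          short_exact_complexes C (res C (Dom C f)) Q (res C (Cod C g)) \<phi> \<psi> \<and>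
          \<epsilon> \<cdot>\<^bsub>C\<^esub> \<phi> 0 = f \<cdot>\<^bsub>C\<^esub> aug C (Dom C f) \<and>
          aug C (Cod C g) \<cdot>\<^bsub>C\<^esub> \<psi> 0 = g \<cdot>\<^bsub>C\<^esub> \<epsilon>)"

text \<open>\<open>\<delta>\<^sub>n : F\<^sub>n(N, Y) \<rightarrow> F\<^sub>n\<^sub>-\<^sub>1(L, Y)\<close>\<close>

definition delta_fst ::
  "('c, 'cm) acat \<Rightarrow> ('d, 'dm) acat \<Rightarrow> ('e, 'em) acat \<Rightarrow> ('c \<times> 'd, 'cm \<times> 'dm, 'e, 'em) ftor \<Rightarrow>
   int \<Rightarrow> 'cm \<Rightarrow> 'cm \<Rightarrow> 'd \<Rightarrow> 'em" where
  "delta_fst C D E F n f g Y =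
     (let (Q, \<phi>, \<psi>) = (SOME (Q, \<phi>, \<psi>). horseshoe C f g Q \<phi> \<psi>);
          G = fix_snd D F Y
      in connecting E (map_cpx G (res C (Dom C f))) (map_cpx G Q) (map_cpx G (res C (Cod C g)))
           (\<lambda>m. far G (\<phi> m)) (\<lambda>m. far G (\<psi> m)) n)"

text \<open>
  \<open>\<delta>\<^sub>n : F\<^sub>n(X, N) \<rightarrow> F\<^sub>n\<^sub>-\<^sub>1(X, L)\<close> for a short exact sequence \<open>0 \<rightarrow> L \<rightarrow> M \<rightarrow> N \<rightarrow> 0\<close> in \<open>D\<close> with
  maps \<open>f\<close>, \<open>g\<close>.
\<close>

definition delta_snd ::
  "('c, 'cm) acat \<Rightarrow> ('d, 'dm) acat \<Rightarrow> ('e, 'em) acat \<Rightarrow> ('c \<times> 'd, 'cm \<times> 'dm, 'e, 'em) ftor \<Rightarrow>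
   int \<Rightarrow> 'c \<Rightarrow> 'dm \<Rightarrow> 'dm \<Rightarrow> 'em" where
  "delta_snd C D E F n X f g =
     (let P = res C X
      in connecting E (map_cpx (fix_snd D F (Dom D f)) P) (map_cpx (fix_snd D F (Cod D f)) P)
           (map_cpx (fix_snd D F (Cod D g)) P)
           (\<lambda>m. far F (Idn C (cob P m), f)) (\<lambda>m. far F (Idn C (cob P m), g)) n)"

section \<open>Derived functors on functor categories\<close>

text \<open>The functor \<open>F\<^sub>n(X, Y)\<close> from \<open>I \<times> J\<close> to \<open>E\<close>, for \<open>X\<close> in \<open>C\<^sup>I\<close> and \<open>Y\<close> in \<open>D\<^sup>J\<close>.\<close>

definition derived_IJ_ob ::
  "('i, 'im) cat \<Rightarrow> ('j, 'jm) cat \<Rightarrow>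
   ('c, 'cm) acat \<Rightarrow> ('d, 'dm) acat \<Rightarrow> ('e, 'em) acat \<Rightarrow> ('c \<times> 'd, 'cm \<times> 'dm, 'e, 'em) ftor \<Rightarrow>
   int \<Rightarrow> ('i, 'im, 'c, 'cm) ftor \<Rightarrow> ('j, 'jm, 'd, 'dm) ftor \<Rightarrow>
   ('i \<times> 'j, 'im \<times> 'jm, 'e, 'em) ftor" where
  "derived_IJ_ob I J C D E F n X Y =
     \<lparr> fob = (\<lambda>(k, i) \<in> Ob (prod_cat I J). derived_ob C D E F n (fob X k) (fob Y i)),
       far = (\<lambda>(u, v) \<in> Ar (prod_cat I J). derived_ar C D E F n (far X u) (far Y v)) \<rparr>"

definition derived_IJ_ar ::
  "('i, 'im) cat \<Rightarrow> ('j, 'jm) cat \<Rightarrow>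
   ('c, 'cm) acat \<Rightarrow> ('d, 'dm) acat \<Rightarrow> ('e, 'em) acat \<Rightarrow> ('c \<times> 'd, 'cm \<times> 'dm, 'e, 'em) ftor \<Rightarrow>
   int \<Rightarrow> ('i, 'im, 'c, 'cm) ntr \<Rightarrow> ('j, 'jm, 'd, 'dm) ntr \<Rightarrow>
   ('i \<times> 'j, 'im \<times> 'jm, 'e, 'em) ntr" where
  "derived_IJ_ar I J C D E F n \<eta> \<theta> =
     \<lparr> nsrc = derived_IJ_ob I J C D E F n (nsrc \<eta>) (nsrc \<theta>),
       ntrg = derived_IJ_ob I J C D E F n (ntrg \<eta>) (ntrg \<theta>),
       ncmp = (\<lambda>(k, i) \<in> Ob (prod_cat I J). derived_ar C D E F n (ncmp \<eta> k) (ncmp \<theta> i)) \<rparr>"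

definition delta_IJ_fst ::
  "('i, 'im) cat \<Rightarrow> ('j, 'jm) cat \<Rightarrow>
   ('c, 'cm) acat \<Rightarrow> ('d, 'dm) acat \<Rightarrow> ('e, 'em) acat \<Rightarrow> ('c \<times> 'd, 'cm \<times> 'dm, 'e, 'em) ftor \<Rightarrow>
   int \<Rightarrow> ('i, 'im, 'c, 'cm) ntr \<Rightarrow> ('i, 'im, 'c, 'cm) ntr \<Rightarrow> ('j, 'jm, 'd, 'dm) ftor \<Rightarrow>
   ('i \<times> 'j, 'im \<times> 'jm, 'e, 'em) ntr" where
  "delta_IJ_fst I J C D E F n f g A =
     \<lparr> nsrc = derived_IJ_ob I J C D E F n (ntrg g) A,
       ntrg = derived_IJ_ob I J C D E F (n - 1) (nsrc f) A,
       ncmp = (\<lambda>(k, i) \<in> Ob (prod_cat I J). delta_fst C D E F n (ncmp f k) (ncmp g k) (fob A i)) \<rparr>"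

definition delta_IJ_snd ::
  "('i, 'im) cat \<Rightarrow> ('j, 'jm) cat \<Rightarrow>
   ('c, 'cm) acat \<Rightarrow> ('d, 'dm) acat \<Rightarrow> ('e, 'em) acat \<Rightarrow> ('c \<times> 'd, 'cm \<times> 'dm, 'e, 'em) ftor \<Rightarrow>
   int \<Rightarrow> ('i, 'im, 'c, 'cm) ftor \<Rightarrow> ('j, 'jm, 'd, 'dm) ntr \<Rightarrow> ('j, 'jm, 'd, 'dm) ntr \<Rightarrow>
   ('i \<times> 'j, 'im \<times> 'jm, 'e, 'em) ntr" where
  "delta_IJ_snd I J C D E F n A f g =
     \<lparr> nsrc = derived_IJ_ob I J C D E F n A (ntrg g),
       ntrg = derived_IJ_ob I J C D E F (n - 1) A (nsrc f),
       ncmp = (\<lambda>(k, i) \<in> Ob (prod_cat I J). delta_snd C D E F n (fob A k) (ncmp f i) (ncmp g i)) \<rparr>"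

section \<open>Long exact sequences\<close>

text \<open>
  \<open>\<cdots> \<rightarrow> Z\<^sub>n\<^sub>+\<^sub>1 \<rightarrow> X\<^sub>n \<rightarrow> Y\<^sub>n \<rightarrow> Z\<^sub>n \<rightarrow> X\<^sub>n\<^sub>-\<^sub>1 \<rightarrow> \<cdots>\<close> with maps \<open>d (n + 1)\<close>, \<open>f n\<close>, \<open>g n\<close>, \<open>d n\<close>,
  for all integers \<open>n\<close>.
\<close>

definition long_exact ::
  "('o, 'm) acat \<Rightarrow> (int \<Rightarrow> 'o) \<Rightarrow> (int \<Rightarrow> 'o) \<Rightarrow> (int \<Rightarrow> 'o) \<Rightarrow>
   (int \<Rightarrow> 'm) \<Rightarrow> (int \<Rightarrow> 'm) \<Rightarrow> (int \<Rightarrow> 'm) \<Rightarrow> bool" where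
  "long_exact C X Y Z f g d \<longleftrightarrow>
     (\<forall>n. X n \<in> Ob C \<and> Y n \<in> Ob C \<and> Z n \<in> Ob C \<and>
          f n \<in> Hom C (X n) (Y n) \<and> g n \<in> Hom C (Y n) (Z n) \<and> d n \<in> Hom C (Z n) (X (n - 1)) \<and>
          exact_at C (d (n + 1)) (f n) \<and> exact_at C (f n) (g n) \<and> exact_at C (g n) (d n))"

text \<open>The squares of a diagram with two such rows and vertical maps \<open>x n\<close>, \<open>y n\<close>, \<open>z n\<close>.\<close>

definition commutative_ladder ::
  "('o, 'm) acat \<Rightarrow>
   (int \<Rightarrow> 'o) \<Rightarrow> (int \<Rightarrow> 'o) \<Rightarrow> (int \<Rightarrow> 'o) \<Rightarrow> (int \<Rightarrow> 'm) \<Rightarrow> (int \<Rightarrow> 'm) \<Rightarrow> (int \<Rightarrow> 'm) \<Rightarrow>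
   (int \<Rightarrow> 'o) \<Rightarrow> (int \<Rightarrow> 'o) \<Rightarrow> (int \<Rightarrow> 'o) \<Rightarrow> (int \<Rightarrow> 'm) \<Rightarrow> (int \<Rightarrow> 'm) \<Rightarrow> (int \<Rightarrow> 'm) \<Rightarrow>
   (int \<Rightarrow> 'm) \<Rightarrow> (int \<Rightarrow> 'm) \<Rightarrow> (int \<Rightarrow> 'm) \<Rightarrow> bool" where
  "commutative_ladder C X Y Z f g d X' Y' Z' f' g' d' x y z \<longleftrightarrow>
     (\<forall>n. x n \<in> Hom C (X n) (X' n) \<and> y n \<in> Hom C (Y n) (Y' n) \<and> z n \<in> Hom C (Z n) (Z' n) \<and>
          y n \<cdot>\<^bsub>C\<^esub> f n = f' n \<cdot>\<^bsub>C\<^esub> x n \<and>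
          z n \<cdot>\<^bsub>C\<^esub> g n = g' n \<cdot>\<^bsub>C\<^esub> y n \<and>
          x (n - 1) \<cdot>\<^bsub>C\<^esub> d n = d' n \<cdot>\<^bsub>C\<^esub> z n)"

end

theory Submission
  imports Defs
begin

text \<open>
  In an abelian category pullbacks of epimorphisms are epimorphisms, so diagrams can be chased with
  generalised elements, lifting along an epimorphism at the price of refining the domain of the
  element. This gives the long exact homology sequence and its naturality.

  In the first variable, a horseshoe \<open>0 \<rightarrow> P\<^sub>L \<rightarrow> Q \<rightarrow> P\<^sub>N \<rightarrow> 0\<close> splits degreewise and hence stays short
  exact under the additive functor \<open>F(-, Y)\<close>; \<open>Q\<close> is exchanged for the chosen resolution of \<open>M\<close> by the
  uniqueness of lifts up to homotopy. For naturality, a morphism of short exact sequences is lifted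
  to a strictly commuting morphism of horseshoes. In the second variable, exactness of \<open>F(P, -)\<close>
  makes \<open>0 \<rightarrow> F(P\<^sub>*, L) \<rightarrow> F(P\<^sub>*, M) \<rightarrow> F(P\<^sub>*, N) \<rightarrow> 0\<close> short exact; zero objects are projective, so this
  includes the negative degrees.

  Kernels and cokernels in functor categories are computed componentwise, hence so is exactness, and
  naturality of the sequences for single objects makes the componentwise maps morphisms of diagrams.
\<close>

section \<open>Additive structure\<close>

text \<open>Resolutions, lifts, horseshoes, cycles and homology are all chosen by Hilbert's
  operator, so the obstacle is independence of choices. The choices made at different objects of I
  are unrelated. Only naturality for arbitrary morphisms of short exact sequences turns the
  componentwise connecting maps into transformations, and it is applied twice: to the structure maps
  of the functors and to the given morphism. Connecting morphisms are compared along strictly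
  commuting maps of complexes, whereas lifts to resolutions commute only up to homotopy. A map of
  horseshoes therefore has the chosen lift prescribed at its left end, corrects an arbitrary lift in
  the middle and takes whatever is induced at its right end; homotopy invariance identifies the last
  with the chosen lift on homology. Functor categories are not treated as instances of the abelian
  locale. Exactness in them refers to some kernel and cokernel, which must be compared with the
  componentwise ones in both directions: to extract a short exact sequence at each object, and to
  assemble exact rows.\<close>

definition Epi :: "('o, 'm, 'z) cat_scheme \<Rightarrow> 'o \<Rightarrow> 'o \<Rightarrow> 'm set" where
  "Epi C a b = {e \<in> Hom C a b. epic C e}"

text \<open>The record \<open>acat\<close> stores sums and zero morphisms but no negatives; the
  group in which to invert is recovered from the endpoints of \<open>f\<close>.\<close>

definition Mneg :: "('o, 'm) acat \<Rightarrow> 'm \<Rightarrow> 'm" where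
  "Mneg C f = inv\<^bsub>Hom_group C (Dom C f) (Cod C f)\<^esub> f"

definition Msub :: "('o, 'm) acat \<Rightarrow> 'm \<Rightarrow> 'm \<Rightarrow> 'm" where
  "Msub C f g = Madd C f (Mneg C g)"

lemma Epi_Hom: "e \<in> Epi C a b \<Longrightarrow> e \<in> Hom C a b"
  by (simp add: Epi_def)

section \<open>Composition, epimorphisms and projectives in a plain category\<close>

context category
begin

lemma Hom_Ob: "f \<in> Hom C a b \<Longrightarrow> a \<in> Ob C \<and> b \<in> Ob C"
  using Dom_in Cod_in by (auto simp: Hom_def)

lemma Hom_Ob1: "f \<in> Hom C a b \<Longrightarrow> a \<in> Ob C"
  and Hom_Ob2: "f \<in> Hom C a b \<Longrightarrow> b \<in> Ob C"
  using Hom_Ob by blast+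

declare Dom_in [simp] Cod_in [simp]

lemma Idn_simps [simp]:
  assumes "a \<in> Ob C"
  shows "Idn C a \<in> Ar C" "Dom C (Idn C a) = a" "Cod C (Idn C a) = a"
  using Idn_in[OF assms] by (auto simp: Hom_def)

lemma Comp_simps [simp]:
  assumes "f \<in> Ar C" "g \<in> Ar C" "Cod C f = Dom C g"
  shows "g \<cdot> f \<in> Ar C" "Dom C (g \<cdot> f) = Dom C f" "Cod C (g \<cdot> f) = Cod C g"
  using assms Comp_in[of f "Dom C f" "Dom C g" g "Cod C g"] by (auto simp: Hom_def)

text \<open>Right-nested composites are the normal form of all later calculations. Typing is
  expressed by \<open>Dom\<close> and \<open>Cod\<close>, so that it is decided by simplification
  once \<open>Hom\<close> is unfolded.\<close>

lemma assoc [simp]: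
  assumes "f \<in> Ar C" "g \<in> Ar C" "h \<in> Ar C" "Cod C f = Dom C g" "Cod C g = Dom C h"
  shows "(h \<cdot> g) \<cdot> f = h \<cdot> (g \<cdot> f)"
  using assms Comp_assoc[of f "Dom C f" "Dom C g" g "Dom C h" h "Cod C h"] by (simp add: Hom_def)

lemma Idn_left_simp [simp]: "f \<in> Ar C \<Longrightarrow> Cod C f = b \<Longrightarrow> Idn C b \<cdot> f = f"
  using Idn_left[of f "Dom C f" b] by (simp add: Hom_def)

lemma Idn_right_simp [simp]: "f \<in> Ar C \<Longrightarrow> Dom C f = a \<Longrightarrow> f \<cdot> Idn C a = f"
  using Idn_right[of f a "Cod C f"] by (simp add: Hom_def)

text \<open>In a right-nested composite the factors \<open>g\<close> and \<open>f\<close> of a known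
  product are separated by a bracket; this form lets an equation between short composites act in
  front of any \<open>x\<close>.\<close>

lemma reassoc:
  assumes "g \<cdot> f = k" "f \<in> Ar C" "g \<in> Ar C" "x \<in> Ar C" "Cod C x = Dom C f" "Cod C f = Dom C g"
  shows "g \<cdot> (f \<cdot> x) = k \<cdot> x"
  using assms by auto

lemma epicD:
  assumes "epic C e" "g \<cdot> e = h \<cdot> e" "e \<in> Hom C a b" "g \<in> Hom C b c" "h \<in> Hom C b c"
  shows "g = h"
  using assms unfolding epic_def Hom_def by auto

lemma monicD:
  assumes "monic C e" "e \<cdot> g = e \<cdot> h" "e \<in> Hom C b c" "g \<in> Hom C a b" "h \<in> Hom C a b"
  shows "g = h"
  using assms unfolding monic_def Hom_def by auto

lemma EpiD:
  assumes "e \<in> Epi C a b" "g \<cdot> e = h \<cdot> e" "g \<in> Hom C b c" "h \<in> Hom C b c"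
  shows "g = h"
  using assms epicD[of e g h a b c] by (auto simp: Epi_def)

lemma Epi_Comp:
  assumes "e \<in> Epi C a b" "f \<in> Epi C b c"
  shows "f \<cdot> e \<in> Epi C a c"
proof -
  have h: "e \<in> Hom C a b" "f \<in> Hom C b c" using assms by (auto simp: Epi_def)
  have *: "g = g'" if "g \<in> Hom C c d" "g' \<in> Hom C c d" "g \<cdot> (f \<cdot> e) = g' \<cdot> (f \<cdot> e)" for g g' d
  proof -
    have "(g \<cdot> f) \<cdot> e = (g' \<cdot> f) \<cdot> e" using that h by (simp add: Hom_def)
    then have "g \<cdot> f = g' \<cdot> f" using assms(1) that h EpiD[of e a b _ _ d] Comp_in by metis
    then show "g = g'" using assms(2) that EpiD[of f b c g g' d] by blast
  qed
  have fe: "f \<cdot> e \<in> Hom C a c" using h by (auto intro: Comp_in)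
  then have "Cod C (f \<cdot> e) = c" "f \<cdot> e \<in> Ar C" by (auto simp: Hom_def)
  with * fe show ?thesis unfolding Epi_def epic_def by blast
qed

lemma Idn_Epi: "a \<in> Ob C \<Longrightarrow> Idn C a \<in> Epi C a a"
  by (auto simp: Epi_def epic_def Hom_def)

lemma projective_lift:
  assumes "projective C P" "e \<in> Epi C a b" "f \<in> Hom C P b"
  obtains g where "g \<in> Hom C P a" "e \<cdot> g = f"
proof -
  have "epic C e" "Dom C e = a" "Cod C e = b" using assms(2) by (auto simp: Epi_def Hom_def)
  with assms that show ?thesis unfolding projective_def by blast
qed

end

section \<open>Addition, zero and negatives of parallel arrows\<close>

context preadditive_category
begin

lemma Hom_group_simps [simp]:
  "carrier (Hom_group C a b) = Hom C a b" "mult (Hom_group C a b) = Madd C"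
  "one (Hom_group C a b) = Mzero C a b"
  by (simp_all add: Hom_group_def)

lemma Mzero_Hom: "a \<in> Ob C \<Longrightarrow> b \<in> Ob C \<Longrightarrow> Mzero C a b \<in> Hom C a b"
  using Hom_comm_group[of a b] by
    (metis Hom_group_simps(1,3) comm_group.axioms(2) group.is_monoid monoid.one_closed)

lemma Mzero_simps [simp]:
  assumes "a \<in> Ob C" "b \<in> Ob C"
  shows "Mzero C a b \<in> Ar C" "Dom C (Mzero C a b) = a" "Cod C (Mzero C a b) = b"
  using Mzero_Hom[OF assms] by (auto simp: Hom_def)

lemma Madd_Hom: "f \<in> Hom C a b \<Longrightarrow> g \<in> Hom C a b \<Longrightarrow> Madd C f g \<in> Hom C a b"
  using Hom_comm_group[of a b] Hom_Ob[of f a b]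
  by (metis Hom_group_simps(1,2) comm_group.axioms(2) group.is_monoid monoid.m_closed)

lemma Madd_simps [simp]:
  assumes "f \<in> Ar C" "g \<in> Ar C" "Dom C f = Dom C g" "Cod C f = Cod C g"
  shows "Madd C f g \<in> Ar C" "Dom C (Madd C f g) = Dom C g" "Cod C (Madd C f g) = Cod C g"
  using assms Madd_Hom[of f "Dom C g" "Cod C g" g] by (auto simp: Hom_def)

lemma Madd_assoc:
  assumes "f \<in> Ar C" "g \<in> Ar C" "h \<in> Ar C" "Dom C f = Dom C g" "Cod C f = Cod C g"
    "Dom C g = Dom C h" "Cod C g = Cod C h"
  shows "Madd C (Madd C f g) h = Madd C f (Madd C g h)"
proof -
  interpret comm_group "Hom_group C (Dom C h) (Cod C h)" using assms Hom_comm_group by simp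
  show ?thesis using m_assoc[of f g h] assms by (simp add: Hom_def)
qed

lemma Madd_comm:
  assumes "f \<in> Ar C" "g \<in> Ar C" "Dom C f = Dom C g" "Cod C f = Cod C g"
  shows "Madd C f g = Madd C g f"
proof -
  interpret comm_group "Hom_group C (Dom C g) (Cod C g)" using assms Hom_comm_group by simp
  show ?thesis using m_comm[of f g] assms by (simp add: Hom_def)
qed

lemma Madd_left_comm:
  assumes "f \<in> Ar C" "g \<in> Ar C" "h \<in> Ar C" "Dom C f = Dom C g" "Cod C f = Cod C g"
    "Dom C g = Dom C h" "Cod C g = Cod C h"
  shows "Madd C f (Madd C g h) = Madd C g (Madd C f h)"
  using assms Madd_assoc[of f g h] Madd_assoc[of g f h] Madd_comm[of f g] by simp

lemmas Madd_ac = Madd_assoc Madd_comm Madd_left_comm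

lemma Madd_zero [simp]:
  assumes "f \<in> Ar C" "Dom C f = a" "Cod C f = b"
  shows "Madd C f (Mzero C a b) = f" "Madd C (Mzero C a b) f = f"
proof -
  interpret comm_group "Hom_group C a b" using assms Hom_comm_group by auto
  show "Madd C f (Mzero C a b) = f" "Madd C (Mzero C a b) f = f"
    using r_one[of f] l_one[of f] assms by (auto simp: Hom_def)
qed

lemma Mneg_simps [simp]:
  assumes "f \<in> Ar C"
  shows "Mneg C f \<in> Ar C" "Dom C (Mneg C f) = Dom C f" "Cod C (Mneg C f) = Cod C f"
    "Madd C f (Mneg C f) = Mzero C (Dom C f) (Cod C f)"
    "Madd C (Mneg C f) f = Mzero C (Dom C f) (Cod C f)"
proof -
  interpret comm_group "Hom_group C (Dom C f) (Cod C f)" using assms Hom_comm_group by auto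
  show "Mneg C f \<in> Ar C" "Dom C (Mneg C f) = Dom C f" "Cod C (Mneg C f) = Cod C f"
    "Madd C f (Mneg C f) = Mzero C (Dom C f) (Cod C f)"
    "Madd C (Mneg C f) f = Mzero C (Dom C f) (Cod C f)"
    using inv_closed[of f] r_inv[of f] l_inv[of f] assms by (auto simp: Hom_def Mneg_def)
qed

lemma Madd_cancel:
  assumes "Madd C f g = Madd C f h" "f \<in> Ar C" "g \<in> Ar C" "h \<in> Ar C" "Dom C f = Dom C g"
    "Cod C f = Cod C g"
    "Dom C f = Dom C h" "Cod C f = Cod C h"
  shows "g = h"
proof -
  have "Madd C (Mneg C f) (Madd C f g) = Madd C (Mneg C f) (Madd C f h)" using assms by simp
  moreover have "Madd C (Mneg C f) (Madd C f g) = g" "Madd C (Mneg C f) (Madd C f h) = h"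
    using assms(2-) by (simp_all add: Madd_assoc[symmetric])
  ultimately show ?thesis by simp
qed

text \<open>An idempotent of a group is neutral. This is how additivity alone yields the
  preservation of zero morphisms, for composition and later for \<open>F\<close>.\<close>

lemma Madd_idem:
  assumes "Madd C f f = f" "f \<in> Ar C"
  shows "f = Mzero C (Dom C f) (Cod C f)"
  using Madd_cancel[of f f "Mzero C (Dom C f) (Cod C f)"] assms by simp

lemma Comp_Madd_right_simp [simp]:
  assumes "f \<in> Ar C" "g \<in> Ar C" "h \<in> Ar C" "Dom C f = Dom C g" "Cod C f = Cod C g"
    "Cod C g = Dom C h"
  shows "h \<cdot> (Madd C f g) = Madd C (h \<cdot> f) (h \<cdot> g)"
  using assms Comp_Madd_right[of f "Dom C g" "Dom C h" g h "Cod C h"] by (simp add: Hom_def)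

lemma Comp_Madd_left_simp [simp]:
  assumes "f \<in> Ar C" "g \<in> Ar C" "h \<in> Ar C" "Dom C f = Dom C g" "Cod C f = Cod C g"
    "Dom C g = Cod C h"
  shows "(Madd C f g) \<cdot> h = Madd C (f \<cdot> h) (g \<cdot> h)"
  using assms Comp_Madd_left[of h "Dom C h" "Cod C h" f "Cod C g" g] by (simp add: Hom_def)

lemma Comp_zero_right [simp]:
  assumes "f \<in> Ar C" "Dom C f = b" "a \<in> Ob C"
  shows "f \<cdot> Mzero C a b = Mzero C a (Cod C f)"
proof -
  have "b \<in> Ob C" using assms by auto
  then have "Madd C (f \<cdot> Mzero C a b) (f \<cdot> Mzero C a b) = f \<cdot> Mzero C a b"
    using assms Comp_Madd_right_simp[of "Mzero C a b" "Mzero C a b" f] by simp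
  from Madd_idem[OF this] show ?thesis using assms \<open>b \<in> Ob C\<close> by simp
qed

lemma Comp_zero_left [simp]:
  assumes "f \<in> Ar C" "Cod C f = a" "b \<in> Ob C"
  shows "Mzero C a b \<cdot> f = Mzero C (Dom C f) b"
proof -
  have "a \<in> Ob C" using assms by auto
  then have "Madd C (Mzero C a b \<cdot> f) (Mzero C a b \<cdot> f) = Mzero C a b \<cdot> f"
    using assms Comp_Madd_left_simp[of "Mzero C a b" "Mzero C a b" f] by simp
  from Madd_idem[OF this] show ?thesis using assms \<open>a \<in> Ob C\<close> by simp
qed

lemma Mneg_unique:
  assumes "Madd C f g = Mzero C (Dom C f) (Cod C f)" "f \<in> Ar C" "g \<in> Ar C" "Dom C f = Dom C g"
    "Cod C f = Cod C g"
  shows "g = Mneg C f"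
  by (rule Madd_cancel[of f]) (use assms in simp_all)

lemma Comp_Mneg_right [simp]:
  assumes "f \<in> Ar C" "h \<in> Ar C" "Cod C f = Dom C h"
  shows "h \<cdot> Mneg C f = Mneg C (h \<cdot> f)"
proof (rule Mneg_unique)
  have "Madd C (h \<cdot> f) (h \<cdot> Mneg C f) = h \<cdot> Madd C f (Mneg C f)"
    using assms by (intro Comp_Madd_right_simp[symmetric]) auto
  then show "Madd C (h \<cdot> f) (h \<cdot> Mneg C f) = Mzero C (Dom C (h \<cdot> f)) (Cod C (h \<cdot> f))"
    using assms by simp
qed (use assms in auto)

lemma Comp_Mneg_left [simp]:
  assumes "f \<in> Ar C" "h \<in> Ar C" "Dom C f = Cod C h"
  shows "Mneg C f \<cdot> h = Mneg C (f \<cdot> h)"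
proof (rule Mneg_unique)
  have "Madd C (f \<cdot> h) (Mneg C f \<cdot> h) = Madd C f (Mneg C f) \<cdot> h"
    using assms by (intro Comp_Madd_left_simp[symmetric]) auto
  then show "Madd C (f \<cdot> h) (Mneg C f \<cdot> h) = Mzero C (Dom C (f \<cdot> h)) (Cod C (f \<cdot> h))"
    using assms by simp
qed (use assms in auto)

lemma Mneg_zero [simp]: "a \<in> Ob C \<Longrightarrow> b \<in> Ob C \<Longrightarrow> Mneg C (Mzero C a b) = Mzero C a b"
  using Mneg_unique[of "Mzero C a b" "Mzero C a b"] by simp

lemma Mneg_Mneg [simp]: "f \<in> Ar C \<Longrightarrow> Mneg C (Mneg C f) = f"
  using Mneg_unique[of "Mneg C f" f] by simp

lemma Msub_simps [simp]:
  assumes "f \<in> Ar C" "g \<in> Ar C" "Dom C f = Dom C g" "Cod C f = Cod C g"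
  shows "Msub C f g \<in> Ar C" "Dom C (Msub C f g) = Dom C g" "Cod C (Msub C f g) = Cod C g"
  using assms by (simp_all add: Msub_def)

lemma Msub_Hom: "f \<in> Hom C a b \<Longrightarrow> g \<in> Hom C a b \<Longrightarrow> Msub C f g \<in> Hom C a b"
  by (simp add: Hom_def)

lemma Comp_Msub_right [simp]:
  assumes "f \<in> Ar C" "g \<in> Ar C" "h \<in> Ar C" "Dom C f = Dom C g" "Cod C f = Cod C g"
    "Cod C g = Dom C h"
  shows "h \<cdot> (Msub C f g) = Msub C (h \<cdot> f) (h \<cdot> g)"
  using assms by (simp add: Msub_def)

lemma Comp_Msub_left [simp]:
  assumes "f \<in> Ar C" "g \<in> Ar C" "h \<in> Ar C" "Dom C f = Dom C g" "Cod C f = Cod C g"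
    "Dom C g = Cod C h"
  shows "(Msub C f g) \<cdot> h = Msub C (f \<cdot> h) (g \<cdot> h)"
  using assms by (simp add: Msub_def)

lemma Msub_self [simp]: "f \<in> Ar C \<Longrightarrow> Msub C f f = Mzero C (Dom C f) (Cod C f)"
  by (simp add: Msub_def)

lemma Msub_zero [simp]:
  assumes "f \<in> Ar C" "Dom C f = a" "Cod C f = b"
  shows "Msub C f (Mzero C a b) = f"
  using assms by (auto simp: Msub_def)

lemma Msub_eq_zero:
  assumes "Msub C f g = Mzero C a b" "f \<in> Hom C a b" "g \<in> Hom C a b"
  shows "f = g"
  using assms Mneg_unique[of "Mneg C g" f] Madd_comm[of f "Mneg C g"]
    by (simp add: Msub_def Hom_def)

lemma Msub_Madd [simp]:
  assumes "f \<in> Ar C" "g \<in> Ar C" "Dom C f = Dom C g" "Cod C f = Cod C g"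
  shows "Madd C (Msub C f g) g = f"
  using assms by (simp add: Msub_def Madd_assoc)

lemma Madd_Msub [simp]:
  assumes "f \<in> Ar C" "g \<in> Ar C" "Dom C f = Dom C g" "Cod C f = Cod C g"
  shows "Madd C g (Msub C f g) = f"
  by (subst Madd_comm) (use assms in simp_all)

lemma Madd_Msub_cancel [simp]:
  assumes "f \<in> Ar C" "g \<in> Ar C" "Dom C f = Dom C g" "Cod C f = Cod C g"
  shows "Msub C (Madd C f g) g = f"
  using assms by (simp add: Msub_def Madd_assoc)

section \<open>Cancellation, zero objects, kernels and cokernels tested against zero\<close>

lemma monicI:
  assumes "f \<in> Hom C a b" "\<And>w x. x \<in> Hom C w a \<Longrightarrow> f \<cdot> x = Mzero C w b \<Longrightarrow> x = Mzero C w a"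
  shows "monic C f"
  unfolding monic_def
proof (intro conjI allI ballI impI)
  show "f \<in> Ar C" using assms by (simp add: Hom_def)
  fix w g h assume h: "g \<in> Hom C w (Dom C f)" "h \<in> Hom C w (Dom C f)" "f \<cdot> g = f \<cdot> h"
  then have "f \<cdot> Msub C g h = Mzero C w b" using assms(1) by (auto simp: Hom_def)
  then have "Msub C g h = Mzero C w a" using h assms by (intro assms(2)) (auto simp: Hom_def)
  then show "g = h" by (rule Msub_eq_zero) (use h assms(1) in \<open>auto simp: Hom_def\<close>)
qed

lemma epicI:
  assumes "f \<in> Hom C a b" "\<And>c x. x \<in> Hom C b c \<Longrightarrow> x \<cdot> f = Mzero C a c \<Longrightarrow> x = Mzero C b c"
  shows "epic C f"
  unfolding epic_def
proof (intro conjI allI ballI impI)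
  show "f \<in> Ar C" using assms by (simp add: Hom_def)
  fix c g h assume h: "g \<in> Hom C (Cod C f) c" "h \<in> Hom C (Cod C f) c" "g \<cdot> f = h \<cdot> f"
  then have "Msub C g h \<cdot> f = Mzero C a c" using assms(1) by (auto simp: Hom_def)
  then have "Msub C g h = Mzero C b c" using h assms by (intro assms(2)) (auto simp: Hom_def)
  then show "g = h" by (rule Msub_eq_zero) (use h assms(1) in \<open>auto simp: Hom_def\<close>)
qed

lemma monic_zero:
  assumes "monic C f" "f \<in> Hom C a b" "x \<in> Hom C w a" "f \<cdot> x = Mzero C w b"
  shows "x = Mzero C w a"
proof -
  have "w \<in> Ob C" "a \<in> Ob C" using assms(3) Hom_Ob by blast+
  then have "Mzero C w a \<in> Hom C w a" "f \<cdot> x = f \<cdot> Mzero C w a"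
    using assms by (simp_all add: Hom_def)
  then show ?thesis using monicD assms by blast
qed

lemma Epi_zero:
  assumes "e \<in> Epi C a b" "x \<in> Hom C b c" "x \<cdot> e = Mzero C a c"
  shows "x = Mzero C b c"
proof -
  have "b \<in> Ob C" "c \<in> Ob C" using assms(2) Hom_Ob by blast+
  then have "Mzero C b c \<in> Hom C b c" "x \<cdot> e = Mzero C b c \<cdot> e"
    using assms by (simp_all add: Hom_def Epi_def)
  then show ?thesis using EpiD assms by blast
qed

text \<open>Composing any arrow into or out of \<open>z\<close> with the identity of
  \<open>z\<close>, which is zero, shows that the arrow is zero.\<close>

lemma zero_objectI:
  assumes "z \<in> Ob C" "Idn C z = Mzero C z z"
  shows "zero_object C z"
  unfolding zero_object_def
proof (intro conjI ballI)
  fix a assume a: "a \<in> Ob C"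
  have "f = Mzero C a z" if f: "f \<in> Hom C a z" for f
  proof -
    have "Idn C z \<cdot> f = f" "f \<in> Ar C" "Dom C f = a" "Cod C f = z"
      using Idn_left[OF f] f by (simp_all add: Hom_def)
    then show ?thesis using Comp_zero_left[of f z z] assms by metis
  qed
  then show "\<exists>!f. f \<in> Hom C a z" using Mzero_Hom[OF a assms(1)] by blast
  have "f = Mzero C z a" if f: "f \<in> Hom C z a" for f
  proof -
    have "f \<cdot> Idn C z = f" "f \<in> Ar C" "Dom C f = z" "Cod C f = a"
      using Idn_right[OF f] f by (simp_all add: Hom_def)
    then show ?thesis using Comp_zero_right[of f z z] assms by metis
  qed
  then show "\<exists>!f. f \<in> Hom C z a" using Mzero_Hom[OF assms(1) a] by blast
qed (rule assms(1))

lemma zero_objectD: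
  assumes "zero_object C z"
  shows "z \<in> Ob C" "f \<in> Hom C a z \<Longrightarrow> f = Mzero C a z" "f \<in> Hom C z a \<Longrightarrow> f = Mzero C z a"
proof -
  show z: "z \<in> Ob C" using assms by (simp add: zero_object_def)
  show "f = Mzero C a z" if "f \<in> Hom C a z" using that assms z Hom_Ob[OF that] Mzero_Hom[of a z]
    unfolding zero_object_def by blast
  show "f = Mzero C z a" if "f \<in> Hom C z a" using that assms z Hom_Ob[OF that] Mzero_Hom[of z a]
    unfolding zero_object_def by blast
qed

text \<open>The only arrow out of a zero object is zero, and the zero arrow lifts it. Hence every
  degree of a resolution is projective, the negative ones included.\<close>

lemma zero_object_projective:
  assumes "zero_object C z"
  shows "projective C z"
  unfolding projective_def
proof (intro conjI allI impI ballI)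
  show z: "z \<in> Ob C" by (rule zero_objectD(1)[OF assms])
  fix e f assume e: "epic C e" "f \<in> Hom C z (Cod C e)"
  then have "e \<cdot> Mzero C z (Dom C e) = f" using z zero_objectD(3)[OF assms e(2)]
    by (simp add: epic_def)
  then show "\<exists>g\<in>Hom C z (Dom C e). e \<cdot> g = f" using e z by (intro bexI[of _ "Mzero C z (Dom C e)"])
    (auto simp: epic_def Hom_def)
qed

text \<open>Uniqueness of factorisations is exactly what \<open>monic C k\<close> provides, so a
  chase only has to supply their existence.\<close>

lemma is_kernelI:
  assumes "f \<in> Hom C b c" "k \<in> Hom C a b" "f \<cdot> k = Mzero C a c"
    "\<And>w h. h \<in> Hom C w b \<Longrightarrow> f \<cdot> h = Mzero C w c \<Longrightarrow> \<exists>u \<in> Hom C w a. k \<cdot> u = h"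
    "monic C k"
  shows "is_kernel C f k"
  unfolding is_kernel_def
proof (intro conjI allI ballI impI)
  fix w h assume h: "h \<in> Hom C w (Dom C f)" "f \<cdot> h = Mzero C w (Cod C f)"
  then obtain u where u: "u \<in> Hom C w a" "k \<cdot> u = h" using assms by (auto simp: Hom_def)
  show "\<exists>!u. u \<in> Hom C w (Dom C k) \<and> k \<cdot> u = h"
  proof (intro ex1I[of _ u])
    show "u \<in> Hom C w (Dom C k) \<and> k \<cdot> u = h" using u assms by (auto simp: Hom_def)
    fix v assume "v \<in> Hom C w (Dom C k) \<and> k \<cdot> v = h"
    then show "v = u" by - (rule monicD[OF assms(5)], use u assms(2) in \<open>auto simp: Hom_def\<close>)
  qed
qed (use assms in \<open>auto simp: Hom_def\<close>)

text \<open>A kernel is monic because the zero arrow factors through it in only one way.\<close>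

lemma is_kernelD:
  assumes "is_kernel C f k"
  shows "f \<in> Ar C" "k \<in> Ar C" "Cod C k = Dom C f" "f \<cdot> k = Mzero C (Dom C k) (Cod C f)"
    "h \<in> Hom C w (Dom C f) \<Longrightarrow> f \<cdot> h = Mzero C w (Cod C f) \<Longrightarrow> \<exists>u \<in> Hom C w (Dom C k). k \<cdot> u = h"
    "monic C k"
proof -
  show f: "f \<in> Ar C" "k \<in> Ar C" "Cod C k = Dom C f" "f \<cdot> k = Mzero C (Dom C k) (Cod C f)"
    "h \<in> Hom C w (Dom C f) \<Longrightarrow> f \<cdot> h = Mzero C w (Cod C f) \<Longrightarrow> \<exists>u \<in> Hom C w (Dom C k). k \<cdot> u = h"
    using assms unfolding is_kernel_def by blast+
  show "monic C k"
  proof (rule monicI)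
    show "k \<in> Hom C (Dom C k) (Dom C f)" using f by (simp add: Hom_def)
    fix w x assume x: "x \<in> Hom C w (Dom C k)" "k \<cdot> x = Mzero C w (Dom C f)"
    have w: "w \<in> Ob C" using x by (auto simp: Hom_def)
    have "\<exists>!u. u \<in> Hom C w (Dom C k) \<and> k \<cdot> u = Mzero C w (Dom C f)"
      using assms f w unfolding is_kernel_def by (auto simp: Mzero_Hom)
    moreover have "k \<cdot> Mzero C w (Dom C k) = Mzero C w (Dom C f)"
      "Mzero C w (Dom C k) \<in> Hom C w (Dom C k)"
      using f w by (auto simp: Hom_def)
    ultimately show "x = Mzero C w (Dom C k)" using x by blast
  qed
qed

lemma is_cokernelI:
  assumes "f \<in> Hom C a b" "q \<in> Hom C b c" "q \<cdot> f = Mzero C a c"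
    "\<And>w h. h \<in> Hom C b w \<Longrightarrow> h \<cdot> f = Mzero C a w \<Longrightarrow> \<exists>u \<in> Hom C c w. u \<cdot> q = h"
    "epic C q"
  shows "is_cokernel C f q"
  unfolding is_cokernel_def
proof (intro conjI allI ballI impI)
  fix w h assume h: "h \<in> Hom C (Cod C f) w" "h \<cdot> f = Mzero C (Dom C f) w"
  then obtain u where u: "u \<in> Hom C c w" "u \<cdot> q = h" using assms by (auto simp: Hom_def)
  show "\<exists>!u. u \<in> Hom C (Cod C q) w \<and> u \<cdot> q = h"
  proof (intro ex1I[of _ u])
    show "u \<in> Hom C (Cod C q) w \<and> u \<cdot> q = h" using u assms by (auto simp: Hom_def)
    fix v assume "v \<in> Hom C (Cod C q) w \<and> v \<cdot> q = h"
    then show "v = u" by - (rule epicD[OF assms(5)], use u assms(2) in \<open>auto simp: Hom_def\<close>)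
  qed
qed (use assms in \<open>auto simp: Hom_def\<close>)

lemma is_cokernelD:
  assumes "is_cokernel C f q"
  shows "f \<in> Ar C" "q \<in> Ar C" "Dom C q = Cod C f" "q \<cdot> f = Mzero C (Dom C f) (Cod C q)"
    "h \<in> Hom C (Cod C f) w \<Longrightarrow> h \<cdot> f = Mzero C (Dom C f) w \<Longrightarrow> \<exists>u \<in> Hom C (Cod C q) w. u \<cdot> q = h"
    "q \<in> Epi C (Cod C f) (Cod C q)"
proof -
  show f: "f \<in> Ar C" "q \<in> Ar C" "Dom C q = Cod C f" "q \<cdot> f = Mzero C (Dom C f) (Cod C q)"
    "h \<in> Hom C (Cod C f) w \<Longrightarrow> h \<cdot> f = Mzero C (Dom C f) w \<Longrightarrow> \<exists>u \<in> Hom C (Cod C q) w. u \<cdot> q = h"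
    using assms unfolding is_cokernel_def by blast+
  have "epic C q"
  proof (rule epicI)
    show "q \<in> Hom C (Cod C f) (Cod C q)" using f by (simp add: Hom_def)
    fix w x assume x: "x \<in> Hom C (Cod C q) w" "x \<cdot> q = Mzero C (Cod C f) w"
    have w: "w \<in> Ob C" using x by (auto simp: Hom_def)
    have "\<exists>!u. u \<in> Hom C (Cod C q) w \<and> u \<cdot> q = Mzero C (Cod C f) w"
      using assms f w unfolding is_cokernel_def by (auto simp: Mzero_Hom)
    moreover have "Mzero C (Cod C q) w \<cdot> q = Mzero C (Cod C f) w"
      "Mzero C (Cod C q) w \<in> Hom C (Cod C q) w"
      using f w by (auto simp: Hom_def)
    ultimately show "x = Mzero C (Cod C q) w" using x by blast
  qed
  then show "q \<in> Epi C (Cod C f) (Cod C q)" using f by (simp add: Epi_def Hom_def)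
qed

end

section \<open>Diagram chases in abelian categories\<close>

context abelian_category
begin

section \<open>Normal monomorphisms and epimorphisms, and pullbacks\<close>

lemma obtain_kernel:
  assumes "f \<in> Hom C b c"
  obtains a k where "is_kernel C f k" "k \<in> Hom C a b" "f \<cdot> k = Mzero C a c" "monic C k"
proof -
  obtain k where k: "is_kernel C f k" using ex_kernel assms by (auto simp: Hom_def)
  show ?thesis
    by (rule that[of k "Dom C k"]) (use is_kernelD[OF k] k assms in \<open>simp_all add: Hom_def\<close>)
qed

lemma obtain_cokernel:
  assumes "f \<in> Hom C a b"
  obtains c q where "is_cokernel C f q" "q \<in> Epi C b c" "q \<cdot> f = Mzero C a c"
proof -
  obtain q where q: "is_cokernel C f q" using ex_cokernel assms by (auto simp: Hom_def)
  show ?thesis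
    by (rule that[of q "Cod C q"]) (use is_cokernelD[OF q] q assms in \<open>simp_all add: Hom_def\<close>)
qed

lemma kernel_factor:
  assumes "is_kernel C f k" "f \<in> Hom C b c" "k \<in> Hom C a b" "h \<in> Hom C w b" "f \<cdot> h = Mzero C w c"
  obtains u where "u \<in> Hom C w a" "k \<cdot> u = h"
  using is_kernelD(5)[OF assms(1), of h w] assms(2-) that by (auto simp: Hom_def)

lemma cokernel_factor:
  assumes "is_cokernel C f q" "f \<in> Hom C a b" "q \<in> Hom C b c" "h \<in> Hom C b w" "h \<cdot> f = Mzero C a w"
  obtains u where "u \<in> Hom C c w" "u \<cdot> q = h"
  using is_cokernelD(5)[OF assms(1), of h w] assms(2-) that by (auto simp: Hom_def)

text \<open>By normality \<open>m\<close> is the kernel of some \<open>g\<close>. Since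
  \<open>g\<close> kills \<open>m\<close>, it factors through the cokernel \<open>q\<close>, so
  whatever \<open>q\<close> kills is killed by \<open>g\<close> and factors through
  \<open>m\<close>.\<close>

lemma monic_is_kernel:
  assumes "monic C m" "is_cokernel C m q"
  shows "is_kernel C q m"
proof -
  obtain g where g: "is_kernel C g m" using monic_normal assms by blast
  note g' = is_kernelD[OF g] and q' = is_cokernelD[OF assms(2)]
  obtain u where u: "u \<in> Hom C (Cod C q) (Cod C g)" "u \<cdot> q = g"
    using q'(5)[of g "Cod C g"] g' by (auto simp: Hom_def)
  show ?thesis
  proof (rule is_kernelI)
    show "q \<in> Hom C (Cod C m) (Cod C q)" "m \<in> Hom C (Dom C m) (Cod C m)" "monic C m"
      "q \<cdot> m = Mzero C (Dom C m) (Cod C q)"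
      using q' assms by (simp_all add: Hom_def)
    fix w h assume h: "h \<in> Hom C w (Cod C m)" "q \<cdot> h = Mzero C w (Cod C q)"
    then have w: "w \<in> Ob C" using Hom_Ob by blast
    have "(u \<cdot> q) \<cdot> h = Mzero C w (Cod C g)"
      using u(1) q' h w by (simp add: Hom_def)
    then show "\<exists>v\<in>Hom C w (Dom C m). m \<cdot> v = h"
      using g'(5)[of h w] h u g' by (simp add: Hom_def)
  qed
qed

lemma epic_is_cokernel:
  assumes "epic C e" "is_kernel C e k"
  shows "is_cokernel C k e"
proof -
  obtain g where g: "is_cokernel C g e" using epic_normal assms by blast
  note g' = is_cokernelD[OF g] and k' = is_kernelD[OF assms(2)]
  obtain u where u: "u \<in> Hom C (Dom C g) (Dom C k)" "k \<cdot> u = g"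
    using k'(5)[of g "Dom C g"] g' by (auto simp: Hom_def)
  show ?thesis
  proof (rule is_cokernelI)
    show "e \<in> Hom C (Dom C e) (Cod C e)" "k \<in> Hom C (Dom C k) (Dom C e)" "epic C e"
      "e \<cdot> k = Mzero C (Dom C k) (Cod C e)"
      using k' assms by (simp_all add: Hom_def)
    fix w h assume h: "h \<in> Hom C (Dom C e) w" "h \<cdot> k = Mzero C (Dom C k) w"
    then have w: "w \<in> Ob C" using Hom_Ob by blast
    have "h \<cdot> (k \<cdot> u) = Mzero C (Dom C g) w"
      using u(1) k' h w by (simp add: Hom_def reassoc[OF h(2)])
    then show "\<exists>v\<in>Hom C (Cod C e) w. v \<cdot> e = h"
      using g'(5)[of h w] h u g' k' by (simp add: Hom_def)
  qed
qed

text \<open>An epimorphism is the cokernel of its kernel, so \<open>t\<close> descends along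
  \<open>p\<close> as soon as it kills that kernel. The condition is phrased for all elements killed
  by \<open>p\<close>, each after a refinement, because that is what a chase delivers; it is how
  arrows are constructed from elementwise recipes.\<close>

lemma factor_Epi:
  assumes p: "p \<in> Epi C w a" and t: "t \<in> Hom C w b"
    and *: "\<And>v u. u \<in> Hom C v w \<Longrightarrow> p \<cdot> u = Mzero C v a \<Longrightarrow>
      \<exists>v' e. e \<in> Epi C v' v \<and> t \<cdot> (u \<cdot> e) = Mzero C v' b"
  obtains h where "h \<in> Hom C a b" "h \<cdot> p = t"
proof -
  have p': "p \<in> Hom C w a" "epic C p" using p by (auto simp: Epi_def)
  obtain v k where k: "is_kernel C p k" "k \<in> Hom C v w" "p \<cdot> k = Mzero C v a"
    using obtain_kernel[OF p'(1)] by blast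
  obtain v' e where e: "e \<in> Epi C v' v" "t \<cdot> (k \<cdot> e) = Mzero C v' b" using *[OF k(2,3)] by blast
  have "t \<cdot> k = Mzero C v b"
    by (rule Epi_zero[OF e(1)]) (use e k t in \<open>simp_all add: Hom_def Epi_def\<close>)
  then show ?thesis
    using cokernel_factor[OF epic_is_cokernel[OF p'(2) k(1)] k(2) p'(1) t] that by blast
qed

text \<open>The pullback is the kernel of the difference \<open>d\<close> of the two maps on the
  biproduct. Since \<open>f\<close> is epic, so is \<open>d\<close>, which makes \<open>d\<close>
  the cokernel of that kernel; this is what shows that the projection to \<open>b\<close> is
  epic.\<close>

lemma pullback_Epi:
  assumes f: "f \<in> Epi C a c" and g: "g \<in> Hom C b c"
  obtains p x y where "x \<in> Hom C p a" "y \<in> Epi C p b" "f \<cdot> x = g \<cdot> y"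
    "\<And>w u v. u \<in> Hom C w a \<Longrightarrow> v \<in> Hom C w b \<Longrightarrow> f \<cdot> u = g \<cdot> v \<Longrightarrow>
      \<exists>t\<in>Hom C w p. x \<cdot> t = u \<and> y \<cdot> t = v"
proof -
  have ob: "a \<in> Ob C" "b \<in> Ob C" "c \<in> Ob C" using Hom_Ob[OF Epi_Hom[OF f]] Hom_Ob[OF g] by auto
  have f': "f \<in> Hom C a c" using f by (simp add: Epi_def)
  obtain s i j p q where bi: "is_biproduct C a b s i j p q" using ex_biproduct ob by blast
  then have s: "s \<in> Ob C" and H: "i \<in> Hom C a s" "j \<in> Hom C b s" "p \<in> Hom C s a" "q \<in> Hom C s b"
    and E: "p \<cdot> i = Idn C a" "q \<cdot> j = Idn C b" "p \<cdot> j = Mzero C b a" "q \<cdot> i = Mzero C a b"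
    unfolding is_biproduct_def by auto
  define d where "d = Msub C (f \<cdot> p) (g \<cdot> q)"
  have d: "d \<in> Hom C s c" using f' g H by (simp add: d_def Hom_def)
  have di: "d \<cdot> i = f" using f' g H E ob by (simp add: d_def Hom_def)
  have dj: "d \<cdot> j = Msub C (Mzero C b c) g" using f' g H E ob by (simp add: d_def Hom_def)
  have "epic C d"
  proof (rule epicI[OF d])
    fix z x assume x: "x \<in> Hom C c z" "x \<cdot> d = Mzero C s z"
    then have "z \<in> Ob C" using Hom_Ob by blast
    then have "(x \<cdot> d) \<cdot> i = Mzero C a z" using x(2) H by (simp add: Hom_def)
    then have "x \<cdot> f = Mzero C a z" using x(1) d H di by (simp add: Hom_def)
    then show "x = Mzero C c z" using Epi_zero[OF f] x by blast
  qed
  obtain r k where k: "is_kernel C d k" "k \<in> Hom C r s" "d \<cdot> k = Mzero C r c"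
    using obtain_kernel[OF d] by blast
  have r: "r \<in> Ob C" using k Hom_Ob by blast
  have cok: "is_cokernel C k d" by (rule epic_is_cokernel[OF \<open>epic C d\<close> k(1)])
  have comm: "f \<cdot> (p \<cdot> k) = g \<cdot> (q \<cdot> k)"
  proof (rule Msub_eq_zero)
    show "Msub C (f \<cdot> (p \<cdot> k)) (g \<cdot> (q \<cdot> k)) = Mzero C r c"
      using k f' g H by (simp add: d_def Hom_def)
  qed (use k f' g H in \<open>simp_all add: Hom_def\<close>)
  \<comment> \<open>If \<open>t\<close> kills \<open>q \<cdot> k\<close>, then
    \<open>t \<cdot> q\<close> kills the kernel of \<open>d\<close> and equals
    \<open>u \<cdot> d\<close>. On the first summand this reads \<open>u \<cdot> f = 0\<close>, so
    \<open>u\<close> vanishes; then the second summand gives that \<open>t\<close> vanishes.\<close>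
  have qk: "epic C (q \<cdot> k)"
  proof (rule epicI)
    show "q \<cdot> k \<in> Hom C r b" using H k by (simp add: Hom_def)
    fix z t assume t: "t \<in> Hom C b z" "t \<cdot> (q \<cdot> k) = Mzero C r z"
    have z: "z \<in> Ob C" using t Hom_Ob by blast
    have tq: "t \<cdot> q \<in> Hom C s z" "(t \<cdot> q) \<cdot> k = Mzero C r z" using t H k by (simp_all add: Hom_def)
    obtain u where u: "u \<in> Hom C c z" "u \<cdot> d = t \<cdot> q" using cokernel_factor[OF cok k(2) d tq]
      by blast
    have "(u \<cdot> d) \<cdot> i = Mzero C a z" unfolding u using t H E z ob by (simp add: Hom_def)
    then have "u \<cdot> f = Mzero C a z" using u(1) d H di by (simp add: Hom_def)
    then have "u = Mzero C c z" using Epi_zero[OF f] u by blast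
    then have "t \<cdot> q = Mzero C s z" using u d z by (simp add: Hom_def)
    then have "(t \<cdot> q) \<cdot> j = Mzero C b z" using H z by (simp add: Hom_def)
    then show "t = Mzero C b z" using t H E by (simp add: Hom_def)
  qed
  show ?thesis
  proof (rule that[of "p \<cdot> k" r "q \<cdot> k"])
    show "p \<cdot> k \<in> Hom C r a" using H k by (simp add: Hom_def)
    show "q \<cdot> k \<in> Epi C r b" using H k qk by (simp add: Hom_def Epi_def)
    show "f \<cdot> (p \<cdot> k) = g \<cdot> (q \<cdot> k)" by (rule comm)
    fix w u v assume uv: "u \<in> Hom C w a" "v \<in> Hom C w b" "f \<cdot> u = g \<cdot> v"
    have w: "w \<in> Ob C" using uv Hom_Ob by blast
    define h where "h = Madd C (i \<cdot> u) (j \<cdot> v)"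
    have h: "h \<in> Hom C w s" using uv H by (simp add: h_def Hom_def)
    have ph: "p \<cdot> h = u" using uv H w ob
      by (simp add: h_def Hom_def reassoc[OF E(1)] reassoc[OF E(3)])
    have qh: "q \<cdot> h = v" using uv H w ob
      by (simp add: h_def Hom_def reassoc[OF E(2)] reassoc[OF E(4)])
    have "d \<cdot> h = Msub C (f \<cdot> (p \<cdot> h)) (g \<cdot> (q \<cdot> h))"
      using h H f' g by (simp add: d_def Hom_def)
    also have "\<dots> = Mzero C w c" unfolding ph qh using uv g by (simp add: Hom_def)
    finally obtain t where t: "t \<in> Hom C w r" "k \<cdot> t = h" using kernel_factor[OF k(1) d k(2) h]
      by blast
    have "(p \<cdot> k) \<cdot> t = u" "(q \<cdot> k) \<cdot> t = v" using t H k ph qh by (simp_all add: Hom_def)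
    with t show "\<exists>t\<in>Hom C w r. (p \<cdot> k) \<cdot> t = u \<and> (q \<cdot> k) \<cdot> t = v" by blast
  qed
qed

section \<open>Exactness in terms of generalised elements\<close>

lemma Epi_cover:
  assumes "f \<in> Epi C a c" "x \<in> Hom C w c"
  obtains w' e y where "e \<in> Epi C w' w" "y \<in> Hom C w' a" "f \<cdot> y = x \<cdot> e"
  using pullback_Epi[OF assms] by metis

text \<open>The definition provides one \<open>m\<close> that is at once the image of
  \<open>f\<close>, as the kernel of its cokernel, and the kernel of \<open>g\<close>. The content
  is that \<open>f\<close> maps onto this image, i.e. that the factor \<open>f'\<close> is
  epic.\<close>

lemma exact_atE:
  assumes ex: "exact_at C f g" and f: "f \<in> Hom C a b" and g: "g \<in> Hom C b c"
  obtains i m f' where "is_kernel C g m" "m \<in> Hom C i b" "f' \<in> Epi C a i" "m \<cdot> f' = f"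
proof -
  obtain m q where q: "is_cokernel C f q" and m: "is_kernel C q m" and mg: "is_kernel C g m"
    using ex unfolding exact_at_def is_image_def by blast
  note q' = is_cokernelD[OF q] and m' = is_kernelD[OF m]
  define i where "i = Dom C m"
  have mH: "m \<in> Hom C i b" using m' q' f by (simp add: i_def Hom_def)
  have qH: "q \<in> Hom C b (Cod C q)" using q' f by (simp add: Hom_def)
  obtain f' where f': "f' \<in> Hom C a i" "m \<cdot> f' = f"
    using kernel_factor[OF m qH mH f] q' f by (auto simp: Hom_def)
  have "epic C f'"
  proof (rule epicI[OF f'(1)])
    \<comment> \<open>Let \<open>k\<close> be the kernel of \<open>t\<close>. As \<open>f'\<close>
      runs through \<open>k\<close>, \<open>f\<close> runs through the monomorphism
      \<open>m \<cdot> k\<close>, which is the kernel of its cokernel \<open>r\<close>. So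
      \<open>r\<close> kills \<open>f\<close>, factors through \<open>q\<close> and kills
      \<open>m\<close>; hence \<open>m\<close> factors through \<open>m \<cdot> k\<close>, which
      makes \<open>k\<close> a split epimorphism and \<open>t\<close> zero.\<close>
    fix d t assume t: "t \<in> Hom C i d" "t \<cdot> f' = Mzero C a d"
    obtain w k where k: "is_kernel C t k" "k \<in> Hom C w i" "t \<cdot> k = Mzero C w d" "monic C k"
      using obtain_kernel[OF t(1)] by blast
    obtain f'' where f'': "f'' \<in> Hom C a w" "k \<cdot> f'' = f'"
      using kernel_factor[OF k(1) t(1) k(2) f'(1) t(2)] by blast
    have mk: "m \<cdot> k \<in> Hom C w b" using mH k by (simp add: Hom_def)
    have "monic C (m \<cdot> k)"
    proof (rule monicI[OF mk])
      fix v x assume x: "x \<in> Hom C v w" "(m \<cdot> k) \<cdot> x = Mzero C v b"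
      have "m \<cdot> (k \<cdot> x) = Mzero C v b" using x mH k by (simp add: Hom_def)
      then have "k \<cdot> x = Mzero C v i"
        by - (rule monic_zero[OF m'(6) mH], use x k in \<open>simp_all add: Hom_def\<close>)
      then show "x = Mzero C v w"
        by - (rule monic_zero[OF k(4,2)], use x k in \<open>simp_all add: Hom_def\<close>)
    qed
    obtain z r where r: "is_cokernel C (m \<cdot> k) r" "r \<in> Epi C b z" "r \<cdot> (m \<cdot> k) = Mzero C w z"
      using obtain_cokernel[OF mk] by blast
    have rk: "is_kernel C r (m \<cdot> k)" by (rule monic_is_kernel[OF \<open>monic C (m \<cdot> k)\<close> r(1)])
    have rH: "r \<in> Hom C b z" using r by (simp add: Epi_def)
    have z: "z \<in> Ob C" "a \<in> Ob C" "i \<in> Ob C" using rH f' Hom_Ob by blast+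
    have "r \<cdot> f = (r \<cdot> (m \<cdot> k)) \<cdot> f''"
      using f'(2)[symmetric] f'(1) f''(2)[symmetric] rH mH k f''(1) by (simp add: Hom_def)
    also have "\<dots> = Mzero C a z" unfolding r(3) using f'' z by (simp add: Hom_def)
    finally obtain r' where r': "r' \<in> Hom C (Cod C q) z" "r' \<cdot> q = r"
      using cokernel_factor[OF q f qH rH] by blast
    have "q \<cdot> m = Mzero C i (Cod C q)" using m'(4) unfolding i_def .
    then have "r \<cdot> m = Mzero C i z" using r'(2)[symmetric] r'(1) qH mH z by (simp add: Hom_def)
    then obtain s where s: "s \<in> Hom C i w" "(m \<cdot> k) \<cdot> s = m"
      using kernel_factor[OF rk rH mk mH] by blast
    have "k \<cdot> s = Idn C i"
    proof (rule monicD[OF m'(6) _ mH])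
      show "m \<cdot> (k \<cdot> s) = m \<cdot> Idn C i" using s mH k by (simp add: Hom_def)
    qed (use s k z in \<open>simp_all add: Hom_def\<close>)
    then have "t = t \<cdot> (k \<cdot> s)" using t by (simp add: Hom_def)
    also have "\<dots> = Mzero C i d" using t s k Hom_Ob[OF t(1)] by (simp add: Hom_def reassoc[OF k(3)])
    finally show "t = Mzero C i d" .
  qed
  with f' mg mH that show ?thesis by (auto simp: Epi_def)
qed

lemma exact_zero:
  assumes "exact_at C f g" "f \<in> Hom C a b" "g \<in> Hom C b c"
  shows "g \<cdot> f = Mzero C a c"
proof -
  obtain i m f' where m: "is_kernel C g m" "m \<in> Hom C i b" "f' \<in> Epi C a i" "m \<cdot> f' = f"
    using exact_atE[OF assms] by blast
  have ob: "c \<in> Ob C" "a \<in> Ob C" using assms Hom_Ob by blast+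
  have gm: "g \<cdot> m = Mzero C i c" using is_kernelD(4)[OF m(1)] m(2) assms(3) by (simp add: Hom_def)
  show ?thesis using m(4)[symmetric] m(2,3) assms(3) ob
    by (simp add: Hom_def Epi_def reassoc[OF gm])
qed

lemma exact_cover:
  assumes "exact_at C f g" "f \<in> Hom C a b" "g \<in> Hom C b c" "x \<in> Hom C w b" "g \<cdot> x = Mzero C w c"
  obtains w' e y where "e \<in> Epi C w' w" "y \<in> Hom C w' a" "f \<cdot> y = x \<cdot> e"
proof -
  obtain i m f' where m: "is_kernel C g m" "m \<in> Hom C i b" "f' \<in> Epi C a i" "m \<cdot> f' = f"
    using exact_atE[OF assms(1-3)] by blast
  obtain u where u: "u \<in> Hom C w i" "m \<cdot> u = x"
    using kernel_factor[OF m(1) assms(3) m(2) assms(4,5)] by blast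
  obtain w' e y where y: "e \<in> Epi C w' w" "y \<in> Hom C w' a" "f' \<cdot> y = u \<cdot> e"
    using Epi_cover[OF m(3) u(1)] by blast
  have "f \<cdot> y = x \<cdot> e" using m(4)[symmetric] u(2)[symmetric] y m(2,3) u(1)
    by (simp add: Hom_def Epi_def)
  with y that show ?thesis by blast
qed

text \<open>With a projective domain the lift along the epic part of \<open>f\<close> exists without
  refining the domain, which is what recursive constructions of chain maps need.\<close>

lemma exact_projective_lift:
  assumes "exact_at C f g" "f \<in> Hom C a b" "g \<in> Hom C b c" "projective C P" "x \<in> Hom C P b"
    "g \<cdot> x = Mzero C P c"
  obtains y where "y \<in> Hom C P a" "f \<cdot> y = x"
proof -
  obtain i m f' where m: "is_kernel C g m" "m \<in> Hom C i b" "f' \<in> Epi C a i" "m \<cdot> f' = f"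
    using exact_atE[OF assms(1-3)] by blast
  obtain u where u: "u \<in> Hom C P i" "m \<cdot> u = x"
    using kernel_factor[OF m(1) assms(3) m(2) assms(5,6)] by blast
  obtain y where y: "y \<in> Hom C P a" "f' \<cdot> y = u" using projective_lift[OF assms(4) m(3) u(1)]
    by blast
  have "f \<cdot> y = x" using m(4)[symmetric] u(2)[symmetric] y m(2,3) by (simp add: Hom_def Epi_def)
  with y that show ?thesis by blast
qed

text \<open>The kernel \<open>m\<close> of \<open>g\<close> is itself an admissible element: after
  an epimorphism it comes from \<open>f\<close>, so the cokernel \<open>q\<close> of
  \<open>f\<close> kills it. Conversely \<open>g\<close> factors through \<open>q\<close>, so
  whatever \<open>q\<close> kills factors through \<open>m\<close>. Thus \<open>m\<close> is a
  kernel of both.\<close>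

lemma exact_atI:
  assumes f: "f \<in> Hom C a b" and g: "g \<in> Hom C b c" and gf: "g \<cdot> f = Mzero C a c"
    and *: "\<And>w x. x \<in> Hom C w b \<Longrightarrow> g \<cdot> x = Mzero C w c \<Longrightarrow>
      \<exists>w' e y. e \<in> Epi C w' w \<and> y \<in> Hom C w' a \<and> f \<cdot> y = x \<cdot> e"
  shows "exact_at C f g"
proof -
  obtain z q where q: "is_cokernel C f q" "q \<in> Epi C b z" "q \<cdot> f = Mzero C a z"
    using obtain_cokernel[OF f] by blast
  obtain i m where m: "is_kernel C g m" "m \<in> Hom C i b" "g \<cdot> m = Mzero C i c" "monic C m"
    using obtain_kernel[OF g] by blast
  have qH: "q \<in> Hom C b z" using q by (simp add: Epi_def)
  have ob: "z \<in> Ob C" "c \<in> Ob C" using qH g Hom_Ob by blast+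
  obtain g' where g': "g' \<in> Hom C z c" "g' \<cdot> q = g" using cokernel_factor[OF q(1) f qH g gf]
    by blast
  have "is_kernel C q m"
  proof (rule is_kernelI[OF qH m(2) _ _ m(4)])
    obtain w e y where y: "e \<in> Epi C w i" "y \<in> Hom C w a" "f \<cdot> y = m \<cdot> e" using *[OF m(2,3)]
      by blast
    have "(q \<cdot> m) \<cdot> e = q \<cdot> (f \<cdot> y)" using y qH m by (simp add: Hom_def Epi_def)
    also have "\<dots> = Mzero C w z" using y(2) qH f ob by (simp add: Hom_def reassoc[OF q(3)])
    finally show "q \<cdot> m = Mzero C i z"
      by - (rule Epi_zero[OF y(1)], use qH m in \<open>simp_all add: Hom_def\<close>)
    fix w h assume h: "h \<in> Hom C w b" "q \<cdot> h = Mzero C w z"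
    then have "w \<in> Ob C" using Hom_Ob by blast
    then have "g \<cdot> h = Mzero C w c" using g'(2)[symmetric] g'(1) qH h by (simp add: Hom_def)
    then show "\<exists>u\<in>Hom C w i. m \<cdot> u = h" using kernel_factor[OF m(1) g m(2) h(1)] by blast
  qed
  with q m show ?thesis unfolding exact_at_def is_image_def by blast
qed

text \<open>Exactness asserts only that some cokernel of \<open>f\<close> and some kernel of
  \<open>g\<close> match. Here any two do, so that choices made separately for every object of an
  index category can be used.\<close>

lemma exact_kernel_of_cokernel:
  assumes ex: "exact_at C f g" and f: "f \<in> Hom C a b" and g: "g \<in> Hom C b c"
    and q: "is_cokernel C f q" and m: "is_kernel C g m"
  shows "is_kernel C q m"
proof -
  note q' = is_cokernelD[OF q] and m' = is_kernelD[OF m]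
  let ?z = "Cod C q" and ?i = "Dom C m"
  have H: "q \<in> Hom C b ?z" "m \<in> Hom C ?i b" using q' m' f g by (simp_all add: Hom_def)
  have ob: "?z \<in> Ob C" "c \<in> Ob C" using Hom_Ob[OF H(1)] Hom_Ob[OF g] by auto
  have qf: "q \<cdot> f = Mzero C a ?z" using q'(4) f by (simp add: Hom_def)
  have gm: "g \<cdot> m = Mzero C ?i c" using m'(4) g by (simp add: Hom_def)
  obtain g' where g': "g' \<in> Hom C ?z c" "g' \<cdot> q = g"
    using cokernel_factor[OF q f H(1) g exact_zero[OF ex f g]] by blast
  show ?thesis
  proof (rule is_kernelI[OF H _ _ m'(6)])
    obtain w e y where y: "e \<in> Epi C w ?i" "y \<in> Hom C w a" "f \<cdot> y = m \<cdot> e"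
      using exact_cover[OF ex f g H(2) gm] by blast
    have "(q \<cdot> m) \<cdot> e = q \<cdot> (f \<cdot> y)" using y H by (simp add: Hom_def Epi_def)
    also have "\<dots> = Mzero C w ?z" using y(2) H f ob by (simp add: Hom_def reassoc[OF qf])
    finally show "q \<cdot> m = Mzero C ?i ?z" by - (rule Epi_zero[OF y(1) Comp_in[OF H(2,1)]])
    fix w h assume h: "h \<in> Hom C w b" "q \<cdot> h = Mzero C w ?z"
    have "g \<cdot> h = Mzero C w c"
      using g'(2)[symmetric] g'(1) H h Hom_Ob1[OF h(1)] by (simp add: Hom_def)
    then show "\<exists>u\<in>Hom C w ?i. m \<cdot> u = h" using kernel_factor[OF m g H(2) h(1)] by blast
  qed
qed

text \<open>This converse of the image factorisation produces exact pairs: cover a kernel by an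
  epimorphism. Resolutions are built in this way.\<close>

lemma exact_at_kernel_epi:
  assumes "is_kernel C g m" "m \<in> Hom C i b" "g \<in> Hom C b c" "e \<in> Epi C a i"
  shows "exact_at C (m \<cdot> e) g"
proof (rule exact_atI)
  have gm: "g \<cdot> m = Mzero C i c" using is_kernelD(4)[OF assms(1)] assms(2,3) by (simp add: Hom_def)
  have "a \<in> Ob C" "c \<in> Ob C" using Hom_Ob[OF assms(3)] Hom_Ob[OF Epi_Hom[OF assms(4)]] by auto
  then show "m \<cdot> e \<in> Hom C a b" "g \<in> Hom C b c" "g \<cdot> (m \<cdot> e) = Mzero C a c"
    using assms gm by (simp_all add: Hom_def Epi_def reassoc[OF gm])
  fix w x assume x: "x \<in> Hom C w b" "g \<cdot> x = Mzero C w c"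
  obtain u where u: "u \<in> Hom C w i" "m \<cdot> u = x" using kernel_factor[OF assms(1,3,2) x] by blast
  obtain w' d y where y: "d \<in> Epi C w' w" "y \<in> Hom C w' a" "e \<cdot> y = u \<cdot> d"
    using Epi_cover[OF assms(4) u(1)] by blast
  have "(m \<cdot> e) \<cdot> y = x \<cdot> d" using u(2)[symmetric] y u(1) assms(2,4) by (simp add: Hom_def Epi_def)
  with y show "\<exists>w' d y. d \<in> Epi C w' w \<and> y \<in> Hom C w' a \<and> (m \<cdot> e) \<cdot> y = x \<cdot> d" by blast
qed

section \<open>Short exact and split sequences\<close>

lemma short_exactI:
  assumes "is_kernel C g f" "g \<in> Epi C b c" "f \<in> Hom C a b"
  shows "short_exact C f g"
proof -
  have g: "g \<in> Hom C b c" using assms by (simp add: Epi_def)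
  have a: "a \<in> Ob C" using assms Hom_Ob by blast
  have "exact_at C (f \<cdot> Idn C a) g" by (rule exact_at_kernel_epi[OF assms(1,3) g Idn_Epi[OF a]])
  then show ?thesis using assms is_kernelD(6)[OF assms(1)] unfolding short_exact_def
    by (simp add: Hom_def Epi_def)
qed

lemma short_exactD:
  assumes "short_exact C f g" "f \<in> Hom C a b" "g \<in> Hom C b c"
  shows "is_kernel C g f" "g \<in> Epi C b c" "g \<cdot> f = Mzero C a c" "monic C f"
proof -
  have se: "monic C f" "exact_at C f g" "epic C g" using assms by (auto simp: short_exact_def)
  show m: "monic C f" by fact
  show "g \<in> Epi C b c" using assms se by (simp add: Epi_def)
  show gf: "g \<cdot> f = Mzero C a c" by (rule exact_zero[OF se(2) assms(2,3)])
  show "is_kernel C g f"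
  proof (rule is_kernelI[OF assms(3,2) gf _ m])
    fix w x assume x: "x \<in> Hom C w b" "g \<cdot> x = Mzero C w c"
    obtain w' e y where y: "e \<in> Epi C w' w" "y \<in> Hom C w' a" "f \<cdot> y = x \<cdot> e"
      using exact_cover[OF se(2) assms(2,3) x] by blast
    have b: "b \<in> Ob C" using x Hom_Ob by blast
    \<comment> \<open>The preimage \<open>y\<close> of \<open>x\<close> exists only over the cover
      \<open>e\<close>. It descends because \<open>f\<close> is monic: where
      \<open>e \<cdot> u\<close> vanishes, so does
      \<open>f \<cdot> (y \<cdot> u) = x \<cdot> (e \<cdot> u)\<close>, hence
      \<open>y \<cdot> u\<close>.\<close>
    obtain t where t: "t \<in> Hom C w a" "t \<cdot> e = y"
    proof (rule factor_Epi[OF y(1,2)])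
      fix v u assume u: "u \<in> Hom C v w'" "e \<cdot> u = Mzero C v w"
      have v: "v \<in> Ob C" using u Hom_Ob by blast
      have "f \<cdot> (y \<cdot> u) = x \<cdot> (e \<cdot> u)" using y u assms x
        by (simp add: Hom_def Epi_def reassoc[OF y(3)])
      also have "\<dots> = Mzero C v b" unfolding u(2) using x v by (simp add: Hom_def)
      finally have "y \<cdot> u = Mzero C v a"
        by - (rule monic_zero[OF m assms(2)], use y u in \<open>simp_all add: Hom_def\<close>)
      then have "y \<cdot> (u \<cdot> Idn C v) = Mzero C v a" using u by (simp add: Hom_def)
      then show "\<exists>v' d. d \<in> Epi C v' v \<and> y \<cdot> (u \<cdot> d) = Mzero C v' a" using Idn_Epi[OF v] by blast
    qed
    have "f \<cdot> t = x"
      by (rule EpiD[OF y(1)]) (use t y x assms in \<open>simp_all add: Hom_def Epi_def\<close>)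
    with t show "\<exists>u\<in>Hom C w a. f \<cdot> u = x" by blast
  qed
qed

text \<open>Projectivity gives the section \<open>s\<close>. The endomorphism
  \<open>1 - s \<cdot> g\<close> is killed by \<open>g\<close>, so it factors through the kernel
  \<open>f\<close>, and the factor is the retraction \<open>r\<close>.\<close>

lemma split_short_exact:
  assumes "short_exact C f g" "f \<in> Hom C a b" "g \<in> Hom C b c" "projective C c"
  obtains r s where "r \<in> Hom C b a" "s \<in> Hom C c b" "r \<cdot> f = Idn C a" "g \<cdot> s = Idn C c"
    "Madd C (f \<cdot> r) (s \<cdot> g) = Idn C b"
proof -
  note se = short_exactD[OF assms(1-3)]
  have ob: "a \<in> Ob C" "b \<in> Ob C" "c \<in> Ob C" using assms Hom_Ob by blast+
  obtain s where s: "s \<in> Hom C c b" "g \<cdot> s = Idn C c"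
    using projective_lift[OF assms(4) se(2) Idn_in[OF ob(3)]] by blast
  define u where "u = Msub C (Idn C b) (s \<cdot> g)"
  have u: "u \<in> Hom C b b" using s assms ob by (simp add: u_def Hom_def)
  have "g \<cdot> u = Mzero C b c" using s assms ob by (simp add: u_def Hom_def reassoc[OF s(2)])
  then obtain r where r: "r \<in> Hom C b a" "f \<cdot> r = u" using kernel_factor[OF se(1) assms(3,2) u]
    by blast
  have "u \<cdot> f = f" using s assms ob se(3) by (simp add: u_def Hom_def)
  then have "f \<cdot> (r \<cdot> f) = f \<cdot> Idn C a" using r assms ob by (simp add: Hom_def reassoc[OF r(2)])
  then have "r \<cdot> f = Idn C a"
    by - (rule monicD[OF se(4) _ assms(2)], use r assms ob in \<open>simp_all add: Hom_def\<close>)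
  moreover have "Madd C (f \<cdot> r) (s \<cdot> g) = Idn C b"
    unfolding r(2) u_def using s assms ob by (simp add: Hom_def)
  ultimately show ?thesis using that r s by blast
qed

text \<open>All hypotheses are equations between sums and composites, and therefore survive any
  additive functor, exact or not.\<close>

lemma split_imp_short_exact:
  assumes H: "f \<in> Hom C a b" "g \<in> Hom C b c" "r \<in> Hom C b a" "s \<in> Hom C c b"
    and E: "r \<cdot> f = Idn C a" "g \<cdot> s = Idn C c" "Madd C (f \<cdot> r) (s \<cdot> g) = Idn C b"
      "g \<cdot> f = Mzero C a c"
  shows "short_exact C f g"
proof (rule short_exactI)
  have ob: "a \<in> Ob C" "b \<in> Ob C" "c \<in> Ob C" using H Hom_Ob by blast+
  show "f \<in> Hom C a b" by (rule H)
  have "epic C g"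
  proof (rule epicI[OF H(2)])
    fix z x assume x: "x \<in> Hom C c z" "x \<cdot> g = Mzero C b z"
    then have "z \<in> Ob C" using Hom_Ob by blast
    have "x = x \<cdot> (g \<cdot> s)" using x H E ob by (simp add: Hom_def)
    also have "\<dots> = Mzero C c z" using x H \<open>z \<in> Ob C\<close> ob
      by (simp add: Hom_def reassoc[OF x(2)] del: E)
    finally show "x = Mzero C c z" .
  qed
  then show "g \<in> Epi C b c" using H by (simp add: Epi_def)
  have m: "monic C f"
  proof (rule monicI[OF H(1)])
    fix w x assume x: "x \<in> Hom C w a" "f \<cdot> x = Mzero C w b"
    then have "w \<in> Ob C" using Hom_Ob by blast
    have "x = r \<cdot> (f \<cdot> x)" using x(1) H ob by (simp add: Hom_def reassoc[OF E(1)])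
    also have "\<dots> = Mzero C w a" unfolding x(2) using H \<open>w \<in> Ob C\<close> by (simp add: Hom_def)
    finally show "x = Mzero C w a" .
  qed
  show "is_kernel C g f"
  proof (rule is_kernelI[OF H(2,1) E(4) _ m])
    fix w x assume x: "x \<in> Hom C w b" "g \<cdot> x = Mzero C w c"
    then have "w \<in> Ob C" using Hom_Ob by blast
    have "x = Madd C (f \<cdot> r) (s \<cdot> g) \<cdot> x" unfolding E(3) using x by (simp add: Hom_def)
    also have "\<dots> = f \<cdot> (r \<cdot> x)" using x H \<open>w \<in> Ob C\<close> by (simp add: Hom_def)
    finally have "f \<cdot> (r \<cdot> x) = x" by simp
    moreover have "r \<cdot> x \<in> Hom C w a" using x H by (simp add: Hom_def)
    ultimately show "\<exists>u\<in>Hom C w a. f \<cdot> u = x" by blast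
  qed
qed

end

section \<open>Homology\<close>

text \<open>
  Chases use generalised elements: a cycle of \<open>K\<close> in degree \<open>n\<close> is an arrow \<open>z : w \<rightarrow> K\<^sub>n\<close> with
  \<open>d z = 0\<close>, and \<open>hclass C K n z : w \<rightarrow> H\<^sub>n(K)\<close> is its class. Every \<open>w \<rightarrow> H\<^sub>n(K)\<close> is a class, and every
  cycle of class zero a boundary, after precomposition with an epimorphism \<open>w' \<rightarrow> w\<close>.
\<close>

definition cycle_maps :: "('o, 'm) acat \<Rightarrow> ('o, 'm) cpx \<Rightarrow> int \<Rightarrow> 'o \<Rightarrow> 'm set" where
  "cycle_maps C K n w = {z \<in> Hom C w (cob K n). cdf K n \<cdot>\<^bsub>C\<^esub> z = Mzero C w (cob K (n - 1))}"

definition hclass :: "('o, 'm) acat \<Rightarrow> ('o, 'm) cpx \<Rightarrow> int \<Rightarrow> 'm \<Rightarrow> 'm" where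
  "hclass C K n z = homology_proj C K n \<cdot>\<^bsub>C\<^esub>
     (THE \<zeta>. \<zeta> \<in> Hom C (Dom C z) (Dom C (cycles C K n)) \<and> cycles C K n \<cdot>\<^bsub>C\<^esub> \<zeta> = z)"

lemma chain_mapD:
  assumes "chain_map C K L \<phi>"
  shows "\<phi> n \<in> Hom C (cob K n) (cob L n)"
    "n - 1 = m \<Longrightarrow> cdf L n \<cdot>\<^bsub>C\<^esub> \<phi> n = \<phi> m \<cdot>\<^bsub>C\<^esub> cdf K n"
  using assms by (auto simp: chain_map_def)

lemma chain_complexD:
  assumes "chain_complex C K"
  shows "cob K n \<in> Ob C" "n - 1 = m \<Longrightarrow> cdf K n \<in> Hom C (cob K n) (cob K m)"
    "n - 1 = m \<Longrightarrow> n - 2 = k \<Longrightarrow> cdf K m \<cdot>\<^bsub>C\<^esub> cdf K n = Mzero C (cob K n) (cob K k)"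
  using assms by (auto simp: chain_complex_def)

lemma cycle_mapsD:
  assumes "z \<in> cycle_maps C K n w"
  shows "z \<in> Hom C w (cob K n)" "n - 1 = m \<Longrightarrow> cdf K n \<cdot>\<^bsub>C\<^esub> z = Mzero C w (cob K m)"
  using assms by (auto simp: cycle_maps_def)

context abelian_category
begin

lemma cdf_simps:
  assumes "chain_complex C K"
  shows "cob K n \<in> Ob C" "cdf K n \<in> Ar C" "Dom C (cdf K n) = cob K n"
    "Cod C (cdf K n) = cob K (n - 1)"
  using chain_complexD(1)[OF assms, of n] chain_complexD(2)[OF assms refl, of n]
    by (simp_all add: Hom_def)

lemma cycles_kernel:
  assumes "chain_complex C K"
  shows "is_kernel C (cdf K n) (cycles C K n)"
    "cycles C K n \<in> Hom C (Dom C (cycles C K n)) (cob K n)" "monic C (cycles C K n)"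
    "n - 1 = m \<Longrightarrow> cdf K n \<cdot> cycles C K n = Mzero C (Dom C (cycles C K n)) (cob K m)"
proof -
  have d: "cdf K n \<in> Hom C (cob K n) (cob K (n - 1))" using chain_complexD(2)[OF assms] by simp
  then have "\<exists>k. is_kernel C (cdf K n) k" using ex_kernel by (auto simp: Hom_def)
  then show k: "is_kernel C (cdf K n) (cycles C K n)" unfolding cycles_def by (rule someI_ex)
  note k' = is_kernelD[OF k]
  show "cycles C K n \<in> Hom C (Dom C (cycles C K n)) (cob K n)" "monic C (cycles C K n)"
    "n - 1 = m \<Longrightarrow> cdf K n \<cdot> cycles C K n = Mzero C (Dom C (cycles C K n)) (cob K m)"
    using k' d by (simp_all add: Hom_def)
qed

lemma cycle_factor:
  assumes "chain_complex C K" "z \<in> cycle_maps C K n w"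
  obtains \<zeta> where "\<zeta> \<in> Hom C w (Dom C (cycles C K n))" "cycles C K n \<cdot> \<zeta> = z"
    "hclass C K n z = homology_proj C K n \<cdot> \<zeta>"
proof -
  note k = cycles_kernel[OF assms(1), of n] and z = cycle_mapsD[OF assms(2)]
  obtain \<zeta> where \<zeta>: "\<zeta> \<in> Hom C w (Dom C (cycles C K n))" "cycles C K n \<cdot> \<zeta> = z"
    using kernel_factor[OF k(1) chain_complexD(2)[OF assms(1) refl] k(2) z(1) z(2)[OF refl]]
      by blast
  have uniq: "\<zeta>' = \<zeta>" if "\<zeta>' \<in> Hom C w (Dom C (cycles C K n)) \<and> cycles C K n \<cdot> \<zeta>' = z" for \<zeta>'
    using monicD[OF k(3) _ k(2), of \<zeta>' \<zeta> w] that \<zeta> by metis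
  have Dz: "Dom C z = w" using z(1) by (simp add: Hom_def)
  have "(THE \<zeta>. \<zeta> \<in> Hom C (Dom C z) (Dom C (cycles C K n)) \<and> cycles C K n \<cdot> \<zeta> = z) = \<zeta>"
    unfolding Dz by (rule the_equality[OF _ uniq]) (use \<zeta> in blast)+
  with \<zeta> that show ?thesis unfolding hclass_def by metis
qed

lemma cycles_Comp_in:
  assumes "chain_complex C K" "\<zeta> \<in> Hom C w (Dom C (cycles C K n))"
  shows "cycles C K n \<cdot> \<zeta> \<in> cycle_maps C K n w"
    "hclass C K n (cycles C K n \<cdot> \<zeta>) = homology_proj C K n \<cdot> \<zeta>"
proof -
  note k = cycles_kernel[OF assms(1), of n]
  have "cob K (n - 1) \<in> Ob C" using chain_complexD[OF assms(1)] by blast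
  then show in_cyc: "cycles C K n \<cdot> \<zeta> \<in> cycle_maps C K n w"
    using assms(2) k(2) chain_complexD(2)[OF assms(1) refl, of n]
    by (simp add: cycle_maps_def Hom_def reassoc[OF k(4)[OF refl]])
  obtain \<zeta>' where \<zeta>': "\<zeta>' \<in> Hom C w (Dom C (cycles C K n))" "cycles C K n \<cdot> \<zeta>' = cycles C K n \<cdot> \<zeta>"
    "hclass C K n (cycles C K n \<cdot> \<zeta>) = homology_proj C K n \<cdot> \<zeta>'"
      using cycle_factor[OF assms(1) in_cyc] by blast
  have "\<zeta>' = \<zeta>" by (rule monicD[OF k(3) \<zeta>'(2) k(2) \<zeta>'(1) assms(2)])
  with \<zeta>' show "hclass C K n (cycles C K n \<cdot> \<zeta>) = homology_proj C K n \<cdot> \<zeta>" by simp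
qed

text \<open>The definite description is justified by \<open>d \<cdot> d = 0\<close>, which makes the
  incoming differential a cycle, and by \<open>cycles\<close> being monic.\<close>

lemma boundary_props:
  assumes "chain_complex C K"
  shows "boundary C K n \<in> Hom C (cob K (n + 1)) (Dom C (cycles C K n))"
    "cycles C K n \<cdot> boundary C K n = cdf K (n + 1)"
proof -
  note k = cycles_kernel[OF assms(1), of n]
  have "cdf K (n + 1) \<in> cycle_maps C K n (cob K (n + 1))"
    using chain_complexD(2,3)[OF assms, of "n + 1"] by (simp add: cycle_maps_def)
  from cycle_factor[OF assms this] obtain \<zeta>
    where \<zeta>: "\<zeta> \<in> Hom C (cob K (n + 1)) (Dom C (cycles C K n))"
    "cycles C K n \<cdot> \<zeta> = cdf K (n + 1)" by blast
  have uniq: "\<zeta>' = \<zeta>" if "\<zeta>' \<in> Hom C (cob K (n + 1)) (Dom C (cycles C K n)) \<and> cycles C K n \<cdot> \<zeta>' =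
    cdf K (n + 1)" for \<zeta>'
    using monicD[OF k(3) _ k(2), of \<zeta>' \<zeta>] that \<zeta> by metis
  have "boundary C K n = \<zeta>" unfolding boundary_def
    by (rule the_equality[OF _ uniq]) (use \<zeta> in blast)+
  with \<zeta> show "boundary C K n \<in> Hom C (cob K (n + 1)) (Dom C (cycles C K n))"
    "cycles C K n \<cdot> boundary C K n = cdf K (n + 1)" by auto
qed

lemma homology_proj_props:
  assumes "chain_complex C K"
  shows "is_cokernel C (boundary C K n) (homology_proj C K n)"
    "homology_proj C K n \<in> Epi C (Dom C (cycles C K n)) (homology C K n)"
    "homology_proj C K n \<in> Hom C (Dom C (cycles C K n)) (homology C K n)"
    "homology_proj C K n \<cdot> boundary C K n = Mzero C (cob K (n + 1)) (homology C K n)"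
    "homology C K n \<in> Ob C"
    "exact_at C (boundary C K n) (homology_proj C K n)"
proof -
  note b = boundary_props[OF assms, of n]
  have "\<exists>q. is_cokernel C (boundary C K n) q" using ex_cokernel b by (auto simp: Hom_def)
  then show q: "is_cokernel C (boundary C K n) (homology_proj C K n)" unfolding homology_proj_def
    by (rule someI_ex)
  note q' = is_cokernelD[OF q]
  show q1: "homology_proj C K n \<in> Epi C (Dom C (cycles C K n)) (homology C K n)"
    "homology_proj C K n \<cdot> boundary C K n = Mzero C (cob K (n + 1)) (homology C K n)"
    using q' b by (simp_all add: Hom_def homology_def)
  show q2: "homology_proj C K n \<in> Hom C (Dom C (cycles C K n)) (homology C K n)"
    using q1 by (simp add: Epi_def)
  show "homology C K n \<in> Ob C" using q2 Hom_Ob by blast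
  show "exact_at C (boundary C K n) (homology_proj C K n)"
    unfolding exact_at_def is_image_def using q ex_kernel q'(2) by blast
qed

lemma cycle_maps_Comp:
  assumes "chain_complex C K" "z \<in> cycle_maps C K n w" "e \<in> Hom C w' w"
  shows "z \<cdot> e \<in> cycle_maps C K n w'" "hclass C K n (z \<cdot> e) = hclass C K n z \<cdot> e"
proof -
  obtain \<zeta> where \<zeta>: "\<zeta> \<in> Hom C w (Dom C (cycles C K n))" "cycles C K n \<cdot> \<zeta> = z"
    "hclass C K n z = homology_proj C K n \<cdot> \<zeta>" using cycle_factor[OF assms(1,2)] by blast
  have "cycles C K n \<cdot> (\<zeta> \<cdot> e) = z \<cdot> e"
    using \<zeta>(2)[symmetric] \<zeta>(1) cycles_kernel(2)[OF assms(1), of n] assms(3) by (simp add: Hom_def)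
  moreover have "\<zeta> \<cdot> e \<in> Hom C w' (Dom C (cycles C K n))" using \<zeta> assms(3) by (simp add: Hom_def)
  ultimately have "z \<cdot> e \<in> cycle_maps C K n w' \<and> hclass C K n (z \<cdot> e) =
    homology_proj C K n \<cdot> (\<zeta> \<cdot> e)"
    using cycles_Comp_in[OF assms(1), of "\<zeta> \<cdot> e" w' n] by simp
  then show "z \<cdot> e \<in> cycle_maps C K n w'" "hclass C K n (z \<cdot> e) = hclass C K n z \<cdot> e"
    using \<zeta> assms(3) homology_proj_props(3)[OF assms(1), of n] by (simp_all add: Hom_def)
qed

lemma hclass_Hom:
  assumes "chain_complex C K" "z \<in> cycle_maps C K n w"
  shows "hclass C K n z \<in> Hom C w (homology C K n)"
proof -
  obtain \<zeta> where \<zeta>: "\<zeta> \<in> Hom C w (Dom C (cycles C K n))" "hclass C K n z = homology_proj C K n \<cdot> \<zeta>"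
    using cycle_factor[OF assms(1,2)] by blast
  then show ?thesis using homology_proj_props(3)[OF assms(1), of n] by (simp add: Hom_def)
qed

lemma cycle_maps_Madd:
  assumes "chain_complex C K" "z \<in> cycle_maps C K n w" "z' \<in> cycle_maps C K n w"
  shows "Madd C z z' \<in> cycle_maps C K n w" "hclass C K n (Madd C z z') =
    Madd C (hclass C K n z) (hclass C K n z')"
proof -
  note k = cycles_kernel(2)[OF assms(1), of n] and p = homology_proj_props(3)[OF assms(1), of n]
  obtain \<zeta> where \<zeta>: "\<zeta> \<in> Hom C w (Dom C (cycles C K n))" "cycles C K n \<cdot> \<zeta> = z"
    "hclass C K n z = homology_proj C K n \<cdot> \<zeta>" using cycle_factor[OF assms(1,2)] by blast
  obtain \<zeta>' where \<zeta>': "\<zeta>' \<in> Hom C w (Dom C (cycles C K n))" "cycles C K n \<cdot> \<zeta>' = z'"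
    "hclass C K n z' = homology_proj C K n \<cdot> \<zeta>'" using cycle_factor[OF assms(1,3)] by blast
  have a: "Madd C \<zeta> \<zeta>' \<in> Hom C w (Dom C (cycles C K n))" using Madd_Hom \<zeta> \<zeta>' by blast
  have b: "cycles C K n \<cdot> Madd C \<zeta> \<zeta>' = Madd C z z'"
    using \<zeta>(1,2) \<zeta>'(1,2) k by (simp add: Hom_def)
  have c: "homology_proj C K n \<cdot> Madd C \<zeta> \<zeta>' = Madd C (hclass C K n z) (hclass C K n z')"
    using \<zeta>(1,3) \<zeta>'(1,3) p by (simp add: Hom_def)
  show "Madd C z z' \<in> cycle_maps C K n w" "hclass C K n (Madd C z z') =
    Madd C (hclass C K n z) (hclass C K n z')"
    using cycles_Comp_in[OF assms(1) a] b c by simp_all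
qed

lemma boundary_in_cycle_maps:
  assumes "chain_complex C K" "b \<in> Hom C w (cob K (n + 1))"
  shows "cdf K (n + 1) \<cdot> b \<in> cycle_maps C K n w" "hclass C K n (cdf K (n + 1) \<cdot> b) =
    Mzero C w (homology C K n)"
proof -
  note bd = boundary_props[OF assms(1), of n] and k = cycles_kernel(2)[OF assms(1), of n]
   and p = homology_proj_props[OF assms(1), of n]
  have a: "boundary C K n \<cdot> b \<in> Hom C w (Dom C (cycles C K n))" using bd assms
    by (simp add: Hom_def)
  have e: "cycles C K n \<cdot> (boundary C K n \<cdot> b) = cdf K (n + 1) \<cdot> b"
    by (rule reassoc[OF bd(2)]) (use bd k assms in \<open>simp_all add: Hom_def\<close>)
  have "homology_proj C K n \<cdot> (boundary C K n \<cdot> b) = Mzero C w (homology C K n)"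
    using bd(1) p(3,5) assms by (simp add: Hom_def reassoc[OF p(4)])
  then show "cdf K (n + 1) \<cdot> b \<in> cycle_maps C K n w" "hclass C K n (cdf K (n + 1) \<cdot> b) =
    Mzero C w (homology C K n)"
    using cycles_Comp_in[OF assms(1) a] e by simp_all
qed

lemma hclass_zero_cover:
  assumes "chain_complex C K" "z \<in> cycle_maps C K n w" "hclass C K n z = Mzero C w (homology C K n)"
  obtains w' e b where "e \<in> Epi C w' w" "b \<in> Hom C w' (cob K (n + 1))" "cdf K (n + 1) \<cdot> b = z \<cdot> e"
proof -
  note bd = boundary_props[OF assms(1), of n] and k = cycles_kernel(2)[OF assms(1), of n]
   and p = homology_proj_props[OF assms(1), of n]
  obtain \<zeta> where \<zeta>: "\<zeta> \<in> Hom C w (Dom C (cycles C K n))" "cycles C K n \<cdot> \<zeta> = z"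
    "hclass C K n z = homology_proj C K n \<cdot> \<zeta>" using cycle_factor[OF assms(1,2)] by blast
  obtain w' e b where b: "e \<in> Epi C w' w" "b \<in> Hom C w' (cob K (n + 1))"
    "boundary C K n \<cdot> b = \<zeta> \<cdot> e"
    using exact_cover[OF p(6) bd(1) p(3) \<zeta>(1)] \<zeta>(3) assms(3) by metis
  have "cdf K (n + 1) \<cdot> b = cycles C K n \<cdot> (boundary C K n \<cdot> b)"
    by (rule reassoc[OF bd(2), symmetric]) (use bd k b in \<open>simp_all add: Hom_def\<close>)
  also have "\<dots> = z \<cdot> e" unfolding b(3) using \<zeta>(1) \<zeta>(2)[symmetric] b(1) k
    by (simp add: Hom_def Epi_def)
  finally show ?thesis using that b by blast
qed

lemma hclass_cover:
  assumes "chain_complex C K" "c \<in> Hom C w (homology C K n)"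
  obtains w' e z where "e \<in> Epi C w' w" "z \<in> cycle_maps C K n w'" "hclass C K n z = c \<cdot> e"
proof -
  note p = homology_proj_props[OF assms(1), of n]
  obtain w' e y where y: "e \<in> Epi C w' w" "y \<in> Hom C w' (Dom C (cycles C K n))"
    "homology_proj C K n \<cdot> y = c \<cdot> e"
    using Epi_cover[OF p(2) assms(2)] by blast
  then show ?thesis using cycles_Comp_in[OF assms(1) y(2)] that by metis
qed

text \<open>The kernel inclusion \<open>cycles C K n\<close> is the universal cycle, and its class
  is the epimorphism \<open>homology_proj\<close>. Agreement on this one class already
  decides.\<close>

lemma homology_Hom_eqI:
  assumes "chain_complex C K" "h \<in> Hom C (homology C K n) a" "h' \<in> Hom C (homology C K n) a"
    "\<And>w z. z \<in> cycle_maps C K n w \<Longrightarrow> h \<cdot> hclass C K n z = h' \<cdot> hclass C K n z"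
  shows "h = h'"
proof -
  note p = homology_proj_props[OF assms(1), of n] and k = cycles_kernel(2)[OF assms(1), of n]
  have "Dom C (cycles C K n) \<in> Ob C" using k Hom_Ob by blast
  then have i: "Idn C (Dom C (cycles C K n)) \<in> Hom C (Dom C (cycles C K n)) (Dom C (cycles C K n))"
    by (rule Idn_in)
  have "hclass C K n (cycles C K n \<cdot> Idn C (Dom C (cycles C K n))) = homology_proj C K n"
    using cycles_Comp_in(2)[OF assms(1) i] p(3) by (simp add: Hom_def)
  then have "h \<cdot> homology_proj C K n = h' \<cdot> homology_proj C K n"
    using assms(4)[OF cycles_Comp_in(1)[OF assms(1) i]] by simp
  then show ?thesis by (rule EpiD[OF p(2) _ assms(2,3)])
qed

section \<open>Induced maps on homology\<close>

lemma chain_map_cycle_maps: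
  assumes "chain_complex C K" "chain_complex C L" "chain_map C K L \<phi>" "z \<in> cycle_maps C K n w"
  shows "\<phi> n \<cdot> z \<in> cycle_maps C L n w"
  using cycle_mapsD[OF assms(4)] chain_mapD(1)[OF assms(3), of n] chain_mapD(1)[OF assms(3), of
    "n - 1"] cdf_simps[OF assms(1)]
    cdf_simps[OF assms(2)] Hom_Ob[OF cycle_mapsD(1)[OF assms(4)]]
  by (simp add: cycle_maps_def Hom_def reassoc[OF chain_mapD(2)[OF assms(3) refl, of n]])

text \<open>For the definite description, existence means that the restriction
  \<open>\<zeta>\<close> to cycles passes to the quotient by boundaries. Uniqueness holds because
  every candidate must send the class of \<open>z\<close> to the class of
  \<open>\<phi> n \<cdot> z\<close>.\<close>

lemma homology_map_props:
  assumes "chain_complex C K" "chain_complex C L" "chain_map C K L \<phi>"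
  shows "homology_map C K L \<phi> n \<in> Hom C (homology C K n) (homology C L n)" (is ?A)
    "z \<in> cycle_maps C K n w \<Longrightarrow> homology_map C K L \<phi> n \<cdot> hclass C K n z = hclass C L n (\<phi> n \<cdot> z)"
proof -
  note pK = homology_proj_props[OF assms(1), of n] and kK = cycles_kernel[OF assms(1), of n]
    and pL = homology_proj_props[OF assms(2), of n] and kL = cycles_kernel[OF assms(2), of n]
    and \<phi> = chain_mapD[OF assms(3), of n] and bK = boundary_props[OF assms(1), of n]
    and bL = boundary_props[OF assms(2), of n]
    and \<phi>' = chain_mapD[OF assms(3), of "n + 1"]
  let ?ZK = "Dom C (cycles C K n)" and ?ZL = "Dom C (cycles C L n)"
  let ?P = "\<lambda>h. h \<in> Hom C (homology C K n) (homology C L n) \<and>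
        (\<exists>\<zeta> \<in> Hom C ?ZK ?ZL. cycles C L n \<cdot> \<zeta> = \<phi> n \<cdot> cycles C K n \<and>
           h \<cdot> homology_proj C K n = homology_proj C L n \<cdot> \<zeta>)"
  have "Idn C ?ZK \<in> Hom C ?ZK ?ZK" using Hom_Ob1[OF kK(2)] Idn_in by blast
  from cycles_Comp_in(1)[OF assms(1) this] have "cycles C K n \<in> cycle_maps C K n ?ZK"
    using kK(2) by (simp add: Hom_def)
  then have "\<phi> n \<cdot> cycles C K n \<in> cycle_maps C L n ?ZK" by (rule chain_map_cycle_maps[OF assms])
  from cycle_factor[OF assms(2) this] obtain \<zeta> where \<zeta>: "\<zeta> \<in> Hom C ?ZK ?ZL"
    "cycles C L n \<cdot> \<zeta> = \<phi> n \<cdot> cycles C K n"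
    by blast
  \<comment> \<open>Boundaries go to boundaries. This is checked inside \<open>cob L n\<close>, i.e.
    after the monomorphism \<open>cycles C L n\<close>, where it is the chain map equation in degree
    \<open>n + 1\<close>.\<close>
  have "\<zeta> \<cdot> boundary C K n = boundary C L n \<cdot> \<phi> (n + 1)"
  proof (rule monicD[OF kL(3) _ kL(2)])
    have "cycles C L n \<cdot> (\<zeta> \<cdot> boundary C K n) = (\<phi> n \<cdot> cycles C K n) \<cdot> boundary C K n"
      by (rule reassoc[OF \<zeta>(2)]) (use \<zeta> bK kL in \<open>simp_all add: Hom_def\<close>)
    also have "\<dots> = \<phi> n \<cdot> cdf K (n + 1)" using bK kK(2) \<phi>(1) by (simp add: Hom_def)
    also have "\<dots> = cdf L (n + 1) \<cdot> \<phi> (n + 1)" using \<phi>'(2)[of n] by simp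
    also have "\<dots> = cycles C L n \<cdot> (boundary C L n \<cdot> \<phi> (n + 1))"
      by (rule reassoc[OF bL(2), symmetric]) (use \<phi>' bL kL in \<open>simp_all add: Hom_def\<close>)
    finally show "cycles C L n \<cdot> (\<zeta> \<cdot> boundary C K n) = cycles C L n \<cdot> (boundary C L n \<cdot> \<phi> (n + 1))"
      .
  qed (use \<zeta> bK bL \<phi>' in \<open>simp_all add: Hom_def\<close>)
  then have "(homology_proj C L n \<cdot> \<zeta>) \<cdot> boundary C K n =
    homology_proj C L n \<cdot> (boundary C L n \<cdot> \<phi> (n + 1))"
    using \<zeta> bK bL pL(3) by (simp add: Hom_def)
  also have "\<dots> = Mzero C (cob K (n + 1)) (homology C L n)"
    using bL(1) pL(3,5) \<phi>'(1) by (simp add: Hom_def reassoc[OF pL(4)])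
  finally obtain h where h: "h \<in> Hom C (homology C K n) (homology C L n)"
    "h \<cdot> homology_proj C K n = homology_proj C L n \<cdot> \<zeta>"
    using cokernel_factor[OF pK(1) bK(1) pK(3), of "homology_proj C L n \<cdot> \<zeta>" "homology C L n"] \<zeta>
      pL(3)
    by (auto simp: Hom_def)
  have Ph: "?P h" using h \<zeta> by blast
  have eq: "h' \<cdot> hclass C K n z = hclass C L n (\<phi> n \<cdot> z)"
    if P: "?P h'" and z: "z \<in> cycle_maps C K n w" for h' w z
  proof -
    obtain \<zeta>' where \<zeta>': "\<zeta>' \<in> Hom C ?ZK ?ZL" "cycles C L n \<cdot> \<zeta>' = \<phi> n \<cdot> cycles C K n"
           "h' \<cdot> homology_proj C K n = homology_proj C L n \<cdot> \<zeta>'"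
             and h': "h' \<in> Hom C (homology C K n) (homology C L n)"
      using P by blast
    obtain \<xi> where \<xi>: "\<xi> \<in> Hom C w ?ZK" "cycles C K n \<cdot> \<xi> = z"
      "hclass C K n z = homology_proj C K n \<cdot> \<xi>"
      using cycle_factor[OF assms(1) z] by blast
    have "h' \<cdot> hclass C K n z = homology_proj C L n \<cdot> (\<zeta>' \<cdot> \<xi>)"
      unfolding \<xi>(3) using \<xi>(1) \<zeta>'(1) h' pK(3) pL(3) by (simp add: Hom_def reassoc[OF \<zeta>'(3)])
    also have "\<dots> = hclass C L n (cycles C L n \<cdot> (\<zeta>' \<cdot> \<xi>))"
      by (rule cycles_Comp_in(2)[OF assms(2), symmetric]) (use \<zeta>' \<xi> in \<open>simp add: Hom_def\<close>)
    also have "cycles C L n \<cdot> (\<zeta>' \<cdot> \<xi>) = \<phi> n \<cdot> z"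
      using \<xi>(1) \<xi>(2)[symmetric] \<zeta>'(1) kK(2) kL(2) \<phi>(1) by (simp add: Hom_def reassoc[OF \<zeta>'(2)])
    finally show ?thesis .
  qed
  have "?P (homology_map C K L \<phi> n)"
    unfolding homology_map_def
  proof (rule theI)
    show "?P h" by (rule Ph)
    fix h' assume "?P h'"
    then show "h' = h" using eq Ph by
      (intro homology_Hom_eqI[OF assms(1), of h' n "homology C L n" h]) auto
  qed
  then show ?A "z \<in> cycle_maps C K n w \<Longrightarrow> homology_map C K L \<phi> n \<cdot> hclass C K n z =
    hclass C L n (\<phi> n \<cdot> z)"
    using eq by blast+
qed

lemma homology_map_unique:
  assumes "chain_complex C K" "chain_complex C L" "chain_map C K L \<phi>"
    "h \<in> Hom C (homology C K n) (homology C L n)"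
    "\<And>w z. z \<in> cycle_maps C K n w \<Longrightarrow> h \<cdot> hclass C K n z = hclass C L n (\<phi> n \<cdot> z)"
  shows "homology_map C K L \<phi> n = h"
  by (rule homology_Hom_eqI[OF assms(1) homology_map_props(1)[OF assms(1-3)] assms(4)])
    (simp add: assms(5) homology_map_props(2)[OF assms(1-3)])

lemma chain_map_Idn:
  assumes "chain_complex C K"
  shows "chain_map C K K (\<lambda>n. Idn C (cob K n))"
  using cdf_simps[OF assms] by (simp add: chain_map_def Hom_def)

lemma homology_map_Idn:
  assumes "chain_complex C K"
  shows "homology_map C K K (\<lambda>n. Idn C (cob K n)) n = Idn C (homology C K n)"
proof (rule homology_map_unique[OF assms assms chain_map_Idn[OF assms]])
  show "Idn C (homology C K n) \<in> Hom C (homology C K n) (homology C K n)"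
    using homology_proj_props(5)[OF assms] Idn_in by blast
  fix w z assume z: "z \<in> cycle_maps C K n w"
  show "Idn C (homology C K n) \<cdot> hclass C K n z = hclass C K n (Idn C (cob K n) \<cdot> z)"
    using hclass_Hom[OF assms z] cycle_mapsD(1)[OF z] by (simp add: Hom_def)
qed

lemma chain_map_Comp:
  assumes "chain_complex C K" "chain_complex C L" "chain_complex C M" "chain_map C K L \<phi>"
    "chain_map C L M \<psi>"
  shows "chain_map C K M (\<lambda>n. \<psi> n \<cdot> \<phi> n)"
  unfolding chain_map_def
proof (intro allI conjI)
  fix n
  note s = cdf_simps[OF assms(1)] cdf_simps[OF assms(2)] cdf_simps[OF assms(3)]
  note \<phi> = chain_mapD(1)[OF assms(4)] and \<psi> = chain_mapD(1)[OF assms(5)]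
  show "\<psi> n \<cdot> \<phi> n \<in> Hom C (cob K n) (cob M n)" using \<phi>[of n] \<psi>[of n] by (simp add: Hom_def)
  show "cdf M n \<cdot> (\<psi> n \<cdot> \<phi> n) = (\<psi> (n - 1) \<cdot> \<phi> (n - 1)) \<cdot> cdf K n"
    using \<phi>[of n] \<psi>[of n] \<phi>[of "n - 1"] \<psi>[of "n - 1"] s chain_mapD(2)[OF assms(4) refl, of n]
    by (simp add: Hom_def reassoc[OF chain_mapD(2)[OF assms(5) refl, of n]])
qed

lemma homology_map_Comp:
  assumes "chain_complex C K" "chain_complex C L" "chain_complex C M" "chain_map C K L \<phi>"
    "chain_map C L M \<psi>"
  shows "homology_map C K M (\<lambda>n. \<psi> n \<cdot> \<phi> n) n = homology_map C L M \<psi> n \<cdot> homology_map C K L \<phi> n"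
proof (rule homology_map_unique[OF assms(1,3) chain_map_Comp[OF assms]])
  note h1 = homology_map_props[OF assms(1,2,4), where n=n]
    and h2 = homology_map_props[OF assms(2,3,5), where n=n]
  show "homology_map C L M \<psi> n \<cdot> homology_map C K L \<phi> n \<in> Hom C (homology C K n) (homology C M n)"
    using h1(1) h2(1) by (simp add: Hom_def)
  fix w z assume z: "z \<in> cycle_maps C K n w"
  have "homology_map C L M \<psi> n \<cdot> (homology_map C K L \<phi> n \<cdot> hclass C K n z) =
    hclass C M n (\<psi> n \<cdot> (\<phi> n \<cdot> z))"
    using h1(2)[OF z] h2(2)[OF chain_map_cycle_maps[OF assms(1,2,4) z]] by simp
  then show "(homology_map C L M \<psi> n \<cdot> homology_map C K L \<phi> n) \<cdot> hclass C K n z =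
    hclass C M n ((\<psi> n \<cdot> \<phi> n) \<cdot> z)"
    using h1(1) h2(1) hclass_Hom[OF assms(1) z] cycle_mapsD(1)[OF z] chain_mapD(1)[OF assms(4), of
      n]
     chain_mapD(1)[OF assms(5), of n] by (simp add: Hom_def)
qed

text \<open>On a cycle the summand \<open>h (n - 1) \<cdot> cdf K n\<close> vanishes, and the other
  summand of the homotopy contributes a boundary.\<close>

lemma homology_map_homotopic:
  assumes "chain_complex C K" "chain_complex C L" "chain_map C K L \<phi>" "chain_map C K L \<psi>"
    and h: "\<And>n. h n \<in> Hom C (cob K n) (cob L (n + 1))"
    and eq: "\<And>n. \<phi> n = Madd C (\<psi> n) (Madd C (cdf L (n + 1) \<cdot> h n) (h (n - 1) \<cdot> cdf K n))"
  shows "homology_map C K L \<phi> n = homology_map C K L \<psi> n"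
proof (rule homology_map_unique[OF assms(1-3)])
  note \<psi> = homology_map_props[OF assms(1,2,4), where n=n]
  show "homology_map C K L \<psi> n \<in> Hom C (homology C K n) (homology C L n)" by (rule \<psi>(1))
  fix w z assume z: "z \<in> cycle_maps C K n w"
  note z' = cycle_mapsD[OF z]
  have w: "w \<in> Ob C" using z'(1) Hom_Ob by blast
  have hz: "h n \<cdot> z \<in> Hom C w (cob L (n + 1))" using h[of n] z' by (simp add: Hom_def)
  note \<psi>z = chain_map_cycle_maps[OF assms(1,2,4) z]
  have "\<phi> n \<cdot> z = Madd C (\<psi> n \<cdot> z) (cdf L (n + 1) \<cdot> (h n \<cdot> z))"
    unfolding eq[of n] using h[of n] h[of "n - 1"] z' w cdf_simps[OF assms(1)]
      cdf_simps[OF assms(2)] chain_mapD(1)[OF assms(4), of n]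
    by (simp add: Hom_def)
  then have "hclass C L n (\<phi> n \<cdot> z) = Madd C (hclass C L n (\<psi> n \<cdot> z)) (Mzero C w (homology C L n))"
    using cycle_maps_Madd(2)[OF assms(2) \<psi>z boundary_in_cycle_maps(1)[OF assms(2) hz]]
      boundary_in_cycle_maps(2)[OF assms(2) hz]
    by simp
  also have "\<dots> = homology_map C K L \<psi> n \<cdot> hclass C K n z"
    using hclass_Hom[OF assms(2) \<psi>z] \<psi>(2)[OF z] by (simp add: Hom_def)
  finally show "homology_map C K L \<psi> n \<cdot> hclass C K n z = hclass C L n (\<phi> n \<cdot> z)" by simp
qed

end

section \<open>The long exact homology sequence\<close>

lemma short_exact_complexesD:
  assumes "short_exact_complexes C K L M \<phi> \<psi>"
  shows "chain_complex C K" "chain_complex C L" "chain_complex C M" "chain_map C K L \<phi>"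
    "chain_map C L M \<psi>"
    "short_exact C (\<phi> n) (\<psi> n)"
  using assms by (auto simp: short_exact_complexes_def)

context abelian_category
begin

section \<open>The connecting morphism\<close>

lemma short_exact_complexes_degree:
  assumes "short_exact_complexes C K L M \<phi> \<psi>"
  shows "\<psi> n \<in> Epi C (cob L n) (cob M n)" "\<phi> n \<in> Hom C (cob K n) (cob L n)"
    "\<psi> n \<in> Hom C (cob L n) (cob M n)"
    "monic C (\<phi> n)" "is_kernel C (\<psi> n) (\<phi> n)" "\<psi> n \<cdot> \<phi> n = Mzero C (cob K n) (cob M n)"
proof -
  note D = short_exact_complexesD[OF assms]
  show h: "\<phi> n \<in> Hom C (cob K n) (cob L n)" "\<psi> n \<in> Hom C (cob L n) (cob M n)"
    using chain_mapD(1)[OF D(4)] chain_mapD(1)[OF D(5)] by auto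
  show "\<psi> n \<in> Epi C (cob L n) (cob M n)"
    "monic C (\<phi> n)" "is_kernel C (\<psi> n) (\<phi> n)" "\<psi> n \<cdot> \<phi> n = Mzero C (cob K n) (cob M n)"
    using short_exactD[OF D(6) h] by auto
qed

lemma short_exact_complexes_lift:
  assumes "short_exact_complexes C K L M \<phi> \<psi>" "y \<in> Hom C w (cob L n)"
    "\<psi> n \<cdot> y = Mzero C w (cob M n)"
  obtains u where "u \<in> Hom C w (cob K n)" "\<phi> n \<cdot> u = y"
  using kernel_factor[OF short_exact_complexes_degree(5,3,2)[OF assms(1)] assms(2,3)] by blast

text \<open>The differential of \<open>z\<close> is mapped by the monomorphism
  \<open>\<phi> (n - 1)\<close> to the differential of \<open>\<phi> n \<cdot> z\<close>, which is
  zero.\<close>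

lemma cycle_preimage:
  assumes "chain_complex C K" "chain_complex C L" "chain_map C K L \<phi>" "monic C (\<phi> (n - 1))"
    "z \<in> Hom C w (cob K n)" "\<phi> n \<cdot> z \<in> cycle_maps C L n w"
  shows "z \<in> cycle_maps C K n w"
proof -
  note s = cdf_simps[OF assms(1)] cdf_simps[OF assms(2)]
  note \<phi> = chain_mapD(1)[OF assms(3), of n] chain_mapD(1)[OF assms(3), of "n - 1"]
  have "\<phi> (n - 1) \<cdot> (cdf K n \<cdot> z) = (cdf L n \<cdot> \<phi> n) \<cdot> z"
    unfolding chain_mapD(2)[OF assms(3) refl] using s \<phi> assms(5) by (simp add: Hom_def)
  also have "\<dots> = Mzero C w (cob L (n - 1))" using cycle_mapsD(2)[OF assms(6) refl] s \<phi> assms(5)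
    by (simp add: Hom_def)
  finally have "cdf K n \<cdot> z = Mzero C w (cob K (n - 1))"
    by - (rule monic_zero[OF assms(4) \<phi>(2)], use s assms(5) in \<open>simp_all add: Hom_def\<close>)
  then show ?thesis using assms(5) by (simp add: cycle_maps_def)
qed

text \<open>This is the statement about boundaries moved down one degree, so that the differential
  appears at \<open>n\<close> instead of \<open>n - 1 + 1\<close>.\<close>

lemma differential_in_cycle_maps:
  assumes "chain_complex C L" "y \<in> Hom C w (cob L n)"
  shows "cdf L n \<cdot> y \<in> cycle_maps C L (n - 1) w"
    "hclass C L (n - 1) (cdf L n \<cdot> y) = Mzero C w (homology C L (n - 1))"
  using boundary_in_cycle_maps[OF assms(1), of y w "n - 1"] assms(2) by simp_all

lemma hclass_zero_cover_pred:
  assumes "chain_complex C K" "z \<in> cycle_maps C K (n - 1) w"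
    "hclass C K (n - 1) z = Mzero C w (homology C K (n - 1))"
  obtains w' e b where "e \<in> Epi C w' w" "b \<in> Hom C w' (cob K n)" "cdf K n \<cdot> b = z \<cdot> e"
  by (rule hclass_zero_cover[OF assms]) (rule that; simp)

text \<open>Every admissible triple of a cycle \<open>x\<close>, a lift \<open>y\<close> and a
  preimage \<open>z\<close> is pulled back from one generic triple living on the pullback
  \<open>W\<close>. The class of the generic cycle is epic, so the value on it determines the
  morphism, and well-definedness needs to be checked only there.\<close>

lemma connecting_spec:
  assumes se: "short_exact_complexes C K L M \<phi> \<psi>"
  shows "connecting C K L M \<phi> \<psi> n \<in> Hom C (homology C M n) (homology C K (n - 1)) \<and>
        (\<forall>w. \<forall>x \<in> Hom C w (Dom C (cycles C M n)). \<forall>y \<in> Hom C w (cob L n).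
         \<forall>z \<in> Hom C w (Dom C (cycles C K (n - 1))).
           \<psi> n \<cdot> y = cycles C M n \<cdot> x \<and>
           \<phi> (n - 1) \<cdot> (cycles C K (n - 1) \<cdot> z) = cdf L n \<cdot> y \<longrightarrow>
           connecting C K L M \<phi> \<psi> n \<cdot> (homology_proj C M n \<cdot> x) = homology_proj C K (n - 1) \<cdot> z)"
proof -
  note D = short_exact_complexesD[OF se]
  note deg = short_exact_complexes_degree[OF se]
  note sK = cdf_simps[OF D(1)] and sL = cdf_simps[OF D(2)] and sM = cdf_simps[OF D(3)]
  note kM = cycles_kernel[OF D(3), of n] and kK = cycles_kernel[OF D(1), of "n - 1"]
  note pM = homology_proj_props[OF D(3), of n] and pK = homology_proj_props[OF D(1), of "n - 1"]
  note cK = chain_mapD(2)[OF D(4)] and cL = chain_mapD(2)[OF D(5)]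
  let ?ZM = "Dom C (cycles C M n)" and ?ZK = "Dom C (cycles C K (n - 1))"
  let ?P = "\<lambda>h. h \<in> Hom C (homology C M n) (homology C K (n - 1)) \<and>
        (\<forall>w. \<forall>x \<in> Hom C w ?ZM. \<forall>y \<in> Hom C w (cob L n). \<forall>z \<in> Hom C w ?ZK.
           \<psi> n \<cdot> y = cycles C M n \<cdot> x \<and>
           \<phi> (n - 1) \<cdot> (cycles C K (n - 1) \<cdot> z) = cdf L n \<cdot> y \<longrightarrow>
           h \<cdot> (homology_proj C M n \<cdot> x) = homology_proj C K (n - 1) \<cdot> z)"
  \<comment> \<open>The pullback of \<open>\<psi>\<^sub>n\<close> and the cycles is the universal place where a lift \<open>y\<close> of \<open>x\<close> exists.\<close>
  obtain W y0 x0 where W: "y0 \<in> Hom C W (cob L n)" "x0 \<in> Epi C W ?ZM" "\<psi> n \<cdot> y0 = cycles C M n \<cdot> x0"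
    and univ: "\<And>w u v. u \<in> Hom C w (cob L n) \<Longrightarrow> v \<in> Hom C w ?ZM \<Longrightarrow> \<psi> n \<cdot> u = cycles C M n \<cdot> v \<Longrightarrow>
      \<exists>t\<in>Hom C w W. y0 \<cdot> t = u \<and> x0 \<cdot> t = v"
    using pullback_Epi[OF deg(1)[of n] kM(2)] by metis
  have x0: "x0 \<in> Hom C W ?ZM" using W by (simp add: Epi_def)
  have Wob: "W \<in> Ob C" using x0 Hom_Ob by blast
  have "\<psi> (n - 1) \<cdot> (cdf L n \<cdot> y0) = (cdf M n \<cdot> \<psi> n) \<cdot> y0"
    unfolding cL[OF refl] using sL sM deg(3)[of "n - 1"] W by (simp add: Hom_def)
  also have "\<dots> = cdf M n \<cdot> (cycles C M n \<cdot> x0)" using W sM deg(3)[of n] by (simp add: Hom_def)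
  also have "\<dots> = Mzero C W (cob M (n - 1))"
    using kM(2) x0 sM by (simp add: Hom_def reassoc[OF kM(4)[OF refl]])
  finally obtain z0 where z0: "z0 \<in> Hom C W (cob K (n - 1))" "\<phi> (n - 1) \<cdot> z0 = cdf L n \<cdot> y0"
    using short_exact_complexes_lift[OF se, of "cdf L n \<cdot> y0" W "n - 1"] W(1) sL
      by (auto simp: Hom_def)
  have z0c: "z0 \<in> cycle_maps C K (n - 1) W"
    by (rule cycle_preimage[OF D(1,2,4) deg(4) z0(1)])
      (simp add: z0(2) differential_in_cycle_maps[OF D(2) W(1)])
  obtain \<zeta> where \<zeta>: "\<zeta> \<in> Hom C W ?ZK" "cycles C K (n - 1) \<cdot> \<zeta> = z0"
    "hclass C K (n - 1) z0 = homology_proj C K (n - 1) \<cdot> \<zeta>"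
    using cycle_factor[OF D(1) z0c] by blast
  \<comment> \<open>\<open>p\<close> is the class of the generic cycle, an epimorphism as a
    composite of two; \<open>t\<close> is the class that the connecting morphism has to assign to
    it.\<close>
  define p where "p = homology_proj C M n \<cdot> x0"
  define t where "t = homology_proj C K (n - 1) \<cdot> \<zeta>"
  have p: "p \<in> Epi C W (homology C M n)" unfolding p_def by (rule Epi_Comp[OF W(2) pM(2)])
  have t: "t \<in> Hom C W (homology C K (n - 1))" unfolding t_def using \<zeta>(1) pK(3)
    by (simp add: Hom_def)
  obtain h where h: "h \<in> Hom C (homology C M n) (homology C K (n - 1))" "h \<cdot> p = t"
  proof (rule factor_Epi[OF p t])
    \<comment> \<open>Where the generic class vanishes, the cycle \<open>x0 \<cdot> u\<close> bounds
      some \<open>b\<close> after refinement. Lifting \<open>b\<close> to \<open>b'\<close> in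
      \<open>L\<close> and subtracting its differential from \<open>y0\<close> leaves an element
      that comes from some \<open>s\<close> in \<open>K\<close>. The correction has zero
      differential, so the differential of \<open>s\<close> is the generic \<open>z0\<close>: the
      value \<open>t\<close> vanishes there.\<close>
    fix v u assume u: "u \<in> Hom C v W" "p \<cdot> u = Mzero C v (homology C M n)"
    have x0u: "x0 \<cdot> u \<in> Hom C v ?ZM" using x0 u by (simp add: Hom_def)
    have "hclass C M n (cycles C M n \<cdot> (x0 \<cdot> u)) = Mzero C v (homology C M n)"
      using cycles_Comp_in(2)[OF D(3) x0u] u x0 pM(3) by (simp add: p_def Hom_def)
    then obtain v1 e1 b where b: "e1 \<in> Epi C v1 v" "b \<in> Hom C v1 (cob M (n + 1))"
      "cdf M (n + 1) \<cdot> b = (cycles C M n \<cdot> (x0 \<cdot> u)) \<cdot> e1"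
      using hclass_zero_cover[OF D(3) cycles_Comp_in(1)[OF D(3) x0u]] by blast
    obtain v2 e2 b' where b': "e2 \<in> Epi C v2 v1" "b' \<in> Hom C v2 (cob L (n + 1))"
      "\<psi> (n + 1) \<cdot> b' = b \<cdot> e2"
      using Epi_cover[OF deg(1) b(2)] by blast
    define E where "E = e1 \<cdot> e2"
    have E: "E \<in> Epi C v2 v" unfolding E_def by (rule Epi_Comp[OF b'(1) b(1)])
    have EH: "E \<in> Hom C v2 v" using E by (simp add: Epi_def)
    have v2: "v2 \<in> Ob C" using EH Hom_Ob by blast
    define y1 where "y1 = Msub C (y0 \<cdot> (u \<cdot> E)) (cdf L (n + 1) \<cdot> b')"
    have y1: "y1 \<in> Hom C v2 (cob L n)" using W(1) u(1) EH b'(2) sL by (simp add: y1_def Hom_def)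
    have "\<psi> n \<cdot> (cdf L (n + 1) \<cdot> b') = (cdf M (n + 1) \<cdot> \<psi> (n + 1)) \<cdot> b'"
      using cL[of "n + 1" n] sL deg(3)[of n] b'(2) by (simp add: Hom_def)
    also have "\<dots> = (cdf M (n + 1) \<cdot> b) \<cdot> e2" using sM deg(3)[of "n + 1"] b' b(2)
      by (simp add: Hom_def Epi_def)
    also have "\<dots> = cycles C M n \<cdot> (x0 \<cdot> (u \<cdot> E))" unfolding b(3) E_def
      using kM(2) x0 u(1) b(1) b'(1) by (simp add: Hom_def Epi_def)
    also have "\<dots> = \<psi> n \<cdot> (y0 \<cdot> (u \<cdot> E))"
      using kM(2) x0 u(1) EH W(1) deg(3)[of n] by (simp add: Hom_def reassoc[OF W(3)])
    finally have "\<psi> n \<cdot> y1 = Mzero C v2 (cob M n)"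
      using W(1) u(1) EH b'(2) sL deg(3)[of n] by (simp add: y1_def Hom_def)
    then obtain s where s: "s \<in> Hom C v2 (cob K n)" "\<phi> n \<cdot> s = y1"
      using short_exact_complexes_lift[OF se y1] by blast
    have dd: "cdf L n \<cdot> cdf L (n + 1) = Mzero C (cob L (n + 1)) (cob L (n - 1))"
      using chain_complexD(3)[OF D(2), of "n + 1"] by simp
    have "\<phi> (n - 1) \<cdot> (cdf K n \<cdot> s) = (cdf L n \<cdot> \<phi> n) \<cdot> s"
      unfolding cK[OF refl] using s sK deg(2)[of "n - 1"] by (simp add: Hom_def)
    also have "\<dots> = cdf L n \<cdot> y1" using s sL deg(2)[of n] by (simp add: Hom_def)
    also have "\<dots> = cdf L n \<cdot> (y0 \<cdot> (u \<cdot> E))"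
      unfolding y1_def using W(1) u(1) EH b'(2) sL v2 by (simp add: Hom_def reassoc[OF dd])
    also have "\<dots> = \<phi> (n - 1) \<cdot> (z0 \<cdot> (u \<cdot> E))"
      using W(1) u(1) EH z0(1) sL deg(2)[of "n - 1"] by (simp add: Hom_def reassoc[OF z0(2)])
    finally have "cdf K n \<cdot> s = z0 \<cdot> (u \<cdot> E)"
      by (rule monicD[OF deg(4)[of "n - 1"] _ deg(2)[of "n - 1"]])
        (use s z0 u EH sK in \<open>simp_all add: Hom_def\<close>)
    moreover have "t \<cdot> (u \<cdot> E) = hclass C K (n - 1) (z0 \<cdot> (u \<cdot> E))"
      using cycle_maps_Comp(2)[OF D(1) z0c, of "u \<cdot> E" v2] u(1) EH \<zeta>(3) by (simp add: t_def Hom_def)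
    ultimately have "t \<cdot> (u \<cdot> E) = Mzero C v2 (homology C K (n - 1))"
      using differential_in_cycle_maps(2)[OF D(1) s(1)] by simp
    with E show "\<exists>v' e. e \<in> Epi C v' v \<and> t \<cdot> (u \<cdot> e) = Mzero C v' (homology C K (n - 1))" by blast
  qed
  have Ph: "?P h"
  proof (intro conjI allI ballI impI)
    show "h \<in> Hom C (homology C M n) (homology C K (n - 1))" by (rule h(1))
    fix w x y z
    assume x: "x \<in> Hom C w ?ZM" and y: "y \<in> Hom C w (cob L n)" and z: "z \<in> Hom C w ?ZK"
      and e: "\<psi> n \<cdot> y = cycles C M n \<cdot> x \<and> \<phi> (n - 1) \<cdot> (cycles C K (n - 1) \<cdot> z) = cdf L n \<cdot> y"
    \<comment> \<open>The pair of \<open>y\<close> and \<open>x\<close> is pulled back from the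
      generic one along \<open>u\<close>. Then \<open>z\<close> must be the pullback of
      \<open>\<zeta>\<close>, since \<open>\<phi> (n - 1)\<close> and
      \<open>cycles C K (n - 1)\<close> are monic.\<close>
    obtain u where u: "u \<in> Hom C w W" "y0 \<cdot> u = y" "x0 \<cdot> u = x" using univ[OF y x] e by blast
    have "\<phi> (n - 1) \<cdot> (cycles C K (n - 1) \<cdot> z) = cdf L n \<cdot> (y0 \<cdot> u)" using e u by simp
    also have "\<dots> = \<phi> (n - 1) \<cdot> (z0 \<cdot> u)"
      using W(1) u(1) z0(1) sL deg(2)[of "n - 1"] by (simp add: Hom_def reassoc[OF z0(2)])
    finally have "cycles C K (n - 1) \<cdot> z = z0 \<cdot> u"
      by (rule monicD[OF deg(4)[of "n - 1"] _ deg(2)[of "n - 1"]])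
        (use z z0 u(1) kK(2) in \<open>simp_all add: Hom_def\<close>)
    also have "\<dots> = cycles C K (n - 1) \<cdot> (\<zeta> \<cdot> u)"
      using \<zeta>(1) u(1) kK(2) by (simp add: Hom_def reassoc[OF \<zeta>(2)])
    finally have z': "z = \<zeta> \<cdot> u"
      by (rule monicD[OF kK(3) _ kK(2)]) (use z \<zeta>(1) u(1) in \<open>simp_all add: Hom_def\<close>)
    have "h \<cdot> (homology_proj C M n \<cdot> x) = h \<cdot> (p \<cdot> u)"
      unfolding p_def u(3)[symmetric] using u(1) x0 pM(3) by (simp add: Hom_def)
    also have "\<dots> = t \<cdot> u" using h p u(1) by (simp add: Hom_def Epi_def reassoc[OF h(2)])
    also have "\<dots> = homology_proj C K (n - 1) \<cdot> z"
      unfolding z' t_def using u(1) \<zeta>(1) pK(3) by (simp add: Hom_def)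
    finally show "h \<cdot> (homology_proj C M n \<cdot> x) = homology_proj C K (n - 1) \<cdot> z" .
  qed
  have \<zeta>0: "\<phi> (n - 1) \<cdot> (cycles C K (n - 1) \<cdot> \<zeta>) = cdf L n \<cdot> y0" using \<zeta>(2) z0(2) by simp
  \<comment> \<open>The generic triple is itself admissible, which prescribes the composite with the
    epimorphism \<open>p\<close>.\<close>
  have uniq: "h' = h" if P: "?P h'" for h'
  proof (rule EpiD[OF p])
    have "h' \<cdot> (homology_proj C M n \<cdot> x0) = homology_proj C K (n - 1) \<cdot> \<zeta>"
      using P x0 W \<zeta>(1) \<zeta>0 by blast
    then show "h' \<cdot> p = h \<cdot> p" using h(2) by (simp only: p_def t_def)
  qed (use P h in blast)+
  have "?P (connecting C K L M \<phi> \<psi> n)"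
    unfolding connecting_def by (rule theI[of ?P h]) (rule Ph, rule uniq)
  then show ?thesis .
qed

text \<open>The recipe is restated for arrows into the complexes instead of arrows into the kernels
  \<open>cycles\<close>. That \<open>z\<close> is a cycle now appears as a conclusion.\<close>

lemma connecting_props:
  assumes se: "short_exact_complexes C K L M \<phi> \<psi>"
  shows "connecting C K L M \<phi> \<psi> n \<in> Hom C (homology C M n) (homology C K (n - 1))"
    "x \<in> cycle_maps C M n w \<Longrightarrow> y \<in> Hom C w (cob L n) \<Longrightarrow> z \<in> Hom C w (cob K (n - 1)) \<Longrightarrow>
     \<psi> n \<cdot> y = x \<Longrightarrow> \<phi> (n - 1) \<cdot> z = cdf L n \<cdot> y \<Longrightarrow>
     z \<in> cycle_maps C K (n - 1) w \<and> connecting C K L M \<phi> \<psi> n \<cdot> hclass C M n x = hclass C K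
       (n - 1) z"
proof -
  note D = short_exact_complexesD[OF se]
  note deg = short_exact_complexes_degree[OF se]
  note con = connecting_spec[OF se, of n]
  show "connecting C K L M \<phi> \<psi> n \<in> Hom C (homology C M n) (homology C K (n - 1))" using con by blast
  assume x: "x \<in> cycle_maps C M n w" and y: "y \<in> Hom C w (cob L n)"
    and z: "z \<in> Hom C w (cob K (n - 1))"
     and e: "\<psi> n \<cdot> y = x" "\<phi> (n - 1) \<cdot> z = cdf L n \<cdot> y"
  have zc: "z \<in> cycle_maps C K (n - 1) w"
    by (rule cycle_preimage[OF D(1,2,4) deg(4) z])
      (simp add: e(2) differential_in_cycle_maps[OF D(2) y])
  obtain \<xi> where \<xi>: "\<xi> \<in> Hom C w (Dom C (cycles C M n))" "cycles C M n \<cdot> \<xi> = x"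
    "hclass C M n x = homology_proj C M n \<cdot> \<xi>"
    using cycle_factor[OF D(3) x] by blast
  obtain \<zeta> where \<zeta>: "\<zeta> \<in> Hom C w (Dom C (cycles C K (n - 1)))" "cycles C K (n - 1) \<cdot> \<zeta> = z"
    "hclass C K (n - 1) z = homology_proj C K (n - 1) \<cdot> \<zeta>"
    using cycle_factor[OF D(1) zc] by blast
  have "\<psi> n \<cdot> y = cycles C M n \<cdot> \<xi> \<and> \<phi> (n - 1) \<cdot> (cycles C K (n - 1) \<cdot> \<zeta>) = cdf L n \<cdot> y"
    using e \<xi>(2) \<zeta>(2) by simp
  then have "connecting C K L M \<phi> \<psi> n \<cdot> (homology_proj C M n \<cdot> \<xi>) = homology_proj C K (n - 1) \<cdot> \<zeta>"
    using con \<xi>(1) y \<zeta>(1) by blast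
  then show "z \<in> cycle_maps C K (n - 1) w \<and> connecting C K L M \<phi> \<psi> n \<cdot> hclass C M n x =
    hclass C K (n - 1) z"
    using zc \<xi>(3) \<zeta>(3) by simp
qed

text \<open>This makes the recipe applicable to an arbitrary class: after an epimorphism a lift and
  a preimage exist. Equations involving the connecting morphism are then checked on such data and
  cancelled along \<open>e\<close>.\<close>

lemma connecting_cover:
  assumes se: "short_exact_complexes C K L M \<phi> \<psi>" and x: "x \<in> cycle_maps C M n w"
  obtains w' e y z where "e \<in> Epi C w' w" "y \<in> Hom C w' (cob L n)" "z \<in> cycle_maps C K (n - 1) w'"
    "\<psi> n \<cdot> y = x \<cdot> e" "\<phi> (n - 1) \<cdot> z = cdf L n \<cdot> y"
    "connecting C K L M \<phi> \<psi> n \<cdot> (hclass C M n x \<cdot> e) = hclass C K (n - 1) z"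
proof -
  note D = short_exact_complexesD[OF se]
  note deg = short_exact_complexes_degree[OF se]
  note sL = cdf_simps[OF D(2)] and sM = cdf_simps[OF D(3)]
  obtain w' e y where y: "e \<in> Epi C w' w" "y \<in> Hom C w' (cob L n)" "\<psi> n \<cdot> y = x \<cdot> e"
    using Epi_cover[OF deg(1) cycle_mapsD(1)[OF x]] by blast
  have xe: "x \<cdot> e \<in> cycle_maps C M n w'" "hclass C M n (x \<cdot> e) = hclass C M n x \<cdot> e"
    using cycle_maps_Comp[OF D(3) x Epi_Hom[OF y(1)]] by auto
  have "\<psi> (n - 1) \<cdot> (cdf L n \<cdot> y) = (cdf M n \<cdot> \<psi> n) \<cdot> y"
    unfolding chain_mapD(2)[OF D(5) refl] using sL sM deg(3)[of "n - 1"] y by (simp add: Hom_def)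
  also have "\<dots> = cdf M n \<cdot> (x \<cdot> e)" using y sM deg(3)[of n] by (simp add: Hom_def)
  also have "\<dots> = Mzero C w' (cob M (n - 1))" by (rule cycle_mapsD(2)[OF xe(1) refl])
  finally obtain z where z: "z \<in> Hom C w' (cob K (n - 1))" "\<phi> (n - 1) \<cdot> z = cdf L n \<cdot> y"
    using short_exact_complexes_lift[OF se, of "cdf L n \<cdot> y" w' "n - 1"] y(2) sL
      by (auto simp: Hom_def)
  show ?thesis using connecting_props(2)[OF se xe(1) y(2) z(1) y(3) z(2)] that[OF y(1,2) _ y(3)
    z(2)] xe(2) by simp
qed

section \<open>Exactness of the homology sequence at its three kinds of terms\<close>

lemma homology_exact_middle:
  assumes se: "short_exact_complexes C K L M \<phi> \<psi>"
  shows "exact_at C (homology_map C K L \<phi> n) (homology_map C L M \<psi> n)"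
proof -
  note D = short_exact_complexesD[OF se]
  note deg = short_exact_complexes_degree[OF se]
  note sK = cdf_simps[OF D(1)] and sL = cdf_simps[OF D(2)] and sM = cdf_simps[OF D(3)]
  note h\<phi> = homology_map_props[OF D(1,2,4), where n=n]
    and h\<psi> = homology_map_props[OF D(2,3,5), where n=n]
  show ?thesis
  proof (rule exact_atI[OF h\<phi>(1) h\<psi>(1)])
    show "homology_map C L M \<psi> n \<cdot> homology_map C K L \<phi> n =
      Mzero C (homology C K n) (homology C M n)"
    proof (rule homology_Hom_eqI[OF D(1)])
      fix w z assume z: "z \<in> cycle_maps C K n w"
      have w: "w \<in> Ob C" using cycle_mapsD(1)[OF z] Hom_Ob by blast
      have "\<psi> n \<cdot> (\<phi> n \<cdot> z) = Mzero C w (cob M n)"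
        using deg(2,3)[of n] cycle_mapsD(1)[OF z] sM by (simp add: Hom_def reassoc[OF deg(6)])
      also have "\<dots> = cdf M (n + 1) \<cdot> Mzero C w (cob M (n + 1))" using w sM by simp
      finally have "hclass C M n (\<psi> n \<cdot> (\<phi> n \<cdot> z)) = Mzero C w (homology C M n)"
        using boundary_in_cycle_maps(2)[OF D(3), of "Mzero C w (cob M (n + 1))" w n] w sM
          by (simp add: Hom_def)
      then have "homology_map C L M \<psi> n \<cdot> (homology_map C K L \<phi> n \<cdot> hclass C K n z) =
        Mzero C w (homology C M n)"
        using h\<phi>(2)[OF z] h\<psi>(2)[OF chain_map_cycle_maps[OF D(1,2,4) z]] by simp
      then show "(homology_map C L M \<psi> n \<cdot> homology_map C K L \<phi> n) \<cdot> hclass C K n z =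
         Mzero C (homology C K n) (homology C M n) \<cdot> hclass C K n z"
        using h\<phi>(1) h\<psi>(1) hclass_Hom[OF D(1) z] homology_proj_props(5)[OF D(3)]
          by (simp add: Hom_def)
    qed (use h\<phi>(1) h\<psi>(1) homology_proj_props(5)[OF D(1)] homology_proj_props(5)[OF D(3)] in
      \<open>simp_all add: Hom_def\<close>)
    fix w c assume c: "c \<in> Hom C w (homology C L n)" "homology_map C L M \<psi> n \<cdot> c =
      Mzero C w (homology C M n)"
    have w: "w \<in> Ob C" using c Hom_Ob by blast
    obtain w1 e1 z where z: "e1 \<in> Epi C w1 w" "z \<in> cycle_maps C L n w1" "hclass C L n z = c \<cdot> e1"
      using hclass_cover[OF D(2) c(1)] by blast
    have e1: "e1 \<in> Hom C w1 w" using z by (simp add: Epi_def)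
    have "hclass C M n (\<psi> n \<cdot> z) = homology_map C L M \<psi> n \<cdot> (c \<cdot> e1)" using h\<psi>(2)[OF z(2)] z(3)
      by simp
    also have "\<dots> = Mzero C w1 (homology C M n)"
      using c(1) e1 h\<psi>(1) homology_proj_props(5)[OF D(3)] by (simp add: Hom_def reassoc[OF c(2)])
    finally obtain w2 e2 b where b: "e2 \<in> Epi C w2 w1" "b \<in> Hom C w2 (cob M (n + 1))"
      "cdf M (n + 1) \<cdot> b = (\<psi> n \<cdot> z) \<cdot> e2"
      using hclass_zero_cover[OF D(3) chain_map_cycle_maps[OF D(2,3,5) z(2)]] by blast
    obtain w3 e3 b' where b': "e3 \<in> Epi C w3 w2" "b' \<in> Hom C w3 (cob L (n + 1))"
      "\<psi> (n + 1) \<cdot> b' = b \<cdot> e3"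
      using Epi_cover[OF deg(1) b(2)] by blast
    have e2: "e2 \<in> Hom C w2 w1" and e3: "e3 \<in> Hom C w3 w2" using b b' by (simp_all add: Epi_def)
    have e23: "e2 \<cdot> e3 \<in> Hom C w3 w1" using e2 e3 by (simp add: Hom_def)
    have w3: "w3 \<in> Ob C" using e3 Hom_Ob by blast
    \<comment> \<open>The image of \<open>z\<close> in \<open>M\<close> bounds. Subtracting from
      \<open>z\<close> the differential of a lift \<open>b'\<close> of the bounding chain does not
      change its class, but makes its image in \<open>M\<close> zero, so that it comes from
      \<open>K\<close>.\<close>
    define y1 where "y1 = Msub C (z \<cdot> (e2 \<cdot> e3)) (cdf L (n + 1) \<cdot> b')"
    note z' = cycle_mapsD(1)[OF z(2)]
    have y1: "y1 \<in> Hom C w3 (cob L n)" using z' e23 b'(2) sL by (simp add: y1_def Hom_def)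
    have "\<psi> n \<cdot> (cdf L (n + 1) \<cdot> b') = (cdf M (n + 1) \<cdot> \<psi> (n + 1)) \<cdot> b'"
      using chain_mapD(2)[OF D(5), of "n + 1" n] sL deg(3)[of n] b'(2) by (simp add: Hom_def)
    also have "\<dots> = (cdf M (n + 1) \<cdot> b) \<cdot> e3" using sM deg(3)[of "n + 1"] b' b(2)
      by (simp add: Hom_def Epi_def)
    also have "\<dots> = \<psi> n \<cdot> (z \<cdot> (e2 \<cdot> e3))" unfolding b(3)
      using z' e2 e3 deg(3)[of n] by (simp add: Hom_def)
    finally have "\<psi> n \<cdot> y1 = Mzero C w3 (cob M n)"
      using z' e23 b'(2) sL deg(3)[of n] by (simp add: y1_def Hom_def)
    then obtain s where s: "s \<in> Hom C w3 (cob K n)" "\<phi> n \<cdot> s = y1"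
      using short_exact_complexes_lift[OF se y1] by blast
    note ze = cycle_maps_Comp[OF D(2) z(2) e23] and bc = boundary_in_cycle_maps[OF D(2) b'(2)]
    have eq: "Madd C y1 (cdf L (n + 1) \<cdot> b') = z \<cdot> (e2 \<cdot> e3)"
      using z' e23 b'(2) sL by (simp add: y1_def Hom_def)
    have dd: "cdf L n \<cdot> cdf L (n + 1) = Mzero C (cob L (n + 1)) (cob L (n - 1))"
      using chain_complexD(3)[OF D(2), of "n + 1"] by simp
    have "cdf L n \<cdot> y1 = Mzero C w3 (cob L (n - 1))"
      using z' e23 b'(2) sL w3 cycle_mapsD(2)[OF ze(1) refl]
        by (simp add: y1_def Hom_def reassoc[OF dd])
    then have y1c: "y1 \<in> cycle_maps C L n w3" using y1 by (simp add: cycle_maps_def)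
    have sc: "s \<in> cycle_maps C K n w3"
      by (rule cycle_preimage[OF D(1,2,4) deg(4) s(1)]) (simp add: s(2) y1c)
    have "homology_map C K L \<phi> n \<cdot> hclass C K n s = hclass C L n y1" using h\<phi>(2)[OF sc] s(2) by simp
    also have "\<dots> = hclass C L n (z \<cdot> (e2 \<cdot> e3))"
      using cycle_maps_Madd(2)[OF D(2) y1c bc(1)] eq bc(2) hclass_Hom[OF D(2) y1c]
        by (simp add: Hom_def)
    also have "\<dots> = c \<cdot> (e1 \<cdot> (e2 \<cdot> e3))" using ze(2) z(3) c(1) e1 e23 by (simp add: Hom_def)
    finally show "\<exists>w' e y. e \<in> Epi C w' w \<and> y \<in> Hom C w' (homology C K n) \<and>
      homology_map C K L \<phi> n \<cdot> y = c \<cdot> e"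
      using Epi_Comp[OF Epi_Comp[OF b'(1) b(1)] z(1)] hclass_Hom[OF D(1) sc] by blast
  qed
qed

lemma homology_exact_right:
  assumes se: "short_exact_complexes C K L M \<phi> \<psi>"
  shows "exact_at C (homology_map C L M \<psi> n) (connecting C K L M \<phi> \<psi> n)"
proof -
  note D = short_exact_complexesD[OF se]
  note deg = short_exact_complexes_degree[OF se]
  note sK = cdf_simps[OF D(1)] and sL = cdf_simps[OF D(2)] and sM = cdf_simps[OF D(3)]
  note h\<psi> = homology_map_props[OF D(2,3,5), where n=n] and con = connecting_props[OF se, where n=n]
  show ?thesis
  proof (rule exact_atI[OF h\<psi>(1) con(1)])
    show "connecting C K L M \<phi> \<psi> n \<cdot> homology_map C L M \<psi> n =
      Mzero C (homology C L n) (homology C K (n - 1))"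
    proof (rule homology_Hom_eqI[OF D(2)])
      fix w z assume z: "z \<in> cycle_maps C L n w"
      note z' = cycle_mapsD[OF z]
      have w: "w \<in> Ob C" using z'(1) Hom_Ob by blast
      \<comment> \<open>The zero cycle has class zero because it is the differential of
        zero.\<close>
      have 0: "Mzero C w (cob K (n - 1)) = cdf K n \<cdot> Mzero C w (cob K n)" using w sK by simp
      have 1: "Mzero C w (cob K n) \<in> Hom C w (cob K n)"
        "Mzero C w (cob K (n - 1)) \<in> Hom C w (cob K (n - 1))"
        using w sK by (simp_all add: Hom_def)
      have 2: "hclass C K (n - 1) (Mzero C w (cob K (n - 1))) = Mzero C w (homology C K (n - 1))"
        unfolding 0 using differential_in_cycle_maps(2)[OF D(1) 1(1)] .
      \<comment> \<open>A cycle \<open>z\<close> of \<open>L\<close> is an admissible lift of its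
        own image, and since its differential vanishes, the preimage in \<open>K\<close> is
        zero.\<close>
      have 3: "\<phi> (n - 1) \<cdot> Mzero C w (cob K (n - 1)) = cdf L n \<cdot> z"
        using w deg(2)[of "n - 1"] z'(2)[OF refl] by (simp add: Hom_def)
      have "connecting C K L M \<phi> \<psi> n \<cdot> hclass C M n (\<psi> n \<cdot> z) = Mzero C w (homology C K (n - 1))"
        using con(2)[OF chain_map_cycle_maps[OF D(2,3,5) z] z'(1) 1(2) refl 3] 2 by simp
      then have "connecting C K L M \<phi> \<psi> n \<cdot> (homology_map C L M \<psi> n \<cdot> hclass C L n z) =
        Mzero C w (homology C K (n - 1))"
        using h\<psi>(2)[OF z] by simp
      then show "(connecting C K L M \<phi> \<psi> n \<cdot> homology_map C L M \<psi> n) \<cdot> hclass C L n z =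
        Mzero C (homology C L n) (homology C K (n - 1)) \<cdot> hclass C L n z"
        using con(1) h\<psi>(1) hclass_Hom[OF D(2) z] homology_proj_props(5)[OF D(1)]
          by (simp add: Hom_def)
    qed (use con(1) h\<psi>(1) homology_proj_props(5)[OF D(1)] homology_proj_props(5)[OF D(2)] in
      \<open>simp_all add: Hom_def\<close>)
    fix w c assume c: "c \<in> Hom C w (homology C M n)" "connecting C K L M \<phi> \<psi> n \<cdot> c =
      Mzero C w (homology C K (n - 1))"
    obtain w1 e1 x where x: "e1 \<in> Epi C w1 w" "x \<in> cycle_maps C M n w1" "hclass C M n x = c \<cdot> e1"
      using hclass_cover[OF D(3) c(1)] by blast
    have e1: "e1 \<in> Hom C w1 w" using x by (simp add: Epi_def)
    obtain w2 e2 y z where yz: "e2 \<in> Epi C w2 w1" "y \<in> Hom C w2 (cob L n)"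
      "z \<in> cycle_maps C K (n - 1) w2"
      "\<psi> n \<cdot> y = x \<cdot> e2" "\<phi> (n - 1) \<cdot> z = cdf L n \<cdot> y"
      "connecting C K L M \<phi> \<psi> n \<cdot> (hclass C M n x \<cdot> e2) = hclass C K (n - 1) z"
      by (rule connecting_cover[OF se x(2)]) (rule that; assumption)
    have e2: "e2 \<in> Hom C w2 w1" using yz by (simp add: Epi_def)
    have "hclass C K (n - 1) z = connecting C K L M \<phi> \<psi> n \<cdot> (c \<cdot> (e1 \<cdot> e2))"
      using yz(6)[symmetric] x(3) c(1) e1 e2 by (simp add: Hom_def)
    also have "\<dots> = Mzero C w2 (homology C K (n - 1))"
      using c(1) e1 e2 con(1) homology_proj_props(5)[OF D(1)]
        by (simp add: Hom_def reassoc[OF c(2)])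
    finally have "hclass C K (n - 1) z = Mzero C w2 (homology C K (n - 1))" .
    from hclass_zero_cover_pred[OF D(1) yz(3) this] obtain w3 e3 b where
      b: "e3 \<in> Epi C w3 w2" "b \<in> Hom C w3 (cob K n)" "cdf K n \<cdot> b = z \<cdot> e3" .
    have e3: "e3 \<in> Hom C w3 w2" using b by (simp add: Epi_def)
    have w3: "w3 \<in> Ob C" using e3 Hom_Ob by blast
    \<comment> \<open>The preimage of the differential of \<open>y\<close> bounds \<open>b\<close>.
      Removing \<open>\<phi> n \<cdot> b\<close> turns the lift into a cycle of \<open>L\<close>
      without changing its image in \<open>M\<close>, since \<open>\<psi> n \<cdot> \<phi> n\<close>
      is zero.\<close>
    define y1 where "y1 = Msub C (y \<cdot> e3) (\<phi> n \<cdot> b)"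
    have y1: "y1 \<in> Hom C w3 (cob L n)" using yz(2) e3 b(2) deg(2)[of n]
      by (simp add: y1_def Hom_def)
    note z' = cycle_mapsD(1)[OF yz(3)]
    have "cdf L n \<cdot> (\<phi> n \<cdot> b) = (\<phi> (n - 1) \<cdot> cdf K n) \<cdot> b"
      by (rule reassoc[OF chain_mapD(2)[OF D(4) refl]])
        (use sL deg(2)[of n] b(2) in \<open>simp_all add: Hom_def\<close>)
    also have "\<dots> = \<phi> (n - 1) \<cdot> (z \<cdot> e3)" using sK deg(2)[of "n - 1"] b by (simp add: Hom_def)
    also have "\<dots> = cdf L n \<cdot> (y \<cdot> e3)"
      using z' e3 deg(2)[of "n - 1"] sL yz(2) by (simp add: Hom_def reassoc[OF yz(5)])
    finally have "cdf L n \<cdot> y1 = Mzero C w3 (cob L (n - 1))"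
      using yz(2) e3 b(2) deg(2)[of n] sL by (simp add: y1_def Hom_def)
    then have y1c: "y1 \<in> cycle_maps C L n w3" using y1 by (simp add: cycle_maps_def)
    have "\<psi> n \<cdot> y1 = x \<cdot> (e2 \<cdot> e3)"
      using yz(2) e3 b(2) deg(2,3)[of n] sM w3 cycle_mapsD(1)[OF x(2)] e2
      by (simp add: y1_def Hom_def reassoc[OF yz(4)] reassoc[OF deg(6)])
    then have "homology_map C L M \<psi> n \<cdot> hclass C L n y1 = hclass C M n (x \<cdot> (e2 \<cdot> e3))"
      using h\<psi>(2)[OF y1c] by simp
    also have "\<dots> = c \<cdot> (e1 \<cdot> (e2 \<cdot> e3))"
      using cycle_maps_Comp(2)[OF D(3) x(2), of "e2 \<cdot> e3" w3] x(3) c(1) e1 e2 e3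
        by (simp add: Hom_def)
    finally show "\<exists>w' e y. e \<in> Epi C w' w \<and> y \<in> Hom C w' (homology C L n) \<and>
      homology_map C L M \<psi> n \<cdot> y = c \<cdot> e"
      using Epi_Comp[OF Epi_Comp[OF b(1) yz(1)] x(1)] hclass_Hom[OF D(2) y1c] by blast
  qed
qed

lemma homology_exact_left:
  assumes se: "short_exact_complexes C K L M \<phi> \<psi>"
  shows "exact_at C (connecting C K L M \<phi> \<psi> n) (homology_map C K L \<phi> (n - 1))"
proof -
  note D = short_exact_complexesD[OF se]
  note deg = short_exact_complexes_degree[OF se]
  note sK = cdf_simps[OF D(1)] and sL = cdf_simps[OF D(2)] and sM = cdf_simps[OF D(3)]
  note h\<phi> = homology_map_props[OF D(1,2,4), where n="n - 1"]
    and con = connecting_props[OF se, where n=n]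
  show ?thesis
  proof (rule exact_atI[OF con(1) h\<phi>(1)])
    show "homology_map C K L \<phi> (n - 1) \<cdot> connecting C K L M \<phi> \<psi> n =
      Mzero C (homology C M n) (homology C L (n - 1))"
    proof (rule homology_Hom_eqI[OF D(3)])
      fix w x assume x: "x \<in> cycle_maps C M n w"
      obtain w2 e2 y z where yz: "e2 \<in> Epi C w2 w" "y \<in> Hom C w2 (cob L n)"
        "z \<in> cycle_maps C K (n - 1) w2"
        "\<psi> n \<cdot> y = x \<cdot> e2" "\<phi> (n - 1) \<cdot> z = cdf L n \<cdot> y"
        "connecting C K L M \<phi> \<psi> n \<cdot> (hclass C M n x \<cdot> e2) = hclass C K (n - 1) z"
        by (rule connecting_cover[OF se x]) (rule that; assumption)
      have "homology_map C K L \<phi> (n - 1) \<cdot> (connecting C K L M \<phi> \<psi> n \<cdot> (hclass C M n x \<cdot> e2)) =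
        hclass C L (n - 1) (cdf L n \<cdot> y)"
        unfolding yz(6) using h\<phi>(2)[OF yz(3)] yz(5) by simp
      also have "\<dots> = Mzero C w2 (homology C L (n - 1))"
        by (rule differential_in_cycle_maps(2)[OF D(2) yz(2)])
      finally have "homology_map C K L \<phi> (n - 1) \<cdot> (connecting C K L M \<phi> \<psi> n \<cdot> (hclass C M n x \<cdot>
        e2)) =
        Mzero C w2 (homology C L (n - 1))" .
      moreover have "w \<in> Ob C" using cycle_mapsD(1)[OF x] Hom_Ob by blast
      ultimately show "(homology_map C K L \<phi> (n - 1) \<cdot> connecting C K L M \<phi> \<psi> n) \<cdot> hclass C M n x =
        Mzero C (homology C M n) (homology C L (n - 1)) \<cdot> hclass C M n x"
        by - (rule EpiD[OF yz(1)], use con(1) h\<phi>(1) hclass_Hom[OF D(3) x] homology_proj_props(5)[OF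
          D(2)] Epi_Hom[OF yz(1)] in \<open>simp_all add: Hom_def\<close>)
    qed (use con(1) h\<phi>(1) homology_proj_props(5)[OF D(3)] homology_proj_props(5)[OF D(2)] in
      \<open>simp_all add: Hom_def\<close>)
    fix w c assume c: "c \<in> Hom C w (homology C K (n - 1))" "homology_map C K L \<phi> (n - 1) \<cdot> c =
      Mzero C w (homology C L (n - 1))"
    obtain w1 e1 z where z: "e1 \<in> Epi C w1 w" "z \<in> cycle_maps C K (n - 1) w1"
      "hclass C K (n - 1) z = c \<cdot> e1"
      using hclass_cover[OF D(1) c(1)] by blast
    have e1: "e1 \<in> Hom C w1 w" using z by (simp add: Epi_def)
    have "hclass C L (n - 1) (\<phi> (n - 1) \<cdot> z) = homology_map C K L \<phi> (n - 1) \<cdot> (c \<cdot> e1)"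
      using h\<phi>(2)[OF z(2)] z(3) by simp
    also have "\<dots> = Mzero C w1 (homology C L (n - 1))"
      using c(1) e1 h\<phi>(1) homology_proj_props(5)[OF D(2)] by (simp add: Hom_def reassoc[OF c(2)])
    finally have "hclass C L (n - 1) (\<phi> (n - 1) \<cdot> z) = Mzero C w1 (homology C L (n - 1))" .
    from hclass_zero_cover_pred[OF D(2) chain_map_cycle_maps[OF D(1,2,4) z(2)] this] obtain w2 e2 y
      where
      y: "e2 \<in> Epi C w2 w1" "y \<in> Hom C w2 (cob L n)" "cdf L n \<cdot> y = (\<phi> (n - 1) \<cdot> z) \<cdot> e2" .
    have e2: "e2 \<in> Hom C w2 w1" using y by (simp add: Epi_def)
    have w2: "w2 \<in> Ob C" using e2 Hom_Ob by blast
    note z' = cycle_mapsD(1)[OF z(2)]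
    have ze: "z \<cdot> e2 \<in> Hom C w2 (cob K (n - 1))" using z' e2 by (simp add: Hom_def)
    have y': "\<phi> (n - 1) \<cdot> (z \<cdot> e2) = cdf L n \<cdot> y" using y(3) z' e2 deg(2)[of "n - 1"]
      by (simp add: Hom_def)
    \<comment> \<open>The chain \<open>y\<close> bounding the image of \<open>z\<close> serves as a
      lift: its image in \<open>M\<close> is a cycle because its differential comes from
      \<open>K\<close>, and the recipe sends the class of that cycle to the class of
      \<open>z \<cdot> e2\<close>.\<close>
    have "cdf M n \<cdot> (\<psi> n \<cdot> y) = (\<psi> (n - 1) \<cdot> cdf L n) \<cdot> y"
      by (rule reassoc[OF chain_mapD(2)[OF D(5) refl]])
        (use sM deg(3)[of n] y(2) in \<open>simp_all add: Hom_def\<close>)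
    also have "\<dots> = \<psi> (n - 1) \<cdot> (\<phi> (n - 1) \<cdot> (z \<cdot> e2))" unfolding y' using sL deg(3)[of "n - 1"] y(2)
      by (simp add: Hom_def)
    also have "\<dots> = Mzero C w2 (cob M (n - 1))"
      using ze deg(2,3)[of "n - 1"] sM by (simp add: Hom_def reassoc[OF deg(6)])
    finally have xc: "\<psi> n \<cdot> y \<in> cycle_maps C M n w2" using y(2) deg(3)[of n]
      by (simp add: cycle_maps_def Hom_def)
    have "connecting C K L M \<phi> \<psi> n \<cdot> hclass C M n (\<psi> n \<cdot> y) = hclass C K (n - 1) (z \<cdot> e2)"
      using con(2)[OF xc y(2) ze refl y'] by simp
    also have "\<dots> = c \<cdot> (e1 \<cdot> e2)" using cycle_maps_Comp(2)[OF D(1) z(2) e2] z(3) c(1) e1 e2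
      by (simp add: Hom_def)
    finally show "\<exists>w' e y. e \<in> Epi C w' w \<and> y \<in> Hom C w' (homology C M n) \<and>
      connecting C K L M \<phi> \<psi> n \<cdot> y = c \<cdot> e"
      using Epi_Comp[OF y(1) z(1)] hclass_Hom[OF D(3) xc] by blast
  qed
qed

text \<open>The maps \<open>l\<close> and \<open>k\<close> carry a lift \<open>y\<close> and a
  preimage \<open>z\<close> for the cycle \<open>x\<close> to such data for its image under
  \<open>m\<close>. This uses both squares as equalities of arrows, not up to homotopy.\<close>

lemma connecting_natural:
  assumes se: "short_exact_complexes C K L M \<phi> \<psi>" and se': "short_exact_complexes C K' L' M' \<phi>' \<psi>'"
    and k: "chain_map C K K' k" and l: "chain_map C L L' l" and m: "chain_map C M M' m"
    and e1: "\<And>n. l n \<cdot> \<phi> n = \<phi>' n \<cdot> k n" and e2: "\<And>n. m n \<cdot> \<psi> n = \<psi>' n \<cdot> l n"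
  shows "homology_map C K K' k (n - 1) \<cdot> connecting C K L M \<phi> \<psi> n =
    connecting C K' L' M' \<phi>' \<psi>' n \<cdot> homology_map C M M' m n"
proof -
  note D = short_exact_complexesD[OF se] and D' = short_exact_complexesD[OF se']
  note deg = short_exact_complexes_degree[OF se] and deg' = short_exact_complexes_degree[OF se']
  note sL = cdf_simps[OF D(2)] and sL' = cdf_simps[OF D'(2)]
  note con = connecting_props[OF se, where n=n] and con' = connecting_props[OF se', where n=n]
  note hk = homology_map_props[OF D(1) D'(1) k, where n="n - 1"]
    and hm = homology_map_props[OF D(3) D'(3) m, where n=n]
  note kH = chain_mapD(1)[OF k, of "n - 1"] and lH = chain_mapD(1)[OF l]
    and mH = chain_mapD(1)[OF m, of n]
  show ?thesis
  proof (rule homology_Hom_eqI[OF D(3)])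
    fix w x assume x: "x \<in> cycle_maps C M n w"
    obtain w2 e y z where yz: "e \<in> Epi C w2 w" "y \<in> Hom C w2 (cob L n)"
      "z \<in> cycle_maps C K (n - 1) w2"
      "\<psi> n \<cdot> y = x \<cdot> e" "\<phi> (n - 1) \<cdot> z = cdf L n \<cdot> y"
      "connecting C K L M \<phi> \<psi> n \<cdot> (hclass C M n x \<cdot> e) = hclass C K (n - 1) z"
      by (rule connecting_cover[OF se x]) (rule that; assumption)
    have e: "e \<in> Hom C w2 w" using yz by (simp add: Epi_def)
    note xe = cycle_maps_Comp[OF D(3) x e]
    note z' = cycle_mapsD(1)[OF yz(3)] and x' = cycle_mapsD(1)[OF x]
    have mx: "m n \<cdot> (x \<cdot> e) \<in> cycle_maps C M' n w2"
      by (rule chain_map_cycle_maps[OF D(3) D'(3) m xe(1)])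
    have ly: "l n \<cdot> y \<in> Hom C w2 (cob L' n)" using yz(2) lH[of n] by (simp add: Hom_def)
    have kz: "k (n - 1) \<cdot> z \<in> Hom C w2 (cob K' (n - 1))" using z' kH by (simp add: Hom_def)
    have a: "\<psi>' n \<cdot> (l n \<cdot> y) = m n \<cdot> (x \<cdot> e)"
    proof -
      have "\<psi>' n \<cdot> (l n \<cdot> y) = (m n \<cdot> \<psi> n) \<cdot> y"
        by (rule reassoc[OF e2[symmetric]])
          (use yz(2) lH[of n] deg'(3)[of n] in \<open>simp_all add: Hom_def\<close>)
      also have "\<dots> = m n \<cdot> (x \<cdot> e)" using yz(2,4) mH deg(3)[of n] by (simp add: Hom_def)
      finally show ?thesis .
    qed
    have b: "\<phi>' (n - 1) \<cdot> (k (n - 1) \<cdot> z) = cdf L' n \<cdot> (l n \<cdot> y)"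
    proof -
      have "\<phi>' (n - 1) \<cdot> (k (n - 1) \<cdot> z) = (l (n - 1) \<cdot> \<phi> (n - 1)) \<cdot> z"
        by (rule reassoc[OF e1[symmetric]])
          (use z' kH deg'(2)[of "n - 1"] in \<open>simp_all add: Hom_def\<close>)
      also have "\<dots> = (l (n - 1) \<cdot> cdf L n) \<cdot> y"
        using z' deg(2)[of "n - 1"] lH[of "n - 1"] yz(2,5) sL by (simp add: Hom_def)
      also have "\<dots> = cdf L' n \<cdot> (l n \<cdot> y)"
        unfolding chain_mapD(2)[OF l refl, symmetric] using yz(2) sL' lH[of n]
          by (simp add: Hom_def)
      finally show ?thesis .
    qed
    have c: "connecting C K' L' M' \<phi>' \<psi>' n \<cdot> (homology_map C M M' m n \<cdot> (hclass C M n x \<cdot> e)) =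
      hclass C K' (n - 1) (k (n - 1) \<cdot> z)"
      using con'(2)[OF mx ly kz a b] hm(2)[OF xe(1)] xe(2) by simp
    have d: "homology_map C K K' k (n - 1) \<cdot> (connecting C K L M \<phi> \<psi> n \<cdot> (hclass C M n x \<cdot> e)) =
      hclass C K' (n - 1) (k (n - 1) \<cdot> z)"
      unfolding yz(6) by (rule hk(2)[OF yz(3)])
    show "(homology_map C K K' k (n - 1) \<cdot> connecting C K L M \<phi> \<psi> n) \<cdot> hclass C M n x =
      (connecting C K' L' M' \<phi>' \<psi>' n \<cdot> homology_map C M M' m n) \<cdot> hclass C M n x"
      by (rule EpiD[OF yz(1)]) (use c d hclass_Hom[OF D(3) x] e con(1) con'(1) hk(1) hm(1) in
        \<open>simp_all add: Hom_def\<close>)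
  qed (use con(1) con'(1) hk(1) hm(1) in \<open>simp_all add: Hom_def\<close>)
qed

end

section \<open>Projective resolutions\<close>

lemma projective_resolutionD:
  assumes "projective_resolution C X P \<epsilon>"
  shows "chain_complex C P" "0 \<le> n \<Longrightarrow> projective C (cob P n)" "n < 0 \<Longrightarrow> zero_object C (cob P n)"
    "\<epsilon> \<in> Hom C (cob P 0) X" "epic C \<epsilon>" "exact_at C (cdf P 1) \<epsilon>"
    "1 \<le> n \<Longrightarrow> m = n + 1 \<Longrightarrow> exact_at C (cdf P m) (cdf P n)"
  using assms by (auto simp: projective_resolution_def)

context abelian_category
begin

text \<open>A projective cover of the kernel of \<open>f\<close>, followed by the inclusion of the
  kernel.\<close>

lemma exists_exact_projective:
  assumes "enough_projectives C" "f \<in> Ar C"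
  shows "\<exists>g. g \<in> Ar C \<and> projective C (Dom C g) \<and> Cod C g = Dom C f \<and> exact_at C g f"
proof -
  have f: "f \<in> Hom C (Dom C f) (Cod C f)" using assms by (simp add: Hom_def)
  obtain a k where k: "is_kernel C f k" "k \<in> Hom C a (Dom C f)" using obtain_kernel[OF f] by blast
  have "a \<in> Ob C" using k Hom_Ob by blast
  then obtain P e where e: "projective C P" "e \<in> Hom C P a" "epic C e"
    using assms(1) unfolding enough_projectives_def by blast
  have "exact_at C (k \<cdot> e) f" by (rule exact_at_kernel_epi[OF k f]) (use e in \<open>simp add: Epi_def\<close>)
  with k e show ?thesis by (intro exI[of _ "k \<cdot> e"]) (simp add: Hom_def)
qed

lemma resolution_exists:
  assumes ep: "enough_projectives C" and X: "X \<in> Ob C"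
  shows "\<exists>P \<epsilon>. projective_resolution C X P \<epsilon>"
proof -
  obtain z where z: "zero_object C z" using ex_zero_object by blast
  note z' = zero_objectD[OF z]
  \<comment> \<open>Augmentation and differentials are chosen as one sequence: term \<open>0\<close>
    is the augmentation onto \<open>X\<close>, and term \<open>n > 0\<close> leaves degree
    \<open>n\<close>. Each choice depends only on its predecessor.\<close>
  let ?P = "\<lambda>n f. f \<in> Ar C \<and> projective C (Dom C f) \<and> (n = 0 \<longrightarrow> epic C f \<and> Cod C f = X)"
  let ?Q = "\<lambda>(n::nat) f g. exact_at C g f \<and> Cod C g = Dom C f"
  have "\<exists>f. ?P 0 f" using ep X unfolding enough_projectives_def Hom_def by blast
  moreover have "\<exists>g. ?P (Suc n) g \<and> ?Q n f g" if "?P n f" for f n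
    using exists_exact_projective[OF ep, of f] that by auto
  ultimately obtain s where s: "\<And>n. ?P n (s n) \<and> ?Q n (s n) (s (Suc n))"
    using dependent_nat_choice[of ?P ?Q] by blast
  have sH: "s (Suc n) \<in> Hom C (Dom C (s (Suc n))) (Dom C (s n))" for n using s[of n] s[of "Suc n"]
    by (simp add: Hom_def)
  have s0: "s 0 \<in> Hom C (Dom C (s 0)) X" using s[of 0] by (simp add: Hom_def)
  have ss: "s n \<cdot> s (Suc n) = Mzero C (Dom C (s (Suc n))) (Cod C (s n))" for n
    by (rule exact_zero[OF _ sH]) (use s[of n] in \<open>simp_all add: Hom_def\<close>)
  \<comment> \<open>In degree \<open>0\<close> the differential is the zero arrow to the zero object
    \<open>z\<close>; the term \<open>s 0\<close> is not part of the complex but its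
    augmentation.\<close>
  define P where "P = \<lparr> cob = (\<lambda>n. if n < 0 then z else Dom C (s (nat n))),
    cdf = (\<lambda>n::int. if n < 0 then Mzero C z z else if n = 0 then Mzero C (Dom C (s 0)) z else s
      (nat n)) \<rparr>"
  have cob_neg: "cob P n = z" if "n < 0" for n using that by (simp add: P_def)
  have cob_nat: "cob P (int n) = Dom C (s n)" for n by (simp add: P_def)
  have cdf_Suc: "cdf P (int (Suc n)) = s (Suc n)" for n by (simp add: P_def nat_add_distrib)
  have cob_Ob: "cob P n \<in> Ob C" for n using z'(1) s by (simp add: P_def)
  have cdf_H: "cdf P n \<in> Hom C (cob P n) (cob P (n - 1))" for n
  proof (cases "n \<le> 0")
    case True
    then show ?thesis using cob_Ob[of n] z'(1) s by (auto simp: P_def Hom_def)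
  next
    case False
    then obtain k where "n = int (Suc k)"
      by (metis not0_implies_Suc of_nat_0_le_iff linorder_not_less nat_int zero_less_imp_eq_int
      less_numeral_extra(3))
    then show ?thesis using sH[of k] by (simp add: P_def Hom_def nat_add_distrib)
  qed
  have cc: "chain_complex C P"
    unfolding chain_complex_def
  proof (intro allI conjI)
    fix n
    show "cob P n \<in> Ob C" "cdf P n \<in> Hom C (cob P n) (cob P (n - 1))" by (rule cob_Ob, rule cdf_H)
    show "cdf P (n - 1) \<cdot> cdf P n = Mzero C (cob P n) (cob P (n - 2))"
    proof (cases "n < 2")
      case True
      \<comment> \<open>Below degree \<open>2\<close> the composite ends in a negative degree. This
        includes \<open>n = 1\<close>, where no exactness of the chosen sequence is
        involved.\<close>
      then have "zero_object C (cob P (n - 2))" using z by (simp add: cob_neg)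
      moreover have "cdf P (n - 1) \<cdot> cdf P n \<in> Hom C (cob P n) (cob P (n - 2))"
        using Comp_in[OF cdf_H[of n] cdf_H[of "n - 1"]] by simp
      ultimately show ?thesis using zero_objectD(2) by blast
    next
      case False
      define k where "k = nat (n - 2)"
      have n: "n = int (Suc (Suc k))" "n - 1 = int (Suc k)" "n - 2 = int k" using False
        by (auto simp: k_def)
      show ?thesis unfolding n(2) n(3) unfolding n(1) cob_nat cdf_Suc using ss[of "Suc k"] s[of k]
        by simp
    qed
  qed
  have "projective_resolution C X P (s 0)"
    unfolding projective_resolution_def
  proof (intro conjI allI impI)
    show "chain_complex C P" by (rule cc)
    show "projective C (cob P n)" if "0 \<le> n" for n using s[of "nat n"] that by (simp add: P_def)
    show "zero_object C (cob P n)" if "n < 0" for n using z that by (simp add: P_def)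
    show "s 0 \<in> Hom C (cob P 0) X" using s0 by (simp add: P_def)
    show "epic C (s 0)" using s[of 0] by simp
    show "exact_at C (cdf P 1) (s 0)" using s[of 0] by (simp add: P_def)
    show "exact_at C (cdf P (n + 1)) (cdf P n)" if "1 \<le> n" for n
      using s[of "nat n"] that by (simp add: P_def nat_add_distrib)
  qed
  then show ?thesis by blast
qed

lemma res_resolution:
  assumes "enough_projectives C" "X \<in> Ob C"
  shows "projective_resolution C X (res C X) (aug C X)"
proof -
  have "\<exists>p. (case p of (P, \<epsilon>) \<Rightarrow> projective_resolution C X P \<epsilon>)" using resolution_exists[OF assms]
    by auto
  then have "case resolution C X of (P, \<epsilon>) \<Rightarrow> projective_resolution C X P \<epsilon>"
    unfolding resolution_def by (rule someI_ex)
  then show ?thesis unfolding res_def aug_def by (simp add: case_prod_beta)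
qed

text \<open>
  Degree \<open>0\<close> holds the resolved objects, and the augmentations are the maps \<open>p 0\<close> and \<open>q 0\<close>.
  Besides lifts to resolutions this also yields the off-diagonal differential of the horseshoe.
\<close>

lemma comparison_sequence:
  assumes p: "\<And>n. p n \<in> Hom C (A (Suc n)) (A n)"
    "\<And>n. p n \<cdot> p (Suc n) = Mzero C (A (Suc (Suc n))) (A n)"
    and proj: "\<And>n. projective C (A (Suc n))"
    and q: "\<And>n. q n \<in> Hom C (B (Suc n)) (B n)" "\<And>n. exact_at C (q (Suc n)) (q n)" "epic C (q 0)"
    and x0: "x0 \<in> Hom C (A 0) (B 0)"
  obtains x where "x 0 = x0" "\<And>n. x n \<in> Hom C (A n) (B n)" "\<And>n. q n \<cdot> x (Suc n) = x n \<cdot> p n"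
proof -
  have ob: "A n \<in> Ob C" "B n \<in> Ob C" for n using Hom_Ob2[OF p(1)] Hom_Ob2[OF q(1)] by auto
  \<comment> \<open>The invariant that \<open>q n\<close> kills \<open>y \<cdot> p (Suc n)\<close>
    is what allows this arrow to be lifted through the exact pair of \<open>q (Suc n)\<close> and
    \<open>q n\<close>. The last clause ties the first term to \<open>x0\<close>.\<close>
  let ?P = "\<lambda>n y. y \<in> Hom C (A (Suc n)) (B (Suc n)) \<and> q n \<cdot> (y \<cdot> p (Suc n)) =
    Mzero C (A (Suc (Suc n))) (B n) \<and>
    (n = 0 \<longrightarrow> q 0 \<cdot> y = x0 \<cdot> p 0)"
  let ?Q = "\<lambda>n y y'. q (Suc n) \<cdot> y' = y \<cdot> p (Suc n)"
  have "q 0 \<in> Epi C (B (Suc 0)) (B 0)" using q by (simp add: Epi_def)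
  moreover have "x0 \<cdot> p 0 \<in> Hom C (A (Suc 0)) (B 0)" using x0 p by (simp add: Hom_def)
  ultimately obtain x1 where x1: "x1 \<in> Hom C (A (Suc 0)) (B (Suc 0))" "q 0 \<cdot> x1 = x0 \<cdot> p 0"
    using projective_lift[OF proj] by blast
  have "q 0 \<cdot> (x1 \<cdot> p (Suc 0)) = Mzero C (A (Suc (Suc 0))) (B 0)"
    using x1(1) x0 p(1)[of 0] p(1)[of "Suc 0"] q(1)[of 0] ob
    by (simp add: Hom_def reassoc[OF x1(2)] p(2))
  with x1 have P0: "\<exists>y. ?P 0 y" by blast
  have step: "\<exists>y'. ?P (Suc n) y' \<and> ?Q n y y'" if Py: "?P n y" for y n
  proof -
    have y: "y \<cdot> p (Suc n) \<in> Hom C (A (Suc (Suc n))) (B (Suc n))" using Py p(1)[of "Suc n"]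
      by (simp add: Hom_def)
    have qy: "q n \<cdot> (y \<cdot> p (Suc n)) = Mzero C (A (Suc (Suc n))) (B n)" using Py by blast
    obtain y' where y': "y' \<in> Hom C (A (Suc (Suc n))) (B (Suc (Suc n)))"
      "q (Suc n) \<cdot> y' = y \<cdot> p (Suc n)"
      by (rule exact_projective_lift[OF q(2)[of n] q(1)[of "Suc n"] q(1)[of n] proj[of "Suc n"] y
        qy])
    have "q (Suc n) \<cdot> (y' \<cdot> p (Suc (Suc n))) = Mzero C (A (Suc (Suc (Suc n)))) (B (Suc n))"
      using y'(1) Py p(1)[of "Suc n"] p(1)[of "Suc (Suc n)"] q(1)[of "Suc n"] ob
      by (simp add: Hom_def reassoc[OF y'(2)] p(2))
    with y' show ?thesis by blast
  qed
  obtain g where g: "\<And>n. ?P n (g n) \<and> ?Q n (g n) (g (Suc n))"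
    using dependent_nat_choice[of ?P ?Q, OF P0 step] by blast
  \<comment> \<open>The chosen sequence \<open>g\<close> begins at position \<open>1\<close>;
    position \<open>0\<close> is the prescribed arrow.\<close>
  define x where "x n = (case n of 0 \<Rightarrow> x0 | Suc k \<Rightarrow> g k)" for n
  show ?thesis
  proof (rule that[of x])
    show "x 0 = x0" by (simp add: x_def)
    show "x n \<in> Hom C (A n) (B n)" for n using x0 g by (cases n) (simp_all add: x_def)
    show "q n \<cdot> x (Suc n) = x n \<cdot> p n" for n using g[of 0] g[of "n - 1"]
      by (cases n) (simp_all add: x_def)
  qed
qed

end

definition augmented_ob :: "'o \<Rightarrow> ('o, 'm) cpx \<Rightarrow> nat \<Rightarrow> 'o" where
  "augmented_ob X P n = (case n of 0 \<Rightarrow> X | Suc k \<Rightarrow> cob P (int k))"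

text \<open>Degree \<open>k\<close> sits at position \<open>Suc k\<close>, so the differential out
  of degree \<open>k + 1\<close> has index \<open>Suc k\<close>.\<close>

definition augmented_df :: "'m \<Rightarrow> ('o, 'm) cpx \<Rightarrow> nat \<Rightarrow> 'm" where
  "augmented_df \<epsilon> P n = (case n of 0 \<Rightarrow> \<epsilon> | Suc k \<Rightarrow> cdf P (int k + 1))"

context abelian_category
begin

section \<open>Lifts to resolutions and their uniqueness up to homotopy\<close>

lemma resolution_zero:
  assumes "projective_resolution C X P \<epsilon>"
  shows "\<epsilon> \<cdot> cdf P 1 = Mzero C (cob P 1) X"
proof -
  note D = projective_resolutionD[OF assms]
  show ?thesis by (rule exact_zero[OF D(6) _ D(4)]) (use chain_complexD(2)[OF D(1), of 1] in simp)
qed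

lemma augmented_props:
  assumes "projective_resolution C X P \<epsilon>"
  shows "augmented_df \<epsilon> P n \<in> Hom C (augmented_ob X P (Suc n)) (augmented_ob X P n)"
    "augmented_df \<epsilon> P n \<cdot> augmented_df \<epsilon> P (Suc n) =
      Mzero C (augmented_ob X P (Suc (Suc n))) (augmented_ob X P n)"
    "projective C (augmented_ob X P (Suc n))"
    "exact_at C (augmented_df \<epsilon> P (Suc n)) (augmented_df \<epsilon> P n)"
    "epic C (augmented_df \<epsilon> P 0)"
proof -
  note D = projective_resolutionD[OF assms]
  show "augmented_df \<epsilon> P n \<in> Hom C (augmented_ob X P (Suc n)) (augmented_ob X P n)"
    using D(4) chain_complexD(2)[OF D(1), of "int (n - 1) + 1" "int (n - 1)"]
    by (cases n) (simp_all add: augmented_df_def augmented_ob_def add.commute)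
  show "augmented_df \<epsilon> P n \<cdot> augmented_df \<epsilon> P (Suc n) =
    Mzero C (augmented_ob X P (Suc (Suc n))) (augmented_ob X P n)"
    using resolution_zero[OF assms] chain_complexD(3)[OF D(1), of "int (n - 1) + 2"
      "int (n - 1) + 1" "int (n - 1)"]
    by (cases n) (simp_all add: augmented_df_def augmented_ob_def algebra_simps)
  show "projective C (augmented_ob X P (Suc n))" using D(2) by (simp add: augmented_ob_def)
  show "exact_at C (augmented_df \<epsilon> P (Suc n)) (augmented_df \<epsilon> P n)"
    using D(6) D(7)[of "int (n - 1) + 1" "int (n - 1) + 2"]
    by (cases n) (simp_all add: augmented_df_def algebra_simps)
  show "epic C (augmented_df \<epsilon> P 0)" using D(5) by (simp add: augmented_df_def)
qed

text \<open>The cases are the three regimes of a resolution: zero objects, the degree that meets the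
  augmentation, and the degrees reached by recursion.\<close>

lemma int_neg_zero_pos_cases:
  obtains (neg) "n < 0" | (zero) "n = 0" | (pos) k where "n = int k + 1"
proof (cases "n \<le> 0")
  case False
  then have "n = int (nat (n - 1)) + 1" by simp
  then show ?thesis by (rule pos)
qed (use neg zero in linarith)

lemma Hom_zero_eq:
  assumes "zero_object C z" "f \<in> Hom C a z" "g \<in> Hom C a z"
  shows "f = g"
  using zero_objectD(2)[OF assms(1)] assms(2,3) by metis

lemma zero_Hom_eq:
  assumes "zero_object C z" "f \<in> Hom C z a" "g \<in> Hom C z a"
  shows "f = g"
  using zero_objectD(3)[OF assms(1)] assms(2,3) by metis

lemma lift_exists:
  assumes P: "projective_resolution C X P \<epsilon>" and Q: "projective_resolution C Y Q \<eta>"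
    and f: "f \<in> Hom C X Y"
  obtains \<phi> where "chain_map C P Q \<phi>" "\<eta> \<cdot> \<phi> 0 = f \<cdot> \<epsilon>"
proof -
  note DP = projective_resolutionD[OF P] and DQ = projective_resolutionD[OF Q]
  have "f \<in> Hom C (augmented_ob X P 0) (augmented_ob Y Q 0)" using f by (simp add: augmented_ob_def)
  then obtain x where x: "x 0 = f" "\<And>n. x n \<in> Hom C (augmented_ob X P n) (augmented_ob Y Q n)"
    "\<And>n. augmented_df \<eta> Q n \<cdot> x (Suc n) = x n \<cdot> augmented_df \<epsilon> P n"
    using comparison_sequence[where p = "augmented_df \<epsilon> P" and A = "augmented_ob X P" and
        q = "augmented_df \<eta> Q" and B = "augmented_ob Y Q",
        OF augmented_props(1,2,3)[OF P] augmented_props(1,4,5)[OF Q]] by metis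
  \<comment> \<open>The lift is zero in negative degrees. For every \<open>n \<le> 0\<close> the
    square ends in a zero object and commutes for that reason, including the square at
    \<open>n = 0\<close>.\<close>
  define \<phi> where "\<phi> n = (if n < 0 then Mzero C (cob P n) (cob Q n) else x (Suc (nat n)))" for n
  have ob: "cob P n \<in> Ob C" "cob Q n \<in> Ob C" for n using chain_complexD(1) DP(1) DQ(1) by blast+
  have dP: "cdf P n \<in> Hom C (cob P n) (cob P (n - 1))"
    and dQ: "cdf Q n \<in> Hom C (cob Q n) (cob Q (n - 1))" for n
    using chain_complexD(2)[OF DP(1)] chain_complexD(2)[OF DQ(1)] by auto
  have \<phi>: "\<phi> n \<in> Hom C (cob P n) (cob Q n)" for n
    using x(2)[of "Suc (nat n)"] ob
      by (cases "n < 0") (simp_all add: \<phi>_def augmented_ob_def Mzero_Hom)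
  have "cdf Q n \<cdot> \<phi> n = \<phi> (n - 1) \<cdot> cdf P n" for n
  proof (cases "n \<le> 0")
    case True
    then have "zero_object C (cob Q (n - 1))" using DQ(3) by simp
    then show ?thesis by (rule Hom_zero_eq) (rule Comp_in[OF \<phi> dQ], rule Comp_in[OF dP \<phi>])
  next
    case False
    then obtain k where k: "n = int k + 1" by (cases n rule: int_neg_zero_pos_cases) auto
    then show ?thesis using x(3)[of "Suc k"] by (simp add: \<phi>_def augmented_df_def nat_add_distrib)
  qed
  moreover have "\<eta> \<cdot> \<phi> 0 = f \<cdot> \<epsilon>" using x(3)[of 0] x(1) by (simp add: \<phi>_def augmented_df_def)
  ultimately show ?thesis using \<phi> that unfolding chain_map_def by blast
qed

lemma lift_homotopy:
  assumes P: "projective_resolution C X P \<epsilon>" and Q: "projective_resolution C Y Q \<eta>"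
    and \<phi>: "chain_map C P Q \<phi>" "\<eta> \<cdot> \<phi> 0 = f \<cdot> \<epsilon>" and \<psi>: "chain_map C P Q \<psi>" "\<eta> \<cdot> \<psi> 0 = f \<cdot> \<epsilon>"
  obtains h where "\<And>n. h n \<in> Hom C (cob P n) (cob Q (n + 1))"
    "\<And>n. \<phi> n = Madd C (\<psi> n) (Madd C (cdf Q (n + 1) \<cdot> h n) (h (n - 1) \<cdot> cdf P n))"
proof -
  note DP = projective_resolutionD[OF P] and DQ = projective_resolutionD[OF Q]
  note sP = cdf_simps[OF DP(1)] and sQ = cdf_simps[OF DQ(1)]
  have dP: "cdf P n \<in> Hom C (cob P n) (cob P (n - 1))"
    and dQ: "cdf Q n \<in> Hom C (cob Q n) (cob Q (n - 1))" for n
    using chain_complexD(2)[OF DP(1)] chain_complexD(2)[OF DQ(1)] by auto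
  \<comment> \<open>Both maps lift \<open>f\<close>, so their difference is a chain map killed by
    the augmentation; it is shown to be null-homotopic.\<close>
  define \<theta> where "\<theta> n = Msub C (\<phi> n) (\<psi> n)" for n
  have H: "\<phi> n \<in> Hom C (cob P n) (cob Q n)" "\<psi> n \<in> Hom C (cob P n) (cob Q n)" for n
    using chain_mapD(1) \<phi>(1) \<psi>(1) by blast+
  have \<theta>: "\<theta> n \<in> Hom C (cob P n) (cob Q n)" for n unfolding \<theta>_def by (rule Msub_Hom[OF H])
  have \<theta>d: "cdf Q n \<cdot> \<theta> n = \<theta> (n - 1) \<cdot> cdf P n" for n
    using H[of n] H[of "n - 1"] sP sQ chain_mapD(2)[OF \<phi>(1) refl, of n] chain_mapD(2)[OF \<psi>(1) refl,
      of n]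
    by (simp add: \<theta>_def Hom_def)
  have \<theta>0: "\<eta> \<cdot> \<theta> 0 = Mzero C (cob P 0) Y"
    using H[of 0] DQ(4) DP(4) \<phi>(2) \<psi>(2) Comp_in[OF H(1) DQ(4)] by (simp add: \<theta>_def Hom_def)
  \<comment> \<open>Only the consequence \<open>d \<cdot> y \<cdot> d = \<theta> \<cdot> d\<close>
    of the homotopy identity is carried along. It says that \<open>\<theta>\<close> in the next
    degree minus \<open>y \<cdot> d\<close> is killed by the differential, and so lifts by
    exactness.\<close>
  let ?P = "\<lambda>n y. y \<in> Hom C (cob P (int n)) (cob Q (int n + 1)) \<and>
    cdf Q (int n + 1) \<cdot> (y \<cdot> cdf P (int n + 1)) = \<theta> (int n) \<cdot> cdf P (int n + 1) \<and>
      (n = 0 \<longrightarrow> cdf Q 1 \<cdot> y = \<theta> 0)"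
  let ?Q = "\<lambda>n y y'. cdf Q (int n + 2) \<cdot> y' = Msub C (\<theta> (int n + 1)) (y \<cdot> cdf P (int n + 1))"
  have dQ1: "cdf Q 1 \<in> Hom C (cob Q 1) (cob Q 0)" using dQ[of 1] by simp
  have "projective C (cob P 0)" using DP(2) by simp
  from exact_projective_lift[OF DQ(6) dQ1 DQ(4) this \<theta> \<theta>0] obtain y0 where
    y0: "y0 \<in> Hom C (cob P 0) (cob Q 1)" "cdf Q 1 \<cdot> y0 = \<theta> 0" .
  have "cdf Q 1 \<cdot> (y0 \<cdot> cdf P 1) = \<theta> 0 \<cdot> cdf P 1"
    by (rule reassoc[OF y0(2)]) (use y0(1) sP sQ in \<open>simp_all add: Hom_def\<close>)
  with y0 have P0: "\<exists>y. ?P 0 y" by auto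
  have step: "\<exists>y'. ?P (Suc n) y' \<and> ?Q n y y'" if y: "?P n y" for y n
  proof -
    define u where "u = Msub C (\<theta> (int n + 1)) (y \<cdot> cdf P (int n + 1))"
    have yH: "y \<in> Hom C (cob P (int n)) (cob Q (int n + 1))" using y by blast
    have u: "u \<in> Hom C (cob P (int n + 1)) (cob Q (int n + 1))"
      using yH \<theta>[of "int n + 1"] sP by (simp add: u_def Hom_def)
    have u0: "cdf Q (int n + 1) \<cdot> u = Mzero C (cob P (int n + 1)) (cob Q (int n))"
      using yH y \<theta>[of "int n + 1"] \<theta>[of "int n"] sP sQ \<theta>d[of "int n + 1"]
        by (simp add: u_def Hom_def)
    have ex: "exact_at C (cdf Q (int n + 2)) (cdf Q (int n + 1))"
      using DQ(7)[of "int n + 1" "int n + 2"] by simp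
    have dQn: "cdf Q (int n + 2) \<in> Hom C (cob Q (int n + 2)) (cob Q (int n + 1))"
      "cdf Q (int n + 1) \<in> Hom C (cob Q (int n + 1)) (cob Q (int n))"
      using sQ by (simp_all add: Hom_def add.commute)
    have pr: "projective C (cob P (int n + 1))" using DP(2) by simp
    obtain y' where y': "y' \<in> Hom C (cob P (int n + 1)) (cob Q (int n + 2))"
      "cdf Q (int n + 2) \<cdot> y' = u"
      by (rule exact_projective_lift[OF ex dQn pr u u0])
    have dd: "cdf P (int n + 1) \<cdot> cdf P (int n + 2) = Mzero C (cob P (int n + 2)) (cob P (int n))"
      by (rule chain_complexD(3)[OF DP(1)]) simp_all
    have "cdf Q (int n + 2) \<cdot> (y' \<cdot> cdf P (int n + 2)) = u \<cdot> cdf P (int n + 2)"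
      by (rule reassoc[OF y'(2)]) (use y'(1) sP sQ in \<open>simp_all add: Hom_def add.commute\<close>)
    also have "\<dots> = \<theta> (int n + 1) \<cdot> cdf P (int n + 2)"
      using yH \<theta>[of "int n + 1"] sP dd sQ by (simp add: u_def Hom_def add.commute)
    finally have "?P (Suc n) y'" using y'(1) by (simp add: algebra_simps)
    moreover have "?Q n y y'" using y'(2) by (simp add: u_def)
    ultimately show ?thesis by blast
  qed
  obtain g where g: "\<And>n. ?P n (g n) \<and> ?Q n (g n) (g (Suc n))"
    using dependent_nat_choice[of ?P ?Q, OF P0 step] by blast
  \<comment> \<open>With zero in negative degrees the second summand of the homotopy disappears at
    \<open>n = 0\<close>, leaving the base case of the recursion.\<close>
  define h where "h n = (if n < 0 then Mzero C (cob P n) (cob Q (n + 1)) else g (nat n))" for n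
  have h: "h n \<in> Hom C (cob P n) (cob Q (n + 1))" for n
    using g[of "nat n"] sP(1)[of n] sQ(1)[of "n + 1"]
      by (cases "n < 0") (simp_all add: h_def Mzero_Hom)
  have A: "cdf Q (n + 1) \<cdot> h n \<in> Hom C (cob P n) (cob Q n)"
    "h (n - 1) \<cdot> cdf P n \<in> Hom C (cob P n) (cob Q n)" for n
    using h[of n] h[of "n - 1"] sP sQ by (simp_all add: Hom_def)
  have eq: "\<theta> n = Madd C (cdf Q (n + 1) \<cdot> h n) (h (n - 1) \<cdot> cdf P n)" for n
  proof (cases n rule: int_neg_zero_pos_cases)
    case neg
    show ?thesis by (rule zero_Hom_eq[OF DP(3)[OF neg] \<theta> Madd_Hom[OF A]])
  next
    case zero
    have "h (-1) \<cdot> cdf P 0 = Mzero C (cob P 0) (cob Q 0)" using sP sQ by (simp add: h_def)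
    then show ?thesis using g[of 0] \<theta>[of 0] by (simp add: zero h_def Hom_def)
  next
    case (pos k)
    have "cdf Q (n + 1) \<cdot> h n = Msub C (\<theta> n) (h (n - 1) \<cdot> cdf P n)"
      using g[of k] by (simp add: pos h_def nat_add_distrib algebra_simps)
    then show ?thesis using \<theta>[of n] A(2)[of n] by (simp add: Hom_def)
  qed
  have "\<phi> n = Madd C (\<psi> n) (Madd C (cdf Q (n + 1) \<cdot> h n) (h (n - 1) \<cdot> cdf P n))" for n
    unfolding eq[symmetric] \<theta>_def using H[of n] by (simp add: Hom_def)
  with h that show ?thesis by blast
qed

section \<open>The horseshoe lemma and maps between horseshoes\<close>

lemma exact_middle:
  assumes H: "a2 \<in> Hom C A2 A1" "a1 \<in> Hom C A1 A0" "b2 \<in> Hom C B2 B1" "b1 \<in> Hom C B1 B0"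
    "c2 \<in> Hom C C2 C1" "c1 \<in> Hom C C1 C0"
    and f: "f2 \<in> Hom C A2 B2" "f1 \<in> Hom C A1 B1" "f0 \<in> Hom C A0 B0" and g: "g2 \<in> Epi C B2 C2"
      "g1 \<in> Hom C B1 C1" "g0 \<in> Hom C B0 C0"
    and k: "is_kernel C g1 f1" and m: "monic C f0"
    and E: "b2 \<cdot> f2 = f1 \<cdot> a2" "b1 \<cdot> f1 = f0 \<cdot> a1" "c2 \<cdot> g2 = g1 \<cdot> b2" "c1 \<cdot> g1 = g0 \<cdot> b1"
    and ea: "exact_at C a2 a1" and ec: "exact_at C c2 c1" and bb: "b1 \<cdot> b2 = Mzero C B2 B0"
  shows "exact_at C b2 b1"
proof (rule exact_atI[OF H(3,4) bb])
  \<comment> \<open>Push \<open>y\<close> to the third sequence, where it comes from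
    \<open>C2\<close>; a lift \<open>s\<close> of this preimage along \<open>g2\<close> hits
    \<open>y\<close> up to an element \<open>u\<close> of the kernel of \<open>g1\<close>. So
    \<open>u\<close> comes from some \<open>t\<close> in \<open>A1\<close>, which \<open>a1\<close>
    kills because \<open>f0\<close> is monic, and exactness of the first sequence supplies the
    missing part of the preimage.\<close>
  fix w y assume y: "y \<in> Hom C w B1" "b1 \<cdot> y = Mzero C w B0"
  have w: "w \<in> Ob C" using y Hom_Ob by blast
  have "c1 \<cdot> (g1 \<cdot> y) = (g0 \<cdot> b1) \<cdot> y" unfolding E(4)[symmetric] using H g y by (simp add: Hom_def)
  also have "\<dots> = Mzero C w C0" using H g y w by (simp add: Hom_def)
  finally obtain w1 e1 r where r: "e1 \<in> Epi C w1 w" "r \<in> Hom C w1 C2" "c2 \<cdot> r = (g1 \<cdot> y) \<cdot> e1"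
    using exact_cover[OF ec H(5,6) Comp_in[OF y(1) g(2)]] by blast
  obtain w2 e2 s where s: "e2 \<in> Epi C w2 w1" "s \<in> Hom C w2 B2" "g2 \<cdot> s = r \<cdot> e2"
    using Epi_cover[OF g(1) r(2)] by blast
  have e12: "e1 \<in> Hom C w1 w" "e2 \<in> Hom C w2 w1" and w2: "w2 \<in> Ob C"
    using r(1) s(1) Hom_Ob1[OF s(2)] by (simp_all add: Epi_def)
  have g2: "g2 \<in> Hom C B2 C2" using g by (simp add: Epi_def)
  define u where "u = Msub C (y \<cdot> (e1 \<cdot> e2)) (b2 \<cdot> s)"
  have u: "u \<in> Hom C w2 B1" using y e12 H s by (simp add: u_def Hom_def)
  have "g1 \<cdot> (b2 \<cdot> s) = (c2 \<cdot> g2) \<cdot> s" unfolding E(3) using H g s by (simp add: Hom_def)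
  also have "\<dots> = (c2 \<cdot> r) \<cdot> e2" using H g2 s r(2) e12 by (simp add: Hom_def)
  also have "\<dots> = g1 \<cdot> (y \<cdot> (e1 \<cdot> e2))" unfolding r(3) using g y e12 by (simp add: Hom_def)
  finally have "g1 \<cdot> u = Mzero C w2 C1" using y e12 H s g by (simp add: u_def Hom_def)
  from kernel_factor[OF k g(2) f(2) u this] obtain t where t: "t \<in> Hom C w2 A1" "f1 \<cdot> t = u"
    by blast
  have ob: "B0 \<in> Ob C" "A0 \<in> Ob C" using Hom_Ob[OF f(3)] by auto
  have "f0 \<cdot> (a1 \<cdot> t) = (b1 \<cdot> f1) \<cdot> t" unfolding E(2) using H f t by (simp add: Hom_def)
  also have "\<dots> = b1 \<cdot> u" using H f t by (simp add: Hom_def)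
  also have "\<dots> = Mzero C w2 B0"
    using y(1) e12 H s w2 ob by (simp add: u_def Hom_def reassoc[OF y(2)] reassoc[OF bb])
  finally have "a1 \<cdot> t = Mzero C w2 A0"
    by - (rule monic_zero[OF m f(3)], use H t in \<open>simp_all add: Hom_def\<close>)
  from exact_cover[OF ea H(1,2) t(1) this] obtain w3 e3 t' where t': "e3 \<in> Epi C w3 w2"
    "t' \<in> Hom C w3 A2" "a2 \<cdot> t' = t \<cdot> e3" by blast
  have e3: "e3 \<in> Hom C w3 w2" using t' by (simp add: Epi_def)
  have "b2 \<cdot> (f2 \<cdot> t') = (f1 \<cdot> a2) \<cdot> t'" unfolding E(1)[symmetric] using H f t'
    by (simp add: Hom_def)
  also have "\<dots> = f1 \<cdot> (t \<cdot> e3)" using H f t' by (simp add: Hom_def)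
  also have "\<dots> = u \<cdot> e3" using f t e3 by (simp add: Hom_def reassoc[OF t(2)])
  also have "\<dots> = Msub C (y \<cdot> (e1 \<cdot> (e2 \<cdot> e3))) (b2 \<cdot> (s \<cdot> e3))" using y e12 e3 H s
    by (simp add: u_def Hom_def)
  finally have "b2 \<cdot> Madd C (f2 \<cdot> t') (s \<cdot> e3) = y \<cdot> (e1 \<cdot> (e2 \<cdot> e3))"
    using y e12 e3 H s f t' by (simp add: Hom_def)
  moreover have "Madd C (f2 \<cdot> t') (s \<cdot> e3) \<in> Hom C w3 B2" using f t' s e3 by (simp add: Hom_def)
  ultimately show "\<exists>w' e z. e \<in> Epi C w' w \<and> z \<in> Hom C w' B2 \<and> b2 \<cdot> z = y \<cdot> e"
    using Epi_Comp[OF Epi_Comp[OF t'(1) s(1)] r(1)] by blast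
qed

text \<open>A monomorphism after \<open>b\<close> leaves its kernel unchanged. Here it splices a
  resolution of \<open>L\<close> onto the inclusion of \<open>L\<close>; later \<open>m\<close> is
  an isomorphism between homology objects.\<close>

lemma exact_monic_Comp:
  assumes "exact_at C a b" "a \<in> Hom C A B" "b \<in> Hom C B D" "monic C m" "m \<in> Hom C D M"
  shows "exact_at C a (m \<cdot> b)"
proof (rule exact_atI[OF assms(2)])
  have ab: "b \<cdot> a = Mzero C A D" by (rule exact_zero[OF assms(1-3)])
  have ob: "A \<in> Ob C" "D \<in> Ob C" using Hom_Ob[OF assms(2)] Hom_Ob[OF assms(3)] by auto
  show "m \<cdot> b \<in> Hom C B M" using assms by (simp add: Hom_def)
  show "(m \<cdot> b) \<cdot> a = Mzero C A M" using assms ab ob by (simp add: Hom_def)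
  fix w x assume x: "x \<in> Hom C w B" "(m \<cdot> b) \<cdot> x = Mzero C w M"
  have "b \<cdot> x = Mzero C w D"
    by (rule monic_zero[OF assms(4,5)]) (use x assms in \<open>simp_all add: Hom_def\<close>)
  then show "\<exists>w' e y. e \<in> Epi C w' w \<and> y \<in> Hom C w' A \<and> a \<cdot> y = x \<cdot> e"
    using exact_cover[OF assms(1-3) x(1)] by blast
qed

lemma biproduct_projective:
  assumes bi: "is_biproduct C a b s i j p q" and a: "projective C a" and b: "projective C b"
  shows "projective C s"
  unfolding projective_def
proof (intro conjI allI impI ballI)
  show "s \<in> Ob C" using bi by (simp add: is_biproduct_def)
  fix e f assume e: "epic C e" and f: "f \<in> Hom C s (Cod C e)"
  have e': "e \<in> Epi C (Dom C e) (Cod C e)" using e by (auto simp: Epi_def Hom_def epic_def)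
  have H: "i \<in> Hom C a s" "j \<in> Hom C b s" "p \<in> Hom C s a" "q \<in> Hom C s b"
    "Madd C (i \<cdot> p) (j \<cdot> q) = Idn C s"
    using bi by (auto simp: is_biproduct_def)
  obtain g where g: "g \<in> Hom C a (Dom C e)" "e \<cdot> g = f \<cdot> i"
    using projective_lift[OF a e' Comp_in[OF H(1) f]] by blast
  obtain h where h: "h \<in> Hom C b (Dom C e)" "e \<cdot> h = f \<cdot> j"
    using projective_lift[OF b e' Comp_in[OF H(2) f]] by blast
  have eA: "e \<in> Ar C" using e by (simp add: epic_def)
  have "e \<cdot> Madd C (g \<cdot> p) (h \<cdot> q) = f \<cdot> Madd C (i \<cdot> p) (j \<cdot> q)"
    using g(1) h(1) H(1-4) eA f by (simp add: Hom_def reassoc[OF g(2)] reassoc[OF h(2)])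
  also have "\<dots> = f" unfolding H(5) using f by (simp add: Hom_def)
  finally show "\<exists>k\<in>Hom C s (Dom C e). e \<cdot> k = f"
    using g(1) h(1) H(3,4) by (intro bexI[of _ "Madd C (g \<cdot> p) (h \<cdot> q)"]) (simp_all add: Hom_def)
qed

lemma biproduct_zero:
  assumes bi: "is_biproduct C a b s i j p q" and a: "zero_object C a" and b: "zero_object C b"
  shows "zero_object C s"
proof (rule zero_objectI)
  have H: "s \<in> Ob C" "i \<in> Hom C a s" "j \<in> Hom C b s" "p \<in> Hom C s a" "q \<in> Hom C s b"
    "Madd C (i \<cdot> p) (j \<cdot> q) = Idn C s"
    using bi by (auto simp: is_biproduct_def)
  show "s \<in> Ob C" by (rule H)
  have "p = Mzero C s a" "q = Mzero C s b" using zero_objectD(2) a b H by blast+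
  then show "Idn C s = Mzero C s s" unfolding H(6)[symmetric] using H(1,2,3) by (simp add: Hom_def)
qed

lemma biproduct_short_exact:
  assumes "is_biproduct C a b s i j p q"
  shows "short_exact C i q"
  by (rule split_imp_short_exact[of i a s q b p j]) (use assms in \<open>simp_all add: is_biproduct_def\<close>)

text \<open>
  \<open>\<tau>\<close> is the part \<open>R\<^sub>n \<rightarrow> P\<^sub>n\<^sub>-\<^sub>1\<close> of the differential on \<open>P \<oplus> R\<close>. Up to the sign, \<open>x\<close> and \<open>\<tau>\<close> lift the
  identity of \<open>N\<close> to the exact sequence \<open>N \<leftarrow> M \<leftarrow> P\<^sub>0 \<leftarrow> P\<^sub>1 \<leftarrow> \<cdots>\<close>.
\<close>

lemma horseshoe_twist:
  assumes se: "short_exact C f g" "f \<in> Hom C L M" "g \<in> Hom C M N"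
    and P: "projective_resolution C L P \<alpha>" and R: "projective_resolution C N R \<beta>"
  obtains x \<tau> where "x \<in> Hom C (cob R 0) M" "g \<cdot> x = \<beta>" "\<And>n. \<tau> n \<in> Hom C (cob R n) (cob P (n - 1))"
    "f \<cdot> (\<alpha> \<cdot> \<tau> 1) = Mneg C (x \<cdot> cdf R 1)"
    "\<And>n. cdf P (n - 1) \<cdot> \<tau> n = Mneg C (\<tau> (n - 1) \<cdot> cdf R n)"
proof -
  note DP = projective_resolutionD[OF P] and DR = projective_resolutionD[OF R]
  note se' = short_exactD[OF se]
  note sP = cdf_simps[OF DP(1)] and sR = cdf_simps[OF DR(1)]
  note aP = augmented_props[OF P] and aR = augmented_props[OF R]
  \<comment> \<open>All differentials of \<open>R\<close> are negated, but not the augmentation. The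
    lifting equations then become the anticommutation that makes the horseshoe differential square
    to zero.\<close>
  define p where "p n = (if n = 0 then \<beta> else Mneg C (augmented_df \<beta> R n))" for n
  \<comment> \<open>On the target side \<open>P\<close> is preceded by both \<open>N\<close> and
    \<open>M\<close>. The position occupied by degree \<open>n\<close> of \<open>R\<close> is thus
    occupied by degree \<open>n - 1\<close> of \<open>P\<close>, whence the drop in degree of
    \<open>\<tau>\<close>.\<close>
  define B where "B n = (case n of 0 \<Rightarrow> N | Suc k \<Rightarrow> case k of 0 \<Rightarrow> M | Suc i \<Rightarrow> cob P (int i))" for n
  define q where "q n = (case n of 0 \<Rightarrow> g | Suc k \<Rightarrow> case k of 0 \<Rightarrow> f \<cdot> \<alpha> | Suc i \<Rightarrow> cdf P (int i + 1))"
    for n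
  have ob: "N \<in> Ob C" "M \<in> Ob C" "L \<in> Ob C" using Hom_Ob[OF se(2)] Hom_Ob[OF se(3)] by auto
  have r0: "augmented_df \<beta> R 0 = \<beta>" by (simp add: augmented_df_def)
  have obR: "augmented_ob N R n \<in> Ob C" for n using ob sR
    by (cases n) (simp_all add: augmented_ob_def)
  have p1: "p n \<in> Hom C (augmented_ob N R (Suc n)) (augmented_ob N R n)" for n
    using aR(1)[of n] aR(1)[of 0] r0 by (simp add: p_def Hom_def)
  have p2: "p n \<cdot> p (Suc n) = Mzero C (augmented_ob N R (Suc (Suc n))) (augmented_ob N R n)" for n
    using aR(1)[of n] aR(1)[of "Suc n"] aR(2)[of n] obR r0
      by (cases "n = 0") (simp_all add: p_def Hom_def)
  have \<alpha>: "\<alpha> \<in> Epi C (cob P 0) L" using DP(4,5) by (simp add: Epi_def)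
  have f\<alpha>: "f \<cdot> \<alpha> \<in> Hom C (cob P 0) M" using DP(4) se(2) by (rule Comp_in)
  have dP1: "cdf P 1 \<in> Hom C (cob P 1) (cob P 0)" using sP by (simp add: Hom_def)
  have q1: "q n \<in> Hom C (B (Suc n)) (B n)" for n
    using se(3) f\<alpha> sP by (auto simp: q_def B_def Hom_def add.commute split: nat.split)
  have q2: "exact_at C (q (Suc n)) (q n)" for n
  proof (cases n)
    case 0
    then show ?thesis using exact_at_kernel_epi[OF se'(1) se(2,3) \<alpha>] by (simp add: q_def)
  next
    case (Suc k)
    show ?thesis
    proof (cases k)
      case 0
      then show ?thesis using Suc exact_monic_Comp[OF DP(6) dP1 DP(4) se'(4) se(2)]
        by (simp add: q_def)
    next
      case (Suc i)
      then show ?thesis using \<open>n = Suc k\<close> DP(7)[of "int i + 1" "int i + 2"]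
        by (simp add: q_def algebra_simps)
    qed
  qed
  have q3: "epic C (q 0)" using se'(2) by (simp add: q_def Epi_def)
  have "Idn C N \<in> Hom C (augmented_ob N R 0) (B 0)" using Idn_in ob
    by (simp add: augmented_ob_def B_def)
  from comparison_sequence[where p = p and A = "augmented_ob N R" and q = q and B = B, OF p1 p2
    aR(3) q1 q2 q3 this]
  obtain x where x: "x 0 = Idn C N" "\<And>n. x n \<in> Hom C (augmented_ob N R n) (B n)"
    "\<And>n. q n \<cdot> x (Suc n) = x n \<cdot> p n"
    by metis
  \<comment> \<open>For \<open>n < 1\<close> the target lies in negative degree, so zero is the only
    possible value.\<close>
  define \<tau> where "\<tau> n = (if n < 1 then Mzero C (cob R n) (cob P (n - 1)) else x (Suc (nat n)))"
    for n
  have \<tau>: "\<tau> n \<in> Hom C (cob R n) (cob P (n - 1))" for n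
  proof (cases "n < 1")
    case True
    then show ?thesis using sR sP by (simp add: \<tau>_def Mzero_Hom)
  next
    case False
    then obtain k where "n = int k + 1" by (cases n rule: int_neg_zero_pos_cases) auto
    then show ?thesis using x(2)[of "Suc (Suc k)"]
      by (simp add: \<tau>_def augmented_ob_def B_def nat_add_distrib add.commute)
  qed
  show ?thesis
  proof (rule that[of "x 1" \<tau>])
    show "x 1 \<in> Hom C (cob R 0) M" using x(2)[of 1] by (simp add: augmented_ob_def B_def)
    show "g \<cdot> x 1 = \<beta>" using x(3)[of 0] x(1) DR(4) by (simp add: q_def p_def Hom_def)
    show "\<tau> n \<in> Hom C (cob R n) (cob P (n - 1))" for n by (rule \<tau>)
    show "f \<cdot> (\<alpha> \<cdot> \<tau> 1) = Mneg C (x 1 \<cdot> cdf R 1)"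
      using x(3)[of 1] x(2)[of 1] x(2)[of 2] sR se(2) DP(4)
      by (simp add: q_def p_def \<tau>_def augmented_df_def augmented_ob_def B_def Hom_def
        numeral_2_eq_2)
    show "cdf P (n - 1) \<cdot> \<tau> n = Mneg C (\<tau> (n - 1) \<cdot> cdf R n)" for n
    proof (cases "n < 2")
      case True
      then have z: "zero_object C (cob P (n - 2))" using DP(3) by simp
      show ?thesis
        by (rule Hom_zero_eq[OF z]) (use \<tau>[of n] \<tau>[of "n - 1"] sP sR in \<open>simp_all add: Hom_def\<close>)
    next
      case False
      define k where "k = nat (n - 2)"
      have n: "n = int k + 2" using False by (simp add: k_def)
      show ?thesis using x(3)[of "Suc (Suc k)"] \<tau>[of "n - 1"] sR
        by (simp add: n \<tau>_def p_def q_def augmented_df_def Hom_def nat_add_distrib add.commute)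
    qed
  qed
qed

text \<open>The differential on the sum of \<open>P\<close> and \<open>R\<close> is the triangular
  matrix with diagonal entries the given differentials and off-diagonal entry \<open>\<tau>\<close>;
  the augmentation is \<open>f \<cdot> \<alpha>\<close> on \<open>P\<close> and \<open>x\<close> on
  \<open>R\<close>. The two equations for \<open>\<tau>\<close> say that consecutive maps compose to
  zero.\<close>

lemma horseshoe_exists:
  assumes se: "short_exact C f g" "f \<in> Hom C L M" "g \<in> Hom C M N"
    and P: "projective_resolution C L P \<alpha>" and R: "projective_resolution C N R \<beta>"
  shows "\<exists>Q \<phi> \<psi> \<epsilon>. projective_resolution C M Q \<epsilon> \<and> short_exact_complexes C P Q R \<phi> \<psi> \<and>
    \<epsilon> \<cdot> \<phi> 0 = f \<cdot> \<alpha> \<and> \<beta> \<cdot> \<psi> 0 = g \<cdot> \<epsilon>"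
proof -
  note DP = projective_resolutionD[OF P] and DR = projective_resolutionD[OF R]
  note se' = short_exactD[OF se]
  note sP = cdf_simps[OF DP(1)] and sR = cdf_simps[OF DR(1)]
  obtain x \<tau> where x: "x \<in> Hom C (cob R 0) M" "g \<cdot> x = \<beta>" and \<tau>:
    "\<And>n. \<tau> n \<in> Hom C (cob R n) (cob P (n - 1))"
    and x\<tau>: "f \<cdot> (\<alpha> \<cdot> \<tau> 1) = Mneg C (x \<cdot> cdf R 1)"
    and \<tau>d: "\<And>n. cdf P (n - 1) \<cdot> \<tau> n = Mneg C (\<tau> (n - 1) \<cdot> cdf R n)"
    using horseshoe_twist[OF se P R] by metis
  have "\<forall>n. \<exists>s i j p q. is_biproduct C (cob P n) (cob R n) s i j p q" using ex_biproduct sP(1) sR(1)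
    by blast
  then obtain s i j p q where bi:
    "\<And>n. is_biproduct C (cob P n) (cob R n) (s n) (i n) (j n) (p n) (q n)" by metis
  have H: "s n \<in> Ob C" "i n \<in> Hom C (cob P n) (s n)" "j n \<in> Hom C (cob R n) (s n)"
    "p n \<in> Hom C (s n) (cob P n)"
    "q n \<in> Hom C (s n) (cob R n)" and E: "p n \<cdot> i n = Idn C (cob P n)" "q n \<cdot> j n = Idn C (cob R n)"
    "p n \<cdot> j n = Mzero C (cob R n) (cob P n)" "q n \<cdot> i n = Mzero C (cob P n) (cob R n)"
    for n using bi[of n] by (auto simp: is_biproduct_def)
  have obL: "L \<in> Ob C" "M \<in> Ob C" "N \<in> Ob C" using Hom_Ob[OF se(2)] Hom_Ob[OF se(3)] by auto
  \<comment> \<open>The component in \<open>P\<close> of the differential to be defined.\<close>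
  define v where "v n = Madd C (cdf P n \<cdot> p n) (\<tau> n \<cdot> q n)" for n
  have v: "v n \<in> Hom C (s n) (cob P (n - 1))" for n
    using sP sR \<tau>[of n] H[of n] by (simp add: v_def Hom_def)
  define Q where "Q = \<lparr> cob = s, cdf =
    (\<lambda>n. Madd C (i (n - 1) \<cdot> v n) (j (n - 1) \<cdot> (cdf R n \<cdot> q n))) \<rparr>"
  have cobQ: "cob Q n = s n" for n by (simp add: Q_def)
  have cdfQ: "cdf Q n = Madd C (i (n - 1) \<cdot> v n) (j (n - 1) \<cdot> (cdf R n \<cdot> q n))" for n
    by (simp add: Q_def)
  have dQ: "cdf Q n \<in> Hom C (s n) (s (n - 1))" for n
    unfolding cdfQ using v[of n] H[of n] H[of "n - 1"] sP sR by (simp add: Hom_def)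
  have qd: "q (n - 1) \<cdot> cdf Q n = cdf R n \<cdot> q n" for n
    unfolding cdfQ using v[of n] H[of n] H[of "n - 1"] sP sR
    by (simp add: Hom_def reassoc[OF E(4)] reassoc[OF E(2)])
  have pd: "p (n - 1) \<cdot> cdf Q n = v n" for n
    unfolding cdfQ using v[of n] H[of n] H[of "n - 1"] sP sR
    by (simp add: Hom_def reassoc[OF E(1)] reassoc[OF E(3)])
  have di: "cdf Q n \<cdot> i n = i (n - 1) \<cdot> cdf P n" for n
    unfolding cdfQ v_def using \<tau>[of n] H[of n] H[of "n - 1"] sP sR
    by (simp add: Hom_def E)
  have ddP: "cdf P (n - 1) \<cdot> cdf P n = Mzero C (cob P n) (cob P (n - 2))"
    and ddR: "cdf R (n - 1) \<cdot> cdf R n = Mzero C (cob R n) (cob R (n - 2))" for n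
    using chain_complexD(3)[OF DP(1)] chain_complexD(3)[OF DR(1)] by auto
  \<comment> \<open>The two cross terms, \<open>\<tau>\<close> followed by the differential of
    \<open>P\<close> and the differential of \<open>R\<close> followed by \<open>\<tau>\<close>,
    cancel because of the sign in \<open>\<tau>d\<close>.\<close>
  have vd: "v (n - 1) \<cdot> cdf Q n = Mzero C (s n) (cob P (n - 2))" for n
  proof -
    have "v (n - 1) \<cdot> cdf Q n = Madd C (cdf P (n - 1) \<cdot> v n) (\<tau> (n - 1) \<cdot> (cdf R n \<cdot> q n))"
      unfolding v_def[of "n - 1"] using dQ[of n] H[of "n - 1"] \<tau>[of "n - 1"] sP sR pd[of n] qd[of n]
      by (simp add: Hom_def)
    also have "cdf P (n - 1) \<cdot> v n = Mneg C (\<tau> (n - 1) \<cdot> (cdf R n \<cdot> q n))"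
      unfolding v_def using \<tau>[of n] \<tau>[of "n - 1"] H[of n] sP sR
      by (simp add: Hom_def reassoc[OF ddP] reassoc[OF \<tau>d])
    finally show ?thesis using \<tau>[of "n - 1"] H[of n] sP sR by (simp add: Hom_def)
  qed
  have ddQ: "cdf Q (n - 1) \<cdot> cdf Q n = Mzero C (s n) (s (n - 2))" for n
    unfolding cdfQ[of "n - 1"] using dQ[of n] v[of "n - 1"] H[of n] H[of "n - 1"] H[of "n - 2"] sP
      sR vd[of n] qd[of n]
    by (simp add: Hom_def reassoc[OF ddR])
  have ccQ: "chain_complex C Q"
    unfolding chain_complex_def cobQ using dQ ddQ H(1) by blast
  have iC: "chain_map C P Q i" unfolding chain_map_def cobQ using H(2) di by blast
  have qC: "chain_map C Q R q" unfolding chain_map_def cobQ using H(5) qd by simp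
  have seC: "short_exact_complexes C P Q R i q"
    unfolding short_exact_complexes_def using DP(1) DR(1) ccQ iC qC biproduct_short_exact[OF bi]
      by blast
  define \<epsilon> where "\<epsilon> = Madd C (f \<cdot> (\<alpha> \<cdot> p 0)) (x \<cdot> q 0)"
  have \<epsilon>: "\<epsilon> \<in> Hom C (s 0) M" using se(2) DP(4) x(1) H[of 0] by (simp add: \<epsilon>_def Hom_def)
  have \<epsilon>i: "\<epsilon> \<cdot> i 0 = f \<cdot> \<alpha>" using se(2) DP(4) x(1) H[of 0] sP obL by (simp add: \<epsilon>_def Hom_def E)
  have g\<epsilon>: "g \<cdot> \<epsilon> = \<beta> \<cdot> q 0"
    using se(2,3) DP(4) DR(4) x(1) H[of 0] sP obL
      by (simp add: \<epsilon>_def Hom_def reassoc[OF se'(3)] reassoc[OF x(2)])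
  have \<alpha>d: "\<alpha> \<cdot> cdf P 1 = Mzero C (cob P 1) L" by (rule resolution_zero[OF P])
  \<comment> \<open>On the summand \<open>P\<close> this is the corresponding fact for its
    resolution; on \<open>R\<close> it is the equation \<open>x\<tau>\<close> for
    \<open>\<tau> 1\<close>.\<close>
  have \<epsilon>d: "\<epsilon> \<cdot> cdf Q 1 = Mzero C (s 1) M"
  proof -
    have "\<epsilon> \<cdot> cdf Q 1 = Madd C (f \<cdot> (\<alpha> \<cdot> v 1)) (x \<cdot> (cdf R 1 \<cdot> q 1))"
      using se(2) DP(4) x(1) H[of 0] dQ[of 1] pd[of 1] qd[of 1] by (simp add: \<epsilon>_def Hom_def)
    also have "f \<cdot> (\<alpha> \<cdot> v 1) = (f \<cdot> (\<alpha> \<cdot> \<tau> 1)) \<cdot> q 1"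
      unfolding v_def using se(2) DP(4) H[of 1] \<tau>[of 1] sP obL by (simp add: Hom_def reassoc[OF \<alpha>d])
    also have "\<dots> = Mneg C (x \<cdot> (cdf R 1 \<cdot> q 1))"
      unfolding x\<tau> using x(1) sR H[of 1] by (simp add: Hom_def)
    finally show ?thesis using x(1) sR H[of 1] by (simp add: Hom_def)
  qed
  have qE: "q n \<in> Epi C (s n) (cob R n)" for n using short_exact_complexes_degree(1)[OF seC] cobQ
    by simp
  have ik: "is_kernel C (q n) (i n)" "monic C (i n)" for n
    using short_exact_complexes_degree(4,5)[OF seC] by auto
  have dP': "cdf P n \<in> Hom C (cob P n) (cob P (n - 1))"
    and dR': "cdf R n \<in> Hom C (cob R n) (cob R (n - 1))" for n
    using sP sR by (simp_all add: Hom_def)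
  have "projective_resolution C M Q \<epsilon>"
    unfolding projective_resolution_def cobQ
  proof (intro conjI allI impI)
    show "chain_complex C Q" by (rule ccQ)
    show "projective C (s n)" if "0 \<le> n" for n
      using biproduct_projective[OF bi DP(2)[OF that] DR(2)[OF that]] .
    show "zero_object C (s n)" if "n < 0" for n
      using biproduct_zero[OF bi DP(3)[OF that] DR(3)[OF that]] .
    show "\<epsilon> \<in> Hom C (s 0) M" by (rule \<epsilon>)
    show "epic C \<epsilon>"
    proof (rule epicI[OF \<epsilon>])
      \<comment> \<open>An arrow killing \<open>\<epsilon>\<close> kills
        \<open>f \<cdot> \<alpha>\<close>, hence \<open>f\<close>, and so equals
        \<open>u \<cdot> g\<close>. Then \<open>u \<cdot> \<beta> \<cdot> q 0\<close> is zero, and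
        both \<open>\<beta>\<close> and \<open>q 0\<close> are epic.\<close>
      fix w t assume t: "t \<in> Hom C M w" "t \<cdot> \<epsilon> = Mzero C (s 0) w"
      have w: "w \<in> Ob C" using t Hom_Ob by blast
      have \<alpha>E: "\<alpha> \<in> Epi C (cob P 0) L" and \<beta>E: "\<beta> \<in> Epi C (cob R 0) N" using DP(4,5) DR(4,5)
        by (simp_all add: Epi_def)
      have "(t \<cdot> f) \<cdot> \<alpha> = (t \<cdot> \<epsilon>) \<cdot> i 0" using t(1) se(2) DP(4) \<epsilon> H[of 0] \<epsilon>i
        by (simp add: Hom_def del: t)
      also have "\<dots> = Mzero C (cob P 0) w" unfolding t(2) using H[of 0] w by (simp add: Hom_def)
      finally have "t \<cdot> f = Mzero C L w" by (rule Epi_zero[OF \<alpha>E Comp_in[OF se(2) t(1)]])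
      moreover have "is_cokernel C f g" using epic_is_cokernel se'(1,2) by (simp add: Epi_def)
      ultimately obtain u where u: "u \<in> Hom C N w" "u \<cdot> g = t"
        using cokernel_factor[OF _ se(2,3) t(1)] by blast
      have "(u \<cdot> \<beta>) \<cdot> q 0 = (u \<cdot> g) \<cdot> \<epsilon>" using u(1) DR(4) H[of 0] se(3) \<epsilon> g\<epsilon> by (simp add: Hom_def)
      also have "\<dots> = Mzero C (s 0) w" unfolding u(2) by (rule t(2))
      finally have "u \<cdot> \<beta> = Mzero C (cob R 0) w" by (rule Epi_zero[OF qE Comp_in[OF DR(4) u(1)]])
      then have "u = Mzero C N w" by (rule Epi_zero[OF \<beta>E u(1)])
      then show "t = Mzero C M w" using u(2) se(3) w by (simp add: Hom_def)
    qed
    \<comment> \<open>At degree \<open>0\<close> the third row of the diagram is the given short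
      exact sequence, and its vertical maps are the three augmentations.\<close>
    show "exact_at C (cdf Q 1) \<epsilon>"
    proof (rule exact_middle)
      show "cdf P 1 \<in> Hom C (cob P 1) (cob P 0)" "cdf R 1 \<in> Hom C (cob R 1) (cob R 0)"
        "cdf Q 1 \<in> Hom C (s 1) (s 0)"
        using dP'[of 1] dR'[of 1] dQ[of 1] by simp_all
      show "cdf Q 1 \<cdot> i 1 = i 0 \<cdot> cdf P 1" "cdf R 1 \<cdot> q 1 = q 0 \<cdot> cdf Q 1" using di[of 1] qd[of 1]
        by simp_all
      show "\<beta> \<cdot> q 0 = g \<cdot> \<epsilon>" using g\<epsilon> by simp
    qed (rule DP DR \<epsilon> H qE se ik se' \<epsilon>i \<epsilon>d)+
    show "exact_at C (cdf Q (n + 1)) (cdf Q n)" if "1 \<le> n" for n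
    proof (rule exact_middle)
      show "cdf P (n + 1) \<in> Hom C (cob P (n + 1)) (cob P n)"
        "cdf R (n + 1) \<in> Hom C (cob R (n + 1)) (cob R n)"
        "cdf Q (n + 1) \<in> Hom C (s (n + 1)) (s n)"
        using dP'[of "n + 1"] dR'[of "n + 1"] dQ[of "n + 1"] by simp_all
      show "cdf Q (n + 1) \<cdot> i (n + 1) = i n \<cdot> cdf P (n + 1)" "cdf R (n + 1) \<cdot> q (n + 1) =
        q n \<cdot> cdf Q (n + 1)"
        using di[of "n + 1"] qd[of "n + 1"] by simp_all
      show "cdf Q n \<cdot> i n = i (n - 1) \<cdot> cdf P n" "cdf R n \<cdot> q n = q (n - 1) \<cdot> cdf Q n"
        using di[of n] qd[of n] by simp_all
      show "exact_at C (cdf P (n + 1)) (cdf P n)" "exact_at C (cdf R (n + 1)) (cdf R n)"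
        using DP(7) DR(7) that by simp_all
      show "cdf Q n \<cdot> cdf Q (n + 1) = Mzero C (s (n + 1)) (s (n - 1))" using ddQ[of "n + 1"] by simp
    qed (rule dP' dR' dQ H qE ik)+
  qed
  then show ?thesis using seC \<epsilon>i g\<epsilon> by metis
qed

text \<open>An arbitrary lift of \<open>m\<close> to \<open>Q\<close> is compatible with \<open>\<kappa>\<close> only up to a homotopy; since the rows split
  degreewise, this homotopy extends to \<open>Q\<close> and can be subtracted from the lift.\<close>

lemma horseshoe_map:
  assumes se: "short_exact C f g" "f \<in> Hom C L M" "g \<in> Hom C M N"
    and se': "short_exact C f' g'" "f' \<in> Hom C L' M'" "g' \<in> Hom C M' N'"
    and P: "projective_resolution C L P \<alpha>" and Q: "projective_resolution C M Q \<epsilon>"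
      and R: "projective_resolution C N R \<beta>"
    and P': "projective_resolution C L' P' \<alpha>'" and Q': "projective_resolution C M' Q' \<epsilon>'"
      and R': "projective_resolution C N' R' \<beta>'"
    and S: "short_exact_complexes C P Q R \<phi> \<psi>" "\<epsilon> \<cdot> \<phi> 0 = f \<cdot> \<alpha>" "\<beta> \<cdot> \<psi> 0 = g \<cdot> \<epsilon>"
    and S': "short_exact_complexes C P' Q' R' \<phi>' \<psi>'" "\<epsilon>' \<cdot> \<phi>' 0 = f' \<cdot> \<alpha>'" "\<beta>' \<cdot> \<psi>' 0 = g' \<cdot> \<epsilon>'"
    and lmn: "l \<in> Hom C L L'" "m \<in> Hom C M M'" "n \<in> Hom C N N'" "m \<cdot> f = f' \<cdot> l" "n \<cdot> g = g' \<cdot> m"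
    and \<kappa>: "chain_map C P P' \<kappa>" "\<alpha>' \<cdot> \<kappa> 0 = l \<cdot> \<alpha>"
  obtains \<mu> \<nu> where "chain_map C Q Q' \<mu>" "chain_map C R R' \<nu>" "\<epsilon>' \<cdot> \<mu> 0 = m \<cdot> \<epsilon>" "\<beta>' \<cdot> \<nu> 0 = n \<cdot> \<beta>"
    "\<And>k. \<mu> k \<cdot> \<phi> k = \<phi>' k \<cdot> \<kappa> k" "\<And>k. \<nu> k \<cdot> \<psi> k = \<psi>' k \<cdot> \<mu> k"
proof -
  note DP = projective_resolutionD[OF P] and DQ = projective_resolutionD[OF Q]
    and DR = projective_resolutionD[OF R]
  note DP' = projective_resolutionD[OF P'] and DQ' = projective_resolutionD[OF Q']
    and DR' = projective_resolutionD[OF R']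
  note sP = cdf_simps[OF DP(1)] and sQ = cdf_simps[OF DQ(1)] and sR = cdf_simps[OF DR(1)]
  note sQ' = cdf_simps[OF DQ'(1)] and sR' = cdf_simps[OF DR'(1)]
  note C1 = short_exact_complexesD[OF S(1)] and C1' = short_exact_complexesD[OF S'(1)]
  note deg = short_exact_complexes_degree[OF S(1)] and deg' = short_exact_complexes_degree[OF S'(1)]
  obtain \<mu>0 where \<mu>0: "chain_map C Q Q' \<mu>0" "\<epsilon>' \<cdot> \<mu>0 0 = m \<cdot> \<epsilon>" using lift_exists[OF Q Q' lmn(2)]
    by blast
  note \<mu>0H = chain_mapD(1)[OF \<mu>0(1)] and \<kappa>H = chain_mapD(1)[OF \<kappa>(1)]
  have A: "chain_map C P Q' (\<lambda>k. \<mu>0 k \<cdot> \<phi> k)"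
    by (rule chain_map_Comp[OF DP(1) DQ(1) DQ'(1) C1(4) \<mu>0(1)])
  have B: "chain_map C P Q' (\<lambda>k. \<phi>' k \<cdot> \<kappa> k)"
    by (rule chain_map_Comp[OF DP(1) DP'(1) DQ'(1) \<kappa>(1) C1'(4)])
  \<comment> \<open>Both ways around the left square lift the same arrow \<open>m \<cdot> f\<close>
    from \<open>P\<close> to \<open>Q'\<close>, hence differ by a homotopy \<open>h\<close>.\<close>
  have A0: "\<epsilon>' \<cdot> (\<mu>0 0 \<cdot> \<phi> 0) = (m \<cdot> f) \<cdot> \<alpha>"
    using \<mu>0H[of 0] deg(2)[of 0] DQ'(4) DQ(4) DP(4) lmn(2) se(2) S(2)
      by (simp add: Hom_def reassoc[OF \<mu>0(2)])
  have B0: "\<epsilon>' \<cdot> (\<phi>' 0 \<cdot> \<kappa> 0) = (m \<cdot> f) \<cdot> \<alpha>"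
    using \<kappa>H[of 0] deg'(2)[of 0] DQ'(4) DP'(4) DP(4) lmn(1) se'(2) \<kappa>(2) unfolding lmn(4)
    by (simp add: Hom_def reassoc[OF S'(2)])
  obtain h where h: "\<And>k. h k \<in> Hom C (cob P k) (cob Q' (k + 1))"
    "\<And>k. \<mu>0 k \<cdot> \<phi> k = Madd C (\<phi>' k \<cdot> \<kappa> k) (Madd C (cdf Q' (k + 1) \<cdot> h k) (h (k - 1) \<cdot> cdf P k))"
    by (rule lift_homotopy[OF P Q' A A0 B B0]) (rule that; assumption)
  have prR: "projective C (cob R k)" for k using DR(2,3)[of k] zero_object_projective
    by (cases "k < 0") auto
  have "\<exists>r. r \<in> Hom C (cob Q k) (cob P k) \<and> r \<cdot> \<phi> k = Idn C (cob P k)" for k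
    using split_short_exact[OF C1(6) deg(2,3) prR] by metis
  then obtain r where r: "\<And>k. r k \<in> Hom C (cob Q k) (cob P k)" "\<And>k. r k \<cdot> \<phi> k = Idn C (cob P k)"
    by metis
  \<comment> \<open>The retractions \<open>r\<close> of the split inclusions extend \<open>h\<close>
    to all of \<open>Q\<close>. They need not commute with the differentials, since a homotopy may
    consist of arbitrary arrows.\<close>
  define H where "H k = h k \<cdot> r k" for k
  have H: "H k \<in> Hom C (cob Q k) (cob Q' (k + 1))" for k unfolding H_def
    by (rule Comp_in[OF r(1) h(1)])
  have H\<phi>: "H k \<cdot> \<phi> k = h k" for k using r[of k] h(1)[of k] deg(2)[of k]
    by (simp add: H_def Hom_def)
  \<comment> \<open>The null-homotopic chain map defined by \<open>H\<close>: its restriction along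
    \<open>\<phi>\<close> is exactly the defect of the left square.\<close>
  define c where "c k = Madd C (cdf Q' (k + 1) \<cdot> H k) (H (k - 1) \<cdot> cdf Q k)" for k
  have c: "c k \<in> Hom C (cob Q k) (cob Q' k)" for k
    using H[of k] H[of "k - 1"] sQ sQ' by (simp add: c_def Hom_def)
  define \<mu> where "\<mu> k = Msub C (\<mu>0 k) (c k)" for k
  have \<mu>: "\<mu> k \<in> Hom C (cob Q k) (cob Q' k)" for k unfolding \<mu>_def by (rule Msub_Hom[OF \<mu>0H c])
  have ddQ: "cdf Q (k - 1) \<cdot> cdf Q k = Mzero C (cob Q k) (cob Q (k - 2))"
    and ddQ': "cdf Q' k \<cdot> cdf Q' (k + 1) = Mzero C (cob Q' (k + 1)) (cob Q' (k - 1))" for k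
    using chain_complexD(3)[OF DQ(1), of k] chain_complexD(3)[OF DQ'(1), of "k + 1"] by simp_all
  have dc: "cdf Q' k \<cdot> c k = c (k - 1) \<cdot> cdf Q k" for k
    using H[of k] H[of "k - 1"] H[of "k - 2"] sQ sQ'
      by (simp add: c_def Hom_def reassoc[OF ddQ'] ddQ)
  have \<mu>C: "chain_map C Q Q' \<mu>"
    unfolding chain_map_def
  proof (intro allI conjI)
    fix k
    show "\<mu> k \<in> Hom C (cob Q k) (cob Q' k)" by (rule \<mu>)
    show "cdf Q' k \<cdot> \<mu> k = \<mu> (k - 1) \<cdot> cdf Q k"
      using chain_mapD(2)[OF \<mu>0(1) refl, of k] dc[of k] \<mu>0H[of k] \<mu>0H[of "k - 1"] c[of k]
        c[of "k - 1"] sQ sQ'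
      by (simp add: \<mu>_def Hom_def)
  qed
  have c\<phi>: "c k \<cdot> \<phi> k = Madd C (cdf Q' (k + 1) \<cdot> h k) (h (k - 1) \<cdot> cdf P k)" for k
    using H[of k] H[of "k - 1"] sQ sQ' deg(2)[of k] deg(2)[of "k - 1"] chain_mapD(2)[OF C1(4) refl,
      of k] H\<phi>[of k] sP
    by (simp add: c_def Hom_def reassoc[OF H\<phi>])
  have \<mu>\<phi>: "\<mu> k \<cdot> \<phi> k = \<phi>' k \<cdot> \<kappa> k" for k
  proof -
    have "\<mu> k \<cdot> \<phi> k = Msub C (\<mu>0 k \<cdot> \<phi> k) (c k \<cdot> \<phi> k)"
      using \<mu>0H[of k] c[of k] deg(2)[of k] by (simp add: \<mu>_def Hom_def)
    also have "\<dots> = \<phi>' k \<cdot> \<kappa> k"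
      unfolding h(2) c\<phi> using h(1)[of k] h(1)[of "k - 1"] sP sQ' \<kappa>H[of k] deg'(2)[of k]
        by (simp add: Hom_def)
    finally show ?thesis .
  qed
  have \<mu>\<epsilon>: "\<epsilon>' \<cdot> \<mu> 0 = m \<cdot> \<epsilon>"
  proof -
    \<comment> \<open>The correction does not disturb the augmentation: in degree \<open>0\<close>
      it is a boundary, because \<open>H (-1)\<close> starts at a zero object, and
      \<open>\<epsilon>'\<close> kills boundaries.\<close>
    have "H (-1) = Mzero C (cob Q (-1)) (cob Q' 0)" using zero_objectD(3)[OF DQ(3)] H[of "-1"]
      by simp
    then have "c 0 = cdf Q' 1 \<cdot> H 0" using H[of 0] sQ sQ' by (simp add: c_def Hom_def)
    then have "\<epsilon>' \<cdot> c 0 = Mzero C (cob Q 0) M'"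
      using H[of 0] sQ' DQ'(4) Hom_Ob2[OF DQ'(4)]
        by (simp add: Hom_def reassoc[OF resolution_zero[OF Q']])
    then show ?thesis using \<mu>0H[of 0] c[of 0] DQ'(4) \<mu>0(2) Comp_in[OF DQ(4) lmn(2)]
      by (simp add: \<mu>_def Hom_def)
  qed
  \<comment> \<open>With the left square strict, \<open>\<psi>' \<cdot> \<mu>\<close> kills
    \<open>\<phi>\<close> and so descends to \<open>R\<close>. The equations for
    \<open>\<nu>\<close> are then inherited by cancelling the epimorphism
    \<open>\<psi>\<close>.\<close>
  have "\<exists>v. v \<in> Hom C (cob R k) (cob R' k) \<and> v \<cdot> \<psi> k = \<psi>' k \<cdot> \<mu> k" for k
  proof -
    have "is_cokernel C (\<phi> k) (\<psi> k)" using epic_is_cokernel deg(1,5)[of k] by (simp add: Epi_def)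
    moreover have "\<psi>' k \<cdot> \<mu> k \<in> Hom C (cob Q k) (cob R' k)" by (rule Comp_in[OF \<mu> deg'(3)])
    moreover have "(\<psi>' k \<cdot> \<mu> k) \<cdot> \<phi> k = Mzero C (cob P k) (cob R' k)"
      using \<mu>[of k] deg'(2,3)[of k] deg(2)[of k] \<mu>\<phi>[of k] \<kappa>H[of k] sR'
        by (simp add: Hom_def reassoc[OF deg'(6)])
    ultimately show ?thesis using cokernel_factor[OF _ deg(2,3)] by metis
  qed
  then obtain \<nu> where \<nu>: "\<And>k. \<nu> k \<in> Hom C (cob R k) (cob R' k)" "\<And>k. \<nu> k \<cdot> \<psi> k = \<psi>' k \<cdot> \<mu> k"
    by metis
  have "chain_map C R R' \<nu>"
    unfolding chain_map_def
  proof (intro allI conjI)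
    fix k
    show "\<nu> k \<in> Hom C (cob R k) (cob R' k)" by (rule \<nu>)
    show "cdf R' k \<cdot> \<nu> k = \<nu> (k - 1) \<cdot> cdf R k"
    proof (rule EpiD[OF deg(1)[of k]])
      have "(cdf R' k \<cdot> \<nu> k) \<cdot> \<psi> k = (cdf R' k \<cdot> \<psi>' k) \<cdot> \<mu> k"
        using \<nu>[of k] \<mu>[of k] deg'(3)[of k] deg(3)[of k] sR' by (simp add: Hom_def)
      also have "\<dots> = \<psi>' (k - 1) \<cdot> (cdf Q' k \<cdot> \<mu> k)"
        unfolding chain_mapD(2)[OF C1'(5) refl] using \<mu>[of k] deg'(3)[of "k - 1"] sQ'
          by (simp add: Hom_def)
      also have "\<dots> = (\<nu> (k - 1) \<cdot> \<psi> (k - 1)) \<cdot> cdf Q k"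
        unfolding chain_mapD(2)[OF \<mu>C refl] \<nu>(2) using \<mu>[of "k - 1"] deg'(3)[of "k - 1"] sQ
          by (simp add: Hom_def)
      also have "\<dots> = (\<nu> (k - 1) \<cdot> cdf R k) \<cdot> \<psi> k"
        using \<nu>(1)[of "k - 1"] deg(3)[of "k - 1"] deg(3)[of k] sQ sR chain_mapD(2)[OF C1(5) refl, of
          k] by (simp add: Hom_def)
      finally show "(cdf R' k \<cdot> \<nu> k) \<cdot> \<psi> k = (\<nu> (k - 1) \<cdot> cdf R k) \<cdot> \<psi> k" .
    qed (use \<nu>(1)[of k] \<nu>(1)[of "k - 1"] sR sR' in \<open>simp_all add: Hom_def\<close>)
  qed
  moreover have "\<beta>' \<cdot> \<nu> 0 = n \<cdot> \<beta>"
  proof (rule EpiD[OF deg(1)[of 0]])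
    have "(\<beta>' \<cdot> \<nu> 0) \<cdot> \<psi> 0 = g' \<cdot> (\<epsilon>' \<cdot> \<mu> 0)"
      using \<nu>[of 0] \<mu>[of 0] deg'(3)[of 0] deg(3)[of 0] DR'(4) DQ'(4) se'(3)
        by (simp add: Hom_def reassoc[OF S'(3)])
    also have "\<dots> = (g' \<cdot> m) \<cdot> \<epsilon>" unfolding \<mu>\<epsilon> using DQ(4) lmn(2) se'(3) by (simp add: Hom_def)
    also have "\<dots> = (n \<cdot> \<beta>) \<cdot> \<psi> 0"
      unfolding lmn(5)[symmetric] using DQ(4) lmn(3) se(3) DR(4) deg(3)[of 0] S(3)
        by (simp add: Hom_def)
    finally show "(\<beta>' \<cdot> \<nu> 0) \<cdot> \<psi> 0 = (n \<cdot> \<beta>) \<cdot> \<psi> 0" .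
  qed (rule Comp_in[OF \<nu>(1) DR'(4)], rule Comp_in[OF DR(4) lmn(3)])
  ultimately show ?thesis using that \<mu>C \<mu>\<epsilon> \<mu>\<phi> \<nu>(2) by blast
qed

section \<open>Exactness under replacement of terms\<close>

lemma exact_Epi_Comp:
  assumes "exact_at C a b" "a \<in> Hom C A B" "b \<in> Hom C B D" "e \<in> Epi C A' A"
  shows "exact_at C (a \<cdot> e) b"
proof (rule exact_atI[OF _ assms(3)])
  have e: "e \<in> Hom C A' A" using assms by (simp add: Epi_def)
  have ba: "b \<cdot> a = Mzero C A D" by (rule exact_zero[OF assms(1-3)])
  show "a \<cdot> e \<in> Hom C A' B" by (rule Comp_in[OF e assms(2)])
  show "b \<cdot> (a \<cdot> e) = Mzero C A' D"
    using assms(2,3) e Hom_Ob[OF assms(3)] by (simp add: Hom_def reassoc[OF ba])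
  fix w x assume x: "x \<in> Hom C w B" "b \<cdot> x = Mzero C w D"
  obtain w1 e1 y where y: "e1 \<in> Epi C w1 w" "y \<in> Hom C w1 A" "a \<cdot> y = x \<cdot> e1"
    using exact_cover[OF assms(1-3) x] by blast
  obtain w2 e2 z where z: "e2 \<in> Epi C w2 w1" "z \<in> Hom C w2 A'" "e \<cdot> z = y \<cdot> e2"
    using Epi_cover[OF assms(4) y(2)] by blast
  have "(a \<cdot> e) \<cdot> z = x \<cdot> (e1 \<cdot> e2)"
    using assms(2) e z y x by (simp add: Hom_def Epi_def reassoc[OF y(3)])
  then show "\<exists>w' e' z. e' \<in> Epi C w' w \<and> z \<in> Hom C w' A' \<and> (a \<cdot> e) \<cdot> z = x \<cdot> e'"
    using Epi_Comp[OF z(1) y(1)] z(2) by blast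
qed

text \<open>This exchanges the middle term of an exact pair for an isomorphic one, as needed when
  the middle complex of a horseshoe is replaced by the chosen resolution.\<close>

lemma exact_iso_middle:
  assumes "exact_at C a b" "a \<in> Hom C A B" "b \<in> Hom C B D"
    and u: "u \<in> Hom C B B'" "v \<in> Hom C B' B" "v \<cdot> u = Idn C B" "u \<cdot> v = Idn C B'"
  shows "exact_at C (u \<cdot> a) (b \<cdot> v)"
proof (rule exact_atI)
  have ba: "b \<cdot> a = Mzero C A D" by (rule exact_zero[OF assms(1-3)])
  show "u \<cdot> a \<in> Hom C A B'" "b \<cdot> v \<in> Hom C B' D" using Comp_in assms by blast+
  show "(b \<cdot> v) \<cdot> (u \<cdot> a) = Mzero C A D"
    using assms(2,3) u(1,2) ba by (simp add: Hom_def reassoc[OF u(3)])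
  fix w x assume x: "x \<in> Hom C w B'" "(b \<cdot> v) \<cdot> x = Mzero C w D"
  have "b \<cdot> (v \<cdot> x) = Mzero C w D" using x assms(3) u(2) by (simp add: Hom_def)
  then obtain w1 e y where y: "e \<in> Epi C w1 w" "y \<in> Hom C w1 A" "a \<cdot> y = (v \<cdot> x) \<cdot> e"
    using exact_cover[OF assms(1-3) Comp_in[OF x(1) u(2)]] by blast
  have "(u \<cdot> a) \<cdot> y = u \<cdot> ((v \<cdot> x) \<cdot> e)" using y assms(2) u(1) by (simp add: Hom_def)
  also have "\<dots> = x \<cdot> e" using y(1) x(1) u(1,2) by (simp add: Hom_def Epi_def reassoc[OF u(4)])
  finally show "\<exists>w' e y. e \<in> Epi C w' w \<and> y \<in> Hom C w' A \<and> (u \<cdot> a) \<cdot> y = x \<cdot> e" using y by blast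
qed

lemma iso_Epi:
  assumes "u \<in> Hom C a b" "v \<in> Hom C b a" "u \<cdot> v = Idn C b"
  shows "u \<in> Epi C a b"
proof -
  have "epic C u"
  proof (rule epicI[OF assms(1)])
    fix c x assume x: "x \<in> Hom C b c" "x \<cdot> u = Mzero C a c"
    have c: "c \<in> Ob C" using x Hom_Ob by blast
    have "x = (x \<cdot> u) \<cdot> v" using x(1) assms by (simp add: Hom_def)
    also have "\<dots> = Mzero C b c" unfolding x(2) using assms(2) c by (simp add: Hom_def)
    finally show "x = Mzero C b c" .
  qed
  then show ?thesis using assms by (simp add: Epi_def)
qed

lemma iso_monic:
  assumes "u \<in> Hom C a b" "v \<in> Hom C b a" "v \<cdot> u = Idn C a"
  shows "monic C u"
proof (rule monicI[OF assms(1)])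
  fix w x assume x: "x \<in> Hom C w a" "u \<cdot> x = Mzero C w b"
  have w: "w \<in> Ob C" using x Hom_Ob by blast
  have "x = v \<cdot> (u \<cdot> x)" using x(1) assms(1,2) by (simp add: Hom_def reassoc[OF assms(3)])
  also have "\<dots> = Mzero C w a" unfolding x(2) using assms(2) w by (simp add: Hom_def)
  finally show "x = Mzero C w a" .
qed

end

section \<open>Derived functors of a bifunctor\<close>

lemma map_cpx_fix_snd [simp]:
  "cob (map_cpx (fix_snd D F Y) P) n = fob F (cob P n, Y)"
  "cdf (map_cpx (fix_snd D F Y) P) n = far F (cdf P n, Idn D Y)"
  by (simp_all add: map_cpx_def fix_snd_def)

locale derived_bifunctor =
  C: abelian_category C + D: abelian_category D + E: abelian_category E
  for C :: "('c, 'cm) acat" (structure) and D :: "('d, 'dm) acat" and E :: "('e, 'em) acat" +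
  fixes F :: "('c \<times> 'd, 'cm \<times> 'dm, 'e, 'em) ftor"
  assumes enough: "enough_projectives C"
    and bifunctor: "additive_bifunctor C D E F"
begin

abbreviation FK where "FK P Y \<equiv> map_cpx (fix_snd D F Y) P"
abbreviation dob where "dob \<equiv> derived_ob C D E F"
abbreviation dar where "dar \<equiv> derived_ar C D E F"

section \<open>The bifunctor on arrows and on complexes\<close>

lemma F_functor: "is_functor (prod_cat C D) E F"
  using bifunctor by (simp add: additive_bifunctor_def)

lemma prod_Hom: "f \<in> Hom C a a' \<Longrightarrow> g \<in> Hom D b b' \<Longrightarrow> (f, g) \<in> Hom (prod_cat C D) (a, b) (a', b')"
  by (simp add: Hom_def prod_cat_def)

lemma F_Hom:
  assumes "f \<in> Hom C a a'" "g \<in> Hom D b b'"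
  shows "far F (f, g) \<in> Hom E (fob F (a, b)) (fob F (a', b'))"
proof -
  have "(f, g) \<in> Ar (prod_cat C D)" "Dom (prod_cat C D) (f, g) = (a, b)"
    "Cod (prod_cat C D) (f, g) = (a', b')"
    using prod_Hom[OF assms] by (simp_all add: Hom_def)
  then show ?thesis using F_functor unfolding is_functor_def by metis
qed

lemma F_Ar [simp]:
  assumes "f \<in> Ar C" "g \<in> Ar D"
  shows "far F (f, g) \<in> Ar E" "Dom E (far F (f, g)) = fob F (Dom C f, Dom D g)"
    "Cod E (far F (f, g)) = fob F (Cod C f, Cod D g)"
  using F_Hom[of f "Dom C f" "Cod C f" g "Dom D g" "Cod D g"] assms by (simp_all add: Hom_def)

lemma F_Ob [simp]: "a \<in> Ob C \<Longrightarrow> b \<in> Ob D \<Longrightarrow> fob F (a, b) \<in> Ob E"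
  using F_functor by (auto simp: is_functor_def prod_cat_def)

lemma F_Idn [simp]: "a \<in> Ob C \<Longrightarrow> b \<in> Ob D \<Longrightarrow> far F (Idn C a, Idn D b) = Idn E (fob F (a, b))"
  using F_functor by (auto simp: is_functor_def prod_cat_def)

lemma F_Comp [simp]:
  assumes "f \<in> Ar C" "f' \<in> Ar C" "Cod C f = Dom C f'" "g \<in> Ar D" "g' \<in> Ar D" "Cod D g = Dom D g'"
  shows "far F (f', g') \<cdot>\<^bsub>E\<^esub> far F (f, g) = far F (f' \<cdot> f, g' \<cdot>\<^bsub>D\<^esub> g)"
proof -
  have "(f, g) \<in> Hom (prod_cat C D) (Dom C f, Dom D g) (Cod C f, Cod D g)"
    "(f', g') \<in> Hom (prod_cat C D) (Cod C f, Cod D g) (Cod C f', Cod D g')"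
    using prod_Hom assms by (simp_all add: Hom_def prod_cat_def)
  then have "far F ((f', g') \<cdot>\<^bsub>prod_cat C D\<^esub> (f, g)) = far F (f', g') \<cdot>\<^bsub>E\<^esub> far F (f, g)"
    using F_functor unfolding is_functor_def by metis
  then show ?thesis by (simp add: prod_cat_def)
qed

text \<open>Additivity is given only with an identity in the second variable; factoring the pair of
  \<open>f\<close> and \<open>g\<close> into a change of the first variable followed by one of the
  second reduces to that case.\<close>

lemma F_Madd_fst:
  assumes "f \<in> Hom C a a'" "f' \<in> Hom C a a'" "g \<in> Hom D b b'"
  shows "far F (Madd C f f', g) = Madd E (far F (f, g)) (far F (f', g))"
proof -
  have b: "b \<in> Ob D" "b' \<in> Ob D" "a' \<in> Ob C" using D.Hom_Ob[OF assms(3)] C.Hom_Ob[OF assms(1)]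
    by auto
  have "additive_functor C E (fix_snd D F b)" using bifunctor b
    by (simp add: additive_bifunctor_def)
  then have a: "far F (Madd C f f', Idn D b) = Madd E (far F (f, Idn D b)) (far F (f', Idn D b))"
    using assms(1,2) unfolding additive_functor_def fix_snd_def by auto
  have "far F (Madd C f f', g) = far F (Idn C a', g) \<cdot>\<^bsub>E\<^esub> far F (Madd C f f', Idn D b)"
    using assms b by (simp add: Hom_def)
  also have "\<dots> = Madd E (far F (f, g)) (far F (f', g))"
    unfolding a using assms b by (simp add: Hom_def)
  finally show ?thesis .
qed

lemma F_zero_fst:
  assumes "a \<in> Ob C" "a' \<in> Ob C" "g \<in> Hom D b b'"
  shows "far F (Mzero C a a', g) = Mzero E (fob F (a, b)) (fob F (a', b'))"
proof -
  note z = C.Mzero_Hom[OF assms(1,2)]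
  have "Madd C (Mzero C a a') (Mzero C a a') = Mzero C a a'" using assms by simp
  then have "Madd E (far F (Mzero C a a', g)) (far F (Mzero C a a', g)) = far F (Mzero C a a', g)"
    using F_Madd_fst[OF z z assms(3)] by simp
  from E.Madd_idem[OF this] show ?thesis using assms by (simp add: Hom_def)
qed

lemma chain_complex_F:
  assumes "chain_complex C P" "Y \<in> Ob D"
  shows "chain_complex E (FK P Y)"
  unfolding chain_complex_def
proof (intro allI conjI)
  fix n
  note s = C.cdf_simps[OF assms(1)]
  show "cob (FK P Y) n \<in> Ob E" "cdf (FK P Y) n \<in> Hom E (cob (FK P Y) n) (cob (FK P Y) (n - 1))"
    using s assms(2) by (simp_all add: Hom_def)
  have "Idn D Y \<in> Hom D Y Y" using assms by (simp add: D.Idn_in)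
  then show "cdf (FK P Y) (n - 1) \<cdot>\<^bsub>E\<^esub> cdf (FK P Y) n =
    Mzero E (cob (FK P Y) n) (cob (FK P Y) (n - 2))"
    using s assms(2) chain_complexD(3)[OF assms(1) refl refl] by (simp add: F_zero_fst)
qed

lemma chain_map_F:
  assumes "chain_complex C P" "chain_complex C P'" "chain_map C P P' \<phi>" "g \<in> Hom D Y Y'"
  shows "chain_map E (FK P Y) (FK P' Y') (\<lambda>n. far F (\<phi> n, g))"
  unfolding chain_map_def
proof (intro allI conjI)
  fix n
  note s = C.cdf_simps[OF assms(1)] C.cdf_simps[OF assms(2)]
  note \<phi> = chain_mapD(1)[OF assms(3)]
  have "Y \<in> Ob D" "Y' \<in> Ob D" using D.Hom_Ob[OF assms(4)] by auto
  then show "far F (\<phi> n, g) \<in> Hom E (cob (FK P Y) n) (cob (FK P' Y') n)"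
    "cdf (FK P' Y') n \<cdot>\<^bsub>E\<^esub> far F (\<phi> n, g) = far F (\<phi> (n - 1), g) \<cdot>\<^bsub>E\<^esub> cdf (FK P Y) n"
    using \<phi>[of n] \<phi>[of "n - 1"] s assms(4) chain_mapD(2)[OF assms(3) refl, of n]
      by (simp_all add: Hom_def)
qed

lemma short_exact_complexes_F:
  assumes S: "short_exact_complexes C P Q R \<phi> \<psi>" and pr: "\<And>n. projective C (cob R n)"
    and Y: "Y \<in> Ob D"
  shows "short_exact_complexes E (FK P Y) (FK Q Y) (FK R Y) (\<lambda>n. far F (\<phi> n, Idn D Y)) (\<lambda>n. far F (\<psi>
    n, Idn D Y))"
proof -
  note S' = short_exact_complexesD[OF S] and deg = C.short_exact_complexes_degree[OF S]
  note i = D.Idn_in[OF Y]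
  have "short_exact E (far F (\<phi> n, Idn D Y)) (far F (\<psi> n, Idn D Y))" for n
  proof -
    obtain r s where rs: "r \<in> Hom C (cob Q n) (cob P n)" "s \<in> Hom C (cob R n) (cob Q n)"
      "r \<cdot> \<phi> n = Idn C (cob P n)" "\<psi> n \<cdot> s = Idn C (cob R n)"
      "Madd C (\<phi> n \<cdot> r) (s \<cdot> \<psi> n) = Idn C (cob Q n)"
      by (rule C.split_short_exact[OF S'(6) deg(2,3) pr])
    note ob = chain_complexD(1)[OF S'(1), of n] chain_complexD(1)[OF S'(2), of n]
      chain_complexD(1)[OF S'(3), of n]
    have "Madd E (far F (\<phi> n \<cdot> r, Idn D Y)) (far F (s \<cdot> \<psi> n, Idn D Y)) = Idn E (fob F (cob Q n, Y))"
      using F_Madd_fst[OF C.Comp_in[OF rs(1) deg(2)] C.Comp_in[OF deg(3) rs(2)] i] rs(5) ob Y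
        by simp
    then show ?thesis
      using rs(1-4) deg(2,3)[of n] deg(6)[of n] ob Y F_zero_fst[OF ob(1,3) i]
      by (intro E.split_imp_short_exact[of _ "fob F (cob P n, Y)" "fob F (cob Q n, Y)" _
        "fob F (cob R n, Y)"
        "far F (r, Idn D Y)" "far F (s, Idn D Y)"]) (simp_all add: Hom_def)
  qed
  then show ?thesis
    unfolding short_exact_complexes_def
    using chain_complex_F[OF _ Y] chain_map_F[OF _ _ _ i] S' by blast
qed

section \<open>Derived functors and independence of the lift\<close>

lemma res_projective_resolution: "X \<in> Ob C \<Longrightarrow> projective_resolution C X (res C X) (aug C X)"
  by (rule C.res_resolution[OF enough])

lemma resolution_projective:
  assumes "projective_resolution C X P \<epsilon>"
  shows "projective C (cob P n)"
  using projective_resolutionD(2,3)[OF assms] C.zero_object_projective by (cases "n < 0") auto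

lemma lift_props:
  assumes "f \<in> Hom C X X'"
  shows "chain_map C (res C X) (res C X') (lift C f)" "aug C X' \<cdot> lift C f 0 = f \<cdot> aug C X"
proof -
  have X: "X \<in> Ob C" "X' \<in> Ob C" "Dom C f = X" "Cod C f = X'" using C.Hom_Ob[OF assms] assms
    by (auto simp: Hom_def)
  obtain \<phi> where "chain_map C (res C X) (res C X') \<phi> \<and> aug C X' \<cdot> \<phi> 0 = f \<cdot> aug C X"
    using C.lift_exists[OF res_projective_resolution res_projective_resolution assms] X by blast
  then have "chain_map C (res C X) (res C X') (lift C f) \<and> aug C X' \<cdot> lift C f 0 = f \<cdot> aug C X"
    unfolding lift_def X(3,4)
    by (rule someI[of "\<lambda>\<phi>. chain_map C (res C X) (res C X') \<phi> \<and> aug C X' \<cdot> \<phi> 0 = f \<cdot> aug C X"])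
  then show "chain_map C (res C X) (res C X') (lift C f)" "aug C X' \<cdot> lift C f 0 = f \<cdot> aug C X"
    by auto
qed

text \<open>Applying \<open>far F\<close> to a homotopy \<open>h\<close> together with
  \<open>g\<close> gives a homotopy. The differentials carry identities in the second variable, so
  both summands keep \<open>g\<close> there and additivity in the first variable applies.\<close>

lemma homology_map_lift_unique:
  assumes P: "projective_resolution C X P \<epsilon>" and Q: "projective_resolution C X' Q \<eta>"
    and \<phi>: "chain_map C P Q \<phi>" "\<eta> \<cdot> \<phi> 0 = f \<cdot> \<epsilon>" and \<psi>: "chain_map C P Q \<psi>" "\<eta> \<cdot> \<psi> 0 = f \<cdot> \<epsilon>"
    and g: "g \<in> Hom D Y Y'"
  shows "homology_map E (FK P Y) (FK Q Y') (\<lambda>m. far F (\<phi> m, g)) n =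
    homology_map E (FK P Y) (FK Q Y') (\<lambda>m. far F (\<psi> m, g)) n"
proof -
  note DP = projective_resolutionD(1)[OF P] and DQ = projective_resolutionD(1)[OF Q]
  note s = C.cdf_simps[OF DP] C.cdf_simps[OF DQ]
  have Y: "Y \<in> Ob D" "Y' \<in> Ob D" using D.Hom_Ob[OF g] by auto
  obtain h where h: "\<And>n. h n \<in> Hom C (cob P n) (cob Q (n + 1))"
    "\<And>n. \<phi> n = Madd C (\<psi> n) (Madd C (cdf Q (n + 1) \<cdot> h n) (h (n - 1) \<cdot> cdf P n))"
    by (rule C.lift_homotopy[OF P Q \<phi> \<psi>]) (rule that; assumption)
  show ?thesis
  proof (rule E.homology_map_homotopic)
    show "chain_complex E (FK P Y)" "chain_complex E (FK Q Y')" using chain_complex_F DP DQ Y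
      by auto
    show "chain_map E (FK P Y) (FK Q Y') (\<lambda>m. far F (\<phi> m, g))"
      "chain_map E (FK P Y) (FK Q Y') (\<lambda>m. far F (\<psi> m, g))"
      using chain_map_F[OF DP DQ _ g] \<phi> \<psi> by auto
    show "far F (h n, g) \<in> Hom E (cob (FK P Y) n) (cob (FK Q Y') (n + 1))" for n
      using F_Hom[OF h(1) g] by simp
    fix n
    have 1: "cdf Q (n + 1) \<cdot> h n \<in> Hom C (cob P n) (cob Q n)"
      "h (n - 1) \<cdot> cdf P n \<in> Hom C (cob P n) (cob Q n)"
      using h(1)[of n] h(1)[of "n - 1"] s by (simp_all add: Hom_def)
    have 2: "cdf (FK Q Y') (n + 1) \<cdot>\<^bsub>E\<^esub> far F (h n, g) = far F (cdf Q (n + 1) \<cdot> h n, g)"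
      "far F (h (n - 1), g) \<cdot>\<^bsub>E\<^esub> cdf (FK P Y) n = far F (h (n - 1) \<cdot> cdf P n, g)"
      using h(1)[of n] h(1)[of "n - 1"] s g Y by (simp_all add: Hom_def)
    show "far F (\<phi> n, g) = Madd E (far F (\<psi> n, g)) (Madd E (cdf (FK Q Y') (n + 1) \<cdot>\<^bsub>E\<^esub> far F (h n, g))
       (far F (h (n - 1), g) \<cdot>\<^bsub>E\<^esub> cdf (FK P Y) n))"
      unfolding 2 h(2)[of n] F_Madd_fst[OF chain_mapD(1)[OF \<psi>(1)] C.Madd_Hom[OF 1] g]
        F_Madd_fst[OF 1 g] ..
  qed
qed

text \<open>This frees \<open>derived_ar\<close> from the choice made by \<open>lift\<close>: any
  lift that is convenient for an argument may be used.\<close>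

lemma derived_ar_lift:
  assumes f: "f \<in> Hom C X X'" and g: "g \<in> Hom D Y Y'"
    and \<phi>: "chain_map C (res C X) (res C X') \<phi>" "aug C X' \<cdot> \<phi> 0 = f \<cdot> aug C X"
  shows "dar n f g = homology_map E (FK (res C X) Y) (FK (res C X') Y') (\<lambda>m. far F (\<phi> m, g)) n"
proof -
  have X: "X \<in> Ob C" "X' \<in> Ob C" "Dom C f = X" "Cod C f = X'" "Dom D g = Y" "Cod D g = Y'"
    using C.Hom_Ob[OF f] f g by (auto simp: Hom_def)
  show ?thesis unfolding derived_ar_def X
    by (rule homology_map_lift_unique[OF res_projective_resolution[OF X(1)]
      res_projective_resolution[OF X(2)] lift_props[OF f] \<phi> g])
qed

lemma res_complex: "X \<in> Ob C \<Longrightarrow> chain_complex C (res C X)"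
  by (rule projective_resolutionD(1)[OF res_projective_resolution])

lemma F_res_complex: "X \<in> Ob C \<Longrightarrow> Y \<in> Ob D \<Longrightarrow> chain_complex E (FK (res C X) Y)"
  by (rule chain_complex_F[OF res_complex])

lemma derived_ob_Ob: "X \<in> Ob C \<Longrightarrow> Y \<in> Ob D \<Longrightarrow> dob n X Y \<in> Ob E"
  unfolding derived_ob_def by (rule E.homology_proj_props(5)[OF F_res_complex])

lemma derived_ar_Hom:
  assumes f: "f \<in> Hom C X X'" and g: "g \<in> Hom D Y Y'"
  shows "dar n f g \<in> Hom E (dob n X Y) (dob n X' Y')"
proof -
  have X: "X \<in> Ob C" "X' \<in> Ob C" "Y \<in> Ob D" "Y' \<in> Ob D" using C.Hom_Ob[OF f] D.Hom_Ob[OF g] by auto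
  show ?thesis
    unfolding derived_ar_lift[OF f g lift_props[OF f]] derived_ob_def
    by (rule E.homology_map_props(1)[OF F_res_complex[OF X(1,3)] F_res_complex[OF X(2,4)]
      chain_map_F[OF res_complex[OF X(1)] res_complex[OF X(2)] lift_props(1)[OF f] g]])
qed

text \<open>The composite of the chosen lifts is in general not the chosen lift of the composite,
  but it is a lift of it.\<close>

lemma derived_ar_Comp:
  assumes f: "f \<in> Hom C X X'" "f' \<in> Hom C X' X''" and g: "g \<in> Hom D Y Y'" "g' \<in> Hom D Y' Y''"
  shows "dar n (f' \<cdot> f) (g' \<cdot>\<^bsub>D\<^esub> g) = dar n f' g' \<cdot>\<^bsub>E\<^esub> dar n f g"
proof -
  have X: "X \<in> Ob C" "X' \<in> Ob C" "X'' \<in> Ob C" "Y \<in> Ob D" "Y' \<in> Ob D" "Y'' \<in> Ob D"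
    using C.Hom_Ob[OF f(1)] C.Hom_Ob[OF f(2)] D.Hom_Ob[OF g(1)] D.Hom_Ob[OF g(2)] by auto
  note l = lift_props[OF f(1)] and l' = lift_props[OF f(2)]
  note lH = chain_mapD(1)[OF l(1)] and l'H = chain_mapD(1)[OF l'(1)]
  note a = projective_resolutionD(4)[OF res_projective_resolution]
  have c: "chain_map C (res C X) (res C X'') (\<lambda>m. lift C f' m \<cdot> lift C f m)"
    by (rule C.chain_map_Comp[OF res_complex[OF X(1)] res_complex[OF X(2)] res_complex[OF X(3)] l(1)
      l'(1)])
  have c0: "aug C X'' \<cdot> (lift C f' 0 \<cdot> lift C f 0) = (f' \<cdot> f) \<cdot> aug C X"
    using lH[of 0] l'H[of 0] a[OF X(1)] a[OF X(2)] a[OF X(3)] f l(2)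
      by (simp add: Hom_def C.reassoc[OF l'(2)])
  have FC: "far F (lift C f' m \<cdot> lift C f m, g' \<cdot>\<^bsub>D\<^esub> g) =
    far F (lift C f' m, g') \<cdot>\<^bsub>E\<^esub> far F (lift C f m, g)" for m
    using lH[of m] l'H[of m] g by (simp add: Hom_def)
  show ?thesis
    unfolding derived_ar_lift[OF C.Comp_in[OF f] D.Comp_in[OF g] c c0] derived_ar_lift[OF f(1) g(1)
      l]
      derived_ar_lift[OF f(2) g(2) l'] FC
    by (rule E.homology_map_Comp[OF F_res_complex[OF X(1,4)] F_res_complex[OF X(2,5)]
      F_res_complex[OF X(3,6)]
      chain_map_F[OF res_complex[OF X(1)] res_complex[OF X(2)] l(1) g(1)]
      chain_map_F[OF res_complex[OF X(2)] res_complex[OF X(3)] l'(1) g(2)]])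
qed

text \<open>The identities of the chosen resolution lift the identity of \<open>X\<close>. In this
  form the map is the one occurring in the short exact sequence of complexes for the second
  variable.\<close>

lemma derived_ar_Idn_fst:
  assumes X: "X \<in> Ob C" and g: "g \<in> Hom D Y Y'"
  shows "dar n (Idn C X) g = homology_map E (FK (res C X) Y) (FK (res C X) Y') (\<lambda>m. far F (Idn C
    (cob (res C X) m), g)) n"
proof (rule derived_ar_lift[OF C.Idn_in[OF X] g C.chain_map_Idn[OF res_complex[OF X]]])
  note a = projective_resolutionD(4)[OF res_projective_resolution[OF X]]
  then show "aug C X \<cdot> Idn C (cob (res C X) 0) = Idn C X \<cdot> aug C X" by (simp add: Hom_def)
qed

lemma derived_ar_Idn:
  assumes "X \<in> Ob C" "Y \<in> Ob D"
  shows "dar n (Idn C X) (Idn D Y) = Idn E (dob n X Y)"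
  unfolding derived_ar_Idn_fst[OF assms(1) D.Idn_in[OF assms(2)]] derived_ob_def
  using E.homology_map_Idn[OF F_res_complex[OF assms]] assms chain_complexD(1)[OF
    res_complex[OF assms(1)]] by simp

section \<open>The long exact sequence in the first variable\<close>

lemma delta_fst_horseshoe:
  assumes se: "short_exact C f g" "f \<in> Hom C L M" "g \<in> Hom C M N"
  obtains Q \<phi> \<psi> \<epsilon> where "projective_resolution C M Q \<epsilon>"
    "short_exact_complexes C (res C L) Q (res C N) \<phi> \<psi>"
    "\<epsilon> \<cdot> \<phi> 0 = f \<cdot> aug C L" "aug C N \<cdot> \<psi> 0 = g \<cdot> \<epsilon>"
    "\<And>n Y. delta_fst C D E F n f g Y = connecting E (FK (res C L) Y) (FK Q Y) (FK (res C N) Y)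
      (\<lambda>m. far F (\<phi> m, Idn D Y)) (\<lambda>m. far F (\<psi> m, Idn D Y)) n"
proof -
  have X: "L \<in> Ob C" "M \<in> Ob C" "N \<in> Ob C" "Dom C f = L" "Cod C f = M" "Cod C g = N"
    using C.Hom_Ob[OF se(2)] C.Hom_Ob[OF se(3)] se by (auto simp: Hom_def)
  \<comment> \<open>The choice depends only on \<open>f\<close> and \<open>g\<close>. Hence one
    horseshoe serves for all \<open>n\<close> and all \<open>Y\<close>, and the connecting maps of
    different degrees belong to the same sequence of complexes.\<close>
  define q where "q = (SOME (Q, \<phi>, \<psi>). horseshoe C f g Q \<phi> \<psi>)"
  obtain Q \<phi> \<psi> where Q: "q = (Q, \<phi>, \<psi>)" by (cases q) auto
  have "\<exists>q. case q of (Q, \<phi>, \<psi>) \<Rightarrow> horseshoe C f g Q \<phi> \<psi>"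
    using C.horseshoe_exists[OF se res_projective_resolution[OF X(1)] res_projective_resolution[OF
      X(3)]]
    unfolding horseshoe_def X by auto
  then have "case q of (Q, \<phi>, \<psi>) \<Rightarrow> horseshoe C f g Q \<phi> \<psi>" unfolding q_def by (rule someI_ex)
  then have "horseshoe C f g Q \<phi> \<psi>" unfolding Q by simp
  then obtain \<epsilon> where \<epsilon>: "projective_resolution C M Q \<epsilon>"
    "short_exact_complexes C (res C L) Q (res C N) \<phi> \<psi>"
    "\<epsilon> \<cdot> \<phi> 0 = f \<cdot> aug C L" "aug C N \<cdot> \<psi> 0 = g \<cdot> \<epsilon>"
    unfolding horseshoe_def X by blast
  have "delta_fst C D E F n f g Y = connecting E (FK (res C L) Y) (FK Q Y) (FK (res C N) Y)
      (\<lambda>m. far F (\<phi> m, Idn D Y)) (\<lambda>m. far F (\<psi> m, Idn D Y)) n" for n Y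
    unfolding delta_fst_def q_def[symmetric] Q X by (simp add: Let_def fix_snd_def)
  with \<epsilon> that show ?thesis by blast
qed

lemma fst_exact:
  assumes se: "short_exact C f g" "f \<in> Hom C L M" "g \<in> Hom C M N" and Y: "Y \<in> Ob D"
  shows "delta_fst C D E F n f g Y \<in> Hom E (dob n N Y) (dob (n - 1) L Y)"
    "exact_at E (dar n f (Idn D Y)) (dar n g (Idn D Y))"
    "exact_at E (dar n g (Idn D Y)) (delta_fst C D E F n f g Y)"
    "exact_at E (delta_fst C D E F (n + 1) f g Y) (dar n f (Idn D Y))"
proof -
  have X: "L \<in> Ob C" "M \<in> Ob C" "N \<in> Ob C" using C.Hom_Ob[OF se(2)] C.Hom_Ob[OF se(3)] by auto
  note i = D.Idn_in[OF Y]
  obtain Q \<phi> \<psi> \<epsilon> where Q: "projective_resolution C M Q \<epsilon>"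
    "short_exact_complexes C (res C L) Q (res C N) \<phi> \<psi>"
    "\<epsilon> \<cdot> \<phi> 0 = f \<cdot> aug C L" "aug C N \<cdot> \<psi> 0 = g \<cdot> \<epsilon>"
    and \<delta>: "\<And>n Y. delta_fst C D E F n f g Y =
      connecting E (FK (res C L) Y) (FK Q Y) (FK (res C N) Y)
      (\<lambda>m. far F (\<phi> m, Idn D Y)) (\<lambda>m. far F (\<psi> m, Idn D Y)) n"
    by (rule delta_fst_horseshoe[OF se]) (rule that; assumption)
  let ?L = "FK (res C L) Y" and ?Q = "FK Q Y" and ?M = "FK (res C M) Y" and ?N = "FK (res C N) Y"
  note rL = res_projective_resolution[OF X(1)] and rM = res_projective_resolution[OF X(2)]
    and rN = res_projective_resolution[OF X(3)]
  note cL = res_complex[OF X(1)] and cM = res_complex[OF X(2)] and cN = res_complex[OF X(3)]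
    and cQ = projective_resolutionD(1)[OF Q(1)]
  note FL = chain_complex_F[OF cL Y] and FM = chain_complex_F[OF cM Y]
    and FN = chain_complex_F[OF cN Y] and FQ = chain_complex_F[OF cQ Y]
  note S = short_exact_complexesD[OF Q(2)]
  have SE: "short_exact_complexes E ?L ?Q ?N (\<lambda>n. far F (\<phi> n, Idn D Y)) (\<lambda>n. far F (\<psi> n, Idn D Y))"
    by (rule short_exact_complexes_F[OF Q(2) resolution_projective[OF rN] Y])
  note S' = short_exact_complexesD[OF SE]
  \<comment> \<open>\<open>Q\<close> and the chosen resolution of \<open>M\<close> are compared by
    lifts of the identity in both directions. Both composites lift the identity as well, so the maps
    \<open>U\<close> and \<open>V\<close> on homology are mutually inverse.\<close>
  obtain u where u: "chain_map C Q (res C M) u" "aug C M \<cdot> u 0 = Idn C M \<cdot> \<epsilon>"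
    using C.lift_exists[OF Q(1) rM C.Idn_in[OF X(2)]] by blast
  obtain v where v: "chain_map C (res C M) Q v" "\<epsilon> \<cdot> v 0 = Idn C M \<cdot> aug C M"
    using C.lift_exists[OF rM Q(1) C.Idn_in[OF X(2)]] by blast
  note uF = chain_map_F[OF cQ cM u(1) i] and vF = chain_map_F[OF cM cQ v(1) i]
  define U where "U n = homology_map E ?Q ?M (\<lambda>m. far F (u m, Idn D Y)) n" for n
  define V where "V n = homology_map E ?M ?Q (\<lambda>m. far F (v m, Idn D Y)) n" for n
  define a where "a n = homology_map E ?L ?Q (\<lambda>m. far F (\<phi> m, Idn D Y)) n" for n
  define b where "b n = homology_map E ?Q ?N (\<lambda>m. far F (\<psi> m, Idn D Y)) n" for n
  note uH = chain_mapD(1)[OF u(1)]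
    and vH = chain_mapD(1)[OF v(1)] and \<phi>H = chain_mapD(1)[OF S(4)] and \<psi>H = chain_mapD(1)[OF S(5)]
  note \<epsilon> = projective_resolutionD(4)[OF Q(1)] and aL = projective_resolutionD(4)[OF rL]
    and aM = projective_resolutionD(4)[OF rM]
    and aN = projective_resolutionD(4)[OF rN]
  have u0: "aug C M \<cdot> u 0 = \<epsilon>" and v0: "\<epsilon> \<cdot> v 0 = aug C M" using u(2) v(2) \<epsilon> aM
    by (simp_all add: Hom_def)
  have UH: "U n \<in> Hom E (homology E ?Q n) (dob n M Y)"
    and VH: "V n \<in> Hom E (dob n M Y) (homology E ?Q n)"
    and aH: "a n \<in> Hom E (dob n L Y) (homology E ?Q n)"
      and bH: "b n \<in> Hom E (homology E ?Q n) (dob n N Y)" for n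
    unfolding U_def V_def a_def b_def derived_ob_def
    using E.homology_map_props(1)[OF FQ FM uF] E.homology_map_props(1)[OF FM FQ vF]
     E.homology_map_props(1)[OF S'(1,2,4)] E.homology_map_props(1)[OF S'(2,3,5)] by auto
  have VU: "V n \<cdot>\<^bsub>E\<^esub> U n = Idn E (homology E ?Q n)" for n
  proof -
    have "V n \<cdot>\<^bsub>E\<^esub> U n = homology_map E ?Q ?Q (\<lambda>m. far F (v m, Idn D Y) \<cdot>\<^bsub>E\<^esub> far F (u m, Idn D Y)) n"
      unfolding U_def V_def using E.homology_map_Comp[OF FQ FM FQ uF vF] by simp
    also have "\<dots> = homology_map E ?Q ?Q (\<lambda>m. far F (v m \<cdot> u m, Idn D Y)) n"
    proof -
      have "far F (v m, Idn D Y) \<cdot>\<^bsub>E\<^esub> far F (u m, Idn D Y) = far F (v m \<cdot> u m, Idn D Y)" for m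
        using uH[of m] vH[of m] Y by (simp add: Hom_def)
      then show ?thesis by simp
    qed
    also have "\<dots> = homology_map E ?Q ?Q (\<lambda>m. far F (Idn C (cob Q m), Idn D Y)) n"
    proof (rule homology_map_lift_unique[OF Q(1) Q(1) C.chain_map_Comp[OF cQ cM cQ u(1) v(1)] _
      C.chain_map_Idn[OF cQ] _ i])
      show "\<epsilon> \<cdot> (v 0 \<cdot> u 0) = Idn C M \<cdot> \<epsilon>"
        using uH[of 0] vH[of 0] \<epsilon> u0 by (simp add: Hom_def C.reassoc[OF v0])
      show "\<epsilon> \<cdot> Idn C (cob Q 0) = Idn C M \<cdot> \<epsilon>" using \<epsilon> by (simp add: Hom_def)
    qed
    also have "\<dots> = Idn E (homology E ?Q n)"
      using E.homology_map_Idn[OF FQ] Y chain_complexD(1)[OF cQ] by simp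
    finally show ?thesis .
  qed
  have UV: "U n \<cdot>\<^bsub>E\<^esub> V n = Idn E (dob n M Y)" for n
  proof -
    have "U n \<cdot>\<^bsub>E\<^esub> V n = homology_map E ?M ?M (\<lambda>m. far F (u m, Idn D Y) \<cdot>\<^bsub>E\<^esub> far F (v m, Idn D Y)) n"
      unfolding U_def V_def using E.homology_map_Comp[OF FM FQ FM vF uF] by simp
    also have "\<dots> = homology_map E ?M ?M (\<lambda>m. far F (u m \<cdot> v m, Idn D Y)) n"
    proof -
      have "far F (u m, Idn D Y) \<cdot>\<^bsub>E\<^esub> far F (v m, Idn D Y) = far F (u m \<cdot> v m, Idn D Y)" for m
        using uH[of m] vH[of m] Y by (simp add: Hom_def)
      then show ?thesis by simp
    qed
    also have "\<dots> = dar n (Idn C M) (Idn D Y)"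
    proof (rule derived_ar_lift[OF C.Idn_in[OF X(2)] i C.chain_map_Comp[OF cM cQ cM v(1) u(1)],
      symmetric])
      show "aug C M \<cdot> (u 0 \<cdot> v 0) = Idn C M \<cdot> aug C M"
        using uH[of 0] vH[of 0] aM v0 by (simp add: Hom_def C.reassoc[OF u0])
    qed
    also have "\<dots> = Idn E (dob n M Y)" by (rule derived_ar_Idn[OF X(2) Y])
    finally show ?thesis .
  qed
  \<comment> \<open>The composite of \<open>\<phi>\<close> with \<open>u\<close> lifts
    \<open>f\<close>. In the same way \<open>v\<close> followed by \<open>\<psi>\<close> lifts
    \<open>g\<close> below, which identifies both maps of the homology sequence with derived maps up
    to the isomorphism.\<close>
  have Ua: "dar n f (Idn D Y) = U n \<cdot>\<^bsub>E\<^esub> a n" for n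
  proof -
    have "U n \<cdot>\<^bsub>E\<^esub> a n = homology_map E ?L ?M (\<lambda>m. far F (u m, Idn D Y) \<cdot>\<^bsub>E\<^esub> far F (\<phi> m, Idn D Y)) n"
      unfolding U_def a_def using E.homology_map_Comp[OF FL FQ FM S'(4) uF] by simp
    also have "\<dots> = homology_map E ?L ?M (\<lambda>m. far F (u m \<cdot> \<phi> m, Idn D Y)) n"
    proof -
      have "far F (u m, Idn D Y) \<cdot>\<^bsub>E\<^esub> far F (\<phi> m, Idn D Y) = far F (u m \<cdot> \<phi> m, Idn D Y)" for m
        using uH[of m] \<phi>H[of m] Y by (simp add: Hom_def)
      then show ?thesis by simp
    qed
    also have "\<dots> = dar n f (Idn D Y)"
    proof (rule derived_ar_lift[OF se(2) i C.chain_map_Comp[OF cL cQ cM S(4) u(1)], symmetric])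
      show "aug C M \<cdot> (u 0 \<cdot> \<phi> 0) = f \<cdot> aug C L"
        using uH[of 0] \<phi>H[of 0] aM \<epsilon> Q(3) by (simp add: Hom_def C.reassoc[OF u0])
    qed
    finally show ?thesis by simp
  qed
  have bV: "dar n g (Idn D Y) = b n \<cdot>\<^bsub>E\<^esub> V n" for n
  proof -
    have "b n \<cdot>\<^bsub>E\<^esub> V n = homology_map E ?M ?N (\<lambda>m. far F (\<psi> m, Idn D Y) \<cdot>\<^bsub>E\<^esub> far F (v m, Idn D Y)) n"
      unfolding b_def V_def using E.homology_map_Comp[OF FM FQ FN vF S'(5)] by simp
    also have "\<dots> = homology_map E ?M ?N (\<lambda>m. far F (\<psi> m \<cdot> v m, Idn D Y)) n"
    proof -
      have "far F (\<psi> m, Idn D Y) \<cdot>\<^bsub>E\<^esub> far F (v m, Idn D Y) = far F (\<psi> m \<cdot> v m, Idn D Y)" for m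
        using vH[of m] \<psi>H[of m] Y by (simp add: Hom_def)
      then show ?thesis by simp
    qed
    also have "\<dots> = dar n g (Idn D Y)"
    proof (rule derived_ar_lift[OF se(3) i C.chain_map_Comp[OF cM cQ cN v(1) S(5)], symmetric])
      show "aug C N \<cdot> (\<psi> 0 \<cdot> v 0) = g \<cdot> aug C M"
        using vH[of 0] \<psi>H[of 0] aN \<epsilon> v0 se(3) by (simp add: Hom_def C.reassoc[OF Q(4)])
    qed
    finally show ?thesis by simp
  qed
  have \<delta>H: "delta_fst C D E F n f g Y \<in> Hom E (dob n N Y) (dob (n - 1) L Y)" for n
    unfolding \<delta> derived_ob_def by (rule E.connecting_props(1)[OF SE])
  show "delta_fst C D E F n f g Y \<in> Hom E (dob n N Y) (dob (n - 1) L Y)" by (rule \<delta>H)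
  show "exact_at E (dar n f (Idn D Y)) (dar n g (Idn D Y))"
    unfolding Ua bV
    by (rule E.exact_iso_middle[OF _ aH bH UH VH VU UV])
      (simp add: a_def b_def E.homology_exact_middle[OF SE])
  show "exact_at E (dar n g (Idn D Y)) (delta_fst C D E F n f g Y)"
    unfolding bV
    by (rule E.exact_Epi_Comp[OF _ bH \<delta>H E.iso_Epi[OF VH UH VU]])
      (simp add: b_def \<delta> E.homology_exact_right[OF SE])
  \<comment> \<open>The target degree \<open>n + 1 - 1\<close> is rewritten as \<open>n\<close>, so
    that the arrow is composable with the map induced by \<open>f\<close>.\<close>
  have \<delta>H': "delta_fst C D E F (n + 1) f g Y \<in> Hom E (dob (n + 1) N Y) (dob n L Y)"
    using \<delta>H[of "n + 1"] by simp
  show "exact_at E (delta_fst C D E F (n + 1) f g Y) (dar n f (Idn D Y))"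
    unfolding Ua
    by (rule E.exact_monic_Comp[OF _ \<delta>H' aH E.iso_monic[OF UH VH VU] UH])
      (use E.homology_exact_left[OF SE, of "n + 1"] in \<open>simp add: a_def \<delta>\<close>)
qed

text \<open>The map of horseshoes starts from the chosen lift of \<open>l\<close>. At the other end
  its \<open>\<nu>\<close> is merely some lift of \<open>n\<close>, which computes the same derived
  map. The middle map enters only through the strict squares.\<close>

lemma fst_natural:
  assumes se: "short_exact C f g" "f \<in> Hom C L M" "g \<in> Hom C M N"
    and se': "short_exact C f' g'" "f' \<in> Hom C L' M'" "g' \<in> Hom C M' N'"
    and lmn: "l \<in> Hom C L L'" "m \<in> Hom C M M'" "n \<in> Hom C N N'" "m \<cdot> f = f' \<cdot> l" "n \<cdot> g = g' \<cdot> m"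
    and a: "a \<in> Hom D Y Y'"
  shows "dar (r - 1) l a \<cdot>\<^bsub>E\<^esub> delta_fst C D E F r f g Y = delta_fst C D E F r f' g' Y' \<cdot>\<^bsub>E\<^esub> dar r n a"
proof -
  have X: "L \<in> Ob C" "N \<in> Ob C" "L' \<in> Ob C" "N' \<in> Ob C"
    using C.Hom_Ob[OF lmn(1)] C.Hom_Ob[OF lmn(3)] by auto
  have Y: "Y \<in> Ob D" "Y' \<in> Ob D" using D.Hom_Ob[OF a] by auto
  obtain Q \<phi> \<psi> \<epsilon> where Q: "projective_resolution C M Q \<epsilon>"
    "short_exact_complexes C (res C L) Q (res C N) \<phi> \<psi>"
    "\<epsilon> \<cdot> \<phi> 0 = f \<cdot> aug C L" "aug C N \<cdot> \<psi> 0 = g \<cdot> \<epsilon>"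
    and \<delta>: "\<And>n Y. delta_fst C D E F n f g Y =
      connecting E (FK (res C L) Y) (FK Q Y) (FK (res C N) Y)
      (\<lambda>m. far F (\<phi> m, Idn D Y)) (\<lambda>m. far F (\<psi> m, Idn D Y)) n"
    by (rule delta_fst_horseshoe[OF se]) (rule that; assumption)
  obtain Q' \<phi>' \<psi>' \<epsilon>' where Q': "projective_resolution C M' Q' \<epsilon>'"
    "short_exact_complexes C (res C L') Q' (res C N') \<phi>' \<psi>'"
    "\<epsilon>' \<cdot> \<phi>' 0 = f' \<cdot> aug C L'" "aug C N' \<cdot> \<psi>' 0 = g' \<cdot> \<epsilon>'"
    and \<delta>': "\<And>n Y. delta_fst C D E F n f' g' Y =
      connecting E (FK (res C L') Y) (FK Q' Y) (FK (res C N') Y)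
      (\<lambda>m. far F (\<phi>' m, Idn D Y)) (\<lambda>m. far F (\<psi>' m, Idn D Y)) n"
    by (rule delta_fst_horseshoe[OF se']) (rule that; assumption)
  note rL = res_projective_resolution[OF X(1)] and rN = res_projective_resolution[OF X(2)]
    and rL' = res_projective_resolution[OF X(3)] and rN' = res_projective_resolution[OF X(4)]
  note l = lift_props[OF lmn(1)]
  obtain \<mu> \<nu> where \<mu>: "chain_map C Q Q' \<mu>" "chain_map C (res C N) (res C N') \<nu>" "\<epsilon>' \<cdot> \<mu> 0 = m \<cdot> \<epsilon>"
    "aug C N' \<cdot> \<nu> 0 = n \<cdot> aug C N"
    "\<And>k. \<mu> k \<cdot> \<phi> k = \<phi>' k \<cdot> lift C l k" "\<And>k. \<nu> k \<cdot> \<psi> k = \<psi>' k \<cdot> \<mu> k"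
    by (rule C.horseshoe_map[OF se se' rL Q(1) rN rL' Q'(1) rN' Q(2-4) Q'(2-4) lmn l])
      (rule that; assumption)
  note c = short_exact_complexesD[OF Q(2)] and c' = short_exact_complexesD[OF Q'(2)]
  note H = chain_mapD(1)[OF c(4)] chain_mapD(1)[OF c(5)] chain_mapD(1)[OF c'(4)]
    chain_mapD(1)[OF c'(5)]
    chain_mapD(1)[OF l(1)] chain_mapD(1)[OF \<mu>(1)] chain_mapD(1)[OF \<mu>(2)]
  show ?thesis
    unfolding derived_ar_lift[OF lmn(1) a l] derived_ar_lift[OF lmn(3) a \<mu>(2,4)] \<delta> \<delta>'
  proof (rule E.connecting_natural)
    show "short_exact_complexes E (FK (res C L) Y) (FK Q Y) (FK (res C N) Y) (\<lambda>n. far F (\<phi> n, Idn D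
      Y)) (\<lambda>n. far F (\<psi> n, Idn D Y))"
      by (rule short_exact_complexes_F[OF Q(2) resolution_projective[OF rN] Y(1)])
    show "short_exact_complexes E (FK (res C L') Y') (FK Q' Y') (FK (res C N') Y') (\<lambda>n. far F (\<phi>' n,
      Idn D Y')) (\<lambda>n. far F (\<psi>' n, Idn D Y'))"
      by (rule short_exact_complexes_F[OF Q'(2) resolution_projective[OF rN'] Y(2)])
    show "chain_map E (FK (res C L) Y) (FK (res C L') Y') (\<lambda>m. far F (lift C l m, a))"
      "chain_map E (FK Q Y) (FK Q' Y') (\<lambda>m. far F (\<mu> m, a))"
      "chain_map E (FK (res C N) Y) (FK (res C N') Y') (\<lambda>m. far F (\<nu> m, a))"
      using chain_map_F[OF c(1) c'(1) l(1) a] chain_map_F[OF c(2) c'(2) \<mu>(1) a] chain_map_F[OF c(3)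
        c'(3) \<mu>(2) a] by auto
    fix k
    show "far F (\<mu> k, a) \<cdot>\<^bsub>E\<^esub> far F (\<phi> k, Idn D Y) = far F (\<phi>' k, Idn D Y') \<cdot>\<^bsub>E\<^esub> far F (lift C l k, a)"
      "far F (\<nu> k, a) \<cdot>\<^bsub>E\<^esub> far F (\<psi> k, Idn D Y) = far F (\<psi>' k, Idn D Y') \<cdot>\<^bsub>E\<^esub> far F (\<mu> k, a)"
      using H[of k] a Y \<mu>(5,6)[of k] by (simp_all add: Hom_def)
  qed
qed

section \<open>The long exact sequence in the second variable\<close>

lemma short_exact_complexes_snd:
  assumes ex: "\<And>P. projective C P \<Longrightarrow> exact_functor D E (fix_fst C F P)"
    and se: "short_exact D f g" "f \<in> Hom D L M" "g \<in> Hom D M N"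
      and P: "projective_resolution C X P \<epsilon>"
  shows "short_exact_complexes E (FK P L) (FK P M) (FK P N)
    (\<lambda>n. far F (Idn C (cob P n), f)) (\<lambda>n. far F (Idn C (cob P n), g))"
proof -
  have Y: "L \<in> Ob D" "M \<in> Ob D" "N \<in> Ob D" using D.Hom_Ob[OF se(2)] D.Hom_Ob[OF se(3)] by auto
  note c = projective_resolutionD(1)[OF P]
  have "short_exact E (far F (Idn C (cob P n), f)) (far F (Idn C (cob P n), g))" for n
    using ex[OF resolution_projective[OF P, of n]] se(1) unfolding exact_functor_def fix_fst_def
      by simp
  then show ?thesis
    unfolding short_exact_complexes_def
    using chain_complex_F[OF c] Y chain_map_F[OF c c C.chain_map_Idn[OF c]] se(2,3) by blast
qed

lemma delta_snd_eq:
  assumes "f \<in> Hom D L M" "g \<in> Hom D M N"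
  shows "delta_snd C D E F n X f g = connecting E (FK (res C X) L) (FK (res C X) M) (FK (res C X) N)
    (\<lambda>n. far F (Idn C (cob (res C X) n), f)) (\<lambda>n. far F (Idn C (cob (res C X) n), g)) n"
  using assms by (simp add: delta_snd_def Let_def Hom_def)

text \<open>One resolution of \<open>X\<close> serves all three objects of \<open>D\<close>, so the
  homology sequence of the complexes already has the required terms and maps.\<close>

lemma snd_exact:
  assumes ex: "\<And>P. projective C P \<Longrightarrow> exact_functor D E (fix_fst C F P)"
    and se: "short_exact D f g" "f \<in> Hom D L M" "g \<in> Hom D M N" and X: "X \<in> Ob C"
  shows "delta_snd C D E F n X f g \<in> Hom E (dob n X N) (dob (n - 1) X L)"
    "exact_at E (dar n (Idn C X) f) (dar n (Idn C X) g)"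
    "exact_at E (dar n (Idn C X) g) (delta_snd C D E F n X f g)"
    "exact_at E (delta_snd C D E F (n + 1) X f g) (dar n (Idn C X) f)"
proof -
  note SE = short_exact_complexes_snd[OF ex se res_projective_resolution[OF X]]
  note eq = derived_ar_Idn_fst[OF X se(2)] derived_ar_Idn_fst[OF X se(3)] delta_snd_eq[OF se(2,3)]
  show "delta_snd C D E F n X f g \<in> Hom E (dob n X N) (dob (n - 1) X L)"
    unfolding eq derived_ob_def by (rule E.connecting_props(1)[OF SE])
  show "exact_at E (dar n (Idn C X) f) (dar n (Idn C X) g)"
    unfolding eq by (rule E.homology_exact_middle[OF SE])
  show "exact_at E (dar n (Idn C X) g) (delta_snd C D E F n X f g)"
    unfolding eq by (rule E.homology_exact_right[OF SE])
  show "exact_at E (delta_snd C D E F (n + 1) X f g) (dar n (Idn C X) f)"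
    unfolding eq using E.homology_exact_left[OF SE, of "n + 1"] by simp
qed

text \<open>A single lift of \<open>a\<close> is used in all three columns. The squares of complexes
  then commute strictly by functoriality of \<open>F\<close>, whichever lift was chosen.\<close>

lemma snd_natural:
  assumes ex: "\<And>P. projective C P \<Longrightarrow> exact_functor D E (fix_fst C F P)"
    and se: "short_exact D f g" "f \<in> Hom D L M" "g \<in> Hom D M N"
    and se': "short_exact D f' g'" "f' \<in> Hom D L' M'" "g' \<in> Hom D M' N'"
    and lmn: "l \<in> Hom D L L'" "m \<in> Hom D M M'" "n \<in> Hom D N N'" "m \<cdot>\<^bsub>D\<^esub> f = f' \<cdot>\<^bsub>D\<^esub> l"
      "n \<cdot>\<^bsub>D\<^esub> g = g' \<cdot>\<^bsub>D\<^esub> m"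
    and a: "a \<in> Hom C X X'"
  shows "dar (r - 1) a l \<cdot>\<^bsub>E\<^esub> delta_snd C D E F r X f g = delta_snd C D E F r X' f' g' \<cdot>\<^bsub>E\<^esub> dar r a n"
proof -
  have X: "X \<in> Ob C" "X' \<in> Ob C" using C.Hom_Ob[OF a] by auto
  note c = res_complex[OF X(1)] and c' = res_complex[OF X(2)]
  note l = lift_props[OF a]
  note SE = short_exact_complexes_snd[OF ex se res_projective_resolution[OF X(1)]]
    and SE' = short_exact_complexes_snd[OF ex se' res_projective_resolution[OF X(2)]]
  show ?thesis
    unfolding derived_ar_lift[OF a lmn(1) l] derived_ar_lift[OF a lmn(3) l] delta_snd_eq[OF se(2,3)]
      delta_snd_eq[OF se'(2,3)]
  proof (rule E.connecting_natural[OF SE SE'])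
    show "chain_map E (FK (res C X) L) (FK (res C X') L') (\<lambda>m. far F (lift C a m, l))"
      "chain_map E (FK (res C X) M) (FK (res C X') M') (\<lambda>k. far F (lift C a k, m))"
      "chain_map E (FK (res C X) N) (FK (res C X') N') (\<lambda>m. far F (lift C a m, n))"
      using chain_map_F[OF c c' l(1)] lmn by auto
    fix k
    show "far F (lift C a k, m) \<cdot>\<^bsub>E\<^esub> far F (Idn C (cob (res C X) k), f) =
      far F (Idn C (cob (res C X') k), f') \<cdot>\<^bsub>E\<^esub> far F (lift C a k, l)"
      "far F (lift C a k, n) \<cdot>\<^bsub>E\<^esub> far F (Idn C (cob (res C X) k), g) =
        far F (Idn C (cob (res C X') k), g') \<cdot>\<^bsub>E\<^esub> far F (lift C a k, m)"
      using chain_mapD(1)[OF l(1), of k] chain_complexD(1)[OF c, of k] chain_complexD(1)[OF c', of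
        k] lmn se(2,3) se'(2,3)
      by (simp_all add: Hom_def)
  qed
qed

end

section \<open>Functor categories\<close>

locale functor_category =
  I: category I + C: abelian_category C
  for I :: "('i, 'im) cat" and C :: "('o, 'm) acat" (structure)
begin

abbreviation FC where "FC \<equiv> functor_cat I C"

lemma FC_simps [simp]:
  "Dom FC \<eta> = nsrc \<eta>" "Cod FC \<eta> = ntrg \<eta>"
  "Idn FC X = \<lparr> nsrc = X, ntrg = X, ncmp = (\<lambda>k \<in> Ob I. Idn C (fob X k)) \<rparr>"
  "\<theta> \<cdot>\<^bsub>FC\<^esub> \<eta> = \<lparr> nsrc = nsrc \<eta>, ntrg = ntrg \<theta>, ncmp = (\<lambda>k \<in> Ob I. ncmp \<theta> k \<cdot> ncmp \<eta> k) \<rparr>"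
  "Mzero FC X Y = \<lparr> nsrc = X, ntrg = Y, ncmp = (\<lambda>k \<in> Ob I. Mzero C (fob X k) (fob Y k)) \<rparr>"
  by (simp_all add: functor_cat_def Let_def)

lemma FC_Ob: "X \<in> Ob FC \<longleftrightarrow> is_functor I C X \<and> fob X \<in> extensional (Ob I) \<and>
  far X \<in> extensional (Ar I)"
  by (simp add: functor_cat_def Let_def)

lemma FC_Ar: "\<eta> \<in> Ar FC \<longleftrightarrow> nsrc \<eta> \<in> Ob FC \<and> ntrg \<eta> \<in> Ob FC \<and> ncmp \<eta> \<in> extensional (Ob I) \<and>
    (\<forall>k \<in> Ob I. ncmp \<eta> k \<in> Hom C (fob (nsrc \<eta>) k) (fob (ntrg \<eta>) k)) \<and>
    (\<forall>u \<in> Ar I. ncmp \<eta> (Cod I u) \<cdot> far (nsrc \<eta>) u = far (ntrg \<eta>) u \<cdot> ncmp \<eta> (Dom I u))"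
  by (auto simp: functor_cat_def Let_def)

lemma FC_functor:
  assumes "X \<in> Ob FC"
  shows "k \<in> Ob I \<Longrightarrow> fob X k \<in> Ob C" "u \<in> Hom I k k' \<Longrightarrow> far X u \<in> Hom C (fob X k) (fob X k')"
    "k \<in> Ob I \<Longrightarrow> far X (Idn I k) = Idn C (fob X k)"
    "u \<in> Hom I k k' \<Longrightarrow> v \<in> Hom I k' k'' \<Longrightarrow> far X (v \<cdot>\<^bsub>I\<^esub> u) = far X v \<cdot> far X u"
  using assms unfolding FC_Ob is_functor_def Hom_def by blast+

lemma FC_HomD:
  assumes "\<eta> \<in> Hom FC X Y"
  shows "X \<in> Ob FC" "Y \<in> Ob FC" "k \<in> Ob I \<Longrightarrow> ncmp \<eta> k \<in> Hom C (fob X k) (fob Y k)"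
    "u \<in> Hom I k k' \<Longrightarrow> ncmp \<eta> k' \<cdot> far X u = far Y u \<cdot> ncmp \<eta> k"
    "nsrc \<eta> = X" "ntrg \<eta> = Y"
  using assms by (auto simp: FC_Ar Hom_def)

lemma FC_HomI:
  assumes "X \<in> Ob FC" "Y \<in> Ob FC" "\<And>k. k \<in> Ob I \<Longrightarrow> c k \<in> Hom C (fob X k) (fob Y k)"
    "\<And>k k' u. k \<in> Ob I \<Longrightarrow> k' \<in> Ob I \<Longrightarrow> u \<in> Hom I k k' \<Longrightarrow> c k' \<cdot> far X u = far Y u \<cdot> c k"
  shows "\<lparr> nsrc = X, ntrg = Y, ncmp = restrict c (Ob I) \<rparr> \<in> Hom FC X Y"
  using assms by (simp add: Hom_def FC_Ar)

text \<open>Components determine the transformation because both families are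
  \<open>undefined\<close> outside the objects of \<open>I\<close>.\<close>

lemma FC_eqI:
  assumes "\<eta> \<in> Hom FC X Y" "\<theta> \<in> Hom FC X Y" "\<And>k. k \<in> Ob I \<Longrightarrow> ncmp \<eta> k = ncmp \<theta> k"
  shows "\<eta> = \<theta>"
proof (rule ntr.equality)
  show "nsrc \<eta> = nsrc \<theta>" "ntrg \<eta> = ntrg \<theta>" using assms(1,2) by (auto simp: Hom_def)
  have "ncmp \<eta> \<in> extensional (Ob I)" "ncmp \<theta> \<in> extensional (Ob I)" using assms(1,2)
    by (auto simp: Hom_def FC_Ar)
  then show "ncmp \<eta> = ncmp \<theta>" using assms(3) by (rule extensionalityI)
qed simp

lemma FC_Comp:
  assumes \<eta>: "\<eta> \<in> Hom FC X Y" and \<theta>: "\<theta> \<in> Hom FC Y Z"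
  shows "\<theta> \<cdot>\<^bsub>FC\<^esub> \<eta> \<in> Hom FC X Z"
proof -
  note h = FC_HomD[OF \<eta>] and t = FC_HomD[OF \<theta>]
  have "\<lparr> nsrc = X, ntrg = Z, ncmp = (\<lambda>k \<in> Ob I. ncmp \<theta> k \<cdot> ncmp \<eta> k) \<rparr> \<in> Hom FC X Z"
  proof (rule FC_HomI[OF h(1) t(2) C.Comp_in[OF h(3) t(3)]])
    fix k k' u assume k: "k \<in> Ob I" "k' \<in> Ob I" and u: "u \<in> Hom I k k'"
    note H = h(3)[OF k(1)] h(3)[OF k(2)] t(3)[OF k(1)] t(3)[OF k(2)] FC_functor(2)[OF h(1) u]
      FC_functor(2)[OF h(2) u] FC_functor(2)[OF t(2) u]
    have "(ncmp \<theta> k' \<cdot> ncmp \<eta> k') \<cdot> far X u = (ncmp \<theta> k' \<cdot> far Y u) \<cdot> ncmp \<eta> k"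
      using H h(4)[OF u] by (simp add: Hom_def)
    also have "\<dots> = far Z u \<cdot> (ncmp \<theta> k \<cdot> ncmp \<eta> k)" unfolding t(4)[OF u] using H
      by (simp add: Hom_def)
    finally show "(ncmp \<theta> k' \<cdot> ncmp \<eta> k') \<cdot> far X u = far Z u \<cdot> (ncmp \<theta> k \<cdot> ncmp \<eta> k)" .
  qed auto
  then show ?thesis by (simp add: h(5) t(6))
qed

section \<open>Componentwise kernels, cokernels and exactness\<close>

lemma FC_zero:
  assumes "X \<in> Ob FC" "Y \<in> Ob FC"
  shows "Mzero FC X Y \<in> Hom FC X Y"
  unfolding FC_simps
  by (rule FC_HomI[OF assms])
    (use FC_functor(1)[OF assms(1)] FC_functor(1)[OF assms(2)] FC_functor(2)[OF assms(1)]
      FC_functor(2)[OF assms(2)]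
     in \<open>auto simp: Hom_def\<close>)

lemma FC_zeroI:
  assumes "\<eta> \<in> Hom FC X Y" "\<And>k. k \<in> Ob I \<Longrightarrow> ncmp \<eta> k = Mzero C (fob X k) (fob Y k)"
  shows "\<eta> = Mzero FC X Y"
  by (rule FC_eqI[OF assms(1) FC_zero]) (use FC_HomD[OF assms(1)] assms(2) in auto)

text \<open>The factorisations at the individual objects are automatically natural: both sides of a
  naturality square agree after the monomorphism \<open>ncmp m k'\<close>. Uniqueness is inherited
  from the components.\<close>

lemma FC_kernel:
  assumes g: "g \<in> Hom FC Y Z" and m: "m \<in> Hom FC X Y"
    and ker: "\<And>k. k \<in> Ob I \<Longrightarrow> is_kernel C (ncmp g k) (ncmp m k)"
  shows "is_kernel FC g m"
  unfolding is_kernel_def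
proof (intro conjI allI ballI impI)
  note G = FC_HomD[OF g] and M = FC_HomD[OF m]
  show "g \<in> Ar FC" "m \<in> Ar FC" "Cod FC m = Dom FC g" using g m by (auto simp: Hom_def)
  have "g \<cdot>\<^bsub>FC\<^esub> m = Mzero FC X Z"
  proof (rule FC_zeroI[OF FC_Comp[OF m g]])
    fix k assume k: "k \<in> Ob I"
    show "ncmp (g \<cdot>\<^bsub>FC\<^esub> m) k = Mzero C (fob X k) (fob Z k)"
      using C.is_kernelD(4)[OF ker[OF k]] k G(3)[OF k] M(3)[OF k] by (simp add: Hom_def)
  qed
  then show "g \<cdot>\<^bsub>FC\<^esub> m = Mzero FC (Dom FC m) (Cod FC g)" using G M by simp
  fix W h assume h0: "h \<in> Hom FC W (Dom FC g)" and gh: "g \<cdot>\<^bsub>FC\<^esub> h = Mzero FC W (Cod FC g)"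
  have h: "h \<in> Hom FC W Y" using h0 G by simp
  note H = FC_HomD[OF h]
  have gh': "ncmp g k \<cdot> ncmp h k = Mzero C (fob W k) (fob Z k)" if k: "k \<in> Ob I" for k
  proof -
    have "ncmp (g \<cdot>\<^bsub>FC\<^esub> h) k = ncmp (Mzero FC W (Cod FC g)) k" unfolding gh ..
    then show ?thesis using k G by simp
  qed
  have "\<forall>k. \<exists>u. k \<in> Ob I \<longrightarrow> u \<in> Hom C (fob W k) (fob X k) \<and> ncmp m k \<cdot> u = ncmp h k"
    using C.kernel_factor[OF ker G(3) M(3) H(3) gh'] by metis
  then obtain u where u: "\<And>k. k \<in> Ob I \<Longrightarrow> u k \<in> Hom C (fob W k) (fob X k)"
    "\<And>k. k \<in> Ob I \<Longrightarrow> ncmp m k \<cdot> u k = ncmp h k" by metis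
  define U where "U = \<lparr> nsrc = W, ntrg = X, ncmp = restrict u (Ob I) \<rparr>"
  have U: "U \<in> Hom FC W X"
    unfolding U_def
  proof (rule FC_HomI[OF H(1) M(1) u(1)])
    fix k k' v assume k: "k \<in> Ob I" "k' \<in> Ob I" and v: "v \<in> Hom I k k'"
    note F = FC_functor(2)[OF H(1) v] FC_functor(2)[OF M(1) v] FC_functor(2)[OF M(2) v]
    note A = M(3)[OF k(1)] M(3)[OF k(2)] H(3)[OF k(1)] u(1)[OF k(1)] u(1)[OF k(2)]
    show "u k' \<cdot> far W v = far X v \<cdot> u k"
    proof (rule C.monicD[OF C.is_kernelD(6)[OF ker[OF k(2)]] _ M(3)[OF k(2)]])
      have "ncmp m k' \<cdot> (u k' \<cdot> far W v) = ncmp h k' \<cdot> far W v"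
        by (rule C.reassoc[OF u(2)[OF k(2)]]) (use A F in \<open>simp_all add: Hom_def\<close>)
      also have "\<dots> = far Y v \<cdot> ncmp h k" by (rule H(4)[OF v])
      also have "\<dots> = (far Y v \<cdot> ncmp m k) \<cdot> u k"
        unfolding u(2)[OF k(1), symmetric] using A F by (simp add: Hom_def)
      also have "\<dots> = ncmp m k' \<cdot> (far X v \<cdot> u k)"
        unfolding M(4)[OF v, symmetric] using A F by (simp add: Hom_def)
      finally show "ncmp m k' \<cdot> (u k' \<cdot> far W v) = ncmp m k' \<cdot> (far X v \<cdot> u k)" .
    qed (rule C.Comp_in[OF F(1) A(5)], rule C.Comp_in[OF A(4) F(2)])
  qed
  show "\<exists>!u. u \<in> Hom FC W (Dom FC m) \<and> m \<cdot>\<^bsub>FC\<^esub> u = h"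
  proof (rule ex1I[of _ U])
    have "m \<cdot>\<^bsub>FC\<^esub> U = h" by (rule FC_eqI[OF FC_Comp[OF U m] h]) (simp add: U_def u(2))
    then show "U \<in> Hom FC W (Dom FC m) \<and> m \<cdot>\<^bsub>FC\<^esub> U = h" using U M by simp
    fix V assume V: "V \<in> Hom FC W (Dom FC m) \<and> m \<cdot>\<^bsub>FC\<^esub> V = h"
    then have V': "V \<in> Hom FC W X" using M by simp
    show "V = U"
    proof (rule FC_eqI[OF V' U])
      fix k assume k: "k \<in> Ob I"
      have "ncmp (m \<cdot>\<^bsub>FC\<^esub> V) k = ncmp m k \<cdot> ncmp V k" using k by simp
      then have "ncmp m k \<cdot> ncmp V k = ncmp m k \<cdot> u k" using conjunct2[OF V] u(2)[OF k] by metis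
      then have "ncmp V k = u k"
        by (rule C.monicD[OF C.is_kernelD(6)[OF ker[OF k]] _ M(3)[OF k] FC_HomD(3)[OF V' k] u(1)[OF
          k]])
      then show "ncmp V k = ncmp U k" using k by (simp add: U_def)
    qed
  qed
qed

text \<open>Dual to the case of kernels: the naturality squares of the descended arrows are compared
  after the epimorphism \<open>ncmp q k\<close>.\<close>

lemma FC_cokernel:
  assumes f: "f \<in> Hom FC X Y" and q: "q \<in> Hom FC Y Z"
    and coker: "\<And>k. k \<in> Ob I \<Longrightarrow> is_cokernel C (ncmp f k) (ncmp q k)"
  shows "is_cokernel FC f q"
  unfolding is_cokernel_def
proof (intro conjI allI ballI impI)
  note G = FC_HomD[OF f] and M = FC_HomD[OF q]
  show "f \<in> Ar FC" "q \<in> Ar FC" "Dom FC q = Cod FC f" using f q by (auto simp: Hom_def)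
  have "q \<cdot>\<^bsub>FC\<^esub> f = Mzero FC X Z"
  proof (rule FC_zeroI[OF FC_Comp[OF f q]])
    fix k assume k: "k \<in> Ob I"
    show "ncmp (q \<cdot>\<^bsub>FC\<^esub> f) k = Mzero C (fob X k) (fob Z k)"
      using C.is_cokernelD(4)[OF coker[OF k]] k G(3)[OF k] M(3)[OF k] by (simp add: Hom_def)
  qed
  then show "q \<cdot>\<^bsub>FC\<^esub> f = Mzero FC (Dom FC f) (Cod FC q)" using G M by simp
  fix W h assume h0: "h \<in> Hom FC (Cod FC f) W" and hf: "h \<cdot>\<^bsub>FC\<^esub> f = Mzero FC (Dom FC f) W"
  have h: "h \<in> Hom FC Y W" using h0 G by simp
  note H = FC_HomD[OF h]
  have hf': "ncmp h k \<cdot> ncmp f k = Mzero C (fob X k) (fob W k)" if k: "k \<in> Ob I" for k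
  proof -
    have "ncmp (h \<cdot>\<^bsub>FC\<^esub> f) k = ncmp (Mzero FC (Dom FC f) W) k" unfolding hf ..
    then show ?thesis using k G by simp
  qed
  have qE: "ncmp q k \<in> Epi C (fob Y k) (fob Z k)" if k: "k \<in> Ob I" for k
    using C.is_cokernelD(6)[OF coker[OF k]] G(3)[OF k] M(3)[OF k] by (simp add: Hom_def)
  have "\<forall>k. \<exists>u. k \<in> Ob I \<longrightarrow> u \<in> Hom C (fob Z k) (fob W k) \<and> u \<cdot> ncmp q k = ncmp h k"
    using C.cokernel_factor[OF coker G(3) M(3) H(3) hf'] by metis
  then obtain u where u: "\<And>k. k \<in> Ob I \<Longrightarrow> u k \<in> Hom C (fob Z k) (fob W k)"
    "\<And>k. k \<in> Ob I \<Longrightarrow> u k \<cdot> ncmp q k = ncmp h k" by metis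
  define U where "U = \<lparr> nsrc = Z, ntrg = W, ncmp = restrict u (Ob I) \<rparr>"
  have U: "U \<in> Hom FC Z W"
    unfolding U_def
  proof (rule FC_HomI[OF M(2) H(2) u(1)])
    fix k k' v assume k: "k \<in> Ob I" "k' \<in> Ob I" and v: "v \<in> Hom I k k'"
    note F = FC_functor(2)[OF H(2) v] FC_functor(2)[OF M(1) v] FC_functor(2)[OF M(2) v]
    note A = M(3)[OF k(1)] M(3)[OF k(2)] H(3)[OF k(1)] u(1)[OF k(1)] u(1)[OF k(2)]
    show "u k' \<cdot> far Z v = far W v \<cdot> u k"
    proof (rule C.EpiD[OF qE[OF k(1)]])
      have "(u k' \<cdot> far Z v) \<cdot> ncmp q k = u k' \<cdot> (ncmp q k' \<cdot> far Y v)"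
        unfolding M(4)[OF v] using A F by (simp add: Hom_def)
      also have "\<dots> = ncmp h k' \<cdot> far Y v"
        by (rule C.reassoc[OF u(2)[OF k(2)]]) (use A F in \<open>simp_all add: Hom_def\<close>)
      also have "\<dots> = far W v \<cdot> ncmp h k" by (rule H(4)[OF v])
      also have "\<dots> = (far W v \<cdot> u k) \<cdot> ncmp q k"
        unfolding u(2)[OF k(1), symmetric] using A F by (simp add: Hom_def)
      finally show "(u k' \<cdot> far Z v) \<cdot> ncmp q k = (far W v \<cdot> u k) \<cdot> ncmp q k" .
    qed (rule C.Comp_in[OF F(3) A(5)], rule C.Comp_in[OF A(4) F(1)])
  qed
  show "\<exists>!u. u \<in> Hom FC (Cod FC q) W \<and> u \<cdot>\<^bsub>FC\<^esub> q = h"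
  proof (rule ex1I[of _ U])
    have "U \<cdot>\<^bsub>FC\<^esub> q = h" by (rule FC_eqI[OF FC_Comp[OF q U] h]) (simp add: U_def u(2))
    then show "U \<in> Hom FC (Cod FC q) W \<and> U \<cdot>\<^bsub>FC\<^esub> q = h" using U M by simp
    fix V assume V: "V \<in> Hom FC (Cod FC q) W \<and> V \<cdot>\<^bsub>FC\<^esub> q = h"
    then have V': "V \<in> Hom FC Z W" using M by simp
    show "V = U"
    proof (rule FC_eqI[OF V' U])
      fix k assume k: "k \<in> Ob I"
      have "ncmp (V \<cdot>\<^bsub>FC\<^esub> q) k = ncmp V k \<cdot> ncmp q k" using k by simp
      then have "ncmp V k \<cdot> ncmp q k = u k \<cdot> ncmp q k" using conjunct2[OF V] u(2)[OF k] by metis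
      then have "ncmp V k = u k"
        by (rule C.EpiD[OF qE[OF k] _ FC_HomD(3)[OF V' k] u(1)[OF k]])
      then show "ncmp V k = ncmp U k" using k by (simp add: U_def)
    qed
  qed
qed

text \<open>Kernels are chosen object by object. An arrow of \<open>I\<close> acts on them by the
  induced map between kernels, and functoriality follows by cancelling the kernel inclusions,
  however the kernels were chosen.\<close>

lemma FC_kernel_exists:
  assumes g: "g \<in> Hom FC Y Z"
  obtains X m where "m \<in> Hom FC X Y" "\<And>k. k \<in> Ob I \<Longrightarrow> is_kernel C (ncmp g k) (ncmp m k)"
    "is_kernel FC g m"
proof -
  note G = FC_HomD[OF g]
  have "\<forall>k. \<exists>a m. k \<in> Ob I \<longrightarrow> is_kernel C (ncmp g k) m \<and> m \<in> Hom C a (fob Y k) \<and> ncmp g k \<cdot> m =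
    Mzero C a (fob Z k) \<and> monic C m"
    using C.obtain_kernel[OF G(3)] by metis
  then obtain a m where m: "\<And>k. k \<in> Ob I \<Longrightarrow> is_kernel C (ncmp g k) (m k)"
    "\<And>k. k \<in> Ob I \<Longrightarrow> m k \<in> Hom C (a k) (fob Y k)" "\<And>k. k \<in> Ob I \<Longrightarrow> ncmp g k \<cdot> m k =
      Mzero C (a k) (fob Z k)"
    "\<And>k. k \<in> Ob I \<Longrightarrow> monic C (m k)" by metis
  have ob: "a k \<in> Ob C" "fob Y k \<in> Ob C" "fob Z k \<in> Ob C" if "k \<in> Ob I" for k
    using C.Hom_Ob[OF m(2)[OF that]] C.Hom_Ob[OF G(3)[OF that]] by auto
  have ex: "\<exists>v \<in> Hom C (a k) (a k'). m k' \<cdot> v = far Y u \<cdot> m k" if u: "u \<in> Hom I k k'" for u k k'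
  proof -
    have k: "k \<in> Ob I" "k' \<in> Ob I" using I.Hom_Ob[OF u] by auto
    note F = FC_functor(2)[OF G(1) u] FC_functor(2)[OF G(2) u]
    have "ncmp g k' \<cdot> (far Y u \<cdot> m k) = (far Z u \<cdot> ncmp g k) \<cdot> m k"
      by (rule C.reassoc[OF G(4)[OF u]])
        (use F G(3)[OF k(2)] m(2)[OF k(1)] in \<open>simp_all add: Hom_def\<close>)
    also have "\<dots> = Mzero C (a k) (fob Z k')"
      using F G(3)[OF k(1)] m(2,3)[OF k(1)] ob[OF k(1)] by (simp add: Hom_def)
    finally show ?thesis using C.kernel_factor[OF m(1)[OF k(2)] G(3)[OF k(2)] m(2)[OF k(2)]
      C.Comp_in[OF m(2)[OF k(1)] F(1)]]
      by metis
  qed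
  have "\<forall>u. \<exists>v. u \<in> Ar I \<longrightarrow> v \<in> Hom C (a (Dom I u)) (a (Cod I u)) \<and> m (Cod I u) \<cdot> v =
    far Y u \<cdot> m (Dom I u)"
  proof (intro allI)
    fix u
    show "\<exists>v. u \<in> Ar I \<longrightarrow> v \<in> Hom C (a (Dom I u)) (a (Cod I u)) \<and> m (Cod I u) \<cdot> v =
      far Y u \<cdot> m (Dom I u)"
      using ex[of u "Dom I u" "Cod I u"] by (cases "u \<in> Ar I") (auto simp: Hom_def)
  qed
  then obtain v where v0: "\<And>u. u \<in> Ar I \<Longrightarrow> v u \<in> Hom C (a (Dom I u)) (a (Cod I u))"
    "\<And>u. u \<in> Ar I \<Longrightarrow> m (Cod I u) \<cdot> v u = far Y u \<cdot> m (Dom I u)" by metis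
  have v: "v u \<in> Hom C (a k) (a k')" "m k' \<cdot> v u = far Y u \<cdot> m k" if "u \<in> Hom I k k'" for u k k'
    using v0[of u] that by (auto simp: Hom_def)
  \<comment> \<open>Objects of the functor category are extensional, so the choices are cut off
    outside \<open>I\<close>.\<close>
  define X where "X = \<lparr> fob = restrict a (Ob I), far = restrict v (Ar I) \<rparr>"
  have Xk: "fob X k = a k" if "k \<in> Ob I" for k using that by (simp add: X_def)
  have Xu: "far X u = v u" if "u \<in> Hom I k k'" for u k k' using that by (simp add: X_def Hom_def)
  have "is_functor I C X"
    unfolding is_functor_def
  proof (intro conjI ballI allI)
    show "fob X k \<in> Ob C" if "k \<in> Ob I" for k using ob that Xk by simp
    show "far X u \<in> Hom C (fob X (Dom I u)) (fob X (Cod I u))" if "u \<in> Ar I" for u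
      using v0(1)[OF that] that by (simp add: X_def)
    show "far X (Idn I k) = Idn C (fob X k)" if k: "k \<in> Ob I" for k
    proof -
      have i: "Idn I k \<in> Hom I k k" using k by (rule I.Idn_in)
      have "v (Idn I k) = Idn C (a k)"
      proof (rule C.monicD[OF m(4)[OF k] _ m(2)[OF k] v(1)[OF i] C.Idn_in[OF ob(1)[OF k]]])
        show "m k \<cdot> v (Idn I k) = m k \<cdot> Idn C (a k)"
          unfolding v(2)[OF i] FC_functor(3)[OF G(1) k] using m(2)[OF k] by (simp add: Hom_def)
      qed
      then show ?thesis using Xu[OF i] Xk[OF k] by simp
    qed
    fix k k' k'' s t assume s: "s \<in> Hom I k k'" and t: "t \<in> Hom I k' k''"
    have k: "k \<in> Ob I" "k' \<in> Ob I" "k'' \<in> Ob I" using I.Hom_Ob[OF s] I.Hom_Ob[OF t] by auto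
    note st = I.Comp_in[OF s t]
    note F = FC_functor(2)[OF G(1) s] FC_functor(2)[OF G(1) t] m(2)[OF k(1)] m(2)[OF k(2)]
      m(2)[OF k(3)] v(1)[OF s] v(1)[OF t]
    have "v (t \<cdot>\<^bsub>I\<^esub> s) = v t \<cdot> v s"
    proof (rule C.monicD[OF m(4)[OF k(3)] _ m(2)[OF k(3)] v(1)[OF st] C.Comp_in[OF v(1)[OF s]
      v(1)[OF t]]])
      have "m k'' \<cdot> (v t \<cdot> v s) = (far Y t \<cdot> m k') \<cdot> v s"
        by (rule C.reassoc[OF v(2)[OF t]]) (use F in \<open>simp_all add: Hom_def\<close>)
      also have "\<dots> = far Y t \<cdot> (far Y s \<cdot> m k)" using F v(2)[OF s] by (simp add: Hom_def)
      finally show "m k'' \<cdot> v (t \<cdot>\<^bsub>I\<^esub> s) = m k'' \<cdot> (v t \<cdot> v s)"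
        unfolding v(2)[OF st] FC_functor(4)[OF G(1) s t] using F by (simp add: Hom_def)
    qed
    then show "far X (t \<cdot>\<^bsub>I\<^esub> s) = far X t \<cdot> far X s" using Xu[OF st] Xu[OF s] Xu[OF t] by simp
  qed
  then have X: "X \<in> Ob FC" unfolding FC_Ob by (simp add: X_def)
  define M where "M = \<lparr> nsrc = X, ntrg = Y, ncmp = restrict m (Ob I) \<rparr>"
  have M: "M \<in> Hom FC X Y" unfolding M_def
    by (rule FC_HomI[OF X G(1)]) (use m(2) v(2) Xk Xu in auto)
  have Mk: "is_kernel C (ncmp g k) (ncmp M k)" if "k \<in> Ob I" for k using m(1)[OF that] that
    by (simp add: M_def)
  show ?thesis using that[OF M Mk FC_kernel[OF g M Mk]] by blast
qed

text \<open>The arrows of \<open>I\<close> act by the induced maps between chosen cokernels;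
  cancelling the epimorphisms \<open>q k\<close> gives functoriality.\<close>

lemma FC_cokernel_exists:
  assumes f: "f \<in> Hom FC X Y"
  obtains Z q where "q \<in> Hom FC Y Z" "\<And>k. k \<in> Ob I \<Longrightarrow> is_cokernel C (ncmp f k) (ncmp q k)"
    "is_cokernel FC f q"
proof -
  note G = FC_HomD[OF f]
  have "\<forall>k. \<exists>c q. k \<in> Ob I \<longrightarrow> is_cokernel C (ncmp f k) q \<and> q \<in> Epi C (fob Y k) c \<and> q \<cdot> ncmp f k =
    Mzero C (fob X k) c"
    using C.obtain_cokernel[OF G(3)] by metis
  then obtain c q where q: "\<And>k. k \<in> Ob I \<Longrightarrow> is_cokernel C (ncmp f k) (q k)"
    "\<And>k. k \<in> Ob I \<Longrightarrow> q k \<in> Epi C (fob Y k) (c k)" "\<And>k. k \<in> Ob I \<Longrightarrow> q k \<cdot> ncmp f k =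
      Mzero C (fob X k) (c k)" by metis
  note qH = Epi_Hom[OF q(2)]
  have ob: "c k \<in> Ob C" "fob Y k \<in> Ob C" "fob X k \<in> Ob C" if "k \<in> Ob I" for k
    using C.Hom_Ob[OF qH[OF that]] C.Hom_Ob[OF G(3)[OF that]] by auto
  have ex: "\<exists>v \<in> Hom C (c k) (c k'). v \<cdot> q k = q k' \<cdot> far Y u" if u: "u \<in> Hom I k k'" for u k k'
  proof -
    have k: "k \<in> Ob I" "k' \<in> Ob I" using I.Hom_Ob[OF u] by auto
    note F = FC_functor(2)[OF G(1) u] FC_functor(2)[OF G(2) u]
    have "(q k' \<cdot> far Y u) \<cdot> ncmp f k = q k' \<cdot> (ncmp f k' \<cdot> far X u)"
      unfolding G(4)[OF u] using F G(3)[OF k(1)] qH[OF k(2)] by (simp add: Hom_def)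
    also have "\<dots> = Mzero C (fob X k) (c k')"
      using F G(3)[OF k(2)] qH[OF k(2)] ob[OF k(2)]
        by (simp add: Hom_def C.reassoc[OF q(3)[OF k(2)]])
    finally show ?thesis using C.cokernel_factor[OF q(1)[OF k(1)] G(3)[OF k(1)] qH[OF k(1)]
      C.Comp_in[OF F(2) qH[OF k(2)]]]
      by metis
  qed
  have "\<forall>u. \<exists>v. u \<in> Ar I \<longrightarrow> v \<in> Hom C (c (Dom I u)) (c (Cod I u)) \<and> v \<cdot> q (Dom I u) =
    q (Cod I u) \<cdot> far Y u"
  proof (intro allI)
    fix u
    show "\<exists>v. u \<in> Ar I \<longrightarrow> v \<in> Hom C (c (Dom I u)) (c (Cod I u)) \<and> v \<cdot> q (Dom I u) =
      q (Cod I u) \<cdot> far Y u"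
      using ex[of u "Dom I u" "Cod I u"] by (cases "u \<in> Ar I") (auto simp: Hom_def)
  qed
  then obtain v where v0: "\<And>u. u \<in> Ar I \<Longrightarrow> v u \<in> Hom C (c (Dom I u)) (c (Cod I u))"
    "\<And>u. u \<in> Ar I \<Longrightarrow> v u \<cdot> q (Dom I u) = q (Cod I u) \<cdot> far Y u" by metis
  have v: "v u \<in> Hom C (c k) (c k')" "v u \<cdot> q k = q k' \<cdot> far Y u" if "u \<in> Hom I k k'" for u k k'
    using v0[of u] that by (auto simp: Hom_def)
  define Z where "Z = \<lparr> fob = restrict c (Ob I), far = restrict v (Ar I) \<rparr>"
  have Zk: "fob Z k = c k" if "k \<in> Ob I" for k using that by (simp add: Z_def)
  have Zu: "far Z u = v u" if "u \<in> Hom I k k'" for u k k' using that by (simp add: Z_def Hom_def)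
  have "is_functor I C Z"
    unfolding is_functor_def
  proof (intro conjI ballI allI)
    show "fob Z k \<in> Ob C" if "k \<in> Ob I" for k using ob that Zk by simp
    show "far Z u \<in> Hom C (fob Z (Dom I u)) (fob Z (Cod I u))" if "u \<in> Ar I" for u
      using v0(1)[OF that] that by (simp add: Z_def)
    show "far Z (Idn I k) = Idn C (fob Z k)" if k: "k \<in> Ob I" for k
    proof -
      have i: "Idn I k \<in> Hom I k k" using k by (rule I.Idn_in)
      have "v (Idn I k) = Idn C (c k)"
      proof (rule C.EpiD[OF q(2)[OF k] _ v(1)[OF i] C.Idn_in[OF ob(1)[OF k]]])
        show "v (Idn I k) \<cdot> q k = Idn C (c k) \<cdot> q k"
          unfolding v(2)[OF i] FC_functor(3)[OF G(2) k] using qH[OF k] by (simp add: Hom_def)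
      qed
      then show ?thesis using Zu[OF i] Zk[OF k] by simp
    qed
    fix k k' k'' s t assume s: "s \<in> Hom I k k'" and t: "t \<in> Hom I k' k''"
    have k: "k \<in> Ob I" "k' \<in> Ob I" "k'' \<in> Ob I" using I.Hom_Ob[OF s] I.Hom_Ob[OF t] by auto
    note st = I.Comp_in[OF s t]
    note F = FC_functor(2)[OF G(2) s] FC_functor(2)[OF G(2) t] qH[OF k(1)] qH[OF k(2)] qH[OF k(3)]
      v(1)[OF s] v(1)[OF t]
    have "v (t \<cdot>\<^bsub>I\<^esub> s) = v t \<cdot> v s"
    proof (rule C.EpiD[OF q(2)[OF k(1)] _ v(1)[OF st] C.Comp_in[OF v(1)[OF s] v(1)[OF t]]])
      have "(v t \<cdot> v s) \<cdot> q k = (v t \<cdot> q k') \<cdot> far Y s"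
        using F v(2)[OF s] by (simp add: Hom_def)
      also have "\<dots> = q k'' \<cdot> (far Y t \<cdot> far Y s)" unfolding v(2)[OF t] using F
        by (simp add: Hom_def)
      finally show "v (t \<cdot>\<^bsub>I\<^esub> s) \<cdot> q k = (v t \<cdot> v s) \<cdot> q k"
        unfolding v(2)[OF st] FC_functor(4)[OF G(2) s t] by simp
    qed
    then show "far Z (t \<cdot>\<^bsub>I\<^esub> s) = far Z t \<cdot> far Z s" using Zu[OF st] Zu[OF s] Zu[OF t] by simp
  qed
  then have Z: "Z \<in> Ob FC" unfolding FC_Ob by (simp add: Z_def)
  define M where "M = \<lparr> nsrc = Y, ntrg = Z, ncmp = restrict q (Ob I) \<rparr>"
  have M: "M \<in> Hom FC Y Z" unfolding M_def
    by (rule FC_HomI[OF G(2) Z]) (use qH v(2) Zk Zu in auto)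
  have Mk: "is_cokernel C (ncmp f k) (ncmp M k)" if "k \<in> Ob I" for k using q(1)[OF that] that
    by (simp add: M_def)
  show ?thesis using that[OF M Mk FC_cokernel[OF f M Mk]] by blast
qed

text \<open>The componentwise cokernel of \<open>f\<close> and kernel of \<open>g\<close> are also a
  cokernel and a kernel in the functor category. At each object they match, since exactness does not
  depend on the choices.\<close>

lemma FC_exactI:
  assumes f: "f \<in> Hom FC X Y" and g: "g \<in> Hom FC Y Z"
    and ex: "\<And>k. k \<in> Ob I \<Longrightarrow> exact_at C (ncmp f k) (ncmp g k)"
  shows "exact_at FC f g"
proof -
  obtain W q where q: "q \<in> Hom FC Y W" "\<And>k. k \<in> Ob I \<Longrightarrow> is_cokernel C (ncmp f k) (ncmp q k)"
    "is_cokernel FC f q"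
    by (rule FC_cokernel_exists[OF f]) (rule that; assumption)
  obtain V m where m: "m \<in> Hom FC V Y" "\<And>k. k \<in> Ob I \<Longrightarrow> is_kernel C (ncmp g k) (ncmp m k)"
    "is_kernel FC g m"
    by (rule FC_kernel_exists[OF g]) (rule that; assumption)
  have "is_kernel FC q m"
    by (rule FC_kernel[OF q(1) m(1)])
      (rule C.exact_kernel_of_cokernel[OF ex FC_HomD(3)[OF f] FC_HomD(3)[OF g] q(2) m(2)])
  with q(3) m(3) show ?thesis unfolding exact_at_def is_image_def by blast
qed

lemma FC_component:
  assumes "\<theta> \<cdot>\<^bsub>FC\<^esub> \<eta> = \<zeta>" "k \<in> Ob I"
  shows "ncmp \<theta> k \<cdot> ncmp \<eta> k = ncmp \<zeta> k"
  using assms by auto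

text \<open>The kernel \<open>m\<close> and cokernel \<open>q\<close> witnessing exactness are
  universal only in the functor category, whereas exactness at \<open>k\<close> needs universal
  arrows of \<open>C\<close>. So they are compared with the componentwise \<open>\<mu>\<close> and
  \<open>p\<close>. Likewise \<open>f\<close> is monic at \<open>k\<close> because its componentwise
  kernel is zero as a transformation, and dually for \<open>g\<close>.\<close>

lemma FC_short_exact:
  assumes se: "short_exact FC f g" and f: "f \<in> Hom FC X Y" and g: "g \<in> Hom FC Y Z" and k: "k \<in> Ob I"
  shows "short_exact C (ncmp f k) (ncmp g k)"
proof -
  note Fd = FC_HomD[OF f] and Gd = FC_HomD[OF g]
  obtain V \<mu> where \<mu>: "\<mu> \<in> Hom FC V Y" "\<And>k. k \<in> Ob I \<Longrightarrow> is_kernel C (ncmp g k) (ncmp \<mu> k)"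
    "is_kernel FC g \<mu>"
    by (rule FC_kernel_exists[OF g]) (rule that; assumption)
  obtain W p where p: "p \<in> Hom FC Y W" "\<And>k. k \<in> Ob I \<Longrightarrow> is_cokernel C (ncmp f k) (ncmp p k)"
    "is_cokernel FC f p"
    by (rule FC_cokernel_exists[OF f]) (rule that; assumption)
  obtain m q where mq: "is_cokernel FC f q" "is_kernel FC q m" "is_kernel FC g m"
    using se unfolding short_exact_def exact_at_def is_image_def by blast
  note fk = Fd(3)[OF k] and gk = Gd(3)[OF k] and \<mu>k = FC_HomD(3)[OF \<mu>(1) k]
    and pk = FC_HomD(3)[OF p(1) k]
  have q: "q \<in> Hom FC Y (ntrg q)" and m: "m \<in> Hom FC (nsrc m) Y"
    using mq Fd Gd unfolding is_cokernel_def is_kernel_def by (auto simp: Hom_def)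
  note qk = FC_HomD(3)[OF q k] and mk = FC_HomD(3)[OF m k]
  have ob: "fob X k \<in> Ob C" "fob Z k \<in> Ob C" "fob W k \<in> Ob C" "fob V k \<in> Ob C" "fob Y k \<in> Ob C"
    using C.Hom_Ob[OF fk] C.Hom_Ob[OF gk] C.Hom_Ob[OF pk] C.Hom_Ob[OF \<mu>k] by auto
  have gm: "ncmp g k \<cdot> ncmp m k = Mzero C (fob (nsrc m) k) (fob Z k)"
  proof -
    have "g \<cdot>\<^bsub>FC\<^esub> m = Mzero FC (Dom FC m) (Cod FC g)" using mq(3) by (simp only: is_kernel_def)
    from FC_component[OF this k] show ?thesis using k Gd(6) by simp
  qed
  have qm: "ncmp q k \<cdot> ncmp m k = Mzero C (fob (nsrc m) k) (fob (ntrg q) k)"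
  proof -
    have "q \<cdot>\<^bsub>FC\<^esub> m = Mzero FC (Dom FC m) (Cod FC q)" using mq(2) by (simp only: is_kernel_def)
    from FC_component[OF this k] show ?thesis using k by simp
  qed
  have "f \<in> Hom FC X (Dom FC q)" "q \<cdot>\<^bsub>FC\<^esub> f = Mzero FC X (Cod FC q)"
    using mq(1) f unfolding is_cokernel_def by (auto simp only: FC_simps Hom_def mem_Collect_eq)
  then obtain f' where f': "f' \<in> Hom FC X (nsrc m)" "m \<cdot>\<^bsub>FC\<^esub> f' = f"
    using mq(2) unfolding is_kernel_def FC_simps(1,2) by blast
  have "\<mu> \<in> Hom FC V (Dom FC g)" "g \<cdot>\<^bsub>FC\<^esub> \<mu> = Mzero FC V (Cod FC g)"
    using \<mu>(1,3) unfolding is_kernel_def by (auto simp only: FC_simps Hom_def mem_Collect_eq)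
  then obtain v where v: "v \<in> Hom FC V (nsrc m)" "m \<cdot>\<^bsub>FC\<^esub> v = \<mu>"
    using mq(3) unfolding is_kernel_def FC_simps(1,2) by blast
  have "p \<in> Hom FC (Cod FC f) W" "p \<cdot>\<^bsub>FC\<^esub> f = Mzero FC (Dom FC f) W"
    using p(1,3) unfolding is_cokernel_def by (auto simp only: FC_simps Hom_def mem_Collect_eq)
  then obtain w where w: "w \<in> Hom FC (ntrg q) W" "w \<cdot>\<^bsub>FC\<^esub> q = p"
    using mq(1) unfolding is_cokernel_def FC_simps(1,2) by blast
  note f'k = FC_HomD(3)[OF f'(1) k] FC_component[OF f'(2) k]
    and vk = FC_HomD(3)[OF v(1) k] FC_component[OF v(2) k]
    and wk = FC_HomD(3)[OF w(1) k] FC_component[OF w(2) k]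
  have gf: "ncmp g k \<cdot> ncmp f k = Mzero C (fob X k) (fob Z k)"
    unfolding f'k(2)[symmetric] using f'k(1) mk gk ob by (simp add: Hom_def C.reassoc[OF gm])
  \<comment> \<open>Here \<open>p\<close> factors through \<open>q\<close> and \<open>\<mu>\<close>
    through \<open>m\<close>, while \<open>q \<cdot> m\<close> vanishes at \<open>k\<close>. Hence
    anything killed by \<open>g\<close> at \<open>k\<close> is killed by the cokernel of
    \<open>f\<close> there.\<close>
  have p\<mu>: "ncmp p k \<cdot> ncmp \<mu> k = Mzero C (fob V k) (fob W k)"
    unfolding vk(2)[symmetric] wk(2)[symmetric] using vk(1) wk(1) mk qk ob C.Hom_Ob[OF qk]
    by (simp add: Hom_def C.reassoc[OF qm])
  have pE: "ncmp p k \<in> Epi C (fob Y k) (fob W k)"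
    using C.is_cokernelD(6)[OF p(2)[OF k]] fk pk by (simp add: Hom_def)
  have fp: "exact_at C (ncmp f k) (ncmp p k)"
    unfolding exact_at_def is_image_def using p(2)[OF k] C.obtain_kernel[OF pk] by metis
  have ex: "exact_at C (ncmp f k) (ncmp g k)"
  proof (rule C.exact_atI[OF fk gk gf])
    fix z x assume x: "x \<in> Hom C z (fob Y k)" "ncmp g k \<cdot> x = Mzero C z (fob Z k)"
    obtain y where y: "y \<in> Hom C z (fob V k)" "ncmp \<mu> k \<cdot> y = x"
      using C.kernel_factor[OF \<mu>(2)[OF k] gk \<mu>k x] by blast
    have "ncmp p k \<cdot> x = Mzero C z (fob W k)"
      unfolding y(2)[symmetric] using y(1) pk \<mu>k ob by (simp add: Hom_def C.reassoc[OF p\<mu>])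
    then show "\<exists>w' e y. e \<in> Epi C w' z \<and> y \<in> Hom C w' (fob X k) \<and> ncmp f k \<cdot> y = x \<cdot> e"
      using C.exact_cover[OF fp fk pk x(1)] by metis
  qed
  have mono: "monic C (ncmp f k)"
  proof -
    obtain U \<kappa> where \<kappa>: "\<kappa> \<in> Hom FC U X" "\<And>k. k \<in> Ob I \<Longrightarrow> is_kernel C (ncmp f k) (ncmp \<kappa> k)"
      "is_kernel FC f \<kappa>"
      by (rule FC_kernel_exists[OF f]) (rule that; assumption)
    note U = FC_HomD[OF \<kappa>(1)]
    have z: "Mzero FC U X \<in> Hom FC U X" by (rule FC_zero[OF U(1,2)])
    have "f \<cdot>\<^bsub>FC\<^esub> \<kappa> = f \<cdot>\<^bsub>FC\<^esub> Mzero FC U X"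
    proof (rule FC_eqI[OF FC_Comp[OF \<kappa>(1) f] FC_Comp[OF z f]])
      fix j assume j: "j \<in> Ob I"
      show "ncmp (f \<cdot>\<^bsub>FC\<^esub> \<kappa>) j = ncmp (f \<cdot>\<^bsub>FC\<^esub> Mzero FC U X) j"
        using j C.is_kernelD(4)[OF \<kappa>(2)[OF j]] Fd(3)[OF j] U(3)[OF j] FC_functor(1)[OF U(1) j]
          by (simp add: Hom_def)
    qed
    moreover have "monic FC f" using se by (simp add: short_exact_def)
    ultimately have "\<kappa> = Mzero FC U X"
      using \<kappa>(1) z Fd(5) unfolding monic_def FC_simps(1) by blast
    then have \<kappa>0: "ncmp \<kappa> k = Mzero C (fob U k) (fob X k)" using k by simp
    note Uk = U(3)[OF k]
    show ?thesis
    proof (rule C.monicI[OF fk])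
      fix z x assume x: "x \<in> Hom C z (fob X k)" "ncmp f k \<cdot> x = Mzero C z (fob Y k)"
      obtain y where y: "y \<in> Hom C z (fob U k)" "ncmp \<kappa> k \<cdot> y = x"
        using C.kernel_factor[OF \<kappa>(2)[OF k] fk Uk x] by blast
      show "x = Mzero C z (fob X k)" unfolding y(2)[symmetric] \<kappa>0 using y(1) ob
        by (simp add: Hom_def)
    qed
  qed
  have epi: "epic C (ncmp g k)"
  proof -
    obtain U \<kappa> where \<kappa>: "\<kappa> \<in> Hom FC Z U" "\<And>k. k \<in> Ob I \<Longrightarrow> is_cokernel C (ncmp g k) (ncmp \<kappa> k)"
      "is_cokernel FC g \<kappa>"
      by (rule FC_cokernel_exists[OF g]) (rule that; assumption)
    note U = FC_HomD[OF \<kappa>(1)]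
    have z: "Mzero FC Z U \<in> Hom FC Z U" by (rule FC_zero[OF U(1,2)])
    have "\<kappa> \<cdot>\<^bsub>FC\<^esub> g = Mzero FC Z U \<cdot>\<^bsub>FC\<^esub> g"
    proof (rule FC_eqI[OF FC_Comp[OF g \<kappa>(1)] FC_Comp[OF g z]])
      fix j assume j: "j \<in> Ob I"
      show "ncmp (\<kappa> \<cdot>\<^bsub>FC\<^esub> g) j = ncmp (Mzero FC Z U \<cdot>\<^bsub>FC\<^esub> g) j"
        using j C.is_cokernelD(4)[OF \<kappa>(2)[OF j]] Gd(3)[OF j] U(3)[OF j] FC_functor(1)[OF U(2) j]
          by (simp add: Hom_def)
    qed
    moreover have "epic FC g" using se by (simp add: short_exact_def)
    ultimately have "\<kappa> = Mzero FC Z U"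
      using \<kappa>(1) z Gd(6) unfolding epic_def FC_simps(2) by blast
    then have \<kappa>0: "ncmp \<kappa> k = Mzero C (fob Z k) (fob U k)" using k by simp
    note Uk = U(3)[OF k]
    show ?thesis
    proof (rule C.epicI[OF gk])
      fix z x assume x: "x \<in> Hom C (fob Z k) z" "x \<cdot> ncmp g k = Mzero C (fob Y k) z"
      obtain y where y: "y \<in> Hom C (fob U k) z" "y \<cdot> ncmp \<kappa> k = x"
        using C.cokernel_factor[OF \<kappa>(2)[OF k] gk Uk x] by blast
      show "x = Mzero C (fob Z k) z" unfolding y(2)[symmetric] \<kappa>0 using y(1) ob
        by (simp add: Hom_def)
    qed
  qed
  show ?thesis unfolding short_exact_def using mono ex epi by blast
qed

end

section \<open>Diagrams of derived functors\<close>

lemma prod_cat_simps [simp]: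
  "Ob (prod_cat A B) = Ob A \<times> Ob B" "Ar (prod_cat A B) = Ar A \<times> Ar B"
  "Dom (prod_cat A B) (f, g) = (Dom A f, Dom B g)" "Cod (prod_cat A B) (f, g) = (Cod A f, Cod B g)"
  "Idn (prod_cat A B) (a, b) = (Idn A a, Idn B b)"
  "(f', g') \<cdot>\<^bsub>prod_cat A B\<^esub> (f, g) = (f' \<cdot>\<^bsub>A\<^esub> f, g' \<cdot>\<^bsub>B\<^esub> g)"
  by (simp_all add: prod_cat_def)

lemma prod_cat_Hom [simp]:
  "(f, g) \<in> Hom (prod_cat A B) (a, b) (a', b') \<longleftrightarrow> f \<in> Hom A a a' \<and> g \<in> Hom B b b'"
  by (auto simp: Hom_def)

lemma category_prod_cat:
  assumes "category A" "category B"
  shows "category (prod_cat A B)"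
proof -
  interpret A: category A by fact
  interpret B: category B by fact
  show ?thesis
  proof
    fix f assume "f \<in> Ar (prod_cat A B)"
    then show "Dom (prod_cat A B) f \<in> Ob (prod_cat A B)" "Cod (prod_cat A B) f \<in> Ob (prod_cat A B)"
      by (auto simp: A.Dom_in A.Cod_in B.Dom_in B.Cod_in)
  next
    fix a assume "a \<in> Ob (prod_cat A B)"
    then show "Idn (prod_cat A B) a \<in> Hom (prod_cat A B) a a" by (auto simp: A.Idn_in B.Idn_in)
  next
    fix f g a b c assume "f \<in> Hom (prod_cat A B) a b" "g \<in> Hom (prod_cat A B) b c"
    then show "g \<cdot>\<^bsub>prod_cat A B\<^esub> f \<in> Hom (prod_cat A B) a c"
      by (cases a, cases b, cases c, cases f, cases g) (auto intro: A.Comp_in B.Comp_in)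
  next
    fix f a b assume "f \<in> Hom (prod_cat A B) a b"
    then show "Idn (prod_cat A B) b \<cdot>\<^bsub>prod_cat A B\<^esub> f = f" "f \<cdot>\<^bsub>prod_cat A B\<^esub> Idn (prod_cat A B) a = f"
      by (cases a, cases b, cases f, auto simp: A.Idn_left B.Idn_left A.Idn_right B.Idn_right)+
  next
    fix f g h a b c d assume "f \<in> Hom (prod_cat A B) a b" "g \<in> Hom (prod_cat A B) b c"
      "h \<in> Hom (prod_cat A B) c d"
    then show "(h \<cdot>\<^bsub>prod_cat A B\<^esub> g) \<cdot>\<^bsub>prod_cat A B\<^esub> f = h \<cdot>\<^bsub>prod_cat A B\<^esub> (g \<cdot>\<^bsub>prod_cat A B\<^esub> f)"
      by (cases a, cases b, cases c, cases d, cases f, cases g, cases h)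
        (auto intro: A.Comp_assoc B.Comp_assoc)
  qed
qed

lemma short_exact_morphismD:
  assumes "short_exact_morphism C f g f' g' l m n"
    and "f \<in> Hom C L M" "g \<in> Hom C M N" "f' \<in> Hom C L' M'" "g' \<in> Hom C M' N'"
  shows "short_exact C f g" "short_exact C f' g'"
    "l \<in> Hom C L L'" "m \<in> Hom C M M'" "n \<in> Hom C N N'"
    "m \<cdot>\<^bsub>C\<^esub> f = f' \<cdot>\<^bsub>C\<^esub> l" "n \<cdot>\<^bsub>C\<^esub> g = g' \<cdot>\<^bsub>C\<^esub> m"
  using assms unfolding short_exact_morphism_def Hom_def by auto

locale derived_diagrams =
  derived_bifunctor C D E F + I: category I + J: category J
  for C :: "('c, 'cm) acat" (structure) and D :: "('d, 'dm) acat" and E :: "('e, 'em) acat"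
    and F :: "('c \<times> 'd, 'cm \<times> 'dm, 'e, 'em) ftor" and I :: "('i, 'im) cat" and J :: "('j, 'jm) cat"
begin

sublocale CI: functor_category I C ..
sublocale DJ: functor_category J D ..

sublocale EIJ: functor_category "prod_cat I J" E
  by (rule functor_category.intro[OF category_prod_cat[OF I.category_axioms J.category_axioms]
    E.abelian_category_axioms])

abbreviation Fo where "Fo \<equiv> derived_IJ_ob I J C D E F"
abbreviation Fa where "Fa \<equiv> derived_IJ_ar I J C D E F"
abbreviation \<delta>1 where "\<delta>1 \<equiv> delta_IJ_fst I J C D E F"
abbreviation \<delta>2 where "\<delta>2 \<equiv> delta_IJ_snd I J C D E F"

section \<open>The componentwise functors and transformations on the product category\<close>

lemma Fo_simps:
  "k \<in> Ob I \<Longrightarrow> i \<in> Ob J \<Longrightarrow> fob (Fo n X Y) (k, i) = dob n (fob X k) (fob Y i)"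
  "u \<in> Hom I k k' \<Longrightarrow> v \<in> Hom J i i' \<Longrightarrow> far (Fo n X Y) (u, v) = dar n (far X u) (far Y v)"
  by (simp_all add: derived_IJ_ob_def Hom_def)

lemma ncmp_simps:
  assumes "k \<in> Ob I" "i \<in> Ob J"
  shows "ncmp (Fa n \<eta> \<theta>) (k, i) = dar n (ncmp \<eta> k) (ncmp \<theta> i)"
    "ncmp (\<delta>1 n f g A) (k, i) = delta_fst C D E F n (ncmp f k) (ncmp g k) (fob A i)"
    "ncmp (\<delta>2 n B s t) (k, i) = delta_snd C D E F n (fob B k) (ncmp s i) (ncmp t i)"
  using assms by (simp_all add: derived_IJ_ar_def delta_IJ_fst_def delta_IJ_snd_def)

lemma Fo_Ob:
  assumes X: "X \<in> Ob CI.FC" and Y: "Y \<in> Ob DJ.FC"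
  shows "Fo n X Y \<in> Ob EIJ.FC"
proof -
  note x = CI.FC_functor[OF X] and y = DJ.FC_functor[OF Y]
  have "is_functor (prod_cat I J) E (Fo n X Y)"
    unfolding is_functor_def
  proof (intro conjI ballI allI)
    fix p assume "p \<in> Ob (prod_cat I J)"
    then obtain k i where p: "p = (k, i)" "k \<in> Ob I" "i \<in> Ob J" by auto
    show "fob (Fo n X Y) p \<in> Ob E" unfolding p(1) Fo_simps(1)[OF p(2,3)]
      by (rule derived_ob_Ob[OF x(1)[OF p(2)] y(1)[OF p(3)]])
    show "far (Fo n X Y) (Idn (prod_cat I J) p) = Idn E (fob (Fo n X Y) p)"
      unfolding p(1) prod_cat_simps Fo_simps(1)[OF p(2,3)] Fo_simps(2)[OF I.Idn_in[OF p(2)]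
        J.Idn_in[OF p(3)]]
        x(3)[OF p(2)] y(3)[OF p(3)]
      by (rule derived_ar_Idn[OF x(1)[OF p(2)] y(1)[OF p(3)]])
  next
    fix w assume "w \<in> Ar (prod_cat I J)"
    then obtain u v where w: "w = (u, v)" and u: "u \<in> Hom I (Dom I u) (Cod I u)"
      and v: "v \<in> Hom J (Dom J v) (Cod J v)"
      by (auto simp: Hom_def)
    show "far (Fo n X Y) w \<in> Hom E (fob (Fo n X Y) (Dom (prod_cat I J) w)) (fob (Fo n X Y) (Cod
      (prod_cat I J) w))"
      unfolding w prod_cat_simps Fo_simps(2)[OF u v] Fo_simps(1)[OF I.Hom_Ob1[OF u] J.Hom_Ob1[OF v]]
        Fo_simps(1)[OF I.Hom_Ob2[OF u] J.Hom_Ob2[OF v]]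
      by (rule derived_ar_Hom[OF x(2)[OF u] y(2)[OF v]])
  next
    fix a b c w z assume wz: "w \<in> Hom (prod_cat I J) a b" "z \<in> Hom (prod_cat I J) b c"
    obtain u v u' v' k i k' i' k'' i'' where e: "w = (u, v)" "z = (u', v')" "a = (k, i)"
      "b = (k', i')" "c = (k'', i'')"
      by (metis surj_pair)
    have u: "u \<in> Hom I k k'" "u' \<in> Hom I k' k''" and v: "v \<in> Hom J i i'" "v' \<in> Hom J i' i''"
      using wz unfolding e by simp_all
    show "far (Fo n X Y) (z \<cdot>\<^bsub>prod_cat I J\<^esub> w) = far (Fo n X Y) z \<cdot>\<^bsub>E\<^esub> far (Fo n X Y) w"
      unfolding e prod_cat_simps Fo_simps(2)[OF I.Comp_in[OF u] J.Comp_in[OF v]] Fo_simps(2)[OF u(1)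
        v(1)] Fo_simps(2)[OF u(2) v(2)]
        x(4)[OF u] y(4)[OF v]
      by (rule derived_ar_Comp[OF x(2)[OF u(1)] x(2)[OF u(2)] y(2)[OF v(1)] y(2)[OF v(2)]])
  qed
  then show ?thesis unfolding EIJ.FC_Ob by (simp add: derived_IJ_ob_def)
qed

lemma EIJ_HomI:
  assumes X: "X \<in> Ob EIJ.FC" and Y: "Y \<in> Ob EIJ.FC"
    and c: "\<And>k i. k \<in> Ob I \<Longrightarrow> i \<in> Ob J \<Longrightarrow> c k i \<in> Hom E (fob X (k, i)) (fob Y (k, i))"
    and nat: "\<And>k k' i i' u v. u \<in> Hom I k k' \<Longrightarrow> v \<in> Hom J i i' \<Longrightarrow> c k' i' \<cdot>\<^bsub>E\<^esub> far X (u, v) =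
      far Y (u, v) \<cdot>\<^bsub>E\<^esub> c k i"
  shows "\<lparr> nsrc = X, ntrg = Y, ncmp = (\<lambda>(k, i) \<in> Ob (prod_cat I J). c k i) \<rparr> \<in> Hom EIJ.FC X Y"
proof (rule EIJ.FC_HomI[OF X Y])
  show "(case p of (k, i) \<Rightarrow> c k i) \<in> Hom E (fob X p) (fob Y p)" if "p \<in> Ob (prod_cat I J)" for p
    using that c by auto
  show "(case p' of (k, i) \<Rightarrow> c k i) \<cdot>\<^bsub>E\<^esub> far X w = far Y w \<cdot>\<^bsub>E\<^esub> (case p of (k, i) \<Rightarrow> c k i)"
    if "w \<in> Hom (prod_cat I J) p p'" for p p' w
    using that nat by (cases p, cases p', cases w) simp
qed

lemma EIJ_eqI:
  assumes "\<eta> \<in> Hom EIJ.FC X Y" "\<theta> \<in> Hom EIJ.FC X Y"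
    "\<And>k i. k \<in> Ob I \<Longrightarrow> i \<in> Ob J \<Longrightarrow> ncmp \<eta> (k, i) = ncmp \<theta> (k, i)"
  shows "\<eta> = \<theta>"
  by (rule EIJ.FC_eqI[OF assms(1,2)]) (use assms(3) in auto)

lemma EIJ_exactI:
  assumes "f \<in> Hom EIJ.FC X Y" "g \<in> Hom EIJ.FC Y Z"
    "\<And>k i. k \<in> Ob I \<Longrightarrow> i \<in> Ob J \<Longrightarrow> exact_at E (ncmp f (k, i)) (ncmp g (k, i))"
  shows "exact_at EIJ.FC f g"
  by (rule EIJ.FC_exactI[OF assms(1,2)]) (use assms(3) in auto)

lemma EIJ_Comp: "k \<in> Ob I \<Longrightarrow> i \<in> Ob J \<Longrightarrow> ncmp (\<theta> \<cdot>\<^bsub>EIJ.FC\<^esub> \<eta>) (k, i) = ncmp \<theta> (k, i) \<cdot>\<^bsub>E\<^esub> ncmp \<eta> (k, i)"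
  by simp

lemma Fa_Hom:
  assumes \<eta>: "\<eta> \<in> Hom CI.FC X X'" and \<theta>: "\<theta> \<in> Hom DJ.FC Y Y'"
  shows "Fa n \<eta> \<theta> \<in> Hom EIJ.FC (Fo n X Y) (Fo n X' Y')"
proof -
  note h = CI.FC_HomD[OF \<eta>] and t = DJ.FC_HomD[OF \<theta>]
  show ?thesis
    unfolding derived_IJ_ar_def h(5,6) t(5,6)
  proof (rule EIJ_HomI[OF Fo_Ob[OF h(1) t(1)] Fo_Ob[OF h(2) t(2)]])
    fix k i assume k: "k \<in> Ob I" "i \<in> Ob J"
    show "dar n (ncmp \<eta> k) (ncmp \<theta> i) \<in> Hom E (fob (Fo n X Y) (k, i)) (fob (Fo n X' Y') (k, i))"
      unfolding Fo_simps(1)[OF k] by (rule derived_ar_Hom[OF h(3)[OF k(1)] t(3)[OF k(2)]])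
  next
    fix k k' i i' u v assume u: "u \<in> Hom I k k'" and v: "v \<in> Hom J i i'"
    note k = I.Hom_Ob1[OF u] I.Hom_Ob2[OF u] and i = J.Hom_Ob1[OF v] J.Hom_Ob2[OF v]
    show "dar n (ncmp \<eta> k') (ncmp \<theta> i') \<cdot>\<^bsub>E\<^esub> far (Fo n X Y) (u, v) =
      far (Fo n X' Y') (u, v) \<cdot>\<^bsub>E\<^esub> dar n (ncmp \<eta> k) (ncmp \<theta> i)"
      unfolding Fo_simps(2)[OF u v]
        derived_ar_Comp[OF CI.FC_functor(2)[OF h(1) u] h(3)[OF k(2)] DJ.FC_functor(2)[OF t(1) v]
          t(3)[OF i(2)], symmetric]
        derived_ar_Comp[OF h(3)[OF k(1)] CI.FC_functor(2)[OF h(2) u] t(3)[OF i(1)]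
          DJ.FC_functor(2)[OF t(2) v], symmetric]
        h(4)[OF u] t(4)[OF v] ..
  qed
qed

text \<open>Squares without connecting maps follow from joint functoriality of the derived functors.
  Commuting squares are allowed in both variables at once, so that one statement covers both halves
  of the result.\<close>

lemma Fa_square:
  assumes \<eta>: "\<eta> \<in> Hom CI.FC X1 X2" "\<eta>' \<in> Hom CI.FC X2 X4" "\<zeta> \<in> Hom CI.FC X1 X3"
    "\<zeta>' \<in> Hom CI.FC X3 X4"
    and \<theta>: "\<theta> \<in> Hom DJ.FC Y1 Y2" "\<theta>' \<in> Hom DJ.FC Y2 Y4" "\<xi> \<in> Hom DJ.FC Y1 Y3" "\<xi>' \<in> Hom DJ.FC Y3 Y4"
    and e: "\<eta>' \<cdot>\<^bsub>CI.FC\<^esub> \<eta> = \<zeta>' \<cdot>\<^bsub>CI.FC\<^esub> \<zeta>" "\<theta>' \<cdot>\<^bsub>DJ.FC\<^esub> \<theta> = \<xi>' \<cdot>\<^bsub>DJ.FC\<^esub> \<xi>"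
  shows "Fa n \<eta>' \<theta>' \<cdot>\<^bsub>EIJ.FC\<^esub> Fa n \<eta> \<theta> = Fa n \<zeta>' \<xi>' \<cdot>\<^bsub>EIJ.FC\<^esub> Fa n \<zeta> \<xi>"
proof (rule EIJ_eqI[OF EIJ.FC_Comp[OF Fa_Hom[OF \<eta>(1) \<theta>(1)] Fa_Hom[OF \<eta>(2) \<theta>(2)]] EIJ.FC_Comp[OF
  Fa_Hom[OF \<eta>(3) \<theta>(3)] Fa_Hom[OF \<eta>(4) \<theta>(4)]]])
  fix k i assume k: "k \<in> Ob I" and i: "i \<in> Ob J"
  have e': "ncmp \<eta>' k \<cdot> ncmp \<eta> k = ncmp \<zeta>' k \<cdot> ncmp \<zeta> k"
    "ncmp \<theta>' i \<cdot>\<^bsub>D\<^esub> ncmp \<theta> i = ncmp \<xi>' i \<cdot>\<^bsub>D\<^esub> ncmp \<xi> i"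
    using CI.FC_component[OF e(1) k] DJ.FC_component[OF e(2) i] k i by simp_all
  note c = CI.FC_HomD(3)[OF _ k] and d = DJ.FC_HomD(3)[OF _ i]
  show "ncmp (Fa n \<eta>' \<theta>' \<cdot>\<^bsub>EIJ.FC\<^esub> Fa n \<eta> \<theta>) (k, i) = ncmp (Fa n \<zeta>' \<xi>' \<cdot>\<^bsub>EIJ.FC\<^esub> Fa n \<zeta> \<xi>) (k, i)"
    unfolding EIJ_Comp[OF k i] ncmp_simps[OF k i]
      derived_ar_Comp[OF c[OF \<eta>(1)] c[OF \<eta>(2)] d[OF \<theta>(1)] d[OF \<theta>(2)], symmetric]
      derived_ar_Comp[OF c[OF \<eta>(3)] c[OF \<eta>(4)] d[OF \<theta>(3)] d[OF \<theta>(4)], symmetric] e' ..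
qed

lemma CI_Idn: "X \<in> Ob CI.FC \<Longrightarrow> Idn CI.FC X \<in> Hom CI.FC X X"
  unfolding CI.FC_simps
  by (rule CI.FC_HomI) (use CI.FC_functor in \<open>auto simp: C.Idn_in Hom_def\<close>)

lemma DJ_Idn: "X \<in> Ob DJ.FC \<Longrightarrow> Idn DJ.FC X \<in> Hom DJ.FC X X"
  unfolding DJ.FC_simps
  by (rule DJ.FC_HomI) (use DJ.FC_functor in \<open>auto simp: D.Idn_in Hom_def\<close>)

text \<open>In the variable that stays constant along a row, this is the square to be fed into
  \<open>Fa_square\<close>.\<close>

lemma CI_Idn_square:
  assumes "\<eta> \<in> Hom CI.FC X Y"
  shows "Idn CI.FC Y \<cdot>\<^bsub>CI.FC\<^esub> \<eta> = \<eta> \<cdot>\<^bsub>CI.FC\<^esub> Idn CI.FC X"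
proof -
  note h = CI.FC_HomD[OF assms]
  show ?thesis
  proof (rule CI.FC_eqI[OF CI.FC_Comp[OF assms CI_Idn[OF h(2)]] CI.FC_Comp[OF CI_Idn[OF h(1)]
    assms]])
    fix k assume "k \<in> Ob I"
    then show "ncmp (Idn CI.FC Y \<cdot>\<^bsub>CI.FC\<^esub> \<eta>) k = ncmp (\<eta> \<cdot>\<^bsub>CI.FC\<^esub> Idn CI.FC X) k"
      using h(3)[of k] by (simp add: Hom_def)
  qed
qed

lemma DJ_Idn_square:
  assumes "\<eta> \<in> Hom DJ.FC X Y"
  shows "Idn DJ.FC Y \<cdot>\<^bsub>DJ.FC\<^esub> \<eta> = \<eta> \<cdot>\<^bsub>DJ.FC\<^esub> Idn DJ.FC X"
proof -
  note h = DJ.FC_HomD[OF assms]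
  show ?thesis
  proof (rule DJ.FC_eqI[OF DJ.FC_Comp[OF assms DJ_Idn[OF h(2)]] DJ.FC_Comp[OF DJ_Idn[OF h(1)]
    assms]])
    fix k assume "k \<in> Ob J"
    then show "ncmp (Idn DJ.FC Y \<cdot>\<^bsub>DJ.FC\<^esub> \<eta>) k = ncmp (\<eta> \<cdot>\<^bsub>DJ.FC\<^esub> Idn DJ.FC X) k"
      using h(3)[of k] by (simp add: Hom_def)
  qed
qed

text \<open>An arrow \<open>u\<close> of \<open>I\<close> acts on the three functors by a morphism
  of short exact sequences, from that at \<open>k\<close> to that at \<open>k'\<close>. Naturality
  of the componentwise connecting maps over the index categories is therefore a case of
  \<open>fst_natural\<close>.\<close>

lemma delta_fst_component_natural:
  assumes f: "f \<in> Hom CI.FC L M" and g: "g \<in> Hom CI.FC M N" and se: "short_exact CI.FC f g"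
    and u: "u \<in> Hom I k k'" and a: "a \<in> Hom D Y Y'"
  shows "dar (r - 1) (far L u) a \<cdot>\<^bsub>E\<^esub> delta_fst C D E F r (ncmp f k) (ncmp g k) Y =
    delta_fst C D E F r (ncmp f k') (ncmp g k') Y' \<cdot>\<^bsub>E\<^esub> dar r (far N u) a"
proof -
  note F = CI.FC_HomD[OF f] and G = CI.FC_HomD[OF g]
  note k = I.Hom_Ob1[OF u] I.Hom_Ob2[OF u]
  show ?thesis
    by (rule fst_natural[OF CI.FC_short_exact[OF se f g k(1)] F(3)[OF k(1)] G(3)[OF k(1)]
        CI.FC_short_exact[OF se f g k(2)] F(3)[OF k(2)] G(3)[OF k(2)]
        CI.FC_functor(2)[OF F(1) u] CI.FC_functor(2)[OF F(2) u] CI.FC_functor(2)[OF G(2) u]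
        F(4)[OF u, symmetric] G(4)[OF u, symmetric] a])
qed

text \<open>Here the structure maps over an arrow \<open>v\<close> of \<open>J\<close> form the
  morphism of short exact sequences, and \<open>a\<close> is the simultaneous change in the first
  variable.\<close>

lemma delta_snd_component_natural:
  assumes ex: "\<And>P. projective C P \<Longrightarrow> exact_functor D E (fix_fst C F P)"
    and f: "f \<in> Hom DJ.FC L M" and g: "g \<in> Hom DJ.FC M N" and se: "short_exact DJ.FC f g"
    and v: "v \<in> Hom J i i'" and a: "a \<in> Hom C X X'"
  shows "dar (r - 1) a (far L v) \<cdot>\<^bsub>E\<^esub> delta_snd C D E F r X (ncmp f i) (ncmp g i) =
    delta_snd C D E F r X' (ncmp f i') (ncmp g i') \<cdot>\<^bsub>E\<^esub> dar r a (far N v)"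
proof -
  note F = DJ.FC_HomD[OF f] and G = DJ.FC_HomD[OF g]
  note k = J.Hom_Ob1[OF v] J.Hom_Ob2[OF v]
  show ?thesis
    by (rule snd_natural[OF ex DJ.FC_short_exact[OF se f g k(1)] F(3)[OF k(1)] G(3)[OF k(1)]
        DJ.FC_short_exact[OF se f g k(2)] F(3)[OF k(2)] G(3)[OF k(2)]
        DJ.FC_functor(2)[OF F(1) v] DJ.FC_functor(2)[OF F(2) v] DJ.FC_functor(2)[OF G(2) v]
        F(4)[OF v, symmetric] G(4)[OF v, symmetric] a])
qed

lemma \<delta>1_Hom:
  assumes f: "f \<in> Hom CI.FC L M" and g: "g \<in> Hom CI.FC M N" and se: "short_exact CI.FC f g"
    and A: "A \<in> Ob DJ.FC"
  shows "\<delta>1 n f g A \<in> Hom EIJ.FC (Fo n N A) (Fo (n - 1) L A)"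
proof -
  note F = CI.FC_HomD[OF f] and G = CI.FC_HomD[OF g]
  show ?thesis
    unfolding delta_IJ_fst_def F(5) G(6)
  proof (rule EIJ_HomI[OF Fo_Ob[OF G(2) A] Fo_Ob[OF F(1) A]])
    fix k i assume k: "k \<in> Ob I" and i: "i \<in> Ob J"
    show "delta_fst C D E F n (ncmp f k) (ncmp g k) (fob A i) \<in> Hom E (fob (Fo n N A) (k, i)) (fob
      (Fo (n - 1) L A) (k, i))"
      unfolding Fo_simps(1)[OF k i]
      by (rule fst_exact(1)[OF CI.FC_short_exact[OF se f g k] F(3)[OF k] G(3)[OF k]
        DJ.FC_functor(1)[OF A i]])
  next
    fix k k' i i' u v assume u: "u \<in> Hom I k k'" and v: "v \<in> Hom J i i'"
    show "delta_fst C D E F n (ncmp f k') (ncmp g k') (fob A i') \<cdot>\<^bsub>E\<^esub> far (Fo n N A) (u, v) =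
       far (Fo (n - 1) L A) (u, v) \<cdot>\<^bsub>E\<^esub> delta_fst C D E F n (ncmp f k) (ncmp g k) (fob A i)"
      unfolding Fo_simps(2)[OF u v]
      by (rule delta_fst_component_natural[OF f g se u DJ.FC_functor(2)[OF A v], symmetric])
  qed
qed

lemma \<delta>2_Hom:
  assumes ex: "\<And>P. projective C P \<Longrightarrow> exact_functor D E (fix_fst C F P)"
    and f: "f \<in> Hom DJ.FC L M" and g: "g \<in> Hom DJ.FC M N" and se: "short_exact DJ.FC f g"
      and A: "A \<in> Ob CI.FC"
  shows "\<delta>2 n A f g \<in> Hom EIJ.FC (Fo n A N) (Fo (n - 1) A L)"
proof -
  note F = DJ.FC_HomD[OF f] and G = DJ.FC_HomD[OF g]
  show ?thesis
    unfolding delta_IJ_snd_def F(5) G(6)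
  proof (rule EIJ_HomI[OF Fo_Ob[OF A G(2)] Fo_Ob[OF A F(1)]])
    fix k i assume k: "k \<in> Ob I" and i: "i \<in> Ob J"
    show "delta_snd C D E F n (fob A k) (ncmp f i) (ncmp g i) \<in> Hom E (fob (Fo n A N) (k, i)) (fob
      (Fo (n - 1) A L) (k, i))"
      unfolding Fo_simps(1)[OF k i]
      by (rule snd_exact(1)[OF ex DJ.FC_short_exact[OF se f g i] F(3)[OF i] G(3)[OF i]
        CI.FC_functor(1)[OF A k]])
  next
    fix k k' i i' u v assume u: "u \<in> Hom I k k'" and v: "v \<in> Hom J i i'"
    show "delta_snd C D E F n (fob A k') (ncmp f i') (ncmp g i') \<cdot>\<^bsub>E\<^esub> far (Fo n A N) (u, v) =
       far (Fo (n - 1) A L) (u, v) \<cdot>\<^bsub>E\<^esub> delta_snd C D E F n (fob A k) (ncmp f i) (ncmp g i)"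
      unfolding Fo_simps(2)[OF u v]
      by (rule delta_snd_component_natural[OF ex f g se v CI.FC_functor(2)[OF A u], symmetric])
  qed
qed

section \<open>Exact rows and commutative ladders\<close>

lemma Idn_component:
  "k \<in> Ob I \<Longrightarrow> ncmp (Idn CI.FC X) k = Idn C (fob X k)"
  "i \<in> Ob J \<Longrightarrow> ncmp (Idn DJ.FC Y) i = Idn D (fob Y i)"
  by simp_all

lemma fst_long_exact:
  assumes f: "f \<in> Hom CI.FC L M" and g: "g \<in> Hom CI.FC M N" and se: "short_exact CI.FC f g"
    and A: "A \<in> Ob DJ.FC"
  shows "long_exact EIJ.FC (\<lambda>r. Fo r L A) (\<lambda>r. Fo r M A) (\<lambda>r. Fo r N A)
    (\<lambda>r. Fa r f (Idn DJ.FC A)) (\<lambda>r. Fa r g (Idn DJ.FC A)) (\<lambda>r. \<delta>1 r f g A)"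
  unfolding long_exact_def
proof (intro allI conjI)
  fix n
  note F = CI.FC_HomD[OF f] and G = CI.FC_HomD[OF g]
  note i = DJ_Idn[OF A]
  show "Fo n L A \<in> Ob EIJ.FC" "Fo n M A \<in> Ob EIJ.FC" "Fo n N A \<in> Ob EIJ.FC"
    using Fo_Ob F(1,2) G(2) A by auto
  show fH: "Fa n f (Idn DJ.FC A) \<in> Hom EIJ.FC (Fo n L A) (Fo n M A)" by (rule Fa_Hom[OF f i])
  show gH: "Fa n g (Idn DJ.FC A) \<in> Hom EIJ.FC (Fo n M A) (Fo n N A)" by (rule Fa_Hom[OF g i])
  show dH: "\<delta>1 n f g A \<in> Hom EIJ.FC (Fo n N A) (Fo (n - 1) L A)" by (rule \<delta>1_Hom[OF f g se A])
  have dH': "\<delta>1 (n + 1) f g A \<in> Hom EIJ.FC (Fo (n + 1) N A) (Fo n L A)"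
    using \<delta>1_Hom[OF f g se A, of "n + 1"] by simp
  note x = fst_exact[OF CI.FC_short_exact[OF se f g] F(3) G(3) DJ.FC_functor(1)[OF A]]
  show "exact_at EIJ.FC (\<delta>1 (n + 1) f g A) (Fa n f (Idn DJ.FC A))"
    by (rule EIJ_exactI[OF dH' fH]) (simp only: ncmp_simps Idn_component x)
  show "exact_at EIJ.FC (Fa n f (Idn DJ.FC A)) (Fa n g (Idn DJ.FC A))"
    by (rule EIJ_exactI[OF fH gH]) (simp only: ncmp_simps Idn_component x)
  show "exact_at EIJ.FC (Fa n g (Idn DJ.FC A)) (\<delta>1 n f g A)"
    by (rule EIJ_exactI[OF gH dH]) (simp only: ncmp_simps Idn_component x)
qed

lemma snd_long_exact:
  assumes ex: "\<And>P. projective C P \<Longrightarrow> exact_functor D E (fix_fst C F P)"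
    and f: "f \<in> Hom DJ.FC L M" and g: "g \<in> Hom DJ.FC M N" and se: "short_exact DJ.FC f g"
      and A: "A \<in> Ob CI.FC"
  shows "long_exact EIJ.FC (\<lambda>r. Fo r A L) (\<lambda>r. Fo r A M) (\<lambda>r. Fo r A N)
    (\<lambda>r. Fa r (Idn CI.FC A) f) (\<lambda>r. Fa r (Idn CI.FC A) g) (\<lambda>r. \<delta>2 r A f g)"
  unfolding long_exact_def
proof (intro allI conjI)
  fix n
  note F = DJ.FC_HomD[OF f] and G = DJ.FC_HomD[OF g]
  note i = CI_Idn[OF A]
  show "Fo n A L \<in> Ob EIJ.FC" "Fo n A M \<in> Ob EIJ.FC" "Fo n A N \<in> Ob EIJ.FC"
    using Fo_Ob F(1,2) G(2) A by auto
  show fH: "Fa n (Idn CI.FC A) f \<in> Hom EIJ.FC (Fo n A L) (Fo n A M)" by (rule Fa_Hom[OF i f])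
  show gH: "Fa n (Idn CI.FC A) g \<in> Hom EIJ.FC (Fo n A M) (Fo n A N)" by (rule Fa_Hom[OF i g])
  show dH: "\<delta>2 n A f g \<in> Hom EIJ.FC (Fo n A N) (Fo (n - 1) A L)" by (rule \<delta>2_Hom[OF ex f g se A])
  have dH': "\<delta>2 (n + 1) A f g \<in> Hom EIJ.FC (Fo (n + 1) A N) (Fo n A L)"
    using \<delta>2_Hom[OF ex f g se A, of "n + 1"] by simp
  note x = snd_exact[OF ex DJ.FC_short_exact[OF se f g] F(3) G(3) CI.FC_functor(1)[OF A]]
  show "exact_at EIJ.FC (\<delta>2 (n + 1) A f g) (Fa n (Idn CI.FC A) f)"
    by (rule EIJ_exactI[OF dH' fH]) (simp only: ncmp_simps Idn_component x)
  show "exact_at EIJ.FC (Fa n (Idn CI.FC A) f) (Fa n (Idn CI.FC A) g)"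
    by (rule EIJ_exactI[OF fH gH]) (simp only: ncmp_simps Idn_component x)
  show "exact_at EIJ.FC (Fa n (Idn CI.FC A) g) (\<delta>2 n A f g)"
    by (rule EIJ_exactI[OF gH dH]) (simp only: ncmp_simps Idn_component x)
qed

text \<open>In the connecting square \<open>fst_natural\<close> is applied at each pair of objects
  to the components of the given morphism, rather than to structure maps as in the construction of
  \<open>\<delta>1\<close>.\<close>

lemma fst_ladder:
  assumes f: "f \<in> Hom CI.FC L M" and g: "g \<in> Hom CI.FC M N" and f': "f' \<in> Hom CI.FC L' M'"
    and g': "g' \<in> Hom CI.FC M' N'"
    and S: "short_exact_morphism CI.FC f g f' g' l m n" and a: "a \<in> Hom DJ.FC A B"
  shows "commutative_ladder EIJ.FC
            (\<lambda>r. Fo r L A) (\<lambda>r. Fo r M A) (\<lambda>r. Fo r N A)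
            (\<lambda>r. Fa r f (Idn DJ.FC A)) (\<lambda>r. Fa r g (Idn DJ.FC A)) (\<lambda>r. \<delta>1 r f g A)
            (\<lambda>r. Fo r L' B) (\<lambda>r. Fo r M' B) (\<lambda>r. Fo r N' B)
            (\<lambda>r. Fa r f' (Idn DJ.FC B)) (\<lambda>r. Fa r g' (Idn DJ.FC B)) (\<lambda>r. \<delta>1 r f' g' B)
            (\<lambda>r. Fa r l a) (\<lambda>r. Fa r m a) (\<lambda>r. Fa r n a)"
  unfolding commutative_ladder_def
proof (intro allI conjI)
  fix r
  note s = short_exact_morphismD[OF S f g f' g']
  note AB = DJ.FC_HomD(1,2)[OF a]
  note i = DJ_Idn[OF AB(1)] DJ_Idn[OF AB(2)] and e = DJ_Idn_square[OF a, symmetric]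
  note F = CI.FC_HomD(3)[OF f] CI.FC_HomD(3)[OF f'] and G = CI.FC_HomD(3)[OF g] CI.FC_HomD(3)[OF g']
  show "Fa r l a \<in> Hom EIJ.FC (Fo r L A) (Fo r L' B)" "Fa r m a \<in> Hom EIJ.FC (Fo r M A) (Fo r M' B)"
    "Fa r n a \<in> Hom EIJ.FC (Fo r N A) (Fo r N' B)" using Fa_Hom s(3-5) a by auto
  show "Fa r m a \<cdot>\<^bsub>EIJ.FC\<^esub> Fa r f (Idn DJ.FC A) = Fa r f' (Idn DJ.FC B) \<cdot>\<^bsub>EIJ.FC\<^esub> Fa r l a"
    by (rule Fa_square[OF f s(4) s(3) f' i(1) a a i(2) s(6) e])
  show "Fa r n a \<cdot>\<^bsub>EIJ.FC\<^esub> Fa r g (Idn DJ.FC A) = Fa r g' (Idn DJ.FC B) \<cdot>\<^bsub>EIJ.FC\<^esub> Fa r m a"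
    by (rule Fa_square[OF g s(5) s(4) g' i(1) a a i(2) s(7) e])
  show "Fa (r - 1) l a \<cdot>\<^bsub>EIJ.FC\<^esub> \<delta>1 r f g A = \<delta>1 r f' g' B \<cdot>\<^bsub>EIJ.FC\<^esub> Fa r n a"
  proof (rule EIJ_eqI[OF EIJ.FC_Comp[OF \<delta>1_Hom[OF f g s(1) AB(1)] Fa_Hom[OF s(3) a]]
        EIJ.FC_Comp[OF Fa_Hom[OF s(5) a] \<delta>1_Hom[OF f' g' s(2) AB(2)]]])
    fix k i assume k: "k \<in> Ob I" and i: "i \<in> Ob J"
    have mf: "ncmp m k \<cdot> ncmp f k = ncmp f' k \<cdot> ncmp l k"
      "ncmp n k \<cdot> ncmp g k = ncmp g' k \<cdot> ncmp m k"
      using CI.FC_component[OF s(6) k] CI.FC_component[OF s(7) k] k by simp_all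
    show "ncmp (Fa (r - 1) l a \<cdot>\<^bsub>EIJ.FC\<^esub> \<delta>1 r f g A) (k, i) =
      ncmp (\<delta>1 r f' g' B \<cdot>\<^bsub>EIJ.FC\<^esub> Fa r n a) (k, i)"
      unfolding EIJ_Comp[OF k i] ncmp_simps[OF k i]
      by (rule fst_natural[OF CI.FC_short_exact[OF s(1) f g k] F(1)[OF k] G(1)[OF k]
        CI.FC_short_exact[OF s(2) f' g' k] F(2)[OF k] G(2)[OF k]
        CI.FC_HomD(3)[OF s(3) k] CI.FC_HomD(3)[OF s(4) k] CI.FC_HomD(3)[OF s(5) k] mf
          DJ.FC_HomD(3)[OF a i]])
  qed
qed

lemma snd_ladder:
  assumes ex: "\<And>P. projective C P \<Longrightarrow> exact_functor D E (fix_fst C F P)"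
    and f: "f \<in> Hom DJ.FC L M" and g: "g \<in> Hom DJ.FC M N" and f': "f' \<in> Hom DJ.FC L' M'"
      and g': "g' \<in> Hom DJ.FC M' N'"
    and S: "short_exact_morphism DJ.FC f g f' g' l m n" and a: "a \<in> Hom CI.FC A B"
  shows "commutative_ladder EIJ.FC
            (\<lambda>r. Fo r A L) (\<lambda>r. Fo r A M) (\<lambda>r. Fo r A N)
            (\<lambda>r. Fa r (Idn CI.FC A) f) (\<lambda>r. Fa r (Idn CI.FC A) g) (\<lambda>r. \<delta>2 r A f g)
            (\<lambda>r. Fo r B L') (\<lambda>r. Fo r B M') (\<lambda>r. Fo r B N')
            (\<lambda>r. Fa r (Idn CI.FC B) f') (\<lambda>r. Fa r (Idn CI.FC B) g') (\<lambda>r. \<delta>2 r B f' g')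
            (\<lambda>r. Fa r a l) (\<lambda>r. Fa r a m) (\<lambda>r. Fa r a n)"
  unfolding commutative_ladder_def
proof (intro allI conjI)
  fix r
  note s = short_exact_morphismD[OF S f g f' g']
  note AB = CI.FC_HomD(1,2)[OF a]
  note i = CI_Idn[OF AB(1)] CI_Idn[OF AB(2)] and e = CI_Idn_square[OF a, symmetric]
  note F = DJ.FC_HomD(3)[OF f] DJ.FC_HomD(3)[OF f'] and G = DJ.FC_HomD(3)[OF g] DJ.FC_HomD(3)[OF g']
  show "Fa r a l \<in> Hom EIJ.FC (Fo r A L) (Fo r B L')" "Fa r a m \<in> Hom EIJ.FC (Fo r A M) (Fo r B M')"
    "Fa r a n \<in> Hom EIJ.FC (Fo r A N) (Fo r B N')" using Fa_Hom s(3-5) a by auto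
  show "Fa r a m \<cdot>\<^bsub>EIJ.FC\<^esub> Fa r (Idn CI.FC A) f = Fa r (Idn CI.FC B) f' \<cdot>\<^bsub>EIJ.FC\<^esub> Fa r a l"
    by (rule Fa_square[OF i(1) a a i(2) f s(4) s(3) f' e s(6)])
  show "Fa r a n \<cdot>\<^bsub>EIJ.FC\<^esub> Fa r (Idn CI.FC A) g = Fa r (Idn CI.FC B) g' \<cdot>\<^bsub>EIJ.FC\<^esub> Fa r a m"
    by (rule Fa_square[OF i(1) a a i(2) g s(5) s(4) g' e s(7)])
  show "Fa (r - 1) a l \<cdot>\<^bsub>EIJ.FC\<^esub> \<delta>2 r A f g = \<delta>2 r B f' g' \<cdot>\<^bsub>EIJ.FC\<^esub> Fa r a n"
  proof (rule EIJ_eqI[OF EIJ.FC_Comp[OF \<delta>2_Hom[OF ex f g s(1) AB(1)] Fa_Hom[OF a s(3)]]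
        EIJ.FC_Comp[OF Fa_Hom[OF a s(5)] \<delta>2_Hom[OF ex f' g' s(2) AB(2)]]])
    fix k i assume k: "k \<in> Ob I" and i: "i \<in> Ob J"
    have mf: "ncmp m i \<cdot>\<^bsub>D\<^esub> ncmp f i = ncmp f' i \<cdot>\<^bsub>D\<^esub> ncmp l i"
      "ncmp n i \<cdot>\<^bsub>D\<^esub> ncmp g i = ncmp g' i \<cdot>\<^bsub>D\<^esub> ncmp m i"
      using DJ.FC_component[OF s(6) i] DJ.FC_component[OF s(7) i] i by simp_all
    show "ncmp (Fa (r - 1) a l \<cdot>\<^bsub>EIJ.FC\<^esub> \<delta>2 r A f g) (k, i) =
      ncmp (\<delta>2 r B f' g' \<cdot>\<^bsub>EIJ.FC\<^esub> Fa r a n) (k, i)"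
      unfolding EIJ_Comp[OF k i] ncmp_simps[OF k i]
      by (rule snd_natural[OF ex DJ.FC_short_exact[OF s(1) f g i] F(1)[OF i] G(1)[OF i]
        DJ.FC_short_exact[OF s(2) f' g' i] F(2)[OF i] G(2)[OF i]
        DJ.FC_HomD(3)[OF s(3) i] DJ.FC_HomD(3)[OF s(4) i] DJ.FC_HomD(3)[OF s(5) i] mf
          CI.FC_HomD(3)[OF a k]])
  qed
qed

end

theorem proposition3p5:
  fixes C :: "('c, 'cm) acat" and D :: "('d, 'dm) acat" and E :: "('e, 'em) acat"
    and F :: "('c \<times> 'd, 'cm \<times> 'dm, 'e, 'em) ftor"
    and I :: "('i, 'im) cat" and J :: "('j, 'jm) cat"
  assumes "abelian_category C" and "abelian_category D" and "abelian_category E"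
    and "enough_projectives C"
    and "additive_bifunctor C D E F" and "right_exact_bifunctor C D E F"
    and "category I" and "category J"
  shows
   "(let CI = functor_cat I C; DJ = functor_cat J D; EIJ = functor_cat (prod_cat I J) E;
         Fo = derived_IJ_ob I J C D E F; Fa = derived_IJ_ar I J C D E F;
         \<delta>1 = delta_IJ_fst I J C D E F; \<delta>2 = delta_IJ_snd I J C D E F
     in
       (\<forall>L M N f g L' M' N' f' g' l m n A B a.
          f \<in> Hom CI L M \<and> g \<in> Hom CI M N \<and> f' \<in> Hom CI L' M' \<and> g' \<in> Hom CI M' N' \<and>
          short_exact_morphism CI f g f' g' l m n \<and> a \<in> Hom DJ A B \<longrightarrow>
          long_exact EIJ
            (\<lambda>r. Fo r L A) (\<lambda>r. Fo r M A) (\<lambda>r. Fo r N A)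
            (\<lambda>r. Fa r f (Idn DJ A)) (\<lambda>r. Fa r g (Idn DJ A)) (\<lambda>r. \<delta>1 r f g A) \<and>
          long_exact EIJ
            (\<lambda>r. Fo r L' B) (\<lambda>r. Fo r M' B) (\<lambda>r. Fo r N' B)
            (\<lambda>r. Fa r f' (Idn DJ B)) (\<lambda>r. Fa r g' (Idn DJ B)) (\<lambda>r. \<delta>1 r f' g' B) \<and>
          commutative_ladder EIJ
            (\<lambda>r. Fo r L A) (\<lambda>r. Fo r M A) (\<lambda>r. Fo r N A)
            (\<lambda>r. Fa r f (Idn DJ A)) (\<lambda>r. Fa r g (Idn DJ A)) (\<lambda>r. \<delta>1 r f g A)
            (\<lambda>r. Fo r L' B) (\<lambda>r. Fo r M' B) (\<lambda>r. Fo r N' B)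
            (\<lambda>r. Fa r f' (Idn DJ B)) (\<lambda>r. Fa r g' (Idn DJ B)) (\<lambda>r. \<delta>1 r f' g' B)
            (\<lambda>r. Fa r l a) (\<lambda>r. Fa r m a) (\<lambda>r. Fa r n a)) \<and>
       ((\<forall>P. projective C P \<longrightarrow> exact_functor D E (fix_fst C F P)) \<longrightarrow>
        (\<forall>L M N f g L' M' N' f' g' l m n A B a.
          f \<in> Hom DJ L M \<and> g \<in> Hom DJ M N \<and> f' \<in> Hom DJ L' M' \<and> g' \<in> Hom DJ M' N' \<and>
          short_exact_morphism DJ f g f' g' l m n \<and> a \<in> Hom CI A B \<longrightarrow>
          long_exact EIJ
            (\<lambda>r. Fo r A L) (\<lambda>r. Fo r A M) (\<lambda>r. Fo r A N)
            (\<lambda>r. Fa r (Idn CI A) f) (\<lambda>r. Fa r (Idn CI A) g) (\<lambda>r. \<delta>2 r A f g) \<and>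
          long_exact EIJ
            (\<lambda>r. Fo r B L') (\<lambda>r. Fo r B M') (\<lambda>r. Fo r B N')
            (\<lambda>r. Fa r (Idn CI B) f') (\<lambda>r. Fa r (Idn CI B) g') (\<lambda>r. \<delta>2 r B f' g') \<and>
          commutative_ladder EIJ
            (\<lambda>r. Fo r A L) (\<lambda>r. Fo r A M) (\<lambda>r. Fo r A N)
            (\<lambda>r. Fa r (Idn CI A) f) (\<lambda>r. Fa r (Idn CI A) g) (\<lambda>r. \<delta>2 r A f g)
            (\<lambda>r. Fo r B L') (\<lambda>r. Fo r B M') (\<lambda>r. Fo r B N')
            (\<lambda>r. Fa r (Idn CI B) f') (\<lambda>r. Fa r (Idn CI B) g') (\<lambda>r. \<delta>2 r B f' g')
            (\<lambda>r. Fa r a l) (\<lambda>r. Fa r a m) (\<lambda>r. Fa r a n))))"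
proof -
  interpret C: abelian_category C by fact
  interpret D: abelian_category D by fact
  interpret E: abelian_category E by fact
  interpret I: category I by fact
  interpret J: category J by fact
  interpret derived_diagrams C D E F I J
    by unfold_locales fact+
  show ?thesis
    unfolding Let_def
  proof (intro conjI allI impI; (elim conjE)?)
    fix L M N f g L' M' N' f' g' l m n A B a
    assume f: "f \<in> Hom CI.FC L M" and g: "g \<in> Hom CI.FC M N" and f': "f' \<in> Hom CI.FC L' M'"
      and g': "g' \<in> Hom CI.FC M' N'"
      and S: "short_exact_morphism CI.FC f g f' g' l m n" and a: "a \<in> Hom DJ.FC A B"
    note s = short_exact_morphismD[OF S f g f' g'] and AB = DJ.FC_HomD(1,2)[OF a]
    show "long_exact EIJ.FC (\<lambda>r. Fo r L A) (\<lambda>r. Fo r M A) (\<lambda>r. Fo r N A)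
            (\<lambda>r. Fa r f (Idn DJ.FC A)) (\<lambda>r. Fa r g (Idn DJ.FC A)) (\<lambda>r. \<delta>1 r f g A)"
      by (rule fst_long_exact[OF f g s(1) AB(1)])
    show "long_exact EIJ.FC (\<lambda>r. Fo r L' B) (\<lambda>r. Fo r M' B) (\<lambda>r. Fo r N' B)
            (\<lambda>r. Fa r f' (Idn DJ.FC B)) (\<lambda>r. Fa r g' (Idn DJ.FC B)) (\<lambda>r. \<delta>1 r f' g' B)"
      by (rule fst_long_exact[OF f' g' s(2) AB(2)])
    show "commutative_ladder EIJ.FC
            (\<lambda>r. Fo r L A) (\<lambda>r. Fo r M A) (\<lambda>r. Fo r N A)
            (\<lambda>r. Fa r f (Idn DJ.FC A)) (\<lambda>r. Fa r g (Idn DJ.FC A)) (\<lambda>r. \<delta>1 r f g A)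
            (\<lambda>r. Fo r L' B) (\<lambda>r. Fo r M' B) (\<lambda>r. Fo r N' B)
            (\<lambda>r. Fa r f' (Idn DJ.FC B)) (\<lambda>r. Fa r g' (Idn DJ.FC B)) (\<lambda>r. \<delta>1 r f' g' B)
            (\<lambda>r. Fa r l a) (\<lambda>r. Fa r m a) (\<lambda>r. Fa r n a)"
      by (rule fst_ladder[OF f g f' g' S a])
  next
    fix L M N f g L' M' N' f' g' l m n A B a
    assume "\<forall>P. projective C P \<longrightarrow> exact_functor D E (fix_fst C F P)"
    then have ex: "\<And>P. projective C P \<Longrightarrow> exact_functor D E (fix_fst C F P)" by blast
    assume f: "f \<in> Hom DJ.FC L M" and g: "g \<in> Hom DJ.FC M N" and f': "f' \<in> Hom DJ.FC L' M'"
      and g': "g' \<in> Hom DJ.FC M' N'"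
      and S: "short_exact_morphism DJ.FC f g f' g' l m n" and a: "a \<in> Hom CI.FC A B"
    note s = short_exact_morphismD[OF S f g f' g'] and AB = CI.FC_HomD(1,2)[OF a]
    show "long_exact EIJ.FC (\<lambda>r. Fo r A L) (\<lambda>r. Fo r A M) (\<lambda>r. Fo r A N)
            (\<lambda>r. Fa r (Idn CI.FC A) f) (\<lambda>r. Fa r (Idn CI.FC A) g) (\<lambda>r. \<delta>2 r A f g)"
      by (rule snd_long_exact[OF ex f g s(1) AB(1)])
    show "long_exact EIJ.FC (\<lambda>r. Fo r B L') (\<lambda>r. Fo r B M') (\<lambda>r. Fo r B N')
            (\<lambda>r. Fa r (Idn CI.FC B) f') (\<lambda>r. Fa r (Idn CI.FC B) g') (\<lambda>r. \<delta>2 r B f' g')"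
      by (rule snd_long_exact[OF ex f' g' s(2) AB(2)])
    show "commutative_ladder EIJ.FC
            (\<lambda>r. Fo r A L) (\<lambda>r. Fo r A M) (\<lambda>r. Fo r A N)
            (\<lambda>r. Fa r (Idn CI.FC A) f) (\<lambda>r. Fa r (Idn CI.FC A) g) (\<lambda>r. \<delta>2 r A f g)
            (\<lambda>r. Fo r B L') (\<lambda>r. Fo r B M') (\<lambda>r. Fo r B N')
            (\<lambda>r. Fa r (Idn CI.FC B) f') (\<lambda>r. Fa r (Idn CI.FC B) g') (\<lambda>r. \<delta>2 r B f' g')
            (\<lambda>r. Fa r a l) (\<lambda>r. Fa r a m) (\<lambda>r. Fa r a n)"
      by (rule snd_ladder[OF ex f g f' g' S a])
  qed
qed

end
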